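(* Let $n \geq 1$. There exists a constant $C>0$, independent of $t$ and of the initial data, such that the following holds. If $[u_{0},u_{1}] \in (H^{1}(\mathbf{R}^{n}) \cap L^{1,1}(\mathbf{R}^{n})) \times (L^{2}(\mathbf{R}^{n}) \cap L^{1,1}(\mathbf{R}^{n}))$, then the unique weak solution $u \in C([0,+\infty);H^{1}(\mathbf{R}^{n})) \cap C^{1}([0,+\infty);L^{2}(\mathbf{R}^{n}))$ of the Cauchy problem $$u_{tt}(t,x) - \Delta u(t,x) + u_{t}(t,x) = 0,\quad (t,x)\in (0,\infty)\times \mathbf{R}^{n},$$ $$u(0,x)= u_{0}(x),\quad u_{t}(0,x) = u_{1}(x),\quad x\in \mathbf{R}^{n},$$ satisfies $$\Vert u(t,\cdot)-(P_{00}+P_{01})G(t,\cdot)\Vert \leq Ct^{-\frac{n}{4}-\frac{1}{2}}\left(\Vert u_{0}\Vert_{1,1}+\Vert u_{1}\Vert_{1,1}+\Vert u_{0}\Vert + \Vert\nabla u_{0}\Vert + \Vert u_{1}\Vert\right),\quad t > 0,$$ where $$P_{00} := \int_{\mathbf{R}^{n}} u_{0}(x)\,dx,\qquad P_{01} := \int_{\mathbf{R}^{n}} u_{1}(x)\,dx.$$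
   Context: $\Vert\cdot\Vert$ denotes the usual $L^{2}(\mathbf{R}^{n})$-norm. The weighted space $L^{1,1}(\mathbf{R}^{n})$ consists of all $f\in L^{1}(\mathbf{R}^{n})$ with $\Vert f\Vert_{1,1} := \int_{\mathbf{R}^{n}}(1+\vert x\vert)\vert f(x)\vert\,dx < +\infty$. The Gauss kernel is $G(t,x) := \frac{1}{(\sqrt{4\pi t})^{n}}e^{-\frac{\vert x\vert^{2}}{4t}}$ for $t>0$, $x \in \mathbf{R}^n$. *)

theory Defs
  imports "HOL-Analysis.Analysis"
begin

text \<open>Elements of Lebesgue and Sobolev spaces are represented by functions; two functions
  represent the same element iff they agree almost everywhere.\<close>

definition in_L2 :: "(real ^ 'n \<Rightarrow> 'b::euclidean_space) \<Rightarrow> bool" where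
  "in_L2 f \<longleftrightarrow> f \<in> borel_measurable lebesgue \<and> integrable lebesgue (\<lambda>x. (norm (f x))\<^sup>2)"

definition L2_nrm :: "(real ^ 'n \<Rightarrow> 'b::euclidean_space) \<Rightarrow> real" where
  "L2_nrm f = sqrt (LINT x|lebesgue. (norm (f x))\<^sup>2)"

definition in_L11 :: "(real ^ 'n \<Rightarrow> real) \<Rightarrow> bool" where
  "in_L11 f \<longleftrightarrow> integrable lebesgue f \<and> integrable lebesgue (\<lambda>x. (1 + norm x) * \<bar>f x\<bar>)"

definition L11_nrm :: "(real ^ 'n \<Rightarrow> real) \<Rightarrow> real" where
  "L11_nrm f = (LINT x|lebesgue. (1 + norm x) * \<bar>f x\<bar>)"

definition pd :: "'a::euclidean_space \<Rightarrow> ('a \<Rightarrow> real) \<Rightarrow> 'a \<Rightarrow> real" where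
  "pd b f x = frechet_derivative f (at x) b"

primrec iterated_pd :: "'a::euclidean_space list \<Rightarrow> ('a \<Rightarrow> real) \<Rightarrow> 'a \<Rightarrow> real" where
  "iterated_pd [] f = f"
| "iterated_pd (b # bs) f = pd b (iterated_pd bs f)"

text \<open>Requiring Frechet differentiability of every iterated partial derivative also makes all
  of them continuous, so this is \<open>C\<^sup>\<infinity>\<close>; moreover \<^const>\<open>frechet_derivative\<close> in \<open>pd\<close> is then
  never applied to a non-differentiable function.\<close>

definition smooth :: "('a::euclidean_space \<Rightarrow> real) \<Rightarrow> bool" where
  "smooth f \<longleftrightarrow> (\<forall>bs. set bs \<subseteq> Basis \<longrightarrow> (\<forall>x. iterated_pd bs f differentiable (at x)))"

text \<open>\<open>C\<^sub>c\<^sup>\<infinity>(\<Omega>)\<close>, extended by zero to the whole space.\<close>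

definition test_function :: "'a::euclidean_space set \<Rightarrow> ('a \<Rightarrow> real) \<Rightarrow> bool" where
  "test_function \<Omega> \<phi> \<longleftrightarrow>
     smooth \<phi> \<and> compact (closure {x. \<phi> x \<noteq> 0}) \<and> closure {x. \<phi> x \<noteq> 0} \<subseteq> \<Omega>"

definition has_weak_gradient :: "(real ^ 'n \<Rightarrow> real) \<Rightarrow> (real ^ 'n \<Rightarrow> real ^ 'n) \<Rightarrow> bool" where
  "has_weak_gradient f g \<longleftrightarrow>
     (\<forall>\<phi>. test_function UNIV \<phi> \<longrightarrow>
        (\<forall>i. (LINT x|lebesgue. f x * pd (axis i 1) \<phi> x) = - (LINT x|lebesgue. g x $ i * \<phi> x)))"

definition in_H1 :: "(real ^ 'n \<Rightarrow> real) \<Rightarrow> bool" where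
  "in_H1 f \<longleftrightarrow> in_L2 f \<and> (\<exists>g. in_L2 g \<and> has_weak_gradient f g)"

text \<open>A representative of the weak gradient, which for \<open>f \<in> H\<^sup>1\<close> is unique almost everywhere.\<close>

definition weak_gradient :: "(real ^ 'n \<Rightarrow> real) \<Rightarrow> real ^ 'n \<Rightarrow> real ^ 'n" where
  "weak_gradient f = (SOME g. in_L2 g \<and> has_weak_gradient f g)"

definition H1_nrm :: "(real ^ 'n \<Rightarrow> real) \<Rightarrow> real" where
  "H1_nrm f = sqrt ((L2_nrm f)\<^sup>2 + (L2_nrm (weak_gradient f))\<^sup>2)"

text \<open>\<open>u \<in> C([0,\<infinity>); H\<^sup>1)\<close>; values of \<open>u\<close> at negative times are irrelevant.\<close>

definition C0_H1 :: "(real \<Rightarrow> real ^ 'n \<Rightarrow> real) \<Rightarrow> bool" where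
  "C0_H1 u \<longleftrightarrow> (\<forall>t\<ge>0. in_H1 (u t)) \<and>
     (\<forall>t\<ge>0. ((\<lambda>s. H1_nrm (\<lambda>x. u s x - u t x)) \<longlongrightarrow> 0) (at t within {0..}))"

text \<open>\<open>u \<in> C\<^sup>1([0,\<infinity>); L\<^sup>2)\<close> with derivative \<open>u'\<close>, which is one-sided at \<open>t = 0\<close>.\<close>

definition C1_L2 :: "(real \<Rightarrow> real ^ 'n \<Rightarrow> real) \<Rightarrow> (real \<Rightarrow> real ^ 'n \<Rightarrow> real) \<Rightarrow> bool" where
  "C1_L2 u u' \<longleftrightarrow> (\<forall>t\<ge>0. in_L2 (u t) \<and> in_L2 (u' t)) \<and>
     (\<forall>t\<ge>0. ((\<lambda>s. L2_nrm (\<lambda>x. (u s x - u t x) / (s - t) - u' t x)) \<longlongrightarrow> 0) (at t within {0..})) \<and>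
     (\<forall>t\<ge>0. ((\<lambda>s. L2_nrm (\<lambda>x. u' s x - u' t x)) \<longlongrightarrow> 0) (at t within {0..}))"

definition ptime :: "(real \<times> (real ^ 'n) \<Rightarrow> real) \<Rightarrow> real \<times> (real ^ 'n) \<Rightarrow> real" where
  "ptime = pd (1, 0)"

definition pspace :: "'n \<Rightarrow> (real \<times> (real ^ 'n) \<Rightarrow> real) \<Rightarrow> real \<times> (real ^ 'n) \<Rightarrow> real" where
  "pspace i = pd (0, axis i 1)"

definition laplacian :: "(real \<times> (real ^ 'n) \<Rightarrow> real) \<Rightarrow> real \<times> (real ^ 'n) \<Rightarrow> real" where
  "laplacian \<psi> z = (\<Sum>i\<in>UNIV. pspace i (pspace i \<psi>) z)"

text \<open>The equation \<open>u\<^sub>t\<^sub>t - \<Delta>u + u\<^sub>t = 0\<close> in the sense of distributions on \<open>(0,\<infinity>) \<times> \<real>\<^sup>n\<close>: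
  integration by parts moves all derivatives onto the test function.  The space-time integral
  is iterated because \<open>u\<close>, with each \<open>u t\<close> only determined almost everywhere,
  need not be jointly measurable.\<close>

definition damped_wave_eq :: "(real \<Rightarrow> real ^ 'n \<Rightarrow> real) \<Rightarrow> bool" where
  "damped_wave_eq u \<longleftrightarrow>
     (\<forall>\<psi>. test_function ({0<..} \<times> UNIV) \<psi> \<longrightarrow>
        (LINT t:{0<..}|lebesgue. (LINT x|lebesgue.
           u t x * (ptime (ptime \<psi>) (t, x) - laplacian \<psi> (t, x) - ptime \<psi> (t, x)))) = 0)"

definition weak_solution ::
  "(real ^ 'n \<Rightarrow> real) \<Rightarrow> (real ^ 'n \<Rightarrow> real) \<Rightarrow> (real \<Rightarrow> real ^ 'n \<Rightarrow> real) \<Rightarrow> bool" where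
  "weak_solution u\<^sub>0 u\<^sub>1 u \<longleftrightarrow>
     C0_H1 u \<and> damped_wave_eq u \<and> (AE x in lebesgue. u 0 x = u\<^sub>0 x) \<and>
     (\<exists>u'. C1_L2 u u' \<and> (AE x in lebesgue. u' 0 x = u\<^sub>1 x))"

definition gauss_kernel :: "real \<Rightarrow> real ^ 'n \<Rightarrow> real" where
  "gauss_kernel t x = 1 / sqrt (4 * pi * t) ^ CARD('n) * exp (- (norm x)\<^sup>2 / (4 * t))"

end

theory Submission
  imports Defs "HOL-Probability.Characteristic_Functions" "HOL-Real_Asymp.Real_Asymp"
begin

text \<open>The Hartley transform, with kernel \<open>cas = cos + sin\<close>, is real, self-adjoint and involutive on
  \<open>L\<^sup>2\<close>.  It turns the equation into \<open>y'' + y' + \<bar>\<xi>\<bar>\<^sup>2 y = 0\<close> for each frequency \<open>\<xi>\<close>, so a solution is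
  the transform of \<open>m\<^sub>0 a + m\<^sub>1 b\<close>, where \<open>a\<close>, \<open>b\<close> are the transforms of the data and
  \<open>m\<^sub>0\<close>, \<open>m\<^sub>1\<close> the fundamental system of that equation.  Both multipliers differ from the heat
  multiplier \<open>exp (-t \<bar>\<xi>\<bar>\<^sup>2)\<close> by at most a constant times
  \<open>\<bar>\<xi>\<bar> exp (-t \<bar>\<xi>\<bar>\<^sup>2 / 2) + exp (-t / 8)\<close>, while \<open>a\<close> and \<open>b\<close> differ from their values at \<open>0\<close> by at most
  \<open>\<bar>\<xi>\<bar>\<close> times the \<open>L\<^sup>1\<^sup>,\<^sup>1\<close> norms of the data; taking \<open>L\<^sup>2\<close> norms gives the rate.
  Two solutions agree because the difference, tested against functions with frequencies in a ball of
  radius \<open>R\<close>, satisfies an ordinary differential equation with an operator bounded by \<open>R\<^sup>2\<close>;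
  compactly supported test functions reach these frequencies through multipliers that are positive
  on the ball.\<close>

section \<open>Square integrable functions\<close>

text \<open>The Hartley transform keeps every function real and needs no separate inverse. The price
  is a reflection: one derivative turns the frequency xi into -xi, and convolution becomes
  multiplication only when a factor is even. The Laplacian, radial multipliers and the heat kernel
  do not feel this, and the equation involves nothing else. Two obstacles shape the proof. A nonzero
  test function never has a transform of compact support, so none lives in a frequency ball; the
  multiplier \<open>m\<close> makes up for this because both \<open>m\<close> and |xi|^2
  \<open>m\<close> are bounded, so L2 limits may be taken inside the Laplacian. And the L2 transform
  is a choice of representative made separately at each time, so for the constructed solution
  Fubini's theorem is applied in (t, xi), where all functions are explicit, and not in (t, x). The
  comparison with the heat multiplier splits at |xi|^2 = 3/16: below it the characteristic roots are
  real and at least 1/2 apart, above it both multipliers already decay like exp (-t/8).\<close>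

definition sq_int :: "('a::euclidean_space \<Rightarrow> real) \<Rightarrow> bool" where
  "sq_int f \<longleftrightarrow> f \<in> borel_measurable borel \<and> integrable lborel (\<lambda>x. (f x)\<^sup>2)"

definition l2_inner :: "('a::euclidean_space \<Rightarrow> real) \<Rightarrow> ('a \<Rightarrow> real) \<Rightarrow> real" where
  "l2_inner f g = (LINT x|lborel. f x * g x)"

definition l2_norm :: "('a::euclidean_space \<Rightarrow> real) \<Rightarrow> real" where
  "l2_norm f = sqrt (LINT x|lborel. (f x)\<^sup>2)"

lemma sq_int_measurable [measurable_dest]: "sq_int f \<Longrightarrow> f \<in> borel_measurable borel"
  by (simp add: sq_int_def)

lemma sq_int_integrable: "sq_int f \<Longrightarrow> integrable lborel (\<lambda>x. (f x)\<^sup>2)"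
  by (simp add: sq_int_def)

lemma sq_int_bound:
  assumes "sq_int g" "f \<in> borel_measurable borel" "AE x in lborel. \<bar>f x\<bar> \<le> \<bar>g x\<bar>"
  shows "sq_int f"
proof -
  note assms(2)[measurable]
  have "integrable lborel (\<lambda>x. (f x)\<^sup>2)"
    using assms(3) by (intro Bochner_Integration.integrable_bound[OF sq_int_integrable[OF assms(1)]])
      (auto simp: abs_le_square_iff)
  then show ?thesis using assms(2) by (simp add: sq_int_def)
qed

lemma sq_int_cong_AE:
  assumes "sq_int g" "f \<in> borel_measurable borel" "AE x in lborel. f x = g x"
  shows "sq_int f"
  using assms by (intro sq_int_bound[OF assms(1,2)]) auto

lemma sq_int_mult_integrable:
  assumes "sq_int f" "sq_int g"
  shows "integrable lborel (\<lambda>x. f x * g x)"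
proof (rule Bochner_Integration.integrable_bound)
  show "integrable lborel (\<lambda>x. (f x)\<^sup>2 + (g x)\<^sup>2)"
    using assms by (simp add: sq_int_def)
  show "(\<lambda>x. f x * g x) \<in> borel_measurable lborel"
    using assms by measurable
  have "\<bar>a * b\<bar> \<le> a\<^sup>2 + b\<^sup>2" for a b :: real
    using sum_squares_bound[of "\<bar>a\<bar>" "\<bar>b\<bar>"] mult_nonneg_nonneg[of "\<bar>a\<bar>" "\<bar>b\<bar>"]
    unfolding abs_mult power2_abs by linarith
  then show "AE x in lborel. norm (f x * g x) \<le> norm ((f x)\<^sup>2 + (g x)\<^sup>2)"
    by auto
qed

lemma sq_int_add: assumes "sq_int f" "sq_int g" shows "sq_int (\<lambda>x. f x + g x)"
  using assms sq_int_mult_integrable[OF assms] unfolding sq_int_def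
  by (auto simp: power2_sum mult.assoc)

lemma sq_int_cmult: assumes "sq_int f" shows "sq_int (\<lambda>x. c * f x)"
  using assms by (auto simp: sq_int_def power_mult_distrib)

lemma sq_int_uminus: assumes "sq_int f" shows "sq_int (\<lambda>x. - f x)"
  using assms by (auto simp: sq_int_def)

lemma sq_int_diff: assumes "sq_int f" "sq_int g" shows "sq_int (\<lambda>x. f x - g x)"
  using sq_int_add[OF assms(1) sq_int_uminus[OF assms(2)]] by simp

lemma sq_int_abs: assumes "sq_int f" shows "sq_int (\<lambda>x. \<bar>f x\<bar>)"
  using assms by (auto simp: sq_int_def)

lemma sq_int_mult_bounded:
  assumes "sq_int f" "g \<in> borel_measurable borel" "\<And>x. \<bar>g x\<bar> \<le> K"
  shows "sq_int (\<lambda>x. g x * f x)"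
proof (rule sq_int_bound[OF sq_int_cmult[OF assms(1), of K]])
  show "(\<lambda>x. g x * f x) \<in> borel_measurable borel"
    using assms(1,2) by measurable
  show "AE x in lborel. \<bar>g x * f x\<bar> \<le> \<bar>K * f x\<bar>"
    using order_trans[OF assms(3) abs_ge_self] by (auto simp: abs_mult intro!: mult_right_mono)
qed

lemma sq_int_indicator:
  assumes "sq_int f" "A \<in> sets borel"
  shows "sq_int (\<lambda>x. indicator A x * f x)"
  using assms by (intro sq_int_mult_bounded[of f _ 1]) (auto simp: indicator_def)

lemma l2_norm_nonneg [simp]: "0 \<le> l2_norm f"
  by (simp add: l2_norm_def integral_nonneg_AE)

lemma l2_norm_power2: "(l2_norm f)\<^sup>2 = (LINT x|lborel. (f x)\<^sup>2)"
  by (simp add: l2_norm_def integral_nonneg_AE)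

lemma l2_norm_inner: "(l2_norm f)\<^sup>2 = l2_inner f f"
  unfolding l2_norm_power2 l2_inner_def by (simp add: power2_eq_square)

lemma l2_norm_cong_AE:
  assumes "f \<in> borel_measurable borel" "g \<in> borel_measurable borel" "AE x in lborel. f x = g x"
  shows "l2_norm f = l2_norm g"
  unfolding l2_norm_def using assms by (intro arg_cong[where f=sqrt] integral_cong_AE) auto

lemma l2_inner_cong_AE:
  assumes "f \<in> borel_measurable borel" "f' \<in> borel_measurable borel" "AE x in lborel. f x = f' x"
    and "g \<in> borel_measurable borel" "g' \<in> borel_measurable borel" "AE x in lborel. g x = g' x"
  shows "l2_inner f g = l2_inner f' g'"
  unfolding l2_inner_def using assms by (intro integral_cong_AE) auto

lemma l2_norm_mono_AE:
  assumes "sq_int g" "f \<in> borel_measurable borel" "AE x in lborel. \<bar>f x\<bar> \<le> \<bar>g x\<bar>"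
  shows "l2_norm f \<le> l2_norm g"
  unfolding l2_norm_def using sq_int_bound[OF assms] assms
  by (intro real_sqrt_le_mono integral_mono_AE) (auto simp: sq_int_def abs_le_square_iff)

lemma l2_norm_cmult: "l2_norm (\<lambda>x. c * f x) = \<bar>c\<bar> * l2_norm f"
  by (simp add: l2_norm_def power_mult_distrib real_sqrt_mult)

lemma l2_norm_uminus: "l2_norm (\<lambda>x. - f x) = l2_norm f"
  by (simp add: l2_norm_def)

lemma l2_norm_minus_commute: "l2_norm (\<lambda>x. f x - g x) = l2_norm (\<lambda>x. g x - f x)"
  by (simp add: l2_norm_def power2_commute)

lemma l2_norm_eq_0D:
  assumes "sq_int f" "l2_norm f = 0"
  shows "AE x in lborel. f x = 0"
  using assms integral_nonneg_eq_0_iff_AE[OF sq_int_integrable[OF assms(1)]]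
  by (auto simp: l2_norm_def)

lemma l2_inner_commute: "l2_inner f g = l2_inner g f"
  by (simp add: l2_inner_def mult.commute)

lemma l2_inner_diff:
  assumes "sq_int f" "sq_int g" "sq_int h"
  shows "l2_inner (\<lambda>x. f x - g x) h = l2_inner f h - l2_inner g h"
  using assms by (simp add: l2_inner_def left_diff_distrib sq_int_mult_integrable)

lemma l2_inner_cmult: "l2_inner (\<lambda>x. c * f x) h = c * l2_inner f h"
  by (simp add: l2_inner_def mult.assoc)

lemma l2_Cauchy_Schwarz:
  assumes "sq_int f" "sq_int g"
  shows "\<bar>l2_inner f g\<bar> \<le> l2_norm f * l2_norm g"
proof (cases "l2_norm f = 0 \<or> l2_norm g = 0")
  case True
  then have "AE x in lborel. f x * g x = 0"
    using l2_norm_eq_0D[of f] l2_norm_eq_0D[of g] assms by auto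
  then have "l2_inner f g = 0"
    unfolding l2_inner_def by (rule integral_eq_zero_AE)
  then show ?thesis by simp
next
  case False
  define A where "A = l2_norm f"
  define B where "B = l2_norm g"
  have AB: "A > 0" "B > 0"
    using False l2_norm_nonneg[of f] l2_norm_nonneg[of g] unfolding A_def B_def by linarith+
  have "\<bar>l2_inner f g\<bar> \<le> (LINT x|lborel. \<bar>f x * g x\<bar>)"
    unfolding l2_inner_def using integral_norm_bound[of lborel "\<lambda>x. f x * g x"] by simp
  also have "\<dots> \<le> (LINT x|lborel. A * B / 2 * ((f x)\<^sup>2 / A\<^sup>2 + (g x)\<^sup>2 / B\<^sup>2))"
  proof (rule integral_mono)
    show "integrable lborel (\<lambda>x. \<bar>f x * g x\<bar>)"
      using sq_int_mult_integrable[OF assms] by simp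
    show "integrable lborel (\<lambda>x. A * B / 2 * ((f x)\<^sup>2 / A\<^sup>2 + (g x)\<^sup>2 / B\<^sup>2))"
      using assms by (simp add: sq_int_def)
    show "\<bar>f x * g x\<bar> \<le> A * B / 2 * ((f x)\<^sup>2 / A\<^sup>2 + (g x)\<^sup>2 / B\<^sup>2)" for x
    proof -
      have "2 * (\<bar>f x\<bar> / A) * (\<bar>g x\<bar> / B) \<le> (\<bar>f x\<bar> / A)\<^sup>2 + (\<bar>g x\<bar> / B)\<^sup>2"
        by (rule sum_squares_bound)
      then have "A * B / 2 * (2 * (\<bar>f x\<bar> / A) * (\<bar>g x\<bar> / B)) \<le> A * B / 2 * ((\<bar>f x\<bar> / A)\<^sup>2 + (\<bar>g x\<bar> / B)\<^sup>2)"
        using AB by (intro mult_left_mono) auto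
      then show ?thesis using AB by (simp add: abs_mult power_divide)
    qed
  qed
  also have "\<dots> = A * B / 2 * (A\<^sup>2 / A\<^sup>2 + B\<^sup>2 / B\<^sup>2)"
    using assms by (simp add: sq_int_def A_def B_def l2_norm_power2)
  also have "\<dots> = A * B" using AB by simp
  finally show ?thesis by (simp add: A_def B_def)
qed

lemma l2_norm_triangle:
  assumes "sq_int f" "sq_int g"
  shows "l2_norm (\<lambda>x. f x + g x) \<le> l2_norm f + l2_norm g"
proof (rule power2_le_imp_le)
  have "(l2_norm (\<lambda>x. f x + g x))\<^sup>2 = (l2_norm f)\<^sup>2 + 2 * l2_inner f g + (l2_norm g)\<^sup>2"
    using assms sq_int_mult_integrable[OF assms]
    by (simp add: l2_norm_power2 l2_inner_def power2_sum sq_int_def mult.assoc)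
  also have "\<dots> \<le> (l2_norm f + l2_norm g)\<^sup>2"
    using l2_Cauchy_Schwarz[OF assms] by (simp add: power2_sum)
  finally show "(l2_norm (\<lambda>x. f x + g x))\<^sup>2 \<le> (l2_norm f + l2_norm g)\<^sup>2" .
qed simp

lemma l2_norm_triangle_diff:
  assumes "sq_int f" "sq_int g"
  shows "l2_norm (\<lambda>x. f x - g x) \<le> l2_norm f + l2_norm g"
  using l2_norm_triangle[OF assms(1) sq_int_uminus[OF assms(2)]] by (simp add: l2_norm_uminus)

lemma l2_norm_triangle3:
  assumes "sq_int f" "sq_int g" "sq_int h"
  shows "l2_norm (\<lambda>x. f x - h x) \<le> l2_norm (\<lambda>x. f x - g x) + l2_norm (\<lambda>x. g x - h x)"
  using l2_norm_triangle[OF sq_int_diff[OF assms(1,2)] sq_int_diff[OF assms(2,3)]] by simp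

section \<open>Completeness of L2\<close>

text \<open>Fatou's lemma repackaged for Bochner integrals: it delivers integrability of the limit
  together with the bound, which both the completeness of L2 and the contraction property of the
  transform need.\<close>

lemma integral_Fatou_bound:
  fixes f :: "nat \<Rightarrow> 'a \<Rightarrow> real"
  assumes f: "\<And>k. integrable M (f k)" "\<And>k x. 0 \<le> f k x" "\<And>k. integral\<^sup>L M (f k) \<le> B"
    and g: "g \<in> borel_measurable M" "AE x in M. (\<lambda>k. f k x) \<longlonglongrightarrow> g x"
  shows "integrable M g" "integral\<^sup>L M g \<le> B" "AE x in M. 0 \<le> g x"
proof -
  show g0: "AE x in M. 0 \<le> g x"
    using g(2) by eventually_elim (rule LIMSEQ_le_const, auto simp: f)
  have B: "0 \<le> B" using f(3)[of 0] integral_nonneg_AE[of "f 0" M] f(2) by fastforce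
  have "(\<integral>\<^sup>+x. ennreal (g x) \<partial>M) = (\<integral>\<^sup>+x. liminf (\<lambda>k. ennreal (f k x)) \<partial>M)"
  proof (rule nn_integral_cong_AE)
    show "AE x in M. ennreal (g x) = liminf (\<lambda>k. ennreal (f k x))"
      using g(2) by eventually_elim (rule lim_imp_Liminf[symmetric], auto intro: tendsto_ennrealI)
  qed
  also have "\<dots> \<le> liminf (\<lambda>k. \<integral>\<^sup>+x. ennreal (f k x) \<partial>M)"
    using f by (intro nn_integral_liminf) auto
  also have "\<dots> \<le> ennreal B"
  proof -
    have "(\<integral>\<^sup>+x. ennreal (f k x) \<partial>M) \<le> ennreal B" for k
      using f by (subst nn_integral_eq_integral) (auto intro: ennreal_leI)
    then have "liminf (\<lambda>k. \<integral>\<^sup>+x. ennreal (f k x) \<partial>M) \<le> liminf (\<lambda>k::nat. ennreal B)"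
      by (intro Liminf_mono) auto
    then show ?thesis by (simp add: Liminf_const)
  qed
  finally have le: "(\<integral>\<^sup>+x. ennreal (g x) \<partial>M) \<le> ennreal B" .
  show gi: "integrable M g"
    using le g0 g(1) by (intro integrableI_nonneg) (auto intro: le_less_trans)
  show "integral\<^sup>L M g \<le> B"
    using le nn_integral_eq_integral[OF gi g0] B by (simp add: ennreal_le_iff)
qed

text \<open>Riesz-Fischer. A fast subsequence converges almost everywhere; Fatou's lemma applied to
  \<open>f n\<close> minus that subsequence, with n fixed, turns pointwise convergence into norm
  convergence of the whole sequence.\<close>

lemma l2_complete:
  fixes f :: "nat \<Rightarrow> 'a::euclidean_space \<Rightarrow> real"
  assumes f: "\<And>k. sq_int (f k)"
    and Cauchy: "\<And>e. e > 0 \<Longrightarrow> \<exists>N. \<forall>m\<ge>N. \<forall>n\<ge>N. l2_norm (\<lambda>x. f m x - f n x) < e"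
  obtains g where "sq_int g" "(\<lambda>k. l2_norm (\<lambda>x. f k x - g x)) \<longlonglongrightarrow> 0"
proof -
  have [measurable]: "f k \<in> borel_measurable borel" for k
    using f by (simp add: sq_int_def)
  have "\<forall>k. \<exists>N. \<forall>m\<ge>N. \<forall>n\<ge>N. l2_norm (\<lambda>x. f m x - f n x) < (1/2)^k"
    using Cauchy by simp
  then obtain R where R: "\<And>k m n. m \<ge> R k \<Longrightarrow> n \<ge> R k \<Longrightarrow> l2_norm (\<lambda>x. f m x - f n x) < (1/2)^k"
    by metis
  \<comment> \<open>Summing the thresholds makes \<open>r k\<close> and \<open>r (Suc k)\<close>
    both at least \<open>R k\<close> without choosing a monotone sequence; the added
    \<open>k\<close> sends the indices to infinity.\<close>
  define r where "r k = (\<Sum>i\<le>k. R i) + k" for k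
  have rR: "r k \<ge> R k" for k
    unfolding r_def by (simp add: member_le_sum trans_le_add1)
  have rk: "r k \<ge> k" for k by (simp add: r_def)
  have rS: "r (Suc k) \<ge> R k" for k
    using rR[of k] by (simp add: r_def)
  \<comment> \<open>The squared norms of these increments are at most 4^-k. The weight 2^k used
    below keeps the sum of squares integrable, and finiteness of the weighted sum at a point forces
    |D k x| to decay like 2^(-k/2), which is summable.\<close>
  define D where "D k x = f (r (Suc k)) x - f (r k) x" for k x
  have [measurable]: "D k \<in> borel_measurable borel" for k
    unfolding D_def by measurable
  have D: "(LINT x|lborel. (D k x)\<^sup>2) \<le> (1/4)^k" for k
  proof -
    have "(l2_norm (D k))\<^sup>2 \<le> ((1/2)^k)\<^sup>2"
      unfolding D_def by (intro power_mono less_imp_le[OF R] rR rS) simp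
    also have "((1/2)^k)\<^sup>2 = (1/4::real)^k"
      unfolding power2_eq_square power_mult_distrib[symmetric] by simp
    finally show ?thesis by (simp add: l2_norm_power2)
  qed
  have Dsq: "sq_int (D k)" for k unfolding D_def by (intro sq_int_diff f)
  have "(\<integral>\<^sup>+x. (\<Sum>k. ennreal (2^k * (D k x)\<^sup>2)) \<partial>lborel) = (\<Sum>k. \<integral>\<^sup>+x. ennreal (2^k * (D k x)\<^sup>2) \<partial>lborel)"
    by (rule nn_integral_suminf) simp
  also have "\<dots> \<le> (\<Sum>k. ennreal ((1/2)^k))"
  proof (rule suminf_le)
    fix k
    have "(\<integral>\<^sup>+x. ennreal (2^k * (D k x)\<^sup>2) \<partial>lborel) = ennreal (2^k * (LINT x|lborel. (D k x)\<^sup>2))"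
      using Dsq[of k] by (subst nn_integral_eq_integral) (auto simp: sq_int_def)
    also have "\<dots> \<le> ennreal (2^k * (1/4)^k)"
      by (intro ennreal_leI mult_left_mono D) auto
    also have "\<dots> = ennreal ((1/2)^k)" by (simp flip: power_mult_distrib)
    finally show "(\<integral>\<^sup>+x. ennreal (2^k * (D k x)\<^sup>2) \<partial>lborel) \<le> ennreal ((1/2)^k)" .
  qed auto
  also have "\<dots> = ennreal (\<Sum>k. (1/2)^k)"
    by (rule suminf_ennreal2) (auto intro: summable_geometric)
  finally have fin: "(\<integral>\<^sup>+x. (\<Sum>k. ennreal (2^k * (D k x)\<^sup>2)) \<partial>lborel) \<noteq> \<infinity>"
    by (auto simp: top_unique)
  have "AE x in lborel. (\<Sum>k. ennreal (2^k * (D k x)\<^sup>2)) \<noteq> \<infinity>"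
    by (rule nn_integral_PInf_AE[OF _ fin]) simp
  then have conv: "AE x in lborel. convergent (\<lambda>k. f (r k) x)"
  proof eventually_elim
    case (elim x)
    define S where "S = (\<Sum>k. ennreal (2^k * (D k x)\<^sup>2))"
    obtain C where C: "C \<ge> 0" "S = ennreal C"
      using elim unfolding S_def[symmetric] by (cases S rule: ennreal_cases) auto
    have "\<bar>D k x\<bar> \<le> sqrt C * (sqrt (1/2))^k" for k
    proof -
      have "(\<Sum>k\<in>{k}. ennreal (2^k * (D k x)\<^sup>2)) \<le> S"
        unfolding S_def by (rule sum_le_suminf[OF summableI]) auto
      then have "2^k * (D k x)\<^sup>2 \<le> C" using C by (simp add: ennreal_le_iff)
      then have "(D k x)\<^sup>2 \<le> C * (1/2)^k" by (simp add: field_simps power_one_over)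
      then have "sqrt ((D k x)\<^sup>2) \<le> sqrt (C * (1/2)^k)" by (rule real_sqrt_le_mono)
      then show ?thesis unfolding real_sqrt_abs real_sqrt_mult real_sqrt_power[of "1/2"] .
    qed
    moreover have "summable (\<lambda>k. sqrt C * (sqrt (1/2))^k)"
    proof (intro summable_mult summable_geometric)
      have "sqrt (1/2) < 1" by (subst real_sqrt_lt_1_iff) simp
      then show "norm (sqrt (1/2)) < 1" using real_sqrt_ge_zero[of "1/2"] unfolding real_norm_def by linarith
    qed
    ultimately have "summable (\<lambda>k. D k x)"
      unfolding real_norm_def[symmetric] by (rule summable_comparison_test'[rotated])
    then have "convergent (\<lambda>n. \<Sum>k<n. D k x)" by (simp add: summable_iff_convergent)
    then have "convergent (\<lambda>n. f (r n) x - f (r 0) x)"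
      unfolding D_def using sum_lessThan_telescope[of "\<lambda>n. f (r n) x"] by simp
    then have "convergent (\<lambda>n. (f (r n) x - f (r 0) x) + f (r 0) x)"
      by (intro convergent_add convergent_const)
    then show ?case by simp
  qed
  define g where "g x = lim (\<lambda>k. f (r k) x)" for x
  have [measurable]: "g \<in> borel_measurable borel"
    unfolding g_def by measurable
  have lim: "AE x in lborel. (\<lambda>k. f (r k) x) \<longlonglongrightarrow> g x"
    using conv by eventually_elim (simp add: g_def convergent_LIMSEQ_iff)
  \<comment> \<open>Fatou's lemma along the indices \<open>r (k + N)\<close>, all at least N, with n
    kept fixed: membership of the difference in L2 and the bound e come out together.\<close>
  have key: "integrable lborel (\<lambda>x. (f n x - g x)\<^sup>2) \<and> (LINT x|lborel. (f n x - g x)\<^sup>2) \<le> e\<^sup>2"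
    if N: "\<forall>m\<ge>N. \<forall>n\<ge>N. l2_norm (\<lambda>x. f m x - f n x) < e" "n \<ge> N" "e > 0" for e N n
  proof -
    have 1: "integrable lborel (\<lambda>x. (f n x - f (r (k + N)) x)\<^sup>2)" for k
      using sq_int_diff[OF f f] by (simp add: sq_int_def)
    have 2: "(LINT x|lborel. (f n x - f (r (k + N)) x)\<^sup>2) \<le> e\<^sup>2" for k
    proof -
      have "l2_norm (\<lambda>x. f n x - f (r (k + N)) x) < e"
        using N rk[of "k+N"] by auto
      then have "(l2_norm (\<lambda>x. f n x - f (r (k + N)) x))\<^sup>2 \<le> e\<^sup>2"
        by (intro power_mono) auto
      then show ?thesis by (simp add: l2_norm_power2)
    qed
    have 3: "AE x in lborel. (\<lambda>k. (f n x - f (r (k + N)) x)\<^sup>2) \<longlonglongrightarrow> (f n x - g x)\<^sup>2"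
      using lim
    proof eventually_elim
      case (elim x)
      then have "(\<lambda>k. f (r (k + N)) x) \<longlonglongrightarrow> g x" by (rule LIMSEQ_ignore_initial_segment)
      then show ?case by (intro tendsto_intros)
    qed
    show ?thesis
      using integral_Fatou_bound[where f="\<lambda>k x. (f n x - f (r (k + N)) x)\<^sup>2" and M=lborel
          and g="\<lambda>x. (f n x - g x)\<^sup>2" and B="e\<^sup>2", OF 1 _ 2 _ 3] by simp
  qed
  obtain N where N: "\<forall>m\<ge>N. \<forall>n\<ge>N. l2_norm (\<lambda>x. f m x - f n x) < 1" using Cauchy[of 1] by auto
  have "sq_int (\<lambda>x. f N x - g x)" using key[OF N order_refl] by (simp add: sq_int_def)
  from sq_int_diff[OF f[of N] this] have g: "sq_int g" by simp
  show thesis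
  proof (rule that[OF g])
    show "(\<lambda>k. l2_norm (\<lambda>x. f k x - g x)) \<longlonglongrightarrow> 0"
    proof (rule LIMSEQ_I)
      fix e :: real assume "e > 0"
      then obtain N where N: "\<forall>m\<ge>N. \<forall>n\<ge>N. l2_norm (\<lambda>x. f m x - f n x) < e/2" using Cauchy[of "e/2"] by auto
      have "norm (l2_norm (\<lambda>x. f n x - g x) - 0) < e" if "n \<ge> N" for n
      proof -
        have "(l2_norm (\<lambda>x. f n x - g x))\<^sup>2 \<le> (e/2)\<^sup>2"
          unfolding l2_norm_power2 using key[OF N that] \<open>e > 0\<close> by simp
        then have "l2_norm (\<lambda>x. f n x - g x) \<le> e/2"
          by (rule power2_le_imp_le) (use \<open>e > 0\<close> in simp)
        then show ?thesis using \<open>e > 0\<close> by simp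
      qed
      then show "\<exists>no. \<forall>n\<ge>no. norm (l2_norm (\<lambda>x. f n x - g x) - 0) < e"
        by blast
    qed
  qed
qed

lemma l2_inner_tendsto:
  assumes "\<And>k. sq_int (f k)" "sq_int g" "sq_int h" "(\<lambda>k. l2_norm (\<lambda>x. f k x - g x)) \<longlonglongrightarrow> 0"
  shows "(\<lambda>k. l2_inner (f k) h) \<longlonglongrightarrow> l2_inner g h"
proof (rule LIM_zero_cancel, rule Lim_null_comparison)
  show "\<forall>\<^sub>F k in sequentially. norm (l2_inner (f k) h - l2_inner g h) \<le> l2_norm (\<lambda>x. f k x - g x) * l2_norm h"
    using l2_Cauchy_Schwarz[OF sq_int_diff[OF assms(1,2)] assms(3)] assms
    by (simp add: l2_inner_diff)
  show "(\<lambda>k. l2_norm (\<lambda>x. f k x - g x) * l2_norm h) \<longlonglongrightarrow> 0"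
    using tendsto_mult_left_zero[OF assms(4)] .
qed

section \<open>Approximation by truncation to balls\<close>

lemma l2_truncation_tendsto:
  assumes "sq_int f"
  shows "(\<lambda>k. l2_norm (\<lambda>x. indicator (ball 0 (real k)) x * f x - f x)) \<longlonglongrightarrow> 0"
proof -
  have [measurable]: "f \<in> borel_measurable borel" using assms by (simp add: sq_int_def)
  have "(\<lambda>k. LINT x|lborel. (indicator (ball 0 (real k)) x * f x - f x)\<^sup>2) \<longlonglongrightarrow> (LINT x::'a|lborel. (0::real))"
  proof (rule integral_dominated_convergence[where w="\<lambda>x. (f x)\<^sup>2"])
    show "integrable lborel (\<lambda>x. (f x)\<^sup>2)" using assms by (simp add: sq_int_def)
    show "AE x in lborel. (\<lambda>k. (indicator (ball 0 (real k)) x * f x - f x)\<^sup>2) \<longlonglongrightarrow> 0"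
    proof (rule AE_I2)
      fix x :: 'a
      obtain N where "norm x < real N" using reals_Archimedean2 by blast
      then have "eventually (\<lambda>k. (indicator (ball 0 (real k)) x * f x - f x)\<^sup>2 = 0) sequentially"
        by (intro eventually_sequentiallyI[of N]) (auto simp: indicator_def)
      then show "(\<lambda>k. (indicator (ball 0 (real k)) x * f x - f x)\<^sup>2) \<longlonglongrightarrow> 0"
        by (rule tendsto_eventually)
    qed
    show "AE x in lborel. norm ((indicator (ball 0 (real k)) x * f x - f x)\<^sup>2) \<le> (f x)\<^sup>2" for k
      by (auto simp: indicator_def)
    show "(\<lambda>x. (indicator (ball 0 (real k)) x * f x - f x)\<^sup>2) \<in> borel_measurable lborel" for k
      using sq_int_integrable[OF sq_int_diff[OF sq_int_indicator[OF assms] assms]] by simp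
  qed auto
  from tendsto_real_sqrt[OF this] show ?thesis by (simp add: l2_norm_def)
qed

text \<open>The indicator of a ball is square integrable, and a product of two square integrable
  functions is integrable. Truncations thus lie in L1 and L2, the class where the transform is given
  by its integral.\<close>

lemma integrable_truncation:
  assumes "sq_int f"
  shows "integrable lborel (\<lambda>x. indicator (ball 0 R) x * f x)"
proof -
  have "sq_int (\<lambda>x::'a. indicator (ball 0 R) x :: real)"
    using emeasure_lborel_ball_finite[of "0::'a" R]
    by (auto intro!: borel_measurable_indicator simp: sq_int_def power2_eq_square simp flip: indicator_inter_arith)
  from sq_int_mult_integrable[OF this assms] show ?thesis .
qed

text \<open>Pairing \<open>f\<close> with its own truncations gives the squared norm in the limit.
  This form suits identities that are known only for test objects in both L1 and L2.\<close>

lemma l2_orthogonal_imp_zero: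
  assumes "sq_int f"
    and "\<And>R. R > 0 \<Longrightarrow> l2_inner f (\<lambda>x. indicator (ball 0 R) x * f x) = 0"
  shows "AE x in lborel. f x = 0"
proof -
  have "l2_inner f f = 0"
  proof (rule LIMSEQ_unique)
    have "(\<lambda>k. l2_inner (\<lambda>x. indicator (ball 0 (real k)) x * f x) f) \<longlonglongrightarrow> l2_inner f f"
      using assms by (intro l2_inner_tendsto l2_truncation_tendsto sq_int_indicator) auto
    then show "(\<lambda>k. l2_inner (\<lambda>x. indicator (ball 0 (real (Suc k))) x * f x) f) \<longlonglongrightarrow> l2_inner f f"
      by (rule LIMSEQ_Suc)
    show "(\<lambda>k. l2_inner (\<lambda>x. indicator (ball 0 (real (Suc k))) x * f x) f) \<longlonglongrightarrow> 0"
      using assms(2) by (subst l2_inner_commute) (simp del: of_nat_Suc)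
  qed
  then show ?thesis
    using assms(1) by (intro l2_norm_eq_0D) (simp_all flip: l2_norm_inner)
qed

section \<open>Gaussian integrals\<close>

text \<open>Affine behaviour of Lebesgue measure; \<open>c\<close> may be negative, so translation
  is the case c = 1 and the reflection x -> a - x the case c = -1.\<close>

lemma lborel_scaled:
  fixes f :: "'a::euclidean_space \<Rightarrow> 'b::{banach,second_countable_topology}"
  assumes c: "c \<noteq> 0" and f [measurable]: "f \<in> borel_measurable borel"
  shows integrable_lborel_scaled_iff: "integrable lborel (\<lambda>x. f (a + c *\<^sub>R x)) \<longleftrightarrow> integrable lborel f"
    and integral_lborel_scaled: "integral\<^sup>L lborel f = \<bar>c\<bar> ^ DIM('a) *\<^sub>R (LINT x|lborel. f (a + c *\<^sub>R x))"
proof -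
  have eq: "lborel = density (distr lborel borel (\<lambda>x::'a. a + c *\<^sub>R x)) (\<lambda>_. ennreal (\<bar>c\<bar>^DIM('a)))"
    using lborel_affine[OF c, of a] by simp
  have "integrable lborel f \<longleftrightarrow> integrable (density (distr lborel borel (\<lambda>x::'a. a + c *\<^sub>R x)) (\<lambda>_. ennreal (\<bar>c\<bar>^DIM('a)))) f"
    by (subst eq) simp
  also have "\<dots> \<longleftrightarrow> integrable lborel (\<lambda>x. f (a + c *\<^sub>R x))"
  proof -
    have "integrable lborel (\<lambda>x. f (a + c *\<^sub>R x))"
      if "integrable lborel (\<lambda>x. \<bar>c\<bar> ^ DIM('a) *\<^sub>R f (a + c *\<^sub>R x))"
      using integrable_scaleR_right[OF that, of "1 / \<bar>c\<bar> ^ DIM('a)"] c by simp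
    then show ?thesis
      by (subst integrable_density) (auto simp: integrable_distr_eq)
  qed
  finally show "integrable lborel (\<lambda>x. f (a + c *\<^sub>R x)) \<longleftrightarrow> integrable lborel f" by simp
  have "integral\<^sup>L lborel f = integral\<^sup>L (density (distr lborel borel (\<lambda>x::'a. a + c *\<^sub>R x)) (\<lambda>_. ennreal (\<bar>c\<bar>^DIM('a)))) f"
    by (subst eq) simp
  also have "\<dots> = \<bar>c\<bar> ^ DIM('a) *\<^sub>R (LINT x|lborel. f (a + c *\<^sub>R x))"
    by (subst integral_density) (auto simp: integral_distr)
  finally show "integral\<^sup>L lborel f = \<bar>c\<bar> ^ DIM('a) *\<^sub>R (LINT x|lborel. f (a + c *\<^sub>R x))" .
qed

lemma integral_lborel_translate:
  fixes f :: "'a::euclidean_space \<Rightarrow> real"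
  assumes "f \<in> borel_measurable borel"
  shows "(LINT x|lborel. f (a + x)) = integral\<^sup>L lborel f"
  using integral_lborel_scaled[of 1 f a] assms by simp

lemma integrable_lborel_translate_iff:
  fixes f :: "'a::euclidean_space \<Rightarrow> real"
  assumes "f \<in> borel_measurable borel"
  shows "integrable lborel (\<lambda>x. f (a + x)) \<longleftrightarrow> integrable lborel f"
  using integrable_lborel_scaled_iff[of 1 f a] assms by simp

lemma integral_lborel_reflect:
  fixes f :: "'a::euclidean_space \<Rightarrow> real"
  assumes "f \<in> borel_measurable borel"
  shows "(LINT x|lborel. f (a - x)) = integral\<^sup>L lborel f"
  using integral_lborel_scaled[of "-1" f a] assms by simp

lemma integrable_lborel_reflect_iff:
  fixes f :: "'a::euclidean_space \<Rightarrow> real"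
  assumes "f \<in> borel_measurable borel"
  shows "integrable lborel (\<lambda>x. f (a - x)) \<longleftrightarrow> integrable lborel f"
  using integrable_lborel_scaled_iff[of "-1" f a] assms by simp

text \<open>Lebesgue measure is the image of the product measure over the basis, so integrals of
  products of coordinate functions factor. The range is a general normed field because
  characteristic functions are complex valued.\<close>

lemma lborel_prod_integral:
  fixes f :: "'a::euclidean_space \<Rightarrow> real \<Rightarrow> 'c::{real_normed_field,banach,second_countable_topology}"
  assumes f: "\<And>b. b \<in> Basis \<Longrightarrow> integrable lborel (f b)"
  shows "integrable lborel (\<lambda>x::'a. \<Prod>b\<in>Basis. f b (x \<bullet> b))"
    and "(LINT x|lborel. (\<Prod>b\<in>Basis. f b (x \<bullet> b))) = (\<Prod>b\<in>Basis. integral\<^sup>L lborel (f b))"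
proof -
  interpret product_sigma_finite "\<lambda>_::'a. lborel :: real measure" ..
  have [measurable]: "f b \<in> borel_measurable borel" if "b \<in> Basis" for b
    using f[OF that] by (auto dest: borel_measurable_integrable)
  have m: "(\<lambda>x::'a. \<Prod>b\<in>Basis. f b (x \<bullet> b)) \<in> borel_measurable borel"
    by (intro borel_measurable_prod) measurable
  have m2: "(\<lambda>h. \<Sum>b\<in>Basis. h b *\<^sub>R b) \<in> (\<Pi>\<^sub>M b\<in>(Basis::'a set). lborel) \<rightarrow>\<^sub>M (borel :: 'a measure)"
    by measurable
  have eq: "(\<Prod>b\<in>Basis. f b ((\<Sum>b\<in>Basis. h b *\<^sub>R b) \<bullet> b)) = (\<Prod>b\<in>Basis. f b (h b))" for h :: "'a \<Rightarrow> real"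
    by (intro prod.cong refl) (simp add: inner_sum_left_Basis)
  have e: "lborel = distr (\<Pi>\<^sub>M b\<in>Basis. lborel) borel (\<lambda>f. \<Sum>b\<in>Basis. f b *\<^sub>R b :: 'a)"
    by (rule lborel_eq)
  show "integrable lborel (\<lambda>x::'a. \<Prod>b\<in>Basis. f b (x \<bullet> b))"
    unfolding e using product_integrable_prod[of Basis f] f m m2
    by (subst integrable_distr_eq) (auto simp: eq)
  show "(LINT x|lborel. (\<Prod>b\<in>Basis. f b (x \<bullet> b))) = (\<Prod>b\<in>Basis. integral\<^sup>L lborel (f b))"
    unfolding e using product_integral_prod[of Basis f] f m m2
    by (subst integral_distr) (auto simp: eq)
qed

section \<open>Gaussians and their cosine and sine integrals\<close>

text \<open>The heat kernel at time 1/2. The product form reduces its characteristic function to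
  that of the one-dimensional normal law.\<close>

definition std_gauss :: "'a::euclidean_space \<Rightarrow> real" where
  "std_gauss x = (\<Prod>b\<in>Basis. std_normal_density (x \<bullet> b))"

text \<open>The heat kernel of the problem over an arbitrary Euclidean space, so that the Gaussian
  lemmas do not depend on the coordinate type.\<close>

definition gauss :: "real \<Rightarrow> 'a::euclidean_space \<Rightarrow> real" where
  "gauss t x = 1 / sqrt (4 * pi * t) ^ DIM('a) * exp (- (norm x)\<^sup>2 / (4 * t))"

lemma gauss_eq_gauss_kernel: "gauss_kernel = (gauss :: real \<Rightarrow> real ^ 'n \<Rightarrow> real)"
  by (simp add: fun_eq_iff gauss_def gauss_kernel_def)

lemma measurable_gauss [measurable]: "gauss t \<in> borel_measurable borel"
  unfolding gauss_def by measurable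

lemma measurable_std_gauss [measurable]: "std_gauss \<in> borel_measurable borel"
  unfolding std_gauss_def by measurable

lemma std_gauss_eq: "std_gauss (x::'a::euclidean_space) = 1 / sqrt (2 * pi) ^ DIM('a) * exp (- (norm x)\<^sup>2 / 2)"
proof -
  have "std_gauss x = (\<Prod>b\<in>(Basis::'a set). 1 / sqrt (2 * pi)) * (\<Prod>b\<in>Basis. exp (- (x \<bullet> b)\<^sup>2 / 2))"
    unfolding std_gauss_def std_normal_density_def by (rule prod.distrib)
  also have "(\<Prod>b\<in>Basis. exp (- (x \<bullet> b)\<^sup>2 / 2)) = exp (\<Sum>b\<in>Basis. - (x \<bullet> b)\<^sup>2 / 2)"
    by (simp add: exp_sum)
  also have "(\<Sum>b\<in>Basis. - (x \<bullet> b)\<^sup>2 / 2) = - (norm x)\<^sup>2 / 2"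
    unfolding power2_norm_eq_inner euclidean_inner[of x x]
    by (simp add: sum_negf power2_eq_square flip: sum_divide_distrib)
  finally show ?thesis by (simp add: power_one_over)
qed

lemma char_std_normal_lborel:
  shows "integrable lborel (\<lambda>x. complex_of_real (std_normal_density x) * iexp (s * x))"
    and "(LINT x|lborel. complex_of_real (std_normal_density x) * iexp (s * x)) = complex_of_real (exp (- s\<^sup>2 / 2))"
proof -
  show "integrable lborel (\<lambda>x. complex_of_real (std_normal_density x) * iexp (s * x))"
    by (rule Bochner_Integration.integrable_bound[OF integrable_normal_density[of 1 0]])
      (auto simp: norm_mult)
  have "(LINT x|lborel. complex_of_real (std_normal_density x) * iexp (s * x)) = char std_normal_distribution s"
    unfolding char_def by (subst integral_density) (auto simp: scaleR_conv_of_real)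
  then show "(LINT x|lborel. complex_of_real (std_normal_density x) * iexp (s * x)) = complex_of_real (exp (- s\<^sup>2 / 2))"
    by (simp add: char_std_normal_distribution)
qed

text \<open>The exponential of a sum splits over the basis, and each factor is the characteristic
  function of the standard normal law. Real and imaginary parts are taken right afterwards, and
  complex numbers do not return.\<close>

lemma std_gauss_iexp:
  fixes \<xi> :: "'a::euclidean_space"
  shows "integrable lborel (\<lambda>x. complex_of_real (std_gauss x) * iexp (x \<bullet> \<xi>))"
    and "(LINT x|lborel. complex_of_real (std_gauss x) * iexp (x \<bullet> \<xi>)) = complex_of_real (exp (- (norm \<xi>)\<^sup>2 / 2))"
proof -
  define f where "f b s = complex_of_real (std_normal_density s) * iexp ((\<xi> \<bullet> b) * s)" for b :: 'a and s
  have eq: "complex_of_real (std_gauss x) * iexp (x \<bullet> \<xi>) = (\<Prod>b\<in>Basis. f b (x \<bullet> b))" for x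
  proof -
    have "iexp (x \<bullet> \<xi>) = iexp (\<Sum>b\<in>Basis. (\<xi> \<bullet> b) * (x \<bullet> b))"
      by (subst euclidean_inner) (simp add: mult.commute)
    also have "\<dots> = (\<Prod>b\<in>Basis. iexp ((\<xi> \<bullet> b) * (x \<bullet> b)))"
      by (simp add: sum_distrib_left exp_sum)
    finally show ?thesis
      by (simp add: std_gauss_def f_def prod.distrib)
  qed
  have f: "integrable lborel (f b)" for b unfolding f_def by (rule char_std_normal_lborel)
  show "integrable lborel (\<lambda>x. complex_of_real (std_gauss x) * iexp (x \<bullet> \<xi>))"
    unfolding eq by (rule lborel_prod_integral) (rule f)
  have "(LINT x|lborel. complex_of_real (std_gauss x) * iexp (x \<bullet> \<xi>)) = (\<Prod>b\<in>Basis. integral\<^sup>L lborel (f b))"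
    unfolding eq by (rule lborel_prod_integral) (rule f)
  also have "\<dots> = (\<Prod>b\<in>Basis. complex_of_real (exp (- (\<xi> \<bullet> b)\<^sup>2 / 2)))"
    unfolding f_def char_std_normal_lborel(2) ..
  also have "\<dots> = complex_of_real (exp (\<Sum>b\<in>Basis. - (\<xi> \<bullet> b)\<^sup>2 / 2))"
    by (simp add: exp_sum)
  also have "(\<Sum>b\<in>Basis. - (\<xi> \<bullet> b)\<^sup>2 / 2) = - (norm \<xi>)\<^sup>2 / 2"
    unfolding power2_norm_eq_inner euclidean_inner[of \<xi> \<xi>]
    by (simp add: sum_negf power2_eq_square flip: sum_divide_distrib)
  finally show "(LINT x|lborel. complex_of_real (std_gauss x) * iexp (x \<bullet> \<xi>)) = complex_of_real (exp (- (norm \<xi>)\<^sup>2 / 2))" .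
qed

lemma std_gauss_cos_sin:
  fixes \<xi> :: "'a::euclidean_space"
  shows "integrable lborel (\<lambda>x. std_gauss x * cos (x \<bullet> \<xi>))" "integrable lborel (\<lambda>x. std_gauss x * sin (x \<bullet> \<xi>))"
    and "(LINT x|lborel. std_gauss x * cos (x \<bullet> \<xi>)) = exp (- (norm \<xi>)\<^sup>2 / 2)"
    and "(LINT x|lborel. std_gauss x * sin (x \<bullet> \<xi>)) = 0"
proof -
  note i = std_gauss_iexp(1)[of \<xi>] and v = std_gauss_iexp(2)[of \<xi>]
  have Re: "Re (complex_of_real (std_gauss x) * iexp (x \<bullet> \<xi>)) = std_gauss x * cos (x \<bullet> \<xi>)"
    and Im: "Im (complex_of_real (std_gauss x) * iexp (x \<bullet> \<xi>)) = std_gauss x * sin (x \<bullet> \<xi>)" for x :: 'a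
    by (simp_all add: Re_exp Im_exp)
  show "integrable lborel (\<lambda>x. std_gauss x * cos (x \<bullet> \<xi>))" "integrable lborel (\<lambda>x. std_gauss x * sin (x \<bullet> \<xi>))"
    using integrable_Re[OF i] integrable_Im[OF i] unfolding Re Im .
  show "(LINT x|lborel. std_gauss x * cos (x \<bullet> \<xi>)) = exp (- (norm \<xi>)\<^sup>2 / 2)"
    using integral_Re[OF i] unfolding Re v by simp
  show "(LINT x|lborel. std_gauss x * sin (x \<bullet> \<xi>)) = 0"
    using integral_Im[OF i] unfolding Im v by simp
qed

lemma gauss_scaled:
  assumes "t > 0"
  shows "sqrt (2 * t) ^ DIM('a) * gauss t (sqrt (2 * t) *\<^sub>R (x::'a::euclidean_space)) = std_gauss x"
proof -
  have "sqrt (4 * pi * t) = sqrt (2 * t) * sqrt (2 * pi)"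
    using assms by (simp flip: real_sqrt_mult)
  then show ?thesis using assms
    by (simp add: gauss_def std_gauss_eq power_mult_distrib)
qed

text \<open>Stretching by sqrt (2 t) reduces to the standard Gaussian; the frequency is rescaled
  with it, and half of |sqrt (2 t) xi|^2 is t |xi|^2.\<close>

lemma gauss_cos_sin:
  fixes \<xi> :: "'a::euclidean_space"
  assumes t: "t > 0"
  shows "integrable lborel (\<lambda>x. gauss t x * cos (x \<bullet> \<xi>))" "integrable lborel (\<lambda>x. gauss t x * sin (x \<bullet> \<xi>))"
    and "(LINT x|lborel. gauss t x * cos (x \<bullet> \<xi>)) = exp (- t * (norm \<xi>)\<^sup>2)"
    and "(LINT x|lborel. gauss t x * sin (x \<bullet> \<xi>)) = 0"
proof -
  let ?c = "sqrt (2 * t)"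
  have c: "?c \<noteq> 0" "\<bar>?c\<bar> = ?c" using t by auto
  have g: "gauss t (0 + ?c *\<^sub>R x) = std_gauss x / ?c ^ DIM('a)" for x :: 'a
    using gauss_scaled[OF t, of x] t by (simp add: field_simps)
  have m: "(\<lambda>x. gauss t x * cos (x \<bullet> \<xi>)) \<in> borel_measurable borel" "(\<lambda>x. gauss t x * sin (x \<bullet> \<xi>)) \<in> borel_measurable borel"
    by measurable
  have n: "(norm (?c *\<^sub>R \<xi>))\<^sup>2 / 2 = t * (norm \<xi>)\<^sup>2" using t by (simp add: power_mult_distrib)
  note sc = std_gauss_cos_sin[of "?c *\<^sub>R \<xi>"]
  show "integrable lborel (\<lambda>x. gauss t x * cos (x \<bullet> \<xi>))"
    using sc(1) unfolding integrable_lborel_scaled_iff[OF c(1) m(1), of 0, symmetric] g by simp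
  show "integrable lborel (\<lambda>x. gauss t x * sin (x \<bullet> \<xi>))"
    using sc(2) unfolding integrable_lborel_scaled_iff[OF c(1) m(2), of 0, symmetric] g by simp
  show "(LINT x|lborel. gauss t x * cos (x \<bullet> \<xi>)) = exp (- t * (norm \<xi>)\<^sup>2)"
    using sc(3) n t unfolding integral_lborel_scaled[OF c(1) m(1), of 0] g by simp
  show "(LINT x|lborel. gauss t x * sin (x \<bullet> \<xi>)) = 0"
    using sc(4) unfolding integral_lborel_scaled[OF c(1) m(2), of 0] g by simp
qed

lemma gauss_nonneg [simp]: "t > 0 \<Longrightarrow> 0 \<le> gauss t x"
  by (simp add: gauss_def)

lemma gauss_minus_commute: "gauss t (x - y) = gauss t (y - x)"
  by (simp add: gauss_def norm_minus_commute)

lemma integrable_gauss: "t > 0 \<Longrightarrow> integrable lborel (gauss t)"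
  using gauss_cos_sin(1)[of t 0] by simp

lemma integral_gauss: "t > 0 \<Longrightarrow> integral\<^sup>L lborel (gauss t) = 1"
  using gauss_cos_sin(3)[of t 0] by simp

lemma integrable_gauss_diff: "t > 0 \<Longrightarrow> integrable lborel (\<lambda>x. gauss t (x - y))"
  using integrable_lborel_translate_iff[of "gauss t" "-y"] integrable_gauss[of t] by (simp add: minus_diff_commute)

lemma integral_gauss_diff: "t > 0 \<Longrightarrow> (LINT x|lborel. gauss t (x - y)) = 1"
  using integral_lborel_translate[of "gauss t" "-y"] integral_gauss[of t] by (simp add: minus_diff_commute)

lemma integrable_gauss_diff': "t > 0 \<Longrightarrow> integrable lborel (\<lambda>y. gauss t (x - y))"
  by (subst gauss_minus_commute) (rule integrable_gauss_diff)

lemma integral_gauss_diff': "t > 0 \<Longrightarrow> (LINT y|lborel. gauss t (x - y)) = 1"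
  by (subst gauss_minus_commute) (rule integral_gauss_diff)

lemma gauss_bound: "t > 0 \<Longrightarrow> gauss t (x::'a::euclidean_space) \<le> 1 / sqrt (4 * pi * t) ^ DIM('a)"
  unfolding gauss_def by (intro mult_left_le) auto

text \<open>A Gaussian in frequency is itself a heat kernel up to a factor, at time 1 / (4 t), so
  its integrals are read off from those of \<open>gauss\<close>.\<close>

lemma exp_eq_gauss:
  assumes "t > 0"
  shows "exp (- t * (norm x)\<^sup>2) = sqrt (pi / t) ^ DIM('a) * gauss (1 / (4 * t)) (x::'a::euclidean_space)"
proof -
  have "4 * pi * (1 / (4 * t)) = pi / t" by (simp add: field_simps)
  then show ?thesis using assms by (simp add: gauss_def)
qed

lemma integrable_exp_norm: "t > 0 \<Longrightarrow> integrable lborel (\<lambda>x::'a::euclidean_space. exp (- t * (norm x)\<^sup>2))"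
  unfolding exp_eq_gauss by (simp add: integrable_gauss)

lemma integral_exp_norm:
  "t > 0 \<Longrightarrow> (LINT x::'a::euclidean_space|lborel. exp (- t * (norm x)\<^sup>2)) = sqrt (pi / t) ^ DIM('a)"
  unfolding exp_eq_gauss by (simp add: integral_gauss)

lemma exp_norm_cos_sin:
  fixes x :: "'a::euclidean_space"
  assumes "t > 0"
  shows "(LINT \<xi>|lborel. exp (- t * (norm \<xi>)\<^sup>2) * cos (\<xi> \<bullet> x)) = (2 * pi) ^ DIM('a) * gauss t x"
    and "(LINT \<xi>|lborel. exp (- t * (norm \<xi>)\<^sup>2) * sin (\<xi> \<bullet> x)) = 0"
proof -
  have t: "1 / (4 * t) > 0" using assms by simp
  have "sqrt (pi / t) * sqrt (4 * pi * t) = 2 * pi"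
    using assms by (simp flip: real_sqrt_mult add: real_sqrt_unique power2_eq_square)
  then have "sqrt (pi / t) = 2 * pi / sqrt (4 * pi * t)"
    using assms by (simp add: field_simps)
  then have s: "sqrt (pi / t) ^ DIM('a) = (2 * pi) ^ DIM('a) / sqrt (4 * pi * t) ^ DIM('a)"
    by (simp add: power_divide)
  show "(LINT \<xi>|lborel. exp (- t * (norm \<xi>)\<^sup>2) * cos (\<xi> \<bullet> x)) = (2 * pi) ^ DIM('a) * gauss t x"
    unfolding exp_eq_gauss[OF assms] using gauss_cos_sin(3)[OF t, of x]
    by (simp add: mult.assoc s) (simp add: gauss_def mult.assoc)
  show "(LINT \<xi>|lborel. exp (- t * (norm \<xi>)\<^sup>2) * sin (\<xi> \<bullet> x)) = 0"
    unfolding exp_eq_gauss[OF assms] using gauss_cos_sin(4)[OF t, of x]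
    by (simp add: mult.assoc)
qed

section \<open>Fubini for bounded kernels and the Schur bound for heat smoothing\<close>

lemma Fubini_bounded_kernel:
  fixes f :: "'a::euclidean_space \<Rightarrow> real" and g :: "'b::euclidean_space \<Rightarrow> real"
  assumes f: "integrable lborel f" and g: "integrable lborel g"
    and K [measurable]: "(\<lambda>(x, y). K x y) \<in> borel_measurable (borel \<Otimes>\<^sub>M borel)" and bd: "\<And>x y. \<bar>K x y\<bar> \<le> C"
  shows "(LINT x|lborel. f x * (LINT y|lborel. g y * K x y)) = (LINT y|lborel. g y * (LINT x|lborel. f x * K x y))"
    and "integrable lborel (\<lambda>x. f x * (LINT y|lborel. g y * K x y))"
proof -
  have [measurable]: "f \<in> borel_measurable borel" "g \<in> borel_measurable borel"
    using f g by (auto dest: borel_measurable_integrable)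
  have *: "integrable (lborel \<Otimes>\<^sub>M lborel) (\<lambda>(x, y). f x * g y * K x y)"
  proof (rule Bochner_Integration.integrable_bound)
    have "integrable (lborel \<Otimes>\<^sub>M lborel) (\<lambda>(x, y). f x * g y)"
      by (rule lborel_pair.Fubini_integrable) (use f g in \<open>auto simp: abs_mult\<close>)
    then show "integrable (lborel \<Otimes>\<^sub>M lborel) (\<lambda>z. C * (\<lambda>(x, y). f x * g y) z)"
      by (rule integrable_mult_right)
    show "(\<lambda>(x, y). f x * g y * K x y) \<in> borel_measurable (lborel \<Otimes>\<^sub>M lborel)"
      by measurable
    show "AE z in lborel \<Otimes>\<^sub>M lborel. norm (case z of (x, y) \<Rightarrow> f x * g y * K x y) \<le> norm (C * (case z of (x, y) \<Rightarrow> f x * g y))"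
    proof (intro AE_I2, clarify)
      fix x :: 'a and y :: 'b
      have "\<bar>f x * g y\<bar> * \<bar>K x y\<bar> \<le> \<bar>f x * g y\<bar> * \<bar>C\<bar>"
        using bd[of x y] by (intro mult_left_mono) auto
      then show "norm (f x * g y * K x y) \<le> norm (C * (f x * g y))"
        by (simp add: abs_mult mult.commute)
    qed
  qed
  have "(LINT x|lborel. f x * (LINT y|lborel. g y * K x y)) = (LINT x|lborel. LINT y|lborel. f x * g y * K x y)"
    by (simp add: mult.assoc)
  also have "\<dots> = (LINT y|lborel. LINT x|lborel. f x * g y * K x y)"
    by (rule lborel_pair.Fubini_integral[OF *, symmetric])
  also have "\<dots> = (LINT y|lborel. g y * (LINT x|lborel. f x * K x y))"
    by (intro Bochner_Integration.integral_cong refl, subst integral_mult_right_zero[symmetric]) (simp add: mult_ac)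
  finally show "(LINT x|lborel. f x * (LINT y|lborel. g y * K x y)) = (LINT y|lborel. g y * (LINT x|lborel. f x * K x y))" .
  show "integrable lborel (\<lambda>x. f x * (LINT y|lborel. g y * K x y))"
    using lborel_pair.integrable_fst[OF *] by (simp add: mult.assoc)
qed

lemma integrable_gauss_kernel_pair:
  fixes h :: "'a::euclidean_space \<Rightarrow> real"
  assumes t: "t > 0" and h: "integrable lborel h"
  shows "integrable (lborel \<Otimes>\<^sub>M lborel) (\<lambda>(x, y). h x * gauss t (x - y))"
    and "integrable (lborel \<Otimes>\<^sub>M lborel) (\<lambda>(x, y). h y * gauss t (x - y))"
proof -
  have [measurable]: "h \<in> borel_measurable borel" using h by (auto dest: borel_measurable_integrable)
  show *: "integrable (lborel \<Otimes>\<^sub>M lborel) (\<lambda>(x, y). h x * gauss t (x - y))"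
    by (rule lborel_pair.Fubini_integrable)
      (use t h in \<open>auto simp: abs_mult integrable_gauss_diff' integral_gauss_diff'\<close>)
  show "integrable (lborel \<Otimes>\<^sub>M lborel) (\<lambda>(x, y). h y * gauss t (x - y))"
    using lborel_pair.integrable_product_swap[OF *] by (simp add: gauss_minus_commute)
qed

text \<open>Schur test: |f g| is at most (f^2 + g^2) / 2, and every row and every column of the
  kernel has integral 1. The bound on the quadratic form is what makes the transform a
  contraction.\<close>

lemma gauss_Schur:
  fixes f g :: "'a::euclidean_space \<Rightarrow> real"
  assumes t: "t > 0" and f: "sq_int f" and g: "sq_int g"
  shows "integrable (lborel \<Otimes>\<^sub>M lborel) (\<lambda>(x, y). f x * g y * gauss t (x - y))"
    and "(LINT x|lborel. f x * (LINT y|lborel. f y * gauss t (x - y))) \<le> (l2_norm f)\<^sup>2"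
proof -
  have main: "integrable (lborel \<Otimes>\<^sub>M lborel) (\<lambda>(x, y). f x * g y * gauss t (x - y)) \<and>
      (LINT z|(lborel \<Otimes>\<^sub>M lborel). (\<lambda>(x, y). f x * g y * gauss t (x - y)) z) \<le> ((l2_norm f)\<^sup>2 + (l2_norm g)\<^sup>2) / 2"
    if f: "sq_int f" and g: "sq_int g" for f g :: "'a \<Rightarrow> real"
  proof -
    note [measurable] = sq_int_measurable[OF f] sq_int_measurable[OF g]
    let ?A = "\<lambda>(x::'a, y::'a). (f x)\<^sup>2 * gauss t (x - y)"
    let ?B = "\<lambda>(x::'a, y::'a). (g y)\<^sup>2 * gauss t (x - y)"
    have A: "integrable (lborel \<Otimes>\<^sub>M lborel) ?A" and B: "integrable (lborel \<Otimes>\<^sub>M lborel) ?B"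
      using integrable_gauss_kernel_pair[OF t] f g by (auto simp: sq_int_def)
    have AB: "integrable (lborel \<Otimes>\<^sub>M lborel) (\<lambda>z. (?A z + ?B z) / 2)" using A B by simp
    have le: "\<bar>f x * g y * gauss t (x - y)\<bar> \<le> ((f x)\<^sup>2 * gauss t (x - y) + (g y)\<^sup>2 * gauss t (x - y)) / 2" for x y
    proof -
      have "\<bar>f x * g y\<bar> \<le> ((f x)\<^sup>2 + (g y)\<^sup>2) / 2"
        using sum_squares_bound[of "\<bar>f x\<bar>" "\<bar>g y\<bar>"] by (simp add: abs_mult)
      then have "\<bar>f x * g y\<bar> * gauss t (x - y) \<le> ((f x)\<^sup>2 + (g y)\<^sup>2) / 2 * gauss t (x - y)"
        using t by (intro mult_right_mono) auto
      then show ?thesis using t by (simp add: abs_mult distrib_right)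
    qed
    have int: "integrable (lborel \<Otimes>\<^sub>M lborel) (\<lambda>(x, y). f x * g y * gauss t (x - y))"
    proof (rule Bochner_Integration.integrable_bound[OF AB])
      show "AE z in lborel \<Otimes>\<^sub>M lborel. norm (case z of (x, y) \<Rightarrow> f x * g y * gauss t (x - y)) \<le> norm ((?A z + ?B z) / 2)"
        unfolding real_norm_def split_beta by (intro AE_I2 order_trans[OF le abs_ge_self])
    qed measurable
    have "(LINT z|(lborel \<Otimes>\<^sub>M lborel). (\<lambda>(x, y). f x * g y * gauss t (x - y)) z) \<le> (LINT z|(lborel \<Otimes>\<^sub>M lborel). (?A z + ?B z) / 2)"
      by (rule integral_mono[OF int AB]) (simp only: split_beta order_trans[OF abs_ge_self le])
    also have "\<dots> = (integral\<^sup>L (lborel \<Otimes>\<^sub>M lborel) ?A + integral\<^sup>L (lborel \<Otimes>\<^sub>M lborel) ?B) / 2"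
      using A B by simp
    also have "integral\<^sup>L (lborel \<Otimes>\<^sub>M lborel) ?A = (l2_norm f)\<^sup>2"
      using lborel_pair.integral_fst[OF A] t by (simp add: integral_gauss_diff' l2_norm_power2)
    also have "integral\<^sup>L (lborel \<Otimes>\<^sub>M lborel) ?B = (l2_norm g)\<^sup>2"
      using lborel_pair.integral_snd[OF B] t by (simp add: integral_gauss_diff l2_norm_power2)
    finally show ?thesis using int by simp
  qed
  show "integrable (lborel \<Otimes>\<^sub>M lborel) (\<lambda>(x, y). f x * g y * gauss t (x - y))"
    using main[OF f g] by simp
  show "(LINT x|lborel. f x * (LINT y|lborel. f y * gauss t (x - y))) \<le> (l2_norm f)\<^sup>2"
    using main[OF f f] lborel_pair.integral_fst[of "\<lambda>x y. f x * f y * gauss t (x - y)"] by (simp add: mult.assoc)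
qed

section \<open>Functions annihilated by all boxes or by all heat kernels\<close>

text \<open>The positive and the negative part of \<open>F\<close> are densities of two measures
  that agree on boxes. Boxes form an intersection-stable generator, so the measures coincide, and
  then the densities.\<close>

lemma AE_zero_if_box_integrals_zero:
  fixes F :: "'a::euclidean_space \<Rightarrow> real"
  assumes F [measurable]: "F \<in> borel_measurable borel"
    and int: "\<And>l u. integrable lborel (\<lambda>x. indicator (box l u) x * F x)"
    and zero: "\<And>l u. (LINT x|lborel. indicator (box l u) x * F x) = 0"
  shows "AE x in lborel. F x = 0"
proof -
  define P where "P x = ennreal (F x)" for x
  define N where "N x = ennreal (- F x)" for x
  have [measurable]: "P \<in> borel_measurable borel" "N \<in> borel_measurable borel"
    unfolding P_def N_def by measurable
  have P: "emeasure (density lborel P) (box l u) = ennreal (LINT x|lborel. indicator (box l u) x * max 0 (F x))" for l u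
  proof -
    have "emeasure (density lborel P) (box l u) = (\<integral>\<^sup>+x. ennreal (indicator (box l u) x * max 0 (F x)) \<partial>lborel)"
      by (subst emeasure_density) (auto intro!: nn_integral_cong simp: P_def indicator_def max_def ennreal_neg)
    also have "\<dots> = ennreal (LINT x|lborel. indicator (box l u) x * max 0 (F x))"
      by (intro nn_integral_eq_integral Bochner_Integration.integrable_bound[OF int[of l u]] AE_I2) (auto simp: indicator_def)
    finally show ?thesis .
  qed
  have N: "emeasure (density lborel N) (box l u) = ennreal (LINT x|lborel. indicator (box l u) x * max 0 (- F x))" for l u
  proof -
    have "emeasure (density lborel N) (box l u) = (\<integral>\<^sup>+x. ennreal (indicator (box l u) x * max 0 (- F x)) \<partial>lborel)"
      by (subst emeasure_density) (auto intro!: nn_integral_cong simp: N_def indicator_def max_def ennreal_neg)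
    also have "\<dots> = ennreal (LINT x|lborel. indicator (box l u) x * max 0 (- F x))"
      by (intro nn_integral_eq_integral Bochner_Integration.integrable_bound[OF int[of l u]] AE_I2) (auto simp: indicator_def)
    finally show ?thesis .
  qed
  have PN: "(LINT x|lborel. indicator (box l u) x * max 0 (F x)) = (LINT x|lborel. indicator (box l u) x * max 0 (- F x))" for l u
  proof -
    have i: "integrable lborel (\<lambda>x. indicator (box l u) x * max 0 (F x))" "integrable lborel (\<lambda>x. indicator (box l u) x * max 0 (- F x))"
      by (intro Bochner_Integration.integrable_bound[OF int[of l u]] AE_I2; auto simp: indicator_def)+
    have "(LINT x|lborel. indicator (box l u) x * F x) =
        (LINT x|lborel. indicator (box l u) x * max 0 (F x) - indicator (box l u) x * max 0 (- F x))"
      by (intro Bochner_Integration.integral_cong) (auto simp: max_def)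
    then show ?thesis using zero[of l u] i by simp
  qed
  have "density lborel P = density lborel N"
  proof (rule measure_eqI_generator_eq)
    let ?E = "range (\<lambda>(a, b). box a b :: 'a set)"
    show "Int_stable ?E"
      by (auto simp: Int_stable_def box_Int_box)
    show "?E \<subseteq> Pow UNIV" "sets (density lborel P) = sigma_sets UNIV ?E" "sets (density lborel N) = sigma_sets UNIV ?E"
      by (simp_all add: borel_eq_box)
    let ?A = "\<lambda>n::nat. box (- (real n *\<^sub>R One)) (real n *\<^sub>R One) :: 'a set"
    show "range ?A \<subseteq> ?E" "(\<Union>i. ?A i) = UNIV"
      unfolding UN_box_eq_UNIV by auto
    show "emeasure (density lborel P) (?A i) \<noteq> \<infinity>" for i unfolding P by simp
    show "emeasure (density lborel P) X = emeasure (density lborel N) X" if "X \<in> ?E" for X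
      using that PN by (auto simp: P N)
  qed
  then have "AE x in lborel. P x = N x"
    by (intro sigma_finite_measure.density_unique[OF sigma_finite_lborel]) auto
  then show ?thesis
  proof eventually_elim
    case (elim x)
    then have "ennreal (F x) = ennreal (- F x)" by (simp add: P_def N_def)
    then show ?case
      by (cases "F x \<ge> 0") (auto simp: ennreal_neg ennreal_eq_0_iff eq_commute[of 0])
  qed
qed

text \<open>Indicators of boxes are L2 limits of their heat smoothings, and by Fubini each smoothing
  pairs to zero with \<open>F\<close>.\<close>

lemma gauss_smoothing_zero:
  fixes F :: "'a::euclidean_space \<Rightarrow> real"
  assumes F: "sq_int F" and zero: "\<And>t a. t > 0 \<Longrightarrow> (LINT x|lborel. F x * gauss t (x - a)) = 0"
  shows "AE x in lborel. F x = 0"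
proof (rule AE_zero_if_box_integrals_zero)
  note [measurable] = sq_int_measurable[OF F]
  show "F \<in> borel_measurable borel" by measurable
  fix l u :: 'a
  let ?I = "indicator (box l u) :: 'a \<Rightarrow> real"
  have fin: "emeasure lborel (box l u) < \<infinity>" by (rule emeasure_lborel_box_finite)
  have I: "sq_int ?I" using fin
    by (auto simp: sq_int_def power2_eq_square borel_measurable_indicator' simp flip: indicator_inter_arith)
  have Ii: "integrable lborel ?I" using fin by simp
  show "integrable lborel (\<lambda>x. ?I x * F x)" using sq_int_mult_integrable[OF I F] .
  define g where "g k x = (LINT y|lborel. ?I y * gauss (1 / real (Suc k)) (x - y))" for k and x :: 'a
  have pos: "1 / real (Suc k) > 0" for k by simp
  have [measurable]: "g k \<in> borel_measurable borel" for k
    unfolding g_def by measurable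
  have g_int: "integrable lborel (\<lambda>y. ?I y * gauss (1 / real (Suc k)) (x - y))" for k and x :: 'a
    by (rule Bochner_Integration.integrable_bound[OF integrable_gauss_diff'[OF pos, of k x]]) (auto simp: indicator_def)
  have g0: "0 \<le> g k x" for k x unfolding g_def by (intro integral_nonneg_AE AE_I2) auto
  have g1: "g k x \<le> 1" for k x
  proof -
    have "g k x \<le> (LINT y|lborel. gauss (1 / real (Suc k)) (x - y))"
      unfolding g_def using pos[of k] by (intro integral_mono g_int integrable_gauss_diff') (auto simp: indicator_def)
    then show ?thesis using integral_gauss_diff'[OF pos, of k x] by simp
  qed
  have lim: "(\<lambda>k. g k x) \<longlonglongrightarrow> 1" if x: "x \<in> box l u" for x
  proof -
    \<comment> \<open>The substitution y = x - sqrt (2 / (k + 1)) z moves the dependence on k from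
      the Gaussian into the indicator, so that dominated convergence has the fixed majorant
      \<open>std_gauss\<close>.\<close>
    have eq: "g k x = (LINT z|lborel. ?I (x - sqrt (2 * (1 / real (Suc k))) *\<^sub>R z) * std_gauss z)" for k
    proof -
      let ?c = "sqrt (2 * (1 / real (Suc k)))"
      have c: "- ?c \<noteq> 0" by simp
      have m: "(\<lambda>y. ?I y * gauss (1 / real (Suc k)) (x - y)) \<in> borel_measurable borel" by measurable
      have "g k x = ?c ^ DIM('a) * (LINT z|lborel. ?I (x + (- ?c) *\<^sub>R z) * gauss (1 / real (Suc k)) (x - (x + (- ?c) *\<^sub>R z)))"
        unfolding g_def by (subst integral_lborel_scaled[OF c m, of x]) simp
      also have "\<dots> = (LINT z|lborel. ?I (x - ?c *\<^sub>R z) * std_gauss z)"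
      proof (subst integral_mult_right_zero[symmetric], intro Bochner_Integration.integral_cong refl)
        show "?c ^ DIM('a) * (?I (x + (- ?c) *\<^sub>R z) * gauss (1 / real (Suc k)) (x - (x + (- ?c) *\<^sub>R z)))
            = ?I (x - ?c *\<^sub>R z) * std_gauss z" for z :: 'a
          unfolding gauss_scaled[OF pos[of k], symmetric] by (simp add: mult_ac del: of_nat_Suc)
      qed
      finally show ?thesis .
    qed
    have "(\<lambda>k. LINT z|lborel. ?I (x - sqrt (2 * (1 / real (Suc k))) *\<^sub>R z) * std_gauss z) \<longlonglongrightarrow> (LINT z|lborel. std_gauss (z::'a))"
    proof (rule integral_dominated_convergence[where w=std_gauss])
      show "integrable lborel (std_gauss :: 'a \<Rightarrow> real)" using std_gauss_cos_sin(1)[of 0] by simp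
      show "AE z in lborel. (\<lambda>k. ?I (x - sqrt (2 * (1 / real (Suc k))) *\<^sub>R z) * std_gauss z) \<longlonglongrightarrow> std_gauss z"
      proof (rule AE_I2)
        fix z :: 'a
        have "(\<lambda>k. sqrt (2 * (1 / real (Suc k)))) \<longlonglongrightarrow> 0" by real_asymp
        then have "(\<lambda>k. x - sqrt (2 * (1 / real (Suc k))) *\<^sub>R z) \<longlonglongrightarrow> x - 0 *\<^sub>R z" by (intro tendsto_intros)
        then have "eventually (\<lambda>k. x - sqrt (2 * (1 / real (Suc k))) *\<^sub>R z \<in> box l u) sequentially"
          using x by (intro topological_tendstoD) auto
        then have "eventually (\<lambda>k. ?I (x - sqrt (2 * (1 / real (Suc k))) *\<^sub>R z) * std_gauss z = std_gauss z) sequentially"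
          by eventually_elim simp
        then show "(\<lambda>k. ?I (x - sqrt (2 * (1 / real (Suc k))) *\<^sub>R z) * std_gauss z) \<longlonglongrightarrow> std_gauss z"
          by (rule tendsto_eventually)
      qed
    qed (auto simp: indicator_def std_gauss_eq)
    then show ?thesis unfolding eq[symmetric] using std_gauss_cos_sin(3)[of "0::'a"] by simp
  qed
  have Ig: "(LINT x|lborel. g k x) = integral\<^sup>L lborel ?I" and g_i: "integrable lborel (g k)" for k
  proof -
    have *: "integrable (lborel \<Otimes>\<^sub>M lborel) (\<lambda>(x, y). ?I y * gauss (1 / real (Suc k)) (x - y))"
      by (rule integrable_gauss_kernel_pair[OF pos Ii])
    show "integrable lborel (g k)" unfolding g_def using lborel_pair.integrable_fst[OF *] .
    show "(LINT x|lborel. g k x) = integral\<^sup>L lborel ?I"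
      unfolding g_def lborel_pair.Fubini_integral[OF *, symmetric] by (simp add: integral_gauss_diff)
  qed
  have gsq: "sq_int (g k)" for k
    using g_i g0 g1 unfolding sq_int_def
    by (auto intro!: Bochner_Integration.integrable_bound[OF g_i[of k]] simp: power2_eq_square mult_left_le)
  \<comment> \<open>Since \<open>g k\<close> lies between 0 and 1 and has the same integral as the
    indicator, the squared distance is at most twice the mass that \<open>g k\<close> misses inside
    the box. Pointwise convergence is thus required only in the open box, not on its boundary or
    outside.\<close>
  have "(\<lambda>k. (l2_norm (\<lambda>x. g k x - ?I x))\<^sup>2) \<longlonglongrightarrow> 0"
  proof (rule real_tendsto_sandwich[where f="\<lambda>_. 0"])
    have "(\<lambda>k. LINT x|lborel. ?I x * g k x) \<longlonglongrightarrow> (LINT x|lborel. ?I x)"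
    proof (rule integral_dominated_convergence[where w="?I"])
      show "AE x in lborel. (\<lambda>k. ?I x * g k x) \<longlonglongrightarrow> ?I x"
        using lim by (auto simp: indicator_def)
      show "AE x in lborel. norm (?I x * g k x) \<le> ?I x" for k
        using g0 g1 by (auto simp: indicator_def)
    qed (use Ii in auto)
    from tendsto_mult_left[OF tendsto_diff[OF tendsto_const[of "integral\<^sup>L lborel ?I"] this], of 2]
    show "(\<lambda>k. 2 * (integral\<^sup>L lborel ?I - (LINT x|lborel. ?I x * g k x))) \<longlonglongrightarrow> 0" by simp
    have "(l2_norm (\<lambda>x. g k x - ?I x))\<^sup>2 \<le> 2 * (integral\<^sup>L lborel ?I - (LINT x|lborel. ?I x * g k x))" for k
    proof -
      have i: "integrable lborel (\<lambda>x. ?I x * g k x)" by (rule sq_int_mult_integrable[OF I gsq])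
      have "(l2_norm (\<lambda>x. g k x - ?I x))\<^sup>2 \<le> (LINT x|lborel. g k x + ?I x - 2 * (?I x * g k x))"
        unfolding l2_norm_power2
      proof (rule integral_mono)
        show "integrable lborel (\<lambda>x. (g k x - ?I x)\<^sup>2)" using sq_int_diff[OF gsq I] by (simp add: sq_int_def)
        show "integrable lborel (\<lambda>x. g k x + ?I x - 2 * (?I x * g k x))"
          using i g_i Ii by simp
        show "(g k x - ?I x)\<^sup>2 \<le> g k x + ?I x - 2 * (?I x * g k x)" for x
          using mult_left_mono[OF g1[of k x] g0[of k x]] by (auto simp: indicator_def power2_eq_square algebra_simps)
      qed
      also have "\<dots> = 2 * (integral\<^sup>L lborel ?I - (LINT x|lborel. ?I x * g k x))"
        using i g_i[of k] Ii Ig[of k] by simp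
      finally show ?thesis .
    qed
    then show "eventually (\<lambda>k. (l2_norm (\<lambda>x. g k x - ?I x))\<^sup>2 \<le> 2 * (integral\<^sup>L lborel ?I - (LINT x|lborel. ?I x * g k x))) sequentially"
      by simp
  qed auto
  from tendsto_real_sqrt[OF this] have lim2: "(\<lambda>k. l2_norm (\<lambda>x. g k x - ?I x)) \<longlonglongrightarrow> 0" by simp
  have "l2_inner (g k) F = 0" for k
  proof -
    have *: "integrable (lborel \<Otimes>\<^sub>M lborel) (\<lambda>(x, y). F x * ?I y * gauss (1 / real (Suc k)) (x - y))"
      by (rule gauss_Schur[OF pos F I])
    have "l2_inner (g k) F = (LINT x|lborel. LINT y|lborel. F x * ?I y * gauss (1 / real (Suc k)) (x - y))"
      unfolding l2_inner_def g_def by (intro Bochner_Integration.integral_cong refl)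
        (simp add: mult.assoc mult.commute[of _ "F _"])
    also have "\<dots> = (LINT y|lborel. LINT x|lborel. F x * ?I y * gauss (1 / real (Suc k)) (x - y))"
      by (rule lborel_pair.Fubini_integral[OF *, symmetric])
    also have "\<dots> = (LINT y|lborel. ?I y * (LINT x|lborel. F x * gauss (1 / real (Suc k)) (x - y)))"
      by (intro Bochner_Integration.integral_cong refl) (simp add: mult.assoc mult.left_commute[of _ "?I _"])
    also have "\<dots> = 0" using zero[OF pos] by simp
    finally show ?thesis .
  qed
  with l2_inner_tendsto[OF gsq I F lim2] have "l2_inner ?I F = 0" by (simp add: LIMSEQ_const_iff)
  then show "(LINT x|lborel. ?I x * F x) = 0" by (simp add: l2_inner_def)
qed

section \<open>The Hartley transform\<close>

definition cas :: "real \<Rightarrow> real" where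
  "cas x = cos x + sin x"

lemma measurable_cas [measurable]: "cas \<in> borel_measurable borel"
  unfolding cas_def by measurable

lemma abs_cas_le: "\<bar>cas x\<bar> \<le> 2"
  unfolding cas_def using abs_cos_le_one[of x] abs_sin_le_one[of x] by linarith

text \<open>The shape is chosen for integration over x against an even function: the sine term drops
  out, and a cosine integral times \<open>cas y\<close> remains.\<close>

lemma cas_add: "cas (x + y) = cos x * cas y + sin x * cas (- y)"
  by (simp add: cas_def cos_add sin_add algebra_simps)

text \<open>When both arguments are inner products with one frequency, a Gaussian weight in that
  frequency kills the sine term, and the rest depends on the difference of the two points only: two
  transforms in a row become a convolution.\<close>

lemma cas_mult: "cas x * cas y = cos (x - y) + sin (x + y)"
proof -
  have "(cos x)\<^sup>2 + (sin x)\<^sup>2 = 1" by simp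
  then show ?thesis by (simp add: cas_def cos_diff sin_add algebra_simps)
qed

section \<open>The transform on integrable functions\<close>

definition hartley :: "('a::euclidean_space \<Rightarrow> real) \<Rightarrow> 'a \<Rightarrow> real" where
  "hartley f \<xi> = 1 / sqrt (2 * pi) ^ DIM('a) * (LINT x|lborel. f x * cas (x \<bullet> \<xi>))"

lemma measurable_hartley [measurable (raw)]:
  assumes "f \<in> borel_measurable borel"
  shows "hartley f \<in> borel_measurable borel"
proof -
  note [measurable] = assms
  show ?thesis unfolding hartley_def by measurable
qed

lemma integrable_mult_cas:
  fixes f :: "'a::euclidean_space \<Rightarrow> real"
  assumes "integrable lborel f"
  shows "integrable lborel (\<lambda>x. f x * cas (x \<bullet> \<xi>))"
proof (rule Bochner_Integration.integrable_bound)
  have [measurable]: "f \<in> borel_measurable borel" using assms by (auto dest: borel_measurable_integrable)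
  show "integrable lborel (\<lambda>x. 2 * f x)" using assms by simp
  show "(\<lambda>x. f x * cas (x \<bullet> \<xi>)) \<in> borel_measurable lborel" by measurable
  have "\<bar>f x\<bar> * \<bar>cas (x \<bullet> \<xi>)\<bar> \<le> \<bar>f x\<bar> * 2" for x by (intro mult_left_mono abs_cas_le) auto
  then show "AE x in lborel. norm (f x * cas (x \<bullet> \<xi>)) \<le> norm (2 * f x)"
    by (simp add: abs_mult mult.commute)
qed

lemma hartley_bound:
  fixes f :: "'a::euclidean_space \<Rightarrow> real"
  assumes "integrable lborel f"
  shows "\<bar>hartley f \<xi>\<bar> \<le> 2 / sqrt (2 * pi) ^ DIM('a) * (LINT x|lborel. \<bar>f x\<bar>)"
proof -
  have "\<bar>LINT x|lborel. f x * cas (x \<bullet> \<xi>)\<bar> \<le> (LINT x|lborel. \<bar>f x * cas (x \<bullet> \<xi>)\<bar>)"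
    using integral_norm_bound[of lborel "\<lambda>x. f x * cas (x \<bullet> \<xi>)"] by simp
  also have "\<dots> \<le> (LINT x|lborel. 2 * \<bar>f x\<bar>)"
  proof (rule integral_mono)
    show "integrable lborel (\<lambda>x. \<bar>f x * cas (x \<bullet> \<xi>)\<bar>)" using integrable_mult_cas[OF assms] by simp
    show "integrable lborel (\<lambda>x. 2 * \<bar>f x\<bar>)" using assms by simp
    show "\<bar>f x * cas (x \<bullet> \<xi>)\<bar> \<le> 2 * \<bar>f x\<bar>" for x
      using mult_left_mono[OF abs_cas_le[of "x \<bullet> \<xi>"], of "\<bar>f x\<bar>"] by (simp add: abs_mult mult.commute)
  qed
  finally show ?thesis by (simp add: hartley_def abs_mult divide_right_mono)
qed

lemma hartley_diff:
  assumes "integrable lborel f" "integrable lborel g"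
  shows "hartley (\<lambda>x. f x - g x) \<xi> = hartley f \<xi> - hartley g \<xi>"
  unfolding hartley_def
  by (simp add: left_diff_distrib integrable_mult_cas[OF assms(1)] integrable_mult_cas[OF assms(2)] diff_divide_distrib)

lemma hartley_multiplication_formula:
  fixes f g :: "'a::euclidean_space \<Rightarrow> real"
  assumes "integrable lborel f" "integrable lborel g"
  shows "l2_inner (hartley f) g = l2_inner f (hartley g)"
proof -
  have "(LINT x|lborel. f x * (LINT y|lborel. g y * cas (x \<bullet> y))) = (LINT y|lborel. g y * (LINT x|lborel. f x * cas (x \<bullet> y)))"
    by (rule Fubini_bounded_kernel[OF assms, of _ 2]) (auto intro: abs_cas_le)
  then show ?thesis
    by (simp add: l2_inner_def hartley_def inner_commute[of _ "_::'a"] mult.commute[of _ "g _"])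
qed

lemma exp_norm_cas_cas:
  fixes x y :: "'a::euclidean_space"
  assumes "t > 0"
  shows "integrable lborel (\<lambda>\<xi>. exp (- t * (norm \<xi>)\<^sup>2) * cas (\<xi> \<bullet> x))"
    and "(LINT \<xi>|lborel. exp (- t * (norm \<xi>)\<^sup>2) * cas (\<xi> \<bullet> x) * cas (\<xi> \<bullet> y)) = (2 * pi) ^ DIM('a) * gauss t (x - y)"
proof -
  let ?e = "\<lambda>\<xi>::'a. exp (- t * (norm \<xi>)\<^sup>2)"
  show "integrable lborel (\<lambda>\<xi>. ?e \<xi> * cas (\<xi> \<bullet> x))"
    by (rule integrable_mult_cas[OF integrable_exp_norm[OF assms]])
  have i: "integrable lborel (\<lambda>\<xi>. ?e \<xi> * cos (\<xi> \<bullet> z))" "integrable lborel (\<lambda>\<xi>. ?e \<xi> * sin (\<xi> \<bullet> z))" for z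
    by (rule Bochner_Integration.integrable_bound[OF integrable_exp_norm[OF assms]];
        auto simp: abs_mult mult_left_le)+
  have "(LINT \<xi>|lborel. ?e \<xi> * cas (\<xi> \<bullet> x) * cas (\<xi> \<bullet> y)) =
      (LINT \<xi>|lborel. ?e \<xi> * cos (\<xi> \<bullet> (x - y)) + ?e \<xi> * sin (\<xi> \<bullet> (x + y)))"
    by (simp add: mult.assoc cas_mult distrib_left inner_diff_right inner_add_right)
  also have "\<dots> = (2 * pi) ^ DIM('a) * gauss t (x - y)"
    using i[of "x - y"] i[of "x + y"] exp_norm_cos_sin[OF assms, of "x - y"] exp_norm_cos_sin[OF assms, of "x + y"]
    by simp
  finally show "(LINT \<xi>|lborel. ?e \<xi> * cas (\<xi> \<bullet> x) * cas (\<xi> \<bullet> y)) = (2 * pi) ^ DIM('a) * gauss t (x - y)" .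
qed

lemma sqrt_2pi_power: "1 / sqrt (2 * pi) ^ n * (1 / sqrt (2 * pi) ^ n) * (2 * pi) ^ n = (1::real)"
proof -
  have "sqrt (2 * pi) ^ n * sqrt (2 * pi) ^ n = (2 * pi) ^ n"
    unfolding power_mult_distrib[symmetric] by simp
  then show ?thesis by simp
qed

text \<open>The Gaussian factor makes the double integral absolutely convergent, so the order can be
  exchanged; the inner integral is then a heat kernel, and the two normalizing factors cancel (2
  pi)^n.\<close>

lemma hartley_regularized:
  fixes f :: "'a::euclidean_space \<Rightarrow> real"
  assumes f: "integrable lborel f" and t: "t > 0"
  shows "hartley (\<lambda>\<xi>. exp (- t * (norm \<xi>)\<^sup>2) * hartley f \<xi>) x = (LINT y|lborel. f y * gauss t (x - y))"
proof -
  let ?e = "\<lambda>\<xi>::'a. exp (- t * (norm \<xi>)\<^sup>2)"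
  let ?c = "1 / sqrt (2 * pi) ^ DIM('a)"
  have "hartley (\<lambda>\<xi>. ?e \<xi> * hartley f \<xi>) x =
      ?c * ?c * (LINT \<xi>|lborel. ?e \<xi> * cas (\<xi> \<bullet> x) * (LINT y|lborel. f y * cas (\<xi> \<bullet> y)))"
    unfolding hartley_def by (simp add: mult_ac inner_commute)
  also have "(LINT \<xi>|lborel. ?e \<xi> * cas (\<xi> \<bullet> x) * (LINT y|lborel. f y * cas (\<xi> \<bullet> y))) =
      (LINT y|lborel. f y * (LINT \<xi>|lborel. ?e \<xi> * cas (\<xi> \<bullet> x) * cas (\<xi> \<bullet> y)))"
    by (rule Fubini_bounded_kernel(1)[OF exp_norm_cas_cas(1)[OF t] f, of _ 2]) (auto intro: abs_cas_le)
  also have "\<dots> = (2 * pi) ^ DIM('a) * (LINT y|lborel. f y * gauss t (x - y))"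
    unfolding exp_norm_cas_cas(2)[OF t] by (subst integral_mult_right_zero[symmetric]) (simp add: mult_ac)
  finally show ?thesis
    using sqrt_2pi_power[of "DIM('a)"] by (simp only: mult.assoc[symmetric] mult_1_left)
qed

text \<open>The Gaussian-weighted energy of the transform equals the pairing of \<open>f\<close>
  with its heat smoothing, hence is at most the energy of \<open>f\<close>. The weights tend to 1,
  and Fatou's lemma removes them. Equality has to wait for the involution.\<close>

lemma hartley_contraction:
  fixes f :: "'a::euclidean_space \<Rightarrow> real"
  assumes f: "integrable lborel f" "sq_int f"
  shows "sq_int (hartley f)" and "l2_norm (hartley f) \<le> l2_norm f"
proof -
  note [measurable] = sq_int_measurable[OF f(2)]
  define g where "g k \<xi> = exp (- (1 / real (Suc k)) * (norm \<xi>)\<^sup>2) * (hartley f \<xi>)\<^sup>2" for k and \<xi> :: 'a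
  define h where "h k \<xi> = exp (- (1 / real (Suc k)) * (norm \<xi>)\<^sup>2) * hartley f \<xi>" for k and \<xi> :: 'a
  have pos: "1 / real (Suc k) > 0" for k by simp
  obtain K where K: "\<And>\<xi>. \<bar>hartley f \<xi>\<bar> \<le> K" using hartley_bound[OF f(1)] by blast
  have K0: "0 \<le> K" using K[of 0] by linarith
  have h: "integrable lborel (h k)" for k
  proof (rule Bochner_Integration.integrable_bound)
    show "integrable lborel (\<lambda>\<xi>::'a. K * exp (- (1 / real (Suc k)) * (norm \<xi>)\<^sup>2))"
      by (intro integrable_mult_right integrable_exp_norm pos)
    show "h k \<in> borel_measurable lborel" unfolding h_def by measurable
    show "AE \<xi> in lborel. norm (h k \<xi>) \<le> norm (K * exp (- (1 / real (Suc k)) * (norm \<xi>)\<^sup>2))"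
      using K K0 by (simp add: h_def abs_mult mult_right_mono)
  qed
  have g: "integrable lborel (g k)" for k
  proof (rule Bochner_Integration.integrable_bound)
    show "integrable lborel (\<lambda>\<xi>. K * h k \<xi>)" using h by simp
    show "g k \<in> borel_measurable lborel" unfolding g_def by measurable
    show "AE \<xi> in lborel. norm (g k \<xi>) \<le> norm (K * h k \<xi>)"
    proof (rule AE_I2)
      fix \<xi> :: 'a
      have "\<bar>hartley f \<xi>\<bar> * \<bar>h k \<xi>\<bar> \<le> K * \<bar>h k \<xi>\<bar>" by (intro mult_right_mono K) simp
      moreover have "g k \<xi> = hartley f \<xi> * h k \<xi>" by (simp add: g_def h_def power2_eq_square)
      ultimately show "norm (g k \<xi>) \<le> norm (K * h k \<xi>)" using K0 by (simp add: abs_mult)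
    qed
  qed
  have "integral\<^sup>L lborel (g k) = l2_inner (hartley f) (h k)" for k
    unfolding l2_inner_def by (intro Bochner_Integration.integral_cong refl)
      (simp add: g_def h_def power2_eq_square)
  also have "l2_inner (hartley f) (h k) = l2_inner f (hartley (h k))" for k
    by (rule hartley_multiplication_formula[OF f(1) h])
  also have "hartley (h k) = (\<lambda>x. LINT y|lborel. f y * gauss (1 / real (Suc k)) (x - y))" for k
    unfolding h_def using hartley_regularized[OF f(1) pos] by (intro ext)
  also have "l2_inner f (\<lambda>x. LINT y|lborel. f y * gauss (1 / real (Suc k)) (x - y)) \<le> (l2_norm f)\<^sup>2" for k
    unfolding l2_inner_def by (rule gauss_Schur(2)[OF pos f(2) f(2)])
  finally have le: "integral\<^sup>L lborel (g k) \<le> (l2_norm f)\<^sup>2" for k .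
  have lim: "AE \<xi> in lborel. (\<lambda>k. g k \<xi>) \<longlonglongrightarrow> (hartley f \<xi>)\<^sup>2"
  proof (rule AE_I2)
    fix \<xi> :: 'a
    have "(\<lambda>k. exp (- (1 / real (Suc k)) * (norm \<xi>)\<^sup>2)) \<longlonglongrightarrow> 1" by real_asymp
    from tendsto_mult_right[OF this, of "(hartley f \<xi>)\<^sup>2"] show "(\<lambda>k. g k \<xi>) \<longlonglongrightarrow> (hartley f \<xi>)\<^sup>2"
      by (simp add: g_def)
  qed
  have m: "(\<lambda>\<xi>. (hartley f \<xi>)\<^sup>2) \<in> borel_measurable lborel" by measurable
  have g0: "0 \<le> g k \<xi>" for k \<xi> by (simp add: g_def)
  note F = integral_Fatou_bound[OF g g0 le m lim]
  show "sq_int (hartley f)" using F(1) by (simp add: sq_int_def)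
  show "l2_norm (hartley f) \<le> l2_norm f"
    using F(2) unfolding l2_norm_power2[symmetric] by (rule power2_le_imp_le) simp
qed

subsection \<open>Extension to square integrable functions\<close>

text \<open>A square integrable function need not be integrable, so the transform is defined by
  duality against functions in both L1 and L2, for which the integral formula holds. The property
  determines it almost everywhere only.\<close>

definition l2_hartley :: "('a::euclidean_space \<Rightarrow> real) \<Rightarrow> 'a \<Rightarrow> real" where
  "l2_hartley f = (SOME g. sq_int g \<and>
     (\<forall>\<psi>. integrable lborel \<psi> \<and> sq_int \<psi> \<longrightarrow> l2_inner g \<psi> = l2_inner f (hartley \<psi>)))"

text \<open>Truncations are in L1 and L2; by contraction their transforms form a Cauchy sequence,
  and the multiplication formula passes to the limit on both sides.\<close>

lemma l2_hartley_exists: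
  fixes f :: "'a::euclidean_space \<Rightarrow> real"
  assumes f: "sq_int f"
  shows "\<exists>g. sq_int g \<and> (\<forall>\<psi>. integrable lborel \<psi> \<and> sq_int \<psi> \<longrightarrow> l2_inner g \<psi> = l2_inner f (hartley \<psi>))"
proof -
  define F where "F k x = indicator (ball 0 (real k)) x * f x" for k x
  have F: "sq_int (F k)" "integrable lborel (F k)" for k
    unfolding F_def using f by (auto intro: sq_int_indicator integrable_truncation)
  have lim: "(\<lambda>k. l2_norm (\<lambda>x. F k x - f x)) \<longlonglongrightarrow> 0"
    unfolding F_def by (rule l2_truncation_tendsto[OF f])
  have HF: "sq_int (hartley (F k))" for k by (rule hartley_contraction[OF F(2,1)])
  have Cauchy: "\<exists>N. \<forall>m\<ge>N. \<forall>n\<ge>N. l2_norm (\<lambda>x. hartley (F m) x - hartley (F n) x) < e" if e: "e > 0" for e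
  proof -
    obtain N where N: "\<And>n. n \<ge> N \<Longrightarrow> l2_norm (\<lambda>x. F n x - f x) < e / 2"
      using LIMSEQ_D[OF lim, of "e/2"] e by auto
    have "l2_norm (\<lambda>x. hartley (F m) x - hartley (F n) x) < e" if "m \<ge> N" "n \<ge> N" for m n
    proof -
      have "l2_norm (\<lambda>x. hartley (F m) x - hartley (F n) x) = l2_norm (hartley (\<lambda>x. F m x - F n x))"
        using hartley_diff[OF F(2) F(2), of m n] by presburger
      also have "\<dots> \<le> l2_norm (\<lambda>x. F m x - F n x)"
        using F by (intro hartley_contraction sq_int_diff) auto
      also have "\<dots> \<le> l2_norm (\<lambda>x. F m x - f x) + l2_norm (\<lambda>x. f x - F n x)"
        by (rule l2_norm_triangle3[OF F(1) f F(1)])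
      also have "\<dots> < e" using N[OF that(1)] N[OF that(2)] l2_norm_minus_commute[of f "F n"] by simp
      finally show ?thesis .
    qed
    then show ?thesis by blast
  qed
  from l2_complete[of "\<lambda>k. hartley (F k)", OF HF Cauchy]
  obtain g where g: "sq_int g" "(\<lambda>k. l2_norm (\<lambda>x. hartley (F k) x - g x)) \<longlonglongrightarrow> 0" by blast
  have "l2_inner g \<psi> = l2_inner f (hartley \<psi>)" if psi: "integrable lborel \<psi>" "sq_int \<psi>" for \<psi>
  proof (rule LIMSEQ_unique)
    show "(\<lambda>k. l2_inner (hartley (F k)) \<psi>) \<longlonglongrightarrow> l2_inner g \<psi>"
      by (rule l2_inner_tendsto[OF HF g(1) psi(2) g(2)])
    show "(\<lambda>k. l2_inner (hartley (F k)) \<psi>) \<longlonglongrightarrow> l2_inner f (hartley \<psi>)"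
      unfolding hartley_multiplication_formula[OF F(2) psi(1)]
      by (rule l2_inner_tendsto[OF F(1) f hartley_contraction(1)[OF psi] lim])
  qed
  with g(1) show ?thesis by blast
qed

lemma
  fixes f :: "'a::euclidean_space \<Rightarrow> real"
  assumes "sq_int f"
  shows sq_int_l2_hartley: "sq_int (l2_hartley f)"
    and l2_hartley_inner: "\<And>\<psi>. integrable lborel \<psi> \<Longrightarrow> sq_int \<psi> \<Longrightarrow> l2_inner (l2_hartley f) \<psi> = l2_inner f (hartley \<psi>)"
  using someI_ex[OF l2_hartley_exists[OF assms]] unfolding l2_hartley_def by auto

lemma l2_hartley_unique:
  fixes f :: "'a::euclidean_space \<Rightarrow> real"
  assumes f: "sq_int f" and g: "sq_int g"
    and eq: "\<And>\<psi>. integrable lborel \<psi> \<Longrightarrow> sq_int \<psi> \<Longrightarrow> l2_inner g \<psi> = l2_inner f (hartley \<psi>)"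
  shows "AE x in lborel. l2_hartley f x = g x"
proof -
  have d: "sq_int (\<lambda>x. l2_hartley f x - g x)" using sq_int_diff[OF sq_int_l2_hartley[OF f] g] .
  have "AE x in lborel. l2_hartley f x - g x = 0"
  proof (rule l2_orthogonal_imp_zero[OF d])
    fix R :: real
    let ?p = "\<lambda>x. indicator (ball 0 R) x * (l2_hartley f x - g x)"
    have p: "integrable lborel ?p" "sq_int ?p"
      using d by (auto intro: integrable_truncation sq_int_indicator)
    show "l2_inner (\<lambda>x. l2_hartley f x - g x) ?p = 0"
      using l2_inner_diff[OF sq_int_l2_hartley[OF f] g p(2)] eq[OF p] l2_hartley_inner[OF f p] by simp
  qed
  then show ?thesis by simp
qed

lemma l2_hartley_eq_hartley:
  assumes "integrable lborel f" "sq_int f"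
  shows "AE x in lborel. l2_hartley f x = hartley f x"
  by (rule l2_hartley_unique[OF assms(2) hartley_contraction(1)[OF assms]])
    (rule hartley_multiplication_formula[OF assms(1)])

text \<open>The conclusion is equality of functions and not just almost everywhere: the predicate
  under the choice operator sees \<open>f\<close> only through integrals, so both sides choose the
  same representative.\<close>

lemma l2_hartley_cong_AE:
  fixes f g :: "'a::euclidean_space \<Rightarrow> real"
  assumes "f \<in> borel_measurable borel" "g \<in> borel_measurable borel" "AE x in lborel. f x = g x"
  shows "l2_hartley f = l2_hartley g"
proof -
  have "l2_inner f (hartley \<psi>) = l2_inner g (hartley \<psi>)" if "sq_int \<psi>" for \<psi> :: "'a \<Rightarrow> real"
    using assms measurable_hartley[OF sq_int_measurable[OF that]]
    by (intro l2_inner_cong_AE) auto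
  then show ?thesis unfolding l2_hartley_def by (intro arg_cong[where f=Eps] ext) auto
qed

lemma l2_hartley_cmult:
  fixes f :: "'a::euclidean_space \<Rightarrow> real"
  assumes f: "sq_int f"
  shows "AE x in lborel. l2_hartley (\<lambda>x. c * f x) x = c * l2_hartley f x"
  by (rule l2_hartley_unique)
    (simp_all add: assms sq_int_cmult sq_int_l2_hartley l2_inner_cmult l2_hartley_inner)

lemma l2_hartley_diff:
  fixes f g :: "'a::euclidean_space \<Rightarrow> real"
  assumes f: "sq_int f" and g: "sq_int g"
  shows "AE x in lborel. l2_hartley (\<lambda>x. f x - g x) x = l2_hartley f x - l2_hartley g x"
  by (rule l2_hartley_unique)
    (simp_all add: assms sq_int_diff sq_int_l2_hartley l2_inner_diff hartley_contraction l2_hartley_inner)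

text \<open>Duality: for a truncation \<open>P k\<close> of the transform, its squared norm is the
  pairing of \<open>f\<close> with the transform of \<open>P k\<close>, hence at most the product of
  the two norms. Division by the norm of \<open>P k\<close> and growing balls give the
  claim.\<close>

lemma l2_hartley_norm_le:
  fixes f :: "'a::euclidean_space \<Rightarrow> real"
  assumes f: "sq_int f"
  shows "l2_norm (l2_hartley f) \<le> l2_norm f"
proof -
  define P where "P k x = indicator (ball 0 (real k)) x * l2_hartley f x" for k x
  note T = sq_int_l2_hartley[OF f]
  have P: "integrable lborel (P k)" "sq_int (P k)" for k
    unfolding P_def using T by (auto intro: integrable_truncation sq_int_indicator)
  have lim: "(\<lambda>k. l2_norm (\<lambda>x. P k x - l2_hartley f x)) \<longlonglongrightarrow> 0"
    unfolding P_def by (rule l2_truncation_tendsto[OF T])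
  have le: "l2_norm (P k) \<le> l2_norm f" for k
  proof (cases "l2_norm (P k) = 0")
    case False
    have "(l2_norm (P k))\<^sup>2 = l2_inner (l2_hartley f) (P k)"
      unfolding l2_norm_inner by (auto simp: l2_inner_def P_def indicator_def intro!: Bochner_Integration.integral_cong)
    also have "\<dots> = l2_inner f (hartley (P k))" by (rule l2_hartley_inner[OF f P])
    also have "\<dots> \<le> l2_norm f * l2_norm (hartley (P k))"
      by (rule order_trans[OF abs_ge_self l2_Cauchy_Schwarz[OF f hartley_contraction(1)[OF P]]])
    also have "\<dots> \<le> l2_norm f * l2_norm (P k)"
      by (intro mult_left_mono hartley_contraction(2)[OF P]) simp
    finally have "l2_norm (P k) * l2_norm (P k) \<le> l2_norm f * l2_norm (P k)" by (simp add: power2_eq_square)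
    moreover have "l2_norm (P k) > 0" using False l2_norm_nonneg[of "P k"] by linarith
    ultimately show ?thesis by simp
  qed simp
  have "l2_norm (l2_hartley f) \<le> l2_norm f + l2_norm (\<lambda>x. P k x - l2_hartley f x)" for k
  proof -
    have "l2_norm (l2_hartley f) = l2_norm (\<lambda>x. P k x - (P k x - l2_hartley f x))" by simp
    also have "\<dots> \<le> l2_norm (P k) + l2_norm (\<lambda>x. P k x - l2_hartley f x)"
      by (rule l2_norm_triangle_diff[OF P(2) sq_int_diff[OF P(2) T]])
    finally show ?thesis using le[of k] by linarith
  qed
  moreover have "(\<lambda>k. l2_norm f + l2_norm (\<lambda>x. P k x - l2_hartley f x)) \<longlonglongrightarrow> l2_norm f + 0"
    by (intro tendsto_intros lim)
  ultimately show ?thesis by (intro LIMSEQ_le_const) auto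
qed

text \<open>The defining property covers an integrable second argument; a general one is
  approximated by truncations, whose transforms converge by the norm bound.\<close>

lemma l2_hartley_selfadjoint:
  fixes f g :: "'a::euclidean_space \<Rightarrow> real"
  assumes f: "sq_int f" and g: "sq_int g"
  shows "l2_inner (l2_hartley f) g = l2_inner f (l2_hartley g)"
proof (rule LIMSEQ_unique)
  define P where "P k x = indicator (ball 0 (real k)) x * g x" for k x
  have P: "integrable lborel (P k)" "sq_int (P k)" for k
    unfolding P_def using g by (auto intro: integrable_truncation sq_int_indicator)
  have lim: "(\<lambda>k. l2_norm (\<lambda>x. P k x - g x)) \<longlonglongrightarrow> 0"
    unfolding P_def by (rule l2_truncation_tendsto[OF g])
  show "(\<lambda>k. l2_inner (P k) (l2_hartley f)) \<longlonglongrightarrow> l2_inner (l2_hartley f) g"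
    unfolding l2_inner_commute[of _ g] by (rule l2_inner_tendsto[OF P(2) g sq_int_l2_hartley[OF f] lim])
  have "l2_inner (P k) (l2_hartley f) = l2_inner (l2_hartley (P k)) f" for k
  proof -
    have "l2_inner (P k) (l2_hartley f) = l2_inner f (hartley (P k))"
      using l2_hartley_inner[OF f P] by (simp add: l2_inner_commute)
    also have "\<dots> = l2_inner f (l2_hartley (P k))"
      using sq_int_measurable[OF f] sq_int_measurable[OF sq_int_l2_hartley[OF P(2)]]
        sq_int_measurable[OF hartley_contraction(1)[OF P]] l2_hartley_eq_hartley[OF P]
      by (intro l2_inner_cong_AE[symmetric]) auto
    finally show ?thesis by (simp add: l2_inner_commute)
  qed
  moreover have "(\<lambda>k. l2_norm (\<lambda>x. l2_hartley (P k) x - l2_hartley g x)) \<longlonglongrightarrow> 0"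
  proof (rule Lim_null_comparison[OF _ lim], intro always_eventually allI)
    fix k
    have "l2_norm (\<lambda>x. l2_hartley (P k) x - l2_hartley g x) = l2_norm (l2_hartley (\<lambda>x. P k x - g x))"
      using l2_hartley_diff[OF P(2) g] sq_int_measurable[OF sq_int_l2_hartley[OF sq_int_diff[OF P(2) g]]]
        sq_int_measurable[OF sq_int_diff[OF sq_int_l2_hartley[OF P(2)] sq_int_l2_hartley[OF g]]]
      by (intro l2_norm_cong_AE[symmetric]) auto
    then show "norm (l2_norm (\<lambda>x. l2_hartley (P k) x - l2_hartley g x)) \<le> l2_norm (\<lambda>x. P k x - g x)"
      using l2_hartley_norm_le[OF sq_int_diff[OF P(2) g]] by simp
  qed
  ultimately show "(\<lambda>k. l2_inner (P k) (l2_hartley f)) \<longlonglongrightarrow> l2_inner f (l2_hartley g)"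
    unfolding l2_inner_commute[of f]
    using l2_inner_tendsto[OF sq_int_l2_hartley[OF P(2)] sq_int_l2_hartley[OF g] f] by simp
qed

lemma hartley_gauss:
  fixes a :: "'a::euclidean_space"
  assumes t: "t > 0"
  shows "hartley (\<lambda>x. gauss t (x - a)) \<xi> = 1 / sqrt (2 * pi) ^ DIM('a) * (exp (- t * (norm \<xi>)\<^sup>2) * cas (\<xi> \<bullet> a))"
proof -
  have m: "(\<lambda>x. gauss t (x - a) * cas (x \<bullet> \<xi>)) \<in> borel_measurable borel" by measurable
  have "(LINT x|lborel. gauss t (x - a) * cas (x \<bullet> \<xi>)) = (LINT x|lborel. gauss t x * cas ((a + x) \<bullet> \<xi>))"
    using integral_lborel_translate[OF m, of a] by simp
  also have "\<dots> = (LINT x|lborel. cas (a \<bullet> \<xi>) * (gauss t x * cos (x \<bullet> \<xi>)) + cas (- (a \<bullet> \<xi>)) * (gauss t x * sin (x \<bullet> \<xi>)))"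
    by (simp add: inner_add_left add.commute[of "a \<bullet> \<xi>"] cas_add algebra_simps)
  also have "\<dots> = exp (- t * (norm \<xi>)\<^sup>2) * cas (\<xi> \<bullet> a)"
    using gauss_cos_sin[OF t, of \<xi>] by (simp add: inner_commute)
  finally show ?thesis by (simp add: hartley_def)
qed

lemma sq_int_gauss_diff:
  fixes a :: "'a::euclidean_space"
  assumes t: "t > 0"
  shows "sq_int (\<lambda>x. gauss t (x - a))"
  unfolding sq_int_def
proof
  show "(\<lambda>x. gauss t (x - a)) \<in> borel_measurable borel" by measurable
  show "integrable lborel (\<lambda>x. (gauss t (x - a))\<^sup>2)"
  proof (rule Bochner_Integration.integrable_bound)
    show "integrable lborel (\<lambda>x. 1 / sqrt (4 * pi * t) ^ DIM('a) * gauss t (x - a))"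
      using integrable_gauss_diff[OF t] by (intro integrable_mult_right)
    show "AE x in lborel. norm ((gauss t (x - a))\<^sup>2) \<le> norm (1 / sqrt (4 * pi * t) ^ DIM('a) * gauss t (x - a))"
    proof (rule AE_I2)
      fix x
      show "norm ((gauss t (x - a))\<^sup>2) \<le> norm (1 / sqrt (4 * pi * t) ^ DIM('a) * gauss t (x - a))"
        using t mult_right_mono[OF gauss_bound[OF t, of "x - a"] gauss_nonneg[OF t, of "x - a"]]
        by (simp add: power2_eq_square abs_mult)
    qed
  qed measurable
qed

text \<open>It suffices to test against translated heat kernels, by
  \<open>gauss_smoothing_zero\<close>, and for these the double transform is explicit.\<close>

lemma l2_hartley_involution:
  fixes f :: "'a::euclidean_space \<Rightarrow> real"
  assumes f: "sq_int f"
  shows "AE x in lborel. l2_hartley (l2_hartley f) x = f x"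
proof -
  note T = sq_int_l2_hartley[OF f]
  note TT = sq_int_l2_hartley[OF T]
  have "AE x in lborel. l2_hartley (l2_hartley f) x - f x = 0"
  proof (rule gauss_smoothing_zero[OF sq_int_diff[OF TT f]])
    fix t :: real and a :: 'a assume t: "t > 0"
    let ?g = "\<lambda>x. gauss t (x - a)"
    have g: "integrable lborel ?g" "sq_int ?g"
      using t by (auto intro: integrable_gauss_diff sq_int_gauss_diff)
    \<comment> \<open>Integrability of the transformed kernel is what allows the duality to be
      applied a second time.\<close>
    have Hg: "integrable lborel (hartley ?g)" "sq_int (hartley ?g)"
      using exp_norm_cas_cas(1)[OF t, of a] hartley_contraction(1)[OF g]
      by (auto simp: hartley_gauss[OF t] fun_eq_iff[symmetric] cong: Bochner_Integration.integrable_cong)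
    have HHg: "hartley (hartley ?g) x = ?g x" for x
    proof -
      have "hartley (hartley ?g) x = 1 / sqrt (2 * pi) ^ DIM('a) * (1 / sqrt (2 * pi) ^ DIM('a)) *
          (LINT \<xi>|lborel. exp (- t * (norm \<xi>)\<^sup>2) * cas (\<xi> \<bullet> a) * cas (\<xi> \<bullet> x))"
        unfolding hartley_def[of "hartley ?g"] hartley_gauss[OF t] by simp
      then show ?thesis unfolding exp_norm_cas_cas(2)[OF t]
        using sqrt_2pi_power[of "DIM('a)"] by (simp add: gauss_minus_commute[of _ x])
    qed
    have "l2_inner (l2_hartley (l2_hartley f)) ?g = l2_inner (l2_hartley f) (hartley ?g)"
      by (rule l2_hartley_inner[OF T g])
    also have "\<dots> = l2_inner f (hartley (hartley ?g))"
      by (rule l2_hartley_inner[OF f Hg])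
    also have "\<dots> = l2_inner f ?g" unfolding HHg ..
    finally have "l2_inner (\<lambda>x. l2_hartley (l2_hartley f) x - f x) ?g = 0"
      by (simp add: l2_inner_diff[OF TT f g(2)])
    then show "(LINT x|lborel. (l2_hartley (l2_hartley f) x - f x) * ?g x) = 0"
      by (simp add: l2_inner_def)
  qed
  then show ?thesis by simp
qed

lemma l2_hartley_Plancherel:
  fixes f g :: "'a::euclidean_space \<Rightarrow> real"
  assumes f: "sq_int f" and g: "sq_int g"
  shows "l2_inner (l2_hartley f) (l2_hartley g) = l2_inner f g"
proof -
  note T = sq_int_l2_hartley[OF f]
  have "l2_inner (l2_hartley f) (l2_hartley g) = l2_inner (l2_hartley (l2_hartley f)) g"
    using l2_hartley_selfadjoint[OF T g] by simp
  also have "\<dots> = l2_inner f g"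
    using sq_int_measurable[OF f] sq_int_measurable[OF g] sq_int_measurable[OF sq_int_l2_hartley[OF T]]
      l2_hartley_involution[OF f] by (intro l2_inner_cong_AE) auto
  finally show ?thesis .
qed

lemma l2_norm_l2_hartley:
  assumes "sq_int f"
  shows "l2_norm (l2_hartley f) = l2_norm f"
  using l2_hartley_Plancherel[OF assms assms]
  by (simp flip: l2_norm_inner)

section \<open>Smooth functions and test functions\<close>

lemma pd_eqI: "(f has_derivative f') (at x) \<Longrightarrow> pd b f x = f' b"
  by (simp add: pd_def frechet_derivative_at[symmetric])

lemma has_derivative_frechet: "f differentiable (at x) \<Longrightarrow> (f has_derivative frechet_derivative f (at x)) (at x)"
  by (simp add: frechet_derivative_works)

lemma frechet_derivative_eq_sum_pd:
  fixes f :: "'a::euclidean_space \<Rightarrow> real"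
  assumes "f differentiable (at x)"
  shows "frechet_derivative f (at x) h = (\<Sum>b\<in>Basis. (h \<bullet> b) * pd b f x)"
proof -
  interpret linear "frechet_derivative f (at x)"
    using has_derivative_frechet[OF assms] by (simp add: has_derivative_def bounded_linear.linear)
  have "frechet_derivative f (at x) (\<Sum>b\<in>Basis. (h \<bullet> b) *\<^sub>R b) = (\<Sum>b\<in>Basis. (h \<bullet> b) * pd b f x)"
    by (simp add: sum scale pd_def)
  then show ?thesis by (simp add: euclidean_representation)
qed

lemma pd_const: "pd b (\<lambda>x. c) = (\<lambda>x. 0)"
  by (rule ext, rule pd_eqI) (auto intro!: derivative_eq_intros)

lemma pd_add:
  assumes "f differentiable (at x)" "g differentiable (at x)"
  shows "pd b (\<lambda>x. f x + g x) x = pd b f x + pd b g x"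
  using has_derivative_add[OF has_derivative_frechet[OF assms(1)] has_derivative_frechet[OF assms(2)]]
  by (subst pd_eqI) (auto simp: pd_def)

lemma pd_mult:
  assumes "f differentiable (at x)" "g differentiable (at x)"
  shows "pd b (\<lambda>x. f x * g x) x = f x * pd b g x + pd b f x * g x"
  using has_derivative_mult[OF has_derivative_frechet[OF assms(1)] has_derivative_frechet[OF assms(2)]]
  by (subst pd_eqI) (auto simp: pd_def)

lemma pd_compose_real:
  fixes H :: "real \<Rightarrow> real"
  assumes "g differentiable (at x)" "H differentiable (at (g x))"
  shows "pd b (\<lambda>x. H (g x)) x = pd b g x * pd 1 H (g x)"
proof -
  have "((\<lambda>x. H (g x)) has_derivative (\<lambda>h. frechet_derivative H (at (g x)) (frechet_derivative g (at x) h))) (at x)"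
    using has_derivative_compose[OF has_derivative_frechet[OF assms(1)] has_derivative_frechet[OF assms(2)]] .
  then have "pd b (\<lambda>x. H (g x)) x = frechet_derivative H (at (g x)) (pd b g x)"
    by (subst pd_eqI) (auto simp: pd_def)
  also have "\<dots> = pd b g x * pd 1 H (g x)"
    by (subst frechet_derivative_eq_sum_pd[OF assms(2)]) simp
  finally show ?thesis .
qed

lemma pd_compose_linear:
  fixes f :: "'b::euclidean_space \<Rightarrow> real"
  assumes "bounded_linear L" "f differentiable (at (L x))"
  shows "pd b (\<lambda>x. f (L x)) x = (\<Sum>c\<in>Basis. (L b \<bullet> c) * pd c f (L x))"
proof -
  have "((\<lambda>x. f (L x)) has_derivative (\<lambda>h. frechet_derivative f (at (L x)) (L h))) (at x)"
    using has_derivative_compose[OF bounded_linear_imp_has_derivative[OF assms(1)] has_derivative_frechet[OF assms(2)]] .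
  then show ?thesis
    by (subst pd_eqI) (auto simp: frechet_derivative_eq_sum_pd[OF assms(2)])
qed

lemma smooth_differentiable: "smooth f \<Longrightarrow> f differentiable (at x)"
  unfolding smooth_def by (drule spec[of _ "[]"]) simp

lemma iterated_pd_append: "iterated_pd (bs @ [b]) f = iterated_pd bs (pd b f)"
  by (induction bs) auto

lemma smooth_pd:
  assumes "smooth f" "b \<in> Basis"
  shows "smooth (pd b f)"
  unfolding smooth_def
proof (intro allI impI)
  fix bs :: "'a list" and x assume "set bs \<subseteq> Basis"
  then have "iterated_pd (bs @ [b]) f differentiable (at x)"
    using assms unfolding smooth_def by (metis Un_subset_iff empty_set insert_subset list.simps(15) set_append bot.extremum)
  then show "iterated_pd bs (pd b f) differentiable (at x)" by (simp add: iterated_pd_append)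
qed

section \<open>Closure properties of smooth functions\<close>

text \<open>All iterated derivatives stay inside \<open>S\<close>. Smoothness is thus shown by
  exhibiting a class stable under differentiation, without formulas for higher derivatives.\<close>

lemma smooth_coinduct:
  assumes "f \<in> S" and S: "\<And>f x. f \<in> S \<Longrightarrow> f differentiable (at x)" "\<And>f b. f \<in> S \<Longrightarrow> b \<in> Basis \<Longrightarrow> pd b f \<in> S"
  shows "smooth f"
proof -
  have "iterated_pd bs f \<in> S" if "set bs \<subseteq> Basis" for bs
    using that by (induction bs) (auto simp: assms)
  then show ?thesis unfolding smooth_def using S(1) by blast
qed

text \<open>The product and chain rules usually leave the original class but stay in the algebra it
  generates, so that algebra is the class to which \<open>smooth_coinduct\<close> is
  applied.\<close>

inductive_set generated_algebra :: "('a::euclidean_space \<Rightarrow> real) set \<Rightarrow> ('a \<Rightarrow> real) set"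
  for S where
  base: "f \<in> S \<Longrightarrow> f \<in> generated_algebra S"
| const: "(\<lambda>x. c) \<in> generated_algebra S"
| add: "f \<in> generated_algebra S \<Longrightarrow> g \<in> generated_algebra S \<Longrightarrow> (\<lambda>x. f x + g x) \<in> generated_algebra S"
| mult: "f \<in> generated_algebra S \<Longrightarrow> g \<in> generated_algebra S \<Longrightarrow> (\<lambda>x. f x * g x) \<in> generated_algebra S"

lemma generated_algebra_sum:
  assumes "\<And>i. i \<in> I \<Longrightarrow> f i \<in> generated_algebra S"
  shows "(\<lambda>x. \<Sum>i\<in>I. f i x) \<in> generated_algebra S"
  using assms by (induction I rule: infinite_finite_induct)
    (auto intro: generated_algebra.add generated_algebra.const)

text \<open>By the sum and product rules, stability under derivatives has to be checked on
  generators only.\<close>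

lemma smooth_generated_algebra:
  assumes diff: "\<And>f x. f \<in> S \<Longrightarrow> f differentiable (at x)"
    and pd: "\<And>f b. f \<in> S \<Longrightarrow> b \<in> Basis \<Longrightarrow> pd b f \<in> generated_algebra S"
    and f: "f \<in> generated_algebra S"
  shows "smooth f"
proof (rule smooth_coinduct[OF f])
  show d: "f differentiable (at x)" if "f \<in> generated_algebra S" for f x
    using that by induction (auto intro!: diff differentiable_add differentiable_mult)
  show "pd b f \<in> generated_algebra S" if "f \<in> generated_algebra S" "b \<in> Basis" for f b
    using that(1)
  proof induction
    case (add f g)
    then have "pd b (\<lambda>x. f x + g x) = (\<lambda>x. pd b f x + pd b g x)"
      by (intro ext pd_add d)
    then show ?case using add by (auto intro: generated_algebra.intros)
  next
    case (mult f g)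
    then have "pd b (\<lambda>x. f x * g x) = (\<lambda>x. f x * pd b g x + pd b f x * g x)"
      by (intro ext pd_mult d)
    then show ?case
      using mult by (simp only:) (intro generated_algebra.add generated_algebra.mult; assumption)
  qed (auto simp: pd that pd_const intro: generated_algebra.const)
qed

lemma smooth_const: "smooth (\<lambda>x. c)"
  by (rule smooth_generated_algebra[of "{}"]) (auto intro: generated_algebra.const)

lemma smooth_add: assumes "smooth f" "smooth g" shows "smooth (\<lambda>x. f x + g x)"
  by (rule smooth_generated_algebra[of "Collect smooth"])
    (use assms in \<open>auto intro: generated_algebra.intros smooth_differentiable smooth_pd\<close>)

lemma smooth_mult: assumes "smooth f" "smooth g" shows "smooth (\<lambda>x. f x * g x)"
  by (rule smooth_generated_algebra[of "Collect smooth"])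
    (use assms in \<open>auto intro: generated_algebra.intros smooth_differentiable smooth_pd\<close>)

lemma smooth_cmult: assumes "smooth f" shows "smooth (\<lambda>x. c * f x)"
  by (rule smooth_mult[OF smooth_const assms])

lemma smooth_sum: assumes "\<And>i. i \<in> I \<Longrightarrow> smooth (f i)" shows "smooth (\<lambda>x. \<Sum>i\<in>I. f i x)"
  using assms by (induction I rule: infinite_finite_induct) (auto intro: smooth_add smooth_const)

lemma smooth_inner: "smooth (\<lambda>x. x \<bullet> v)"
proof (rule smooth_generated_algebra[of "{\<lambda>x. x \<bullet> v}"])
  have "pd b (\<lambda>x. x \<bullet> v) = (\<lambda>x. b \<bullet> v)" for b
    by (rule ext, rule pd_eqI) (auto intro!: derivative_eq_intros)
  then show "pd b f \<in> generated_algebra {\<lambda>x. x \<bullet> v}" if "f \<in> {\<lambda>x. x \<bullet> v}" for f b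
    using that by (auto intro: generated_algebra.const)
qed (auto intro: generated_algebra.base)

text \<open>All composites with \<open>g\<close> serve as generators at once, because the derivative
  of one composite contains another one, with the derivative of \<open>H\<close> in place of
  \<open>H\<close>.\<close>

lemma smooth_compose_real:
  fixes H :: "real \<Rightarrow> real"
  assumes "smooth H" "smooth g"
  shows "smooth (\<lambda>x. H (g x))"
proof (rule smooth_generated_algebra[of "Collect smooth \<union> {\<lambda>x. H (g x) |H. smooth H}"])
  let ?S = "Collect smooth \<union> {\<lambda>x. H (g x) |H. smooth H}"
  note g = smooth_differentiable[OF assms(2)]
  show "f differentiable (at x)" if "f \<in> ?S" for f x
    using that by (auto intro: smooth_differentiable g differentiable_compose[of _ g])
  show "pd b f \<in> generated_algebra ?S" if "f \<in> ?S" and b: "b \<in> Basis" for f b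
    using that(1)
  proof
    assume "f \<in> {\<lambda>x. H (g x) |H. smooth H}"
    then obtain H where f: "f = (\<lambda>x. H (g x))" and H: "smooth H" by blast
    have "pd b f = (\<lambda>x. pd b g x * pd 1 H (g x))"
      unfolding f by (intro ext pd_compose_real g smooth_differentiable[OF H])
    moreover have "pd b g \<in> generated_algebra ?S"
      using smooth_pd[OF assms(2) b] by (auto intro: generated_algebra.base)
    moreover have "(\<lambda>x. pd 1 H (g x)) \<in> generated_algebra ?S"
      using smooth_pd[OF H, of 1] by (intro generated_algebra.base) auto
    ultimately show ?thesis by (auto intro: generated_algebra.mult)
  qed (auto intro: generated_algebra.base smooth_pd b)
  show "(\<lambda>x. H (g x)) \<in> generated_algebra ?S" using assms by (intro generated_algebra.base) auto
qed

lemma smooth_compose_linear: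
  fixes f :: "'b::euclidean_space \<Rightarrow> real" and L :: "'a::euclidean_space \<Rightarrow> 'b"
  assumes "smooth f" and L: "bounded_linear L"
  shows "smooth (\<lambda>x. f (L x))"
proof (rule smooth_generated_algebra[of "{\<lambda>x. f (L x) |f. smooth f}"])
  let ?S = "{\<lambda>x. f (L x) |f. smooth f}"
  show "f differentiable (at x)" if "f \<in> ?S" for f x
    using that bounded_linear_imp_differentiable[OF L] by (auto intro: smooth_differentiable differentiable_compose[of _ L])
  show "pd b f \<in> generated_algebra ?S" if fS: "f \<in> ?S" for f b
  proof -
    obtain h where f: "f = (\<lambda>x. h (L x))" and h: "smooth h" using fS by blast
    have "pd b f = (\<lambda>x. \<Sum>c\<in>Basis. (L b \<bullet> c) * pd c h (L x))"
      unfolding f by (intro ext pd_compose_linear L smooth_differentiable[OF h])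
    also have "\<dots> \<in> generated_algebra ?S"
      by (intro generated_algebra_sum generated_algebra.mult generated_algebra.const generated_algebra.base)
        (auto intro: smooth_pd[OF h])
    finally show ?thesis .
  qed
  show "(\<lambda>x. f (L x)) \<in> generated_algebra ?S" using assms by (intro generated_algebra.base) auto
qed

lemma smooth_continuous: assumes "smooth f" shows "continuous_on S f"
  by (meson assms smooth_differentiable continuous_at_imp_continuous_on differentiable_imp_continuous_within)

lemma smooth_borel: "smooth f \<Longrightarrow> f \<in> borel_measurable borel"
  by (intro borel_measurable_continuous_onI smooth_continuous)

subsection \<open>A bump function\<close>

text \<open>For k = 0 the classical function exp (-1/s), flat at 0. The powers of 1/s are included
  because differentiation produces them; with them the family is closed under derivatives up to
  linear combinations.\<close>

definition flat_exp :: "nat \<Rightarrow> real \<Rightarrow> real" where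
  "flat_exp k s = (if s > 0 then (1 / s) ^ k * exp (- (1 / s)) else 0)"

lemma has_derivative_flat_exp:
  "(flat_exp k has_derivative (\<lambda>h. (- real k * flat_exp (Suc k) s + flat_exp (k + 2) s) * h)) (at s)"
proof -
  have "(flat_exp k has_field_derivative (- real k * flat_exp (Suc k) s + flat_exp (k + 2) s)) (at s)"
  proof (cases s "0::real" rule: linorder_cases)
    case less
    have "((\<lambda>s. 0::real) has_field_derivative 0) (at s)" by simp
    then have "(flat_exp k has_field_derivative 0) (at s)"
      by (rule DERIV_cong_ev[THEN iffD1, rotated 3])
        (auto simp: flat_exp_def less intro!: eventually_mono[OF eventually_nhds_in_open[of "{..<0}" s]])
    then show ?thesis using less by (simp add: flat_exp_def)
  next
    case greater
    have "((\<lambda>s. (1 / s) ^ k * exp (- (1 / s))) has_field_derivative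
        (- real k * ((1 / s) ^ Suc k * exp (- (1 / s))) + (1 / s) ^ (k + 2) * exp (- (1 / s)))) (at s)"
    proof -
      define u where "u = 1 / s"
      have u: "((\<lambda>s. 1 / s) has_field_derivative - u\<^sup>2) (at s)"
        using greater by (auto intro!: derivative_eq_intros simp: u_def power2_eq_square)
      have "((\<lambda>s. (1 / s) ^ k * exp (- (1 / s))) has_field_derivative
          (real k * (- u\<^sup>2 * u ^ (k - Suc 0)) * exp (- u) + exp (- u) * - (- u\<^sup>2) * u ^ k)) (at s)"
        using DERIV_mult[OF DERIV_power[OF u, of k] DERIV_fun_exp[OF DERIV_minus[OF u]]]
        by (simp add: u_def)
      \<comment> \<open>For k = 0 the exponent \<open>k - Suc 0\<close> is a truncated difference,
        harmless because of the factor \<open>real k\<close>; hence the case split.\<close>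
      moreover have "real k * (- u\<^sup>2 * u ^ (k - Suc 0)) * exp (- u) + exp (- u) * - (- u\<^sup>2) * u ^ k
          = - real k * (u ^ Suc k * exp (- u)) + u ^ (k + 2) * exp (- u)"
        by (cases k) (simp_all add: power2_eq_square algebra_simps)
      ultimately show ?thesis by (simp only: u_def)
    qed
    then have "(flat_exp k has_field_derivative
        (- real k * ((1 / s) ^ Suc k * exp (- (1 / s))) + (1 / s) ^ (k + 2) * exp (- (1 / s)))) (at s)"
      by (rule DERIV_cong_ev[THEN iffD1, rotated 3])
        (auto simp: flat_exp_def greater intro!: eventually_mono[OF eventually_nhds_in_open[of "{0<..}" s]])
    then show ?thesis using greater by (simp add: flat_exp_def)
  next
    case equal
    \<comment> \<open>From the right, the difference quotient at 0 is (1/h)^(k+1) exp (-1/h), which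
      with y = 1/h is the decay of y^(k+1) / exp y at infinity. From the left the quotient is
      0.\<close>
    have "((\<lambda>y. y ^ Suc k / exp y) \<longlongrightarrow> 0) (at_top :: real filter)"
      by (rule tendsto_power_div_exp_0)
    from filterlim_compose[OF this filterlim_inverse_at_top_right]
    have r: "((\<lambda>h. inverse h ^ Suc k / exp (inverse h)) \<longlongrightarrow> 0) (at_right (0::real))" .
    have "((\<lambda>h. (flat_exp k (0 + h) - flat_exp k 0) / h) \<longlongrightarrow> 0) (at_right (0::real))"
      by (rule Lim_transform_eventually[OF r])
        (auto simp: eventually_at_right_less flat_exp_def inverse_eq_divide exp_minus field_simps
          intro!: eventually_mono[OF eventually_at_right_less])
    moreover have "((\<lambda>h. (flat_exp k (0 + h) - flat_exp k 0) / h) \<longlongrightarrow> 0) (at_left (0::real))"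
      by (rule tendsto_eventually)
        (auto simp: flat_exp_def eventually_at_filter)
    ultimately have "((\<lambda>h. (flat_exp k (0 + h) - flat_exp k 0) / h) \<longlongrightarrow> 0) (at 0)"
      by (simp add: filterlim_split_at)
    then show ?thesis using equal by (simp add: has_field_derivative_def[symmetric] DERIV_def flat_exp_def)
  qed
  then show ?thesis by (simp add: has_field_derivative_def)
qed

lemma smooth_flat_exp: "smooth (flat_exp k)"
proof (rule smooth_generated_algebra[of "range flat_exp"])
  show "f differentiable (at x)" if "f \<in> range flat_exp" for f x
    using that has_derivative_flat_exp by (auto simp: differentiable_def)
  have "pd 1 (flat_exp k) = (\<lambda>s. - real k * flat_exp (Suc k) s + flat_exp (k + 2) s)" for k
    using pd_eqI[OF has_derivative_flat_exp, of 1 k] by auto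
  moreover have "(\<lambda>s. - real k * flat_exp (Suc k) s + flat_exp (k + 2) s) \<in> generated_algebra (range flat_exp)" for k
    by (intro generated_algebra.add generated_algebra.mult generated_algebra.const generated_algebra.base rangeI)
  ultimately show "pd b f \<in> generated_algebra (range flat_exp)" if "f \<in> range flat_exp" "b \<in> Basis" for f b
    using that by auto
qed (auto intro: generated_algebra.base)

text \<open>The squared norm is a polynomial, so no singularity arises at the origin. For
  \<open>e > 0\<close> the function is positive exactly inside the ball of radius
  \<open>e\<close>.\<close>

definition bump :: "real \<Rightarrow> 'a::euclidean_space \<Rightarrow> real" where
  "bump e x = flat_exp 0 (e\<^sup>2 - (norm x)\<^sup>2)"

lemma smooth_bump: "smooth (bump e :: 'a::euclidean_space \<Rightarrow> real)"
proof -
  have "smooth (\<lambda>x::'a. e\<^sup>2 + (-1) * (\<Sum>b\<in>Basis. (x \<bullet> b) * (x \<bullet> b)))"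
    by (intro smooth_add smooth_const smooth_cmult smooth_sum smooth_mult smooth_inner)
  moreover have "(norm x)\<^sup>2 = (\<Sum>b\<in>Basis. (x \<bullet> b) * (x \<bullet> b))" for x :: 'a
    unfolding power2_norm_eq_inner by (rule euclidean_inner)
  ultimately have "smooth (\<lambda>x::'a. e\<^sup>2 - (norm x)\<^sup>2)"
    by simp
  from smooth_compose_real[OF smooth_flat_exp this] show ?thesis
    by (simp add: bump_def[abs_def])
qed

lemma bump_nonneg: "0 \<le> bump e x"
  by (simp add: bump_def flat_exp_def)

lemma bump_pos_iff: "e > 0 \<Longrightarrow> bump e x > 0 \<longleftrightarrow> norm x < e"
proof -
  assume "e > 0"
  then have "(norm x)\<^sup>2 < e\<^sup>2 \<longleftrightarrow> norm x < e" using power2_less_imp_less[of "norm x" e] power_strict_mono[of "norm x" e 2] by auto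
  then show ?thesis by (auto simp: bump_def flat_exp_def)
qed

lemma bump_uminus: "bump e (- x) = bump e x"
  by (simp add: bump_def)

subsection \<open>Compactly supported functions\<close>

lemma support_subset_cball:
  assumes "compact (closure {x. f x \<noteq> (0::real)})"
  obtains R where "R > 0" "\<And>x. norm x \<ge> R \<Longrightarrow> f x = 0"
proof -
  obtain B where B: "\<And>x. x \<in> closure {x. f x \<noteq> 0} \<Longrightarrow> norm x \<le> B"
    using compact_imp_bounded[OF assms] unfolding bounded_iff by blast
  have "f x = 0" if "norm x \<ge> \<bar>B\<bar> + 1" for x
    using B[of x] that closure_subset[of "{x. f x \<noteq> 0}"] by (cases "f x = 0") auto
  then show ?thesis by (intro that[of "\<bar>B\<bar> + 1"]) auto
qed

lemma compact_supportI:
  fixes f :: "'a::euclidean_space \<Rightarrow> real"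
  assumes "\<And>x. norm x \<ge> R \<Longrightarrow> f x = 0"
  shows "compact (closure {x. f x \<noteq> 0})"
proof -
  have "{x. f x \<noteq> 0} \<subseteq> cball 0 R" using assms by (force simp: dist_norm)
  then show ?thesis using bounded_subset[OF bounded_cball] by (simp add: compact_closure)
qed

lemma continuous_compact_support_bounded:
  fixes f :: "'a::euclidean_space \<Rightarrow> real"
  assumes "continuous_on UNIV f" "\<And>x. norm x \<ge> R \<Longrightarrow> f x = 0"
  obtains K where "K \<ge> 0" "\<And>x. \<bar>f x\<bar> \<le> K"
proof -
  have "compact (f ` cball 0 \<bar>R\<bar>)"
    by (intro compact_continuous_image continuous_on_subset[OF assms(1)]) auto
  from compact_imp_bounded[OF this]
  obtain K where K: "\<And>y. y \<in> f ` cball 0 \<bar>R\<bar> \<Longrightarrow> norm y \<le> K"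
    unfolding bounded_iff by blast
  have "\<bar>f x\<bar> \<le> \<bar>K\<bar>" for x
  proof (cases "norm x \<le> \<bar>R\<bar>")
    case True
    then have "f x \<in> f ` cball 0 \<bar>R\<bar>" by (intro imageI) simp
    from K[OF this] show ?thesis by simp
  qed (simp add: assms(2))
  then show ?thesis by (intro that[of "\<bar>K\<bar>"]) auto
qed

lemma bounded_support_integrable:
  fixes f :: "'a::euclidean_space \<Rightarrow> real"
  assumes "f \<in> borel_measurable borel" "\<And>x. norm x \<ge> R \<Longrightarrow> f x = 0" "\<And>x. \<bar>f x\<bar> \<le> K"
  shows "integrable lborel f"
proof (rule Bochner_Integration.integrable_bound)
  show "integrable lborel (\<lambda>x::'a. K * indicator (cball 0 \<bar>R\<bar>) x)"
    using emeasure_lborel_cball_finite[of "0::'a" "\<bar>R\<bar>"] by simp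
  show "f \<in> borel_measurable lborel" using assms(1) by simp
  show "AE x in lborel. norm (f x) \<le> norm (K * indicator (cball 0 \<bar>R\<bar>) x)"
  proof (rule AE_I2)
    fix x :: 'a
    show "norm (f x) \<le> norm (K * indicator (cball 0 \<bar>R\<bar>) x)"
      using assms(2)[of x] order_trans[OF assms(3)[of x] abs_ge_self] by (cases "norm x \<le> \<bar>R\<bar>") auto
  qed
qed

lemma bounded_support_sq_int:
  fixes f :: "'a::euclidean_space \<Rightarrow> real"
  assumes "f \<in> borel_measurable borel" "\<And>x. norm x \<ge> R \<Longrightarrow> f x = 0" "\<And>x. \<bar>f x\<bar> \<le> K"
  shows "sq_int f"
proof -
  have K: "0 \<le> K" using assms(3)[of 0] by linarith
  have "integrable lborel (\<lambda>x. (f x)\<^sup>2)"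
    by (rule bounded_support_integrable[of _ R "K\<^sup>2"])
      (use assms K in \<open>auto intro: power2_le_iff_abs_le[THEN iffD2]\<close>)
  then show ?thesis using assms(1) by (simp add: sq_int_def)
qed

lemma continuous_support_integrable:
  fixes f :: "'a::euclidean_space \<Rightarrow> real"
  assumes "continuous_on UNIV f" "\<And>x. norm x \<ge> R \<Longrightarrow> f x = 0"
  shows "integrable lborel f" "sq_int f"
proof -
  obtain K where "\<And>x. \<bar>f x\<bar> \<le> K" using continuous_compact_support_bounded[OF assms] by metis
  then show "integrable lborel f" "sq_int f"
    using assms by (auto intro!: bounded_support_integrable[of f R K] bounded_support_sq_int[of f R K] borel_measurable_continuous_onI)
qed

text \<open>Translation invariance of the integral makes the integral of every difference quotient vanish.\<close>

lemma integral_pd_eq_0: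
  fixes F :: "'a::euclidean_space \<Rightarrow> real"
  assumes diff: "\<And>x. F differentiable (at x)" and cont: "continuous_on UNIV (pd b F)"
    and supp: "\<And>x. norm x \<ge> R \<Longrightarrow> F x = 0"
  shows "(LINT x|lborel. pd b F x) = 0"
proof -
  have F_cont: "continuous_on UNIV F"
    by (meson diff continuous_at_imp_continuous_on differentiable_imp_continuous_within)
  have pd_supp: "pd b F x = 0" if "norm x \<ge> R + 1" for x
  proof -
    have "((\<lambda>x. 0::real) has_derivative (\<lambda>h. 0)) (at x)" by simp
    then have "(F has_derivative (\<lambda>h. 0)) (at x)"
      by (rule has_derivative_transform_within_open[where s="- cball 0 R"]) (use that supp in auto)
    then show ?thesis by (simp add: pd_eqI)
  qed
  obtain M where M: "M \<ge> 0" "\<And>x. \<bar>pd b F x\<bar> \<le> M"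
    using continuous_compact_support_bounded[OF cont pd_supp] by metis
  define h where "h k = 1 / real (Suc k)" for k
  have h: "h k > 0" "h k \<le> 1" for k by (auto simp: h_def field_simps)
  have h0: "h \<longlonglongrightarrow> 0" unfolding h_def by real_asymp
  define D where "D k x = (F (h k *\<^sub>R b + x) - F x) / h k" for k x
  have line: "((\<lambda>s. F (s *\<^sub>R b + x)) has_real_derivative pd b F (s *\<^sub>R b + x)) (at s)" for s x
  proof -
    have "((\<lambda>s. F (s *\<^sub>R b + x)) has_derivative (\<lambda>h. frechet_derivative F (at (s *\<^sub>R b + x)) (h *\<^sub>R b))) (at s)"
      by (rule has_derivative_compose[OF _ has_derivative_frechet[OF diff]]) (auto intro!: derivative_eq_intros)
    moreover have "frechet_derivative F (at (s *\<^sub>R b + x)) (h *\<^sub>R b) = pd b F (s *\<^sub>R b + x) * h" for h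
      using linear_cmul[OF bounded_linear.linear[OF has_derivative_bounded_linear[OF has_derivative_frechet[OF diff]]]]
      by (simp add: pd_def mult.commute)
    ultimately show ?thesis by (simp add: has_field_derivative_def)
  qed
  \<comment> \<open>The mean value theorem bounds all difference quotients by the maximum of the
    derivative. Step sizes are at most 1, so the quotients also vanish outside one common ball;
    together this gives an integrable majorant.\<close>
  have D_bd: "\<bar>D k x\<bar> \<le> M" for k x
  proof -
    obtain z where "F (h k *\<^sub>R b + x) - F (0 *\<^sub>R b + x) = (h k - 0) * pd b F (z *\<^sub>R b + x)"
      using MVT2[of 0 "h k", OF h(1) line[of x]] by blast
    then have "D k x = pd b F (z *\<^sub>R b + x)" using h(1)[of k] by (simp add: D_def field_simps)
    then show ?thesis using M(2) by simp
  qed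
  have D_supp: "D k x = 0" if "norm x \<ge> R + norm b" for k x
  proof -
    have "norm (h k *\<^sub>R b) \<le> norm b" using h[of k] mult_right_mono[of "h k" 1 "norm b"] by simp
    moreover have "norm (h k *\<^sub>R b + x) \<ge> norm x - norm (h k *\<^sub>R b)"
      using norm_triangle_ineq2[of x "- (h k *\<^sub>R b)"] by (simp add: add.commute)
    ultimately have "norm (h k *\<^sub>R b + x) \<ge> R" "norm x \<ge> R" using that norm_ge_zero[of b] by linarith+
    then show ?thesis by (simp add: D_def supp)
  qed
  have F_int: "integrable lborel F" by (rule continuous_support_integrable[OF F_cont supp])
  have F_meas: "F \<in> borel_measurable borel" by (rule borel_measurable_continuous_onI[OF F_cont])
  have "(LINT x|lborel. D k x) = 0" for k
    unfolding D_def
    using F_int integral_lborel_translate[OF F_meas, of "h k *\<^sub>R b"] integrable_lborel_translate_iff[OF F_meas, of "h k *\<^sub>R b"]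
    by simp
  moreover have "(\<lambda>k. LINT x|lborel. D k x) \<longlonglongrightarrow> (LINT x|lborel. pd b F x)"
  proof (rule integral_dominated_convergence[where w="\<lambda>x. M * indicator (cball 0 \<bar>R + norm b\<bar>) x"])
    show "integrable lborel (\<lambda>x::'a. M * indicator (cball 0 \<bar>R + norm b\<bar>) x)"
      using emeasure_lborel_cball_finite[of "0::'a" "\<bar>R + norm b\<bar>"] by simp
    show "AE x in lborel. norm (D k x) \<le> M * indicator (cball 0 \<bar>R + norm b\<bar>) x" for k
      using D_bd D_supp by (auto simp: indicator_def)
    show "AE x in lborel. (\<lambda>k. D k x) \<longlonglongrightarrow> pd b F x"
    proof (rule AE_I2)
      fix x
      have "((\<lambda>s. (F (s *\<^sub>R b + x) - F x) / s) \<longlongrightarrow> pd b F x) (at 0)"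
        using line[of x 0] by (simp add: DERIV_def)
      then show "(\<lambda>k. D k x) \<longlonglongrightarrow> pd b F x"
        unfolding D_def by (rule filterlim_compose)
          (use h0 h(1) in \<open>auto simp: filterlim_at less_imp_neq[THEN not_sym]\<close>)
    qed
    show "pd b F \<in> borel_measurable lborel" using borel_measurable_continuous_onI[OF cont] by simp
    show "D k \<in> borel_measurable lborel" for k
      unfolding D_def using F_meas by measurable
  qed
  ultimately show ?thesis by (simp add: LIMSEQ_const_iff)
qed

text \<open>Compact support of \<open>f\<close> alone makes the boundary terms vanish, so
  \<open>g\<close> may be a plane wave.\<close>

lemma integral_pd_mult:
  fixes f g :: "'a::euclidean_space \<Rightarrow> real"
  assumes f: "smooth f" "\<And>x. norm x \<ge> R \<Longrightarrow> f x = 0" and b: "b \<in> Basis"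
    and g: "\<And>x. g differentiable (at x)" "continuous_on UNIV (pd b g)"
  shows "(LINT x|lborel. pd b f x * g x) = - (LINT x|lborel. f x * pd b g x)"
proof -
  note fd = smooth_differentiable[OF f(1)]
  have g_cont: "continuous_on UNIV g"
    by (meson g(1) continuous_at_imp_continuous_on differentiable_imp_continuous_within)
  have f_cont: "continuous_on UNIV f" "continuous_on UNIV (pd b f)"
    by (intro smooth_continuous f smooth_pd b)+
  have eq: "pd b (\<lambda>x. f x * g x) = (\<lambda>x. f x * pd b g x + pd b f x * g x)"
    by (intro ext pd_mult fd g)
  have pd_supp: "pd b f x = 0" if "norm x \<ge> R + 1" for x
  proof -
    have "((\<lambda>x. 0::real) has_derivative (\<lambda>h. 0)) (at x)" by simp
    then have "(f has_derivative (\<lambda>h. 0)) (at x)"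
      by (rule has_derivative_transform_within_open[where s="- cball 0 R"]) (use that f(2) in auto)
    then show ?thesis by (simp add: pd_eqI)
  qed
  have i: "integrable lborel (\<lambda>x. f x * pd b g x)"
    by (rule continuous_support_integrable[of _ R]) (auto intro!: continuous_intros f_cont g simp: f)
  have j: "integrable lborel (\<lambda>x. pd b f x * g x)"
    by (rule continuous_support_integrable[of _ "R + 1"]) (auto intro!: continuous_intros f_cont g_cont simp: pd_supp)
  have "(LINT x|lborel. pd b (\<lambda>x. f x * g x) x) = 0"
    by (rule integral_pd_eq_0[of _ _ R])
      (auto simp: eq f intro!: continuous_intros f_cont g g_cont differentiable_mult fd)
  then show ?thesis using i j by (simp add: eq)
qed

section \<open>Test functions: supports, derivatives, integrability\<close>

lemma test_function_smooth: "test_function \<Omega> f \<Longrightarrow> smooth f"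
  by (simp add: test_function_def)

lemma test_function_support:
  assumes "test_function \<Omega> f"
  obtains R where "R > 0" "\<And>x. norm x \<ge> R \<Longrightarrow> f x = 0"
  using assms support_subset_cball[of f] unfolding test_function_def by metis

lemma test_functionI:
  assumes "smooth f" "\<And>x. norm x \<ge> R \<Longrightarrow> f x = 0"
  shows "test_function UNIV f"
  using assms compact_supportI[of R f] by (auto simp: test_function_def)

lemma pd_support: "closure {x. pd b f x \<noteq> 0} \<subseteq> closure {x. f x \<noteq> (0::real)}"
proof (rule closure_minimal)
  show "{x. pd b f x \<noteq> 0} \<subseteq> closure {x. f x \<noteq> 0}"
  proof (rule ccontr)
    assume "\<not> ?thesis"
    then obtain x where x: "pd b f x \<noteq> 0" "x \<notin> closure {x. f x \<noteq> 0}" by blast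
    have "((\<lambda>x. 0::real) has_derivative (\<lambda>h. 0)) (at x)" by simp
    then have "(f has_derivative (\<lambda>h. 0)) (at x)"
      by (rule has_derivative_transform_within_open[where s="- closure {x. f x \<noteq> 0}"])
        (use x closure_subset[of "{x. f x \<noteq> 0}"] in auto)
    with x show False by (simp add: pd_eqI)
  qed
qed simp

lemma test_function_pd:
  assumes "test_function \<Omega> f" "b \<in> Basis"
  shows "test_function \<Omega> (pd b f)"
proof -
  have "compact (closure {x. pd b f x \<noteq> 0})"
    using assms pd_support[of b f] unfolding test_function_def
    by (metis closed_Int_compact closed_closure inf.absorb1)
  then show ?thesis using assms pd_support[of b f] smooth_pd unfolding test_function_def by blast
qed

lemma test_function_integrable: "test_function \<Omega> f \<Longrightarrow> integrable lborel f"
  and test_function_sq_int: "test_function \<Omega> f \<Longrightarrow> sq_int f"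
  by (metis test_function_support smooth_continuous test_function_smooth continuous_support_integrable)+

section \<open>Convolution and Fourier multipliers of test functions\<close>

lemma test_function_bounds:
  assumes "test_function \<Omega> f"
  obtains R K where "R > 0" "K \<ge> 0" "\<And>x. norm x \<ge> R \<Longrightarrow> f x = 0" "\<And>x. \<bar>f x\<bar> \<le> K"
proof -
  obtain R where R: "R > 0" "\<And>x. norm x \<ge> R \<Longrightarrow> f x = 0" using test_function_support[OF assms] by metis
  obtain K where "K \<ge> 0" "\<And>x. \<bar>f x\<bar> \<le> K"
    using continuous_compact_support_bounded[OF smooth_continuous[OF test_function_smooth[OF assms]] R(2)] by metis
  with R that show thesis by blast
qed

text \<open>The partial derivatives are again test functions, hence bounded. The uniform constants
  supply the majorant for differentiating a convolution under the integral sign.\<close>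

lemma test_function_Lipschitz:
  fixes f :: "'a::euclidean_space \<Rightarrow> real"
  assumes f: "test_function \<Omega> f"
  obtains M where "M \<ge> 0" "\<And>x y. \<bar>f x - f y\<bar> \<le> M * norm (x - y)"
    "\<And>x h. \<bar>frechet_derivative f (at x) h\<bar> \<le> M * norm h"
proof -
  have "\<forall>b\<in>Basis. \<exists>K\<ge>0. \<forall>x. \<bar>pd b f x\<bar> \<le> K"
    using test_function_bounds[OF test_function_pd[OF f]] by metis
  then obtain K where K: "\<And>b. b \<in> Basis \<Longrightarrow> K b \<ge> 0" "\<And>b x. b \<in> Basis \<Longrightarrow> \<bar>pd b f x\<bar> \<le> K b"
    by metis
  define M where "M = (\<Sum>b\<in>Basis. K b)"
  note d = smooth_differentiable[OF test_function_smooth[OF f]]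
  have D: "\<bar>frechet_derivative f (at x) h\<bar> \<le> M * norm h" for x h
  proof -
    have "\<bar>frechet_derivative f (at x) h\<bar> \<le> (\<Sum>b\<in>Basis. \<bar>(h \<bullet> b) * pd b f x\<bar>)"
      unfolding frechet_derivative_eq_sum_pd[OF d] by (rule sum_abs)
    also have "\<dots> \<le> (\<Sum>b\<in>Basis. norm h * K b)"
      unfolding abs_mult by (intro sum_mono mult_mono K Basis_le_norm) auto
    finally show ?thesis by (simp add: M_def sum_distrib_left mult.commute)
  qed
  have "M \<ge> 0" unfolding M_def by (intro sum_nonneg K)
  moreover have "norm (f x - f y) \<le> M * norm (x - y)" for x y
    by (rule differentiable_bound[of UNIV f "\<lambda>x. frechet_derivative f (at x)"])
      (use D has_derivative_frechet[OF d] in \<open>auto intro!: onorm_le\<close>)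
  ultimately show thesis using D by (intro that[of M]) auto
qed

section \<open>Convolution with a test function\<close>

definition conv :: "('a::euclidean_space \<Rightarrow> real) \<Rightarrow> ('a \<Rightarrow> real) \<Rightarrow> 'a \<Rightarrow> real" where
  "conv f g x = (LINT y|lborel. f (x - y) * g y)"

lemma conv_integrable:
  fixes f g :: "'a::euclidean_space \<Rightarrow> real"
  assumes f: "test_function \<Omega> f" and g: "integrable lborel g"
  shows "integrable lborel (\<lambda>y. f (x - y) * g y)"
proof -
  obtain K where K: "\<And>x. \<bar>f x\<bar> \<le> K" "K \<ge> 0" using test_function_bounds[OF f] by metis
  have [measurable]: "f \<in> borel_measurable borel" "g \<in> borel_measurable borel"
    using g by (auto intro: smooth_borel test_function_smooth[OF f])
  show ?thesis
  proof (rule Bochner_Integration.integrable_bound)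
    show "integrable lborel (\<lambda>y. K * g y)" using g by simp
    show "AE y in lborel. norm (f (x - y) * g y) \<le> norm (K * g y)"
      using K by (auto simp: abs_mult intro!: mult_right_mono)
  qed measurable
qed

text \<open>All derivatives fall on the test function, so \<open>g\<close> contributes integrability
  only. The remainder quotients are dominated by 2 \<open>M\<close> |g|: one \<open>M\<close> from
  the Lipschitz bound, one from the derivative.\<close>

lemma has_derivative_conv:
  fixes f g :: "'a::euclidean_space \<Rightarrow> real"
  assumes f: "test_function \<Omega> f" and g: "integrable lborel g"
  shows "(conv f g has_derivative (\<lambda>h. LINT y|lborel. frechet_derivative f (at (x - y)) h * g y)) (at x)"
proof -
  obtain M where M: "M \<ge> 0" "\<And>x y. \<bar>f x - f y\<bar> \<le> M * norm (x - y)"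
    "\<And>x h. \<bar>frechet_derivative f (at x) h\<bar> \<le> M * norm h" using test_function_Lipschitz[OF f] by metis
  note d = smooth_differentiable[OF test_function_smooth[OF f]]
  have [measurable]: "f \<in> borel_measurable borel" "g \<in> borel_measurable borel"
    using g by (auto intro: smooth_borel test_function_smooth[OF f])
  have [measurable]: "pd b f \<in> borel_measurable borel" if "b \<in> Basis" for b
    using that by (intro smooth_borel smooth_pd test_function_smooth[OF f])
  have D_eq: "(LINT y|lborel. frechet_derivative f (at (x - y)) h * g y) =
      (\<Sum>b\<in>Basis. (h \<bullet> b) * conv (pd b f) g x)" for h
  proof -
    have "(LINT y|lborel. frechet_derivative f (at (x - y)) h * g y) =
        (LINT y|lborel. (\<Sum>b\<in>Basis. (h \<bullet> b) * (pd b f (x - y) * g y)))"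
      by (simp add: frechet_derivative_eq_sum_pd[OF d] sum_distrib_right mult.assoc)
    also have "\<dots> = (\<Sum>b\<in>Basis. LINT y|lborel. (h \<bullet> b) * (pd b f (x - y) * g y))"
      by (rule Bochner_Integration.integral_sum) (intro integrable_mult_right conv_integrable[OF test_function_pd[OF f] g])
    finally show ?thesis by (simp add: conv_def)
  qed
  have D_int: "integrable lborel (\<lambda>y. frechet_derivative f (at (x - y)) h * g y)" for h
  proof -
    have "integrable lborel (\<lambda>y. \<Sum>b\<in>Basis. (h \<bullet> b) * (pd b f (x - y) * g y))"
      by (intro Bochner_Integration.integrable_sum integrable_mult_right conv_integrable[OF test_function_pd[OF f] g])
    then show ?thesis
      by (simp add: frechet_derivative_eq_sum_pd[OF d] sum_distrib_right mult.assoc)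
  qed
  have lin: "bounded_linear (\<lambda>h. \<Sum>b\<in>Basis. (h \<bullet> b) * conv (pd b f) g x)"
    by (intro bounded_linear_sum bounded_linear_mult_const bounded_linear_inner_left)
  have "((\<lambda>h. norm (conv f g (x + h) - conv f g x - (\<Sum>b\<in>Basis. (h \<bullet> b) * conv (pd b f) g x)) / norm h) \<longlongrightarrow> 0) (at 0)"
    unfolding tendsto_at_iff_sequentially
  proof (intro allI impI)
    fix X :: "nat \<Rightarrow> 'a" assume X0: "\<forall>i. X i \<in> UNIV - {0}" and X: "X \<longlonglongrightarrow> 0"
    define r where "r i y = (f (x - y + X i) - f (x - y) - frechet_derivative f (at (x - y)) (X i)) / norm (X i) * g y" for i y
    have r_int: "integrable lborel (r i)" for i
      using conv_integrable[OF f g, of "x + X i"] conv_integrable[OF f g, of x] D_int[of "X i"]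
      unfolding r_def by (simp add: left_diff_distrib diff_divide_distrib add_diff_eq diff_add_eq)
    have r_eq: "(conv f g (x + X i) - conv f g x - (\<Sum>b\<in>Basis. (X i \<bullet> b) * conv (pd b f) g x)) / norm (X i) = (LINT y|lborel. r i y)" for i
      using conv_integrable[OF f g, of "x + X i"] conv_integrable[OF f g, of x] D_int[of "X i"]
      unfolding D_eq[symmetric] unfolding r_def conv_def
      by (simp add: left_diff_distrib diff_divide_distrib add_diff_eq diff_add_eq)
    have "(\<lambda>i. LINT y|lborel. r i y) \<longlonglongrightarrow> (LINT y|(lborel::'a measure). 0)"
    proof (rule integral_dominated_convergence[where w="\<lambda>y. 2 * M * \<bar>g y\<bar>"])
      show "integrable lborel (\<lambda>y. 2 * M * \<bar>g y\<bar>)" using g by simp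
      show "AE y in lborel. (\<lambda>i. r i y) \<longlonglongrightarrow> 0"
      proof (rule AE_I2)
        fix y
        have "((\<lambda>h. norm (f (x - y + h) - f (x - y) - frechet_derivative f (at (x - y)) h) / norm h) \<longlongrightarrow> 0) (at 0)"
          using has_derivative_frechet[OF d, of "x - y"] unfolding has_derivative_at by blast
        from this[unfolded tendsto_at_iff_sequentially, rule_format, of X] X0 X
        have "(\<lambda>i. norm (f (x - y + X i) - f (x - y) - frechet_derivative f (at (x - y)) (X i)) / norm (X i)) \<longlonglongrightarrow> 0"
          by (simp add: comp_def)
        then have "(\<lambda>i. \<bar>(f (x - y + X i) - f (x - y) - frechet_derivative f (at (x - y)) (X i)) / norm (X i)\<bar>) \<longlonglongrightarrow> 0"
          by simp
        then have "(\<lambda>i. (f (x - y + X i) - f (x - y) - frechet_derivative f (at (x - y)) (X i)) / norm (X i)) \<longlonglongrightarrow> 0"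
          by (rule tendsto_rabs_zero_cancel)
        from tendsto_mult_left_zero[OF this] show "(\<lambda>i. r i y) \<longlonglongrightarrow> 0" unfolding r_def .
      qed
      show "AE y in lborel. norm (r i y) \<le> 2 * M * \<bar>g y\<bar>" for i
      proof (rule AE_I2)
        fix y
        have "\<bar>f (x - y + X i) - f (x - y) - frechet_derivative f (at (x - y)) (X i)\<bar> \<le> 2 * M * norm (X i)"
          using M(2)[of "x - y + X i" "x - y"] M(3)[of "x - y" "X i"] by (simp add: algebra_simps)
        then have "\<bar>f (x - y + X i) - f (x - y) - frechet_derivative f (at (x - y)) (X i)\<bar> / norm (X i) \<le> 2 * M"
          using X0 by (simp add: divide_le_eq)
        from mult_right_mono[OF this, of "\<bar>g y\<bar>"] show "norm (r i y) \<le> 2 * M * \<bar>g y\<bar>"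
          by (simp add: r_def abs_mult)
      qed
    qed (use r_int in auto)
    then have "(\<lambda>i. \<bar>LINT y|lborel. r i y\<bar>) \<longlonglongrightarrow> 0" by (simp add: tendsto_rabs_zero)
    then show "((\<lambda>h. norm (conv f g (x + h) - conv f g x - (\<Sum>b\<in>Basis. (h \<bullet> b) * conv (pd b f) g x)) / norm h) \<circ> X) \<longlonglongrightarrow> 0"
      unfolding r_eq[symmetric] by (simp add: comp_def)
  qed
  then show ?thesis unfolding has_derivative_at D_eq using lin by blast
qed

lemma pd_conv:
  assumes "test_function \<Omega> f" "integrable lborel g"
  shows "pd b (conv f g) = conv (pd b f) g"
  using pd_eqI[OF has_derivative_conv[OF assms]] by (intro ext) (simp add: conv_def pd_def)

text \<open>A derivative of the convolution is the convolution with a derivative of the test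
  function, so these convolutions form a class stable under differentiation.\<close>

lemma smooth_conv:
  fixes f g :: "'a::euclidean_space \<Rightarrow> real"
  assumes f: "test_function \<Omega> f" and g: "integrable lborel g"
  shows "smooth (conv f g)"
proof (rule smooth_coinduct[of _ "{conv f g |f. test_function \<Omega> f}"])
  show "h differentiable (at x)" if "h \<in> {conv f g |f. test_function \<Omega> f}" for h x
    using that has_derivative_conv[OF _ g] by (auto simp: differentiable_def)
  show "pd b h \<in> {conv f g |f. test_function \<Omega> f}" if h: "h \<in> {conv f g |f. test_function \<Omega> f}" and b: "b \<in> Basis" for h b
    using h pd_conv[OF _ g] test_function_pd[OF _ b] by auto
qed (use f in auto)

lemma conv_support:
  assumes "\<And>x. norm x \<ge> R \<Longrightarrow> f x = 0" "\<And>x. norm x \<ge> S \<Longrightarrow> g x = 0" "norm x \<ge> R + S"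
  shows "conv f g x = 0"
proof -
  have "f (x - y) * g y = 0" for y
  proof (cases "norm y \<ge> S")
    case False
    then have "norm (x - y) \<ge> R" using norm_triangle_ineq2[of x y] assms(3) by linarith
    then show ?thesis by (simp add: assms(1))
  qed (simp add: assms(2))
  then have "(\<lambda>y. f (x - y) * g y) = (\<lambda>y. 0)" by (intro ext)
  then show ?thesis by (simp only: conv_def) simp
qed

lemma test_function_conv:
  fixes f g :: "'a::euclidean_space \<Rightarrow> real"
  assumes f: "test_function UNIV f" and g: "integrable lborel g" "\<And>x. norm x \<ge> S \<Longrightarrow> g x = 0"
  shows "test_function UNIV (conv f g)"
proof -
  obtain R where R: "\<And>x. norm x \<ge> R \<Longrightarrow> f x = 0" using test_function_support[OF f] by metis
  show ?thesis by (rule test_functionI[OF smooth_conv[OF f g(1)] conv_support[OF R g(2)]])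
qed

text \<open>Evenness of \<open>f\<close> removes the sine term of the addition formula; otherwise
  the transform of \<open>g\<close> at the reflected frequency would enter as well.\<close>

lemma hartley_conv_even:
  fixes f g :: "'a::euclidean_space \<Rightarrow> real"
  assumes f: "test_function UNIV f" "\<And>x. f (- x) = f x"
    and g: "integrable lborel g" "\<And>x. norm x \<ge> S \<Longrightarrow> g x = 0"
  shows "hartley (conv f g) \<xi> = (LINT x|lborel. f x * cos (x \<bullet> \<xi>)) * hartley g \<xi>"
proof -
  obtain R K where R: "\<And>x. norm x \<ge> R \<Longrightarrow> f x = 0" and K: "\<And>x. \<bar>f x\<bar> \<le> K"
    using test_function_bounds[OF f(1)] by metis
  have [measurable]: "f \<in> borel_measurable borel" "g \<in> borel_measurable borel"
    using g by (auto intro: smooth_borel test_function_smooth[OF f(1)])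
  let ?I = "indicator (cball 0 \<bar>R + S\<bar>) :: 'a \<Rightarrow> real"
  have Ii: "integrable lborel ?I"
    using emeasure_lborel_cball_finite[of "0::'a" "\<bar>R + S\<bar>"] by simp
  have fcs: "integrable lborel (\<lambda>x. f x * cos (x \<bullet> \<xi>))" "integrable lborel (\<lambda>x. f x * sin (x \<bullet> \<xi>))"
    by (rule Bochner_Integration.integrable_bound[OF test_function_integrable[OF f(1)]]; auto simp: abs_mult mult_left_le)+
  have sin0: "(LINT x|lborel. f x * sin (x \<bullet> \<xi>)) = 0"
  proof -
    have m: "(\<lambda>x. f x * sin (x \<bullet> \<xi>)) \<in> borel_measurable borel" by measurable
    have "(LINT x|lborel. f x * sin (x \<bullet> \<xi>)) = (LINT x|lborel. - (f x * sin (x \<bullet> \<xi>)))"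
      using integral_lborel_reflect[OF m, of 0] by (simp add: f(2))
    then show ?thesis by simp
  qed
  have inner: "(LINT x|lborel. f (x - y) * cas (x \<bullet> \<xi>)) = (LINT x|lborel. f x * cos (x \<bullet> \<xi>)) * cas (y \<bullet> \<xi>)" for y
  proof -
    have m: "(\<lambda>x. f (x - y) * cas (x \<bullet> \<xi>)) \<in> borel_measurable borel" by measurable
    have "(LINT x|lborel. f (x - y) * cas (x \<bullet> \<xi>)) = (LINT x|lborel. f x * cas ((y + x) \<bullet> \<xi>))"
      using integral_lborel_translate[OF m, of y] by simp
    also have "\<dots> = (LINT x|lborel. cas (y \<bullet> \<xi>) * (f x * cos (x \<bullet> \<xi>)) + cas (- (y \<bullet> \<xi>)) * (f x * sin (x \<bullet> \<xi>)))"
      by (simp add: inner_add_left add.commute[of "y \<bullet> \<xi>"] cas_add algebra_simps)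
    finally show ?thesis using fcs sin0 by simp
  qed
  \<comment> \<open>The function \<open>cas\<close> is not integrable in x. The support of the
    convolution lets the indicator of a ball be inserted, and then the bounded factor f (x - y)
    plays the kernel in Fubini's theorem.\<close>
  have supp: "conv f g x = ?I x * conv f g x" for x
    using conv_support[OF R g(2), where x=x] by (auto simp: indicator_def)
  have "(LINT x|lborel. conv f g x * cas (x \<bullet> \<xi>)) =
      (LINT x|lborel. (?I x * cas (x \<bullet> \<xi>)) * (LINT y|lborel. g y * f (x - y)))"
    by (subst supp) (simp add: conv_def mult_ac)
  also have "\<dots> = (LINT y|lborel. g y * (LINT x|lborel. ?I x * cas (x \<bullet> \<xi>) * f (x - y)))"
    by (rule Fubini_bounded_kernel[OF integrable_mult_cas[OF Ii] g(1) _ K]) measurable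
  also have "\<dots> = (LINT y|lborel. g y * (LINT x|lborel. f (x - y) * cas (x \<bullet> \<xi>)))"
  proof (intro Bochner_Integration.integral_cong refl)
    fix y
    show "g y * (LINT x|lborel. ?I x * cas (x \<bullet> \<xi>) * f (x - y)) = g y * (LINT x|lborel. f (x - y) * cas (x \<bullet> \<xi>))"
    proof (cases "norm y \<ge> S")
      case False
      have "?I x * cas (x \<bullet> \<xi>) * f (x - y) = f (x - y) * cas (x \<bullet> \<xi>)" for x
      proof (cases "norm x \<le> \<bar>R + S\<bar>")
        case x: False
        then have "norm (x - y) \<ge> R" using False norm_triangle_ineq2[of x y] by linarith
        then show ?thesis by (simp add: R)
      qed simp
      then have "(\<lambda>x. ?I x * cas (x \<bullet> \<xi>) * f (x - y)) = (\<lambda>x. f (x - y) * cas (x \<bullet> \<xi>))" by (intro ext)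
      then show ?thesis by (simp only:)
    qed (simp add: g)
  qed
  also have "\<dots> = (LINT x|lborel. f x * cos (x \<bullet> \<xi>)) * (LINT y|lborel. g y * cas (y \<bullet> \<xi>))"
    unfolding inner by (subst integral_mult_right_zero[symmetric]) (simp add: mult_ac)
  finally show ?thesis by (simp add: hartley_def)
qed

section \<open>Transforms of derivatives\<close>

lemma has_derivative_cas_inner:
  "((\<lambda>x. cas (x \<bullet> \<xi>)) has_derivative (\<lambda>h. (h \<bullet> \<xi>) * cas (- (x \<bullet> \<xi>)))) (at x)"
  unfolding cas_def by (auto intro!: derivative_eq_intros simp: algebra_simps)

text \<open>Integration by parts moves the derivative to \<open>cas\<close>, and the derivative of
  \<open>cas\<close> is \<open>cas\<close> of the negated argument; hence the reflected
  frequency.\<close>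

lemma hartley_pd:
  fixes f :: "'a::euclidean_space \<Rightarrow> real"
  assumes f: "test_function \<Omega> f" and b: "b \<in> Basis"
  shows "hartley (pd b f) \<xi> = - (\<xi> \<bullet> b) * hartley f (- \<xi>)"
proof -
  obtain R where R: "\<And>x. norm x \<ge> R \<Longrightarrow> f x = 0" using test_function_support[OF f] by metis
  have pd: "pd b (\<lambda>x. cas (x \<bullet> \<xi>)) = (\<lambda>x. (b \<bullet> \<xi>) * cas (- (x \<bullet> \<xi>)))"
    by (intro ext pd_eqI[OF has_derivative_cas_inner])
  have "(LINT x|lborel. pd b f x * cas (x \<bullet> \<xi>)) = - (LINT x|lborel. f x * pd b (\<lambda>x. cas (x \<bullet> \<xi>)) x)"
  proof (rule integral_pd_mult[OF test_function_smooth[OF f] R b])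
    show "(\<lambda>x. cas (x \<bullet> \<xi>)) differentiable (at x)" for x
      using has_derivative_cas_inner by (auto simp: differentiable_def)
    show "continuous_on UNIV (pd b (\<lambda>x. cas (x \<bullet> \<xi>)))"
      unfolding pd unfolding cas_def by (intro continuous_intros)
  qed
  also have "\<dots> = - (\<xi> \<bullet> b) * (LINT x|lborel. f x * cas (x \<bullet> (- \<xi>)))"
    unfolding pd mult.left_commute[of "f _"] by (simp add: inner_commute)
  finally show ?thesis by (simp add: hartley_def)
qed

text \<open>The purely spatial counterpart of \<open>laplacian\<close>, which acts on functions of
  time and space.\<close>

definition lap :: "('a::euclidean_space \<Rightarrow> real) \<Rightarrow> 'a \<Rightarrow> real" where
  "lap f x = (\<Sum>b\<in>Basis. pd b (pd b f) x)"

lemma test_function_lap: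
  fixes f :: "'a::euclidean_space \<Rightarrow> real"
  assumes f: "test_function UNIV f" shows "test_function UNIV (lap f)"
proof -
  obtain R where R: "\<And>x. norm x \<ge> R \<Longrightarrow> f x = 0" using test_function_support[OF f] by metis
  have "\<exists>R. \<forall>x. norm x \<ge> R \<longrightarrow> pd b (pd b f) x = 0" if "b \<in> Basis" for b
    using test_function_support[OF test_function_pd[OF test_function_pd[OF f that] that]] by metis
  then obtain r where r: "\<And>b x. b \<in> Basis \<Longrightarrow> norm x \<ge> r b \<Longrightarrow> pd b (pd b f) x = 0" by metis
  have "smooth (lap f)" unfolding lap_def[abs_def]
    by (intro smooth_sum smooth_pd test_function_smooth[OF f])
  then show ?thesis
  proof (rule test_functionI[where R="\<Sum>b\<in>Basis. \<bar>r b\<bar>"])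
    fix x :: 'a assume x: "(\<Sum>b\<in>Basis. \<bar>r b\<bar>) \<le> norm x"
    have "pd b (pd b f) x = 0" if b: "b \<in> Basis" for b
    proof -
      have "\<bar>r b\<bar> \<le> (\<Sum>b\<in>Basis. \<bar>r b\<bar>)" by (rule member_le_sum) (use b in auto)
      then show ?thesis using x b by (intro r) linarith+
    qed
    then show "lap f x = 0" by (simp add: lap_def)
  qed
qed

text \<open>Two derivatives in the same direction reflect the frequency twice, so the Laplacian
  becomes a genuine multiplier.\<close>

lemma hartley_lap:
  fixes f :: "'a::euclidean_space \<Rightarrow> real"
  assumes f: "test_function UNIV f"
  shows "hartley (lap f) \<xi> = - (norm \<xi>)\<^sup>2 * hartley f \<xi>"
proof -
  have i: "integrable lborel (\<lambda>x. pd b (pd b f) x * cas (x \<bullet> \<xi>))" if "b \<in> Basis" for b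
    by (intro integrable_mult_cas test_function_integrable[OF test_function_pd[OF test_function_pd[OF f that] that]])
  have "hartley (lap f) \<xi> = (\<Sum>b\<in>Basis. hartley (pd b (pd b f)) \<xi>)"
    unfolding hartley_def lap_def sum_distrib_right
    by (subst Bochner_Integration.integral_sum[OF i]) (auto simp: sum_distrib_left)
  also have "\<dots> = (\<Sum>b\<in>Basis. - (\<xi> \<bullet> b)\<^sup>2 * hartley f \<xi>)"
    by (intro sum.cong refl) (simp add: hartley_pd[OF test_function_pd[OF f]] hartley_pd[OF f] power2_eq_square)
  also have "\<dots> = - (norm \<xi>)\<^sup>2 * hartley f \<xi>"
    unfolding power2_norm_eq_inner euclidean_inner[of \<xi> \<xi>]
    by (simp add: sum_negf sum_distrib_right power2_eq_square)
  finally show ?thesis .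
qed

lemma bump_eq_0: "e > 0 \<Longrightarrow> norm x \<ge> e \<Longrightarrow> bump e x = 0"
  using bump_pos_iff[of e x] bump_nonneg[of e x] by linarith

lemma test_function_bump: "e > 0 \<Longrightarrow> test_function UNIV (bump e :: 'a::euclidean_space \<Rightarrow> real)"
  by (rule test_functionI[OF smooth_bump bump_eq_0])

text \<open>The multiplier is the cosine transform of a bump function supported where \<open>cos (x \<bullet> \<xi>) > 0\<close>.\<close>

lemma test_function_multiplier:
  fixes R :: real
  assumes R: "R > 0"
  obtains m :: "'a::euclidean_space \<Rightarrow> real" and K :: real
  where "m \<in> borel_measurable borel" "\<And>\<xi>. \<bar>m \<xi>\<bar> \<le> K" "\<And>\<xi>. (norm \<xi>)\<^sup>2 * \<bar>m \<xi>\<bar> \<le> K"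
    "\<And>\<xi>. norm \<xi> \<le> R \<Longrightarrow> m \<xi> > 0"
    "\<And>g k. sq_int g \<Longrightarrow> \<exists>\<phi>. test_function UNIV \<phi> \<and>
      (\<forall>\<xi>. hartley \<phi> \<xi> = m \<xi> * hartley (\<lambda>x. indicator (ball 0 (real k)) x * g x) \<xi>)"
proof -
  \<comment> \<open>With this radius |x . xi| is at most 1 on the support whenever |xi| is at most
    \<open>R\<close>, so the cosine stays above cos 1 > 0 there.\<close>
  define e where "e = 1 / R"
  have e: "e > 0" using R by (simp add: e_def)
  define f where "f = (bump e :: 'a \<Rightarrow> real)"
  have f: "test_function UNIV f" unfolding f_def by (rule test_function_bump[OF e])
  have f_even: "f (- x) = f x" for x by (simp add: f_def bump_uminus)
  have f0: "f x \<ge> 0" for x by (simp add: f_def bump_nonneg)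
  note f_i = test_function_integrable[OF f]
  have [measurable]: "f \<in> borel_measurable borel" by (intro smooth_borel test_function_smooth[OF f])
  define m where "m \<xi> = (LINT x|lborel. f x * cos (x \<bullet> \<xi>))" for \<xi>
  have fcs: "integrable lborel (\<lambda>x. f x * cos (x \<bullet> \<xi>))" "integrable lborel (\<lambda>x. f x * sin (x \<bullet> \<xi>))" for \<xi>
    by (rule Bochner_Integration.integrable_bound[OF f_i]; auto simp: abs_mult mult_left_le)+
  have m_eq: "m \<xi> = sqrt (2 * pi) ^ DIM('a) * hartley f \<xi>" for \<xi>
  proof -
    have ms: "(\<lambda>x. f x * sin (x \<bullet> \<xi>)) \<in> borel_measurable borel" by measurable
    have "(LINT x|lborel. f x * sin (x \<bullet> \<xi>)) = (LINT x|lborel. - (f x * sin (x \<bullet> \<xi>)))"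
      using integral_lborel_reflect[OF ms, of 0] by (simp add: f_even)
    then have "(LINT x|lborel. f x * sin (x \<bullet> \<xi>)) = 0" by simp
    then show ?thesis using fcs[of \<xi>] by (simp add: m_def hartley_def cas_def distrib_left)
  qed
  \<comment> \<open>One constant for two bounds: the first summand controls \<open>m\<close>, the
    second controls |xi|^2 \<open>m\<close>, which is up to sign the unnormalized transform of
    \<open>lap f\<close>.\<close>
  define K where "K = 2 * (LINT x|lborel. \<bar>f x\<bar>) + 2 * (LINT x|lborel. \<bar>lap f x\<bar>)"
  have nn: "0 \<le> (LINT x|lborel. \<bar>f x\<bar>)" "0 \<le> (LINT x|lborel. \<bar>lap f x\<bar>)"
    by (intro integral_nonneg_AE; simp)+
  show thesis
  proof (rule that[of m K])
    show "m \<in> borel_measurable borel" unfolding m_def by measurable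
    show "\<bar>m \<xi>\<bar> \<le> K" for \<xi>
    proof -
      have "\<bar>m \<xi>\<bar> \<le> sqrt (2 * pi) ^ DIM('a) * (2 / sqrt (2 * pi) ^ DIM('a) * (LINT x|lborel. \<bar>f x\<bar>))"
        unfolding m_eq abs_mult using hartley_bound[OF f_i, of \<xi>] by (intro mult_mono) auto
      then have "\<bar>m \<xi>\<bar> \<le> 2 * (LINT x|lborel. \<bar>f x\<bar>)" by simp
      then show ?thesis using nn unfolding K_def by linarith
    qed
    show "(norm \<xi>)\<^sup>2 * \<bar>m \<xi>\<bar> \<le> K" for \<xi>
    proof -
      have "(norm \<xi>)\<^sup>2 * \<bar>m \<xi>\<bar> = sqrt (2 * pi) ^ DIM('a) * \<bar>hartley (lap f) \<xi>\<bar>"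
        unfolding hartley_lap[OF f] m_eq by (simp add: abs_mult)
      also have "\<dots> \<le> sqrt (2 * pi) ^ DIM('a) * (2 / sqrt (2 * pi) ^ DIM('a) * (LINT x|lborel. \<bar>lap f x\<bar>))"
        using hartley_bound[OF test_function_integrable[OF test_function_lap[OF f]], of \<xi>] by (intro mult_left_mono) auto
      finally have "(norm \<xi>)\<^sup>2 * \<bar>m \<xi>\<bar> \<le> 2 * (LINT x|lborel. \<bar>lap f x\<bar>)" by simp
      then show ?thesis using nn unfolding K_def by linarith
    qed
    show "m \<xi> > 0" if \<xi>: "norm \<xi> \<le> R" for \<xi>
    proof -
      have c: "f x * cos 1 \<le> f x * cos (x \<bullet> \<xi>)" for x
      proof (cases "norm x < e")
        case True
        have "\<bar>x \<bullet> \<xi>\<bar> \<le> norm x * norm \<xi>" by (rule Cauchy_Schwarz_ineq2)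
        also have "\<dots> \<le> e * R" using True \<xi> e by (intro mult_mono) auto
        finally have "\<bar>x \<bullet> \<xi>\<bar> \<le> 1" using R by (simp add: e_def)
        then have "cos 1 \<le> cos \<bar>x \<bullet> \<xi>\<bar>" using pi_gt3 by (intro cos_monotone_0_pi_le) auto
        then show ?thesis using f0[of x] by (intro mult_left_mono) auto
      next
        case False
        then have "f x = 0" using bump_pos_iff[OF e, of x] f0[of x] unfolding f_def by linarith
        then show ?thesis by simp
      qed
      have "(LINT x|lborel. f x) > 0"
      proof -
        have "(LINT x|lborel. f x) \<noteq> 0"
        proof
          assume "(LINT x|lborel. f x) = 0"
          then have ae: "AE x in lborel. f x = 0"
            using integral_nonneg_eq_0_iff_AE[OF f_i] f0 by simp
          then have "AE x::'a in lborel. x \<notin> ball 0 e"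
          proof eventually_elim
            case (elim x)
            then show ?case using bump_pos_iff[OF e, of x] by (simp add: f_def)
          qed
          then have "ball 0 e \<in> null_sets (lborel :: 'a measure)"
            by (subst (asm) AE_iff_null_sets[symmetric]) auto
          then have "open (ball (0::'a) e)" "negligible (ball (0::'a) e)"
            by (auto simp: negligible_iff_null_sets null_sets_completionI)
          then show False using open_not_negligible[of "ball (0::'a) e"] e by auto
        qed
        moreover have "(LINT x|lborel. f x) \<ge> 0" by (intro integral_nonneg_AE) (simp add: f0)
        ultimately show ?thesis by linarith
      qed
      moreover have "cos 1 > (0::real)" using pi_gt3 by (intro cos_gt_zero) auto
      ultimately have "0 < (LINT x|lborel. f x) * cos 1" by simp
      also have "\<dots> = (LINT x|lborel. f x * cos 1)" by simp
      also have "\<dots> \<le> m \<xi>" unfolding m_def using f_i fcs c by (intro integral_mono) auto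
      finally show ?thesis .
    qed
    show "\<exists>\<phi>. test_function UNIV \<phi> \<and> (\<forall>\<xi>. hartley \<phi> \<xi> = m \<xi> * hartley (\<lambda>x. indicator (ball 0 (real k)) x * g x) \<xi>)"
      if g: "sq_int g" for g k
    proof -
      have i: "integrable lborel (\<lambda>x. indicator (ball 0 (real k)) x * g x)" by (rule integrable_truncation[OF g])
      have s: "indicator (ball 0 (real k)) x * g x = 0" if "norm x \<ge> real k" for x using that by (simp add: indicator_def)
      show ?thesis
        using test_function_conv[OF f i s] hartley_conv_even[OF f f_even i s] unfolding m_def by blast
    qed
  qed
qed

text \<open>Times the multiplier, \<open>V\<close> is square integrable because (1 + |xi|^2) m is
  bounded, and it is orthogonal to the transforms of all truncated functions; so m V vanishes, and m
  > 0 on the ball. \<open>V\<close> itself may grow by two powers of |xi| over L2, which admits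
  symbols such as xi_i.\<close>

lemma test_functions_total:
  fixes V :: "'a::euclidean_space \<Rightarrow> real"
  assumes V [measurable]: "V \<in> borel_measurable borel" and W: "sq_int (\<lambda>\<xi>. V \<xi> / (1 + (norm \<xi>)\<^sup>2))"
    and zero: "\<And>\<phi>. test_function UNIV \<phi> \<Longrightarrow> l2_inner V (hartley \<phi>) = 0"
  shows "AE \<xi> in lborel. V \<xi> = 0"
proof -
  have main: "AE \<xi> in lborel. norm \<xi> \<le> R \<longrightarrow> V \<xi> = 0" if R: "R > 0" for R
  proof -
    obtain m :: "'a \<Rightarrow> real" and K where m [measurable]: "m \<in> borel_measurable borel"
      and K: "\<And>\<xi>. \<bar>m \<xi>\<bar> \<le> K" "\<And>\<xi>. (norm \<xi>)\<^sup>2 * \<bar>m \<xi>\<bar> \<le> K"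
      and pos: "\<And>\<xi>. norm \<xi> \<le> R \<Longrightarrow> m \<xi> > 0"
      and ex: "\<And>g k. sq_int g \<Longrightarrow> \<exists>\<phi>. test_function UNIV \<phi> \<and>
        (\<forall>\<xi>. hartley \<phi> \<xi> = m \<xi> * hartley (\<lambda>x. indicator (ball 0 (real k)) x * g x) \<xi>)"
      by (rule test_function_multiplier[OF R], rule that)
    define F where "F \<xi> = m \<xi> * V \<xi>" for \<xi>
    have one: "1 + (norm \<xi>)\<^sup>2 > 0" for \<xi> :: 'a by (simp add: add_pos_nonneg)
    have "sq_int (\<lambda>\<xi>. (m \<xi> * (1 + (norm \<xi>)\<^sup>2)) * (V \<xi> / (1 + (norm \<xi>)\<^sup>2)))"
    proof (rule sq_int_mult_bounded[OF W, of _ "2 * K"])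
      show "\<bar>m \<xi> * (1 + (norm \<xi>)\<^sup>2)\<bar> \<le> 2 * K" for \<xi>
      proof -
        have "\<bar>m \<xi> * (1 + (norm \<xi>)\<^sup>2)\<bar> = \<bar>m \<xi>\<bar> + (norm \<xi>)\<^sup>2 * \<bar>m \<xi>\<bar>"
          unfolding abs_mult using one[of \<xi>] by (simp add: distrib_left mult.commute)
        then show ?thesis using K(1)[of \<xi>] K(2)[of \<xi>] by linarith
      qed
    qed measurable
    moreover have "(m \<xi> * (1 + (norm \<xi>)\<^sup>2)) * (V \<xi> / (1 + (norm \<xi>)\<^sup>2)) = F \<xi>" for \<xi>
      using one[of \<xi>] by (simp add: F_def)
    ultimately have F: "sq_int F" by simp
    have "AE \<xi> in lborel. l2_hartley F \<xi> = 0"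
    proof (rule l2_orthogonal_imp_zero[OF sq_int_l2_hartley[OF F]])
      fix S :: real
      obtain k :: nat where k: "S \<le> real k" using real_arch_simple[of S] ..
      let ?g = "\<lambda>x. indicator (ball 0 S) x * l2_hartley F x"
      have g: "integrable lborel ?g" "sq_int ?g"
        using sq_int_l2_hartley[OF F] by (auto intro: integrable_truncation sq_int_indicator)
      \<comment> \<open>A second truncation at radius k >= S changes nothing, so the multiplier
        lemma applies to the truncated function itself.\<close>
      have gk: "(\<lambda>x. indicator (ball 0 (real k)) x * ?g x) = ?g" using k by (auto simp: indicator_def fun_eq_iff)
      obtain \<phi> where \<phi>: "test_function UNIV \<phi>" "\<And>\<xi>. hartley \<phi> \<xi> = m \<xi> * hartley ?g \<xi>"
        using ex[OF g(2), of k] unfolding gk by blast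
      have "l2_inner (l2_hartley F) ?g = l2_inner F (hartley ?g)" by (rule l2_hartley_inner[OF F g])
      also have "\<dots> = l2_inner V (hartley \<phi>)" by (simp add: l2_inner_def F_def \<phi>(2) mult_ac)
      finally show "l2_inner (l2_hartley F) ?g = 0" using zero[OF \<phi>(1)] by simp
    qed
    then have "l2_norm (l2_hartley F) = 0"
      unfolding l2_norm_def by (subst integral_eq_zero_AE) auto
    then have "AE \<xi> in lborel. F \<xi> = 0"
      using l2_norm_eq_0D[OF F] by (simp add: l2_norm_l2_hartley[OF F])
    then show ?thesis by eventually_elim (use pos in \<open>force simp: F_def\<close>)
  qed
  have "AE \<xi> in lborel. \<forall>k. norm \<xi> \<le> real (Suc k) \<longrightarrow> V \<xi> = 0"
    unfolding AE_all_countable using main by (intro allI) simp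
  then show ?thesis
  proof eventually_elim
    case (elim \<xi>)
    obtain k :: nat where "norm \<xi> \<le> real k" using real_arch_simple[of "norm \<xi>"] ..
    then show ?case using elim[rule_format, of k] by simp
  qed
qed

section \<open>Solution multipliers\<close>

text \<open>Removing exp (-t/2) from y'' + y' + r y = 0 leaves z'' + q z = 0 with q = r - 1/4.
  \<open>osc_cos\<close> and \<open>osc_sin\<close> are its solutions with initial data (1, 0) and
  (0, 1); at q = 0 the hyperbolic branch gives cosh 0 = 1.\<close>

definition osc_cos :: "real \<Rightarrow> real \<Rightarrow> real" where
  "osc_cos q t = (if q > 0 then cos (sqrt q * t) else cosh (sqrt (- q) * t))"

definition osc_sin :: "real \<Rightarrow> real \<Rightarrow> real" where
  "osc_sin q t = (if q > 0 then sin (sqrt q * t) / sqrt q else if q = 0 then t else sinh (sqrt (- q) * t) / sqrt (- q))"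

text \<open>With \<open>r = \<bar>\<xi>\<bar>\<^sup>2\<close>, the pair \<open>sol0 r\<close>, \<open>sol1 r\<close> is the fundamental system of
  \<open>y'' + y' + r y = 0\<close>.\<close>

definition sol1 :: "real \<Rightarrow> real \<Rightarrow> real" where
  "sol1 r t = exp (- t / 2) * osc_sin (r - 1 / 4) t"

definition sol0 :: "real \<Rightarrow> real \<Rightarrow> real" where
  "sol0 r t = exp (- t / 2) * (osc_cos (r - 1 / 4) t + osc_sin (r - 1 / 4) t / 2)"

lemma osc_cos_deriv: "(osc_cos q has_real_derivative - q * osc_sin q t) (at t)"
proof (cases "q > 0")
  case True
  then have "q / sqrt q = sqrt q" by (simp add: real_div_sqrt)
  then have "- q * (sin (sqrt q * t) / sqrt q) = - (sin (sqrt q * t) * sqrt q)"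
    by (metis mult.commute mult_minus_left times_divide_eq_left times_divide_eq_right)
  with True show ?thesis unfolding osc_cos_def[abs_def] osc_sin_def
    by (auto intro!: derivative_eq_intros)
next
  case False
  show ?thesis
  proof (cases "q = 0")
    case False
    with \<open>\<not> q > 0\<close> have "- q / sqrt (- q) = sqrt (- q)" by (intro real_div_sqrt) simp
    then have "- q * (sinh (sqrt (- q) * t) / sqrt (- q)) = sinh (sqrt (- q) * t) * sqrt (- q)"
      by (metis mult.commute times_divide_eq_left times_divide_eq_right)
    with False \<open>\<not> q > 0\<close> show ?thesis unfolding osc_cos_def[abs_def] osc_sin_def
      by (auto intro!: derivative_eq_intros)
  qed (simp add: osc_cos_def[abs_def])
qed

lemma osc_sin_deriv: "(osc_sin q has_real_derivative osc_cos q t) (at t)"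
proof (cases q "0::real" rule: linorder_cases)
  case less
  then have "((\<lambda>t. sinh (sqrt (- q) * t) / sqrt (- q)) has_real_derivative cosh (sqrt (- q) * t) * sqrt (- q) / sqrt (- q)) (at t)"
    by (intro DERIV_cdivide) (auto intro!: derivative_eq_intros)
  then show ?thesis using less unfolding osc_cos_def osc_sin_def[abs_def] by simp
next
  case equal
  then show ?thesis unfolding osc_cos_def osc_sin_def[abs_def] by simp
next
  case greater
  then have "((\<lambda>t. sin (sqrt q * t) / sqrt q) has_real_derivative cos (sqrt q * t) * sqrt q / sqrt q) (at t)"
    by (intro DERIV_cdivide) (auto intro!: derivative_eq_intros)
  then show ?thesis using greater unfolding osc_cos_def osc_sin_def[abs_def] by simp
qed

text \<open>With \<open>sol0_deriv\<close> this is a closed first-order system equivalent to the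
  second-order equation. The term with \<open>osc_sin\<close> in \<open>sol0\<close> is there to
  make its derivative vanish at time 0.\<close>

lemma sol1_deriv: "(sol1 r has_real_derivative sol0 r t - sol1 r t) (at t)"
  unfolding sol1_def[abs_def] sol0_def
  by (auto intro!: derivative_eq_intros osc_sin_deriv simp: field_simps)

lemma sol0_deriv: "(sol0 r has_real_derivative - r * sol1 r t) (at t)"
  unfolding sol1_def sol0_def[abs_def]
  by (auto intro!: derivative_eq_intros osc_sin_deriv osc_cos_deriv simp: field_simps)

lemma sol_at_0 [simp]: "sol0 r 0 = 1" "sol1 r 0 = 0"
  by (simp_all add: sol0_def sol1_def osc_cos_def osc_sin_def)

lemma measurable_sol0 [measurable]:
  assumes [measurable]: "f \<in> borel_measurable M" "g \<in> borel_measurable M"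
  shows "(\<lambda>x. sol0 (f x) (g x)) \<in> borel_measurable M"
  unfolding sol0_def osc_cos_def osc_sin_def cosh_field_def sinh_field_def by measurable

lemma measurable_sol1 [measurable]:
  assumes [measurable]: "f \<in> borel_measurable M" "g \<in> borel_measurable M"
  shows "(\<lambda>x. sol1 (f x) (g x)) \<in> borel_measurable M"
  unfolding sol1_def osc_sin_def sinh_field_def by measurable

section \<open>Bounds for the multipliers and comparison with the heat multiplier\<close>

text \<open>The energy is dissipated: its time derivative is -2 r sol1^2, and it starts at
  1.\<close>

lemma sol_energy:
  assumes t: "t \<ge> 0" and r: "r \<ge> 0"
  shows "(sol0 r t)\<^sup>2 + r * (sol1 r t)\<^sup>2 \<le> 1"
proof -
  have d: "((\<lambda>t. (sol0 r t)\<^sup>2 + r * (sol1 r t)\<^sup>2) has_real_derivative - 2 * r * (sol1 r s)\<^sup>2) (at s)" for s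
    by (auto intro!: derivative_eq_intros sol0_deriv sol1_deriv simp: power2_eq_square algebra_simps)
  have "(sol0 r t)\<^sup>2 + r * (sol1 r t)\<^sup>2 \<le> (sol0 r 0)\<^sup>2 + r * (sol1 r 0)\<^sup>2"
    using t by (rule DERIV_nonpos_imp_nonincreasing) (use d r in \<open>force intro!: mult_nonneg_nonneg\<close>)
  then show ?thesis by simp
qed

lemma abs_sol0_le:
  assumes "t \<ge> 0" "r \<ge> 0" shows "\<bar>sol0 r t\<bar> \<le> 1"
proof -
  have "(sol0 r t)\<^sup>2 \<le> 1" using sol_energy[OF assms] mult_nonneg_nonneg[OF assms(2) zero_le_power2[of "sol1 r t"]] by linarith
  then show ?thesis by (simp add: abs_square_le_1)
qed

lemma sqrt_sol1_le:
  assumes "t \<ge> 0" "r \<ge> 0" shows "sqrt r * \<bar>sol1 r t\<bar> \<le> 1"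
proof -
  have "r * (sol1 r t)\<^sup>2 \<le> 1"
    using sol_energy[OF assms] zero_le_power2[of "sol0 r t"] by linarith
  then have "(sqrt r * sol1 r t)\<^sup>2 \<le> 1" using assms by (simp add: power_mult_distrib)
  then have "\<bar>sqrt r * sol1 r t\<bar> \<le> 1" by (simp add: abs_square_le_1)
  then show ?thesis using assms by (simp add: abs_mult)
qed

text \<open>The energy loses control of \<open>sol1\<close> as r tends to 0. Instead, the derivative
  of exp t sol1 is exp t sol0, of absolute value at most exp t, so integration gives |exp t sol1| <=
  exp t - 1.\<close>

lemma abs_sol1_le:
  assumes t: "t \<ge> 0" and r: "r \<ge> 0" shows "\<bar>sol1 r t\<bar> \<le> 1"
proof -
  have d: "((\<lambda>t. exp t * sol1 r t) has_real_derivative exp s * sol0 r s) (at s)" for s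
    by (auto intro!: derivative_eq_intros sol1_deriv simp: algebra_simps)
  have e: "(exp has_real_derivative exp s) (at s)" for s :: real by (auto intro!: derivative_eq_intros)
  have b: "- exp s \<le> exp s * sol0 r s" "exp s * sol0 r s \<le> exp s" if "s \<ge> 0" for s
  proof -
    have m: "-1 \<le> sol0 r s" "sol0 r s \<le> 1" using abs_sol0_le[OF that r] by linarith+
    show "- exp s \<le> exp s * sol0 r s" "exp s * sol0 r s \<le> exp s"
      using mult_left_mono[OF m(1), of "exp s"] mult_left_mono[OF m(2), of "exp s"] by simp_all
  qed
  have up: "exp t * sol1 r t - exp t \<le> exp 0 * sol1 r 0 - exp 0"
    using t by (rule DERIV_nonpos_imp_nonincreasing)
      (intro exI conjI, rule DERIV_diff[OF d e], use b in auto)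
  have lo: "exp 0 * sol1 r 0 + exp 0 \<le> exp t * sol1 r t + exp t"
    using t by (rule DERIV_nonneg_imp_nondecreasing)
      (intro exI conjI, rule DERIV_add[OF d e], use b in force)
  have "exp t * sol1 r t \<le> exp t * 1" "exp t * (-1) \<le> exp t * sol1 r t"
    using up lo unfolding sol_at_0 exp_zero by linarith+
  then show ?thesis unfolding mult_le_cancel_left_pos[OF exp_gt_zero] by (simp add: abs_le_iff)
qed

text \<open>Half of the decay pays for the factor x. Applied to x = r t, it absorbs the time factor
  that arises when two exponents are compared.\<close>

lemma mult_exp_minus_le:
  fixes x :: real
  assumes "x \<ge> 0" shows "x * exp (- x) \<le> exp (- x / 2)"
proof -
  have "x \<le> 1 + x / 2 + (x / 2)\<^sup>2 / 2"
    using zero_le_power2[of "x - 2"] by (simp add: power2_eq_square algebra_simps)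
  also have "\<dots> \<le> exp (x / 2)" using assms by (intro exp_lower_Taylor_quadratic) simp
  finally have "x * exp (- x) \<le> exp (x / 2) * exp (- x)" by (intro mult_right_mono) auto
  then show ?thesis by (simp flip: exp_add)
qed

lemma sinh_le_exp: fixes x :: real assumes "x \<ge> 0" shows "0 \<le> sinh x" "sinh x \<le> x * exp x"
proof -
  have "1 - exp (- 2 * x) \<le> 2 * x" using exp_ge_add_one_self[of "- 2 * x"] by simp
  then have "exp x * (1 - exp (- 2 * x)) \<le> exp x * (2 * x)" by (intro mult_left_mono) auto
  then show "sinh x \<le> x * exp x" by (simp add: sinh_field_def algebra_simps flip: exp_add)
qed (use assms in simp)

lemma cosh_le_exp: fixes x :: real assumes "x \<ge> 0" shows "cosh x \<le> exp x"
proof -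
  have "exp (- x) \<le> exp x" using assms by simp
  then show ?thesis by (simp add: cosh_field_def)
qed

text \<open>The characteristic roots are -1/2 + s and -1/2 - s. The slow mode \<open>A\<close>
  follows the heat factor \<open>E\<close> since s - 1/2 = -r + O(r^2), the fast mode
  \<open>B\<close> is exponentially small in t, and 1 / (2 s) = 1 + O(r). The exponent error r^2 t
  costs half of the decay and becomes O(r); finally r <= sqrt r.\<close>

lemma sol_diff_exp_low:
  assumes t: "t \<ge> 0" and r: "0 \<le> r" "r \<le> 3 / 16"
  shows "\<bar>sol0 r t - exp (- r * t)\<bar> \<le> 12 * (sqrt r * exp (- r * t / 2) + exp (- t / 8))"
    and "\<bar>sol1 r t - exp (- r * t)\<bar> \<le> 12 * (sqrt r * exp (- r * t / 2) + exp (- t / 8))"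
proof -
  define s where "s = sqrt (1 / 4 - r)"
  have s2: "s * s = 1 / 4 - r" using r by (simp add: s_def)
  \<comment> \<open>Equality holds at r = 3/16, where the two roots are 1/2 apart.\<close>
  have s_lo: "1 / 4 \<le> s" unfolding s_def using r by (intro real_le_rsqrt) (simp add: power2_eq_square)
  have s_hi: "s \<le> 1 / 2 - r" unfolding s_def using r
    by (intro real_le_lsqrt) (auto simp: power2_eq_square algebra_simps)
  define A where "A = exp ((s - 1 / 2) * t)"
  define B where "B = exp (- (s + 1 / 2) * t)"
  define E where "E = exp (- r * t)"
  define e' where "e' = exp (- r * t / 2)"
  have pos: "A > 0" "B > 0" "E > 0" "e' > 0" by (simp_all add: A_def B_def E_def e'_def)
  have m1: "sol1 r t = (A - B) / (2 * s)" and m0: "sol0 r t = (A + B) / 2 + (A - B) / (2 * s) / 2"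
  proof -
    have "\<not> r - 1/4 > 0" "r - 1/4 \<noteq> 0" "- (r - 1/4) = 1/4 - r" using r by auto
    then have 1: "osc_sin (r - 1/4) t = sinh (s * t) / s" "osc_cos (r - 1/4) t = cosh (s * t)"
      by (simp_all add: osc_sin_def osc_cos_def s_def)
    have 2: "A = exp (- t / 2) * exp (s * t)" "B = exp (- t / 2) * exp (- (s * t))"
      unfolding A_def B_def exp_add[symmetric] by (simp_all add: algebra_simps)
    show "sol1 r t = (A - B) / (2 * s)"
      unfolding sol1_def 1 2 sinh_field_def using s_lo by (simp add: field_simps)
    show "sol0 r t = (A + B) / 2 + (A - B) / (2 * s) / 2"
      unfolding sol0_def 1 2 sinh_field_def cosh_field_def using s_lo by (simp add: field_simps)
  qed
  have "(s - 1 / 2) * t \<le> - r * t" using s_hi t by (intro mult_right_mono) auto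
  then have AE: "A \<le> E" by (simp add: A_def E_def)
  have Ee: "E \<le> e'" using r t by (simp add: E_def e'_def)
  have EA: "E - A \<le> 4 * (r * e')"
  proof -
    \<comment> \<open>Multiplication by the conjugate: (1/2 - r - s) (1/2 - r + s) = r^2 and the
      second factor is at least 1/4, so the exponents differ by at most 4 r^2.\<close>
    have "(1/2 - r - s) * (1/4) \<le> (1/2 - r - s) * (1/2 - r + s)"
      using s_hi s_lo r by (intro mult_left_mono) auto
    also have "\<dots> = (1/2 - r) * (1/2 - r) - s * s" by (simp add: algebra_simps)
    also have "\<dots> = r * r" unfolding s2 by (simp add: algebra_simps)
    finally have d: "1/2 - r - s \<le> 4 * (r * r)" by simp
    have "A = E * exp (- ((1/2 - r - s) * t))" unfolding A_def E_def exp_add[symmetric] by (simp add: algebra_simps)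
    then have "E - A = E * (1 - exp (- ((1/2 - r - s) * t)))" by (simp add: algebra_simps)
    also have "\<dots> \<le> E * ((1/2 - r - s) * t)"
      using exp_ge_add_one_self[of "- ((1/2 - r - s) * t)"] pos by (intro mult_left_mono) auto
    also have "\<dots> \<le> E * (4 * (r * r) * t)" using d t pos by (intro mult_left_mono mult_right_mono) auto
    also have "\<dots> = 4 * r * (r * t * exp (- (r * t)))" by (simp add: E_def mult_ac)
    also have "\<dots> \<le> 4 * r * exp (- (r * t) / 2)"
      using r t by (intro mult_left_mono mult_exp_minus_le) auto
    finally show ?thesis by (simp add: e'_def)
  qed
  have s1: "1 / (2 * s) \<ge> 1" "1 / (2 * s) - 1 \<le> 8 * r" "1 / (2 * s) \<le> 2"
  proof -
    show "1 / (2 * s) \<ge> 1" using s_lo s_hi r by (simp add: field_simps)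
    show "1 / (2 * s) \<le> 2" using s_lo by (simp add: field_simps)
    \<comment> \<open>The same device for the amplitude: (1 - 2 s) (1 + 2 s) = 4 r.\<close>
    have "(1 - 2 * s) * 1 \<le> (1 - 2 * s) * (1 + 2 * s)" using s_lo s_hi r by (intro mult_left_mono) auto
    also have "\<dots> = 4 * r" using s2 by (simp add: algebra_simps)
    finally have a: "1 - 2 * s \<le> 4 * r" by simp
    have "1 / (2 * s) - 1 = (1 - 2 * s) * (1 / (2 * s))" using s_lo by (simp add: field_simps)
    also have "\<dots> \<le> (4 * r) * 2" using a s_lo s_hi r \<open>1 / (2 * s) \<le> 2\<close> by (intro mult_mono) auto
    finally show "1 / (2 * s) - 1 \<le> 8 * r" by simp
  qed
  have B: "B \<le> exp (- t / 8)"
  proof -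
    have "- (s + 1 / 2) * t \<le> (- 1/8) * t" using s_lo t by (intro mult_right_mono) auto
    then show ?thesis by (simp add: B_def)
  qed
  have rs: "r \<le> sqrt r"
    using r by (intro real_le_rsqrt) (auto simp: power2_eq_square intro: mult_left_le)
  then have rse: "r * e' \<le> sqrt r * e'" using pos by (intro mult_right_mono) auto
  \<comment> \<open>The 12 is 8 from the amplitude 1 / (2 s) - 1 plus 4 from the exponent; the 2
    bounds the amplitude 1 / (2 s) of the fast mode.\<close>
  have m1E: "\<bar>sol1 r t - E\<bar> \<le> 12 * (r * e') + 2 * exp (- t / 8)"
  proof -
    have "sol1 r t - E = A * (1 / (2 * s) - 1) + (A - E) - B * (1 / (2 * s))"
      unfolding m1 using s_lo by (simp add: field_simps)
    moreover have "A * (1 / (2 * s) - 1) \<le> e' * (8 * r)" "0 \<le> A * (1 / (2 * s) - 1)"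
      using AE Ee pos s1 r by (auto intro!: mult_mono simp del: divide_le_eq_1_pos le_divide_eq_1_pos)
    moreover have "B * (1 / (2 * s)) \<le> exp (- t / 8) * 2" "0 \<le> B * (1 / (2 * s))"
      using mult_mono[OF B s1(3)] pos s_lo by auto
    moreover have "0 \<le> r * e'" using r pos by simp
    ultimately show ?thesis using EA AE by (simp add: mult.commute)
  qed
  have m0E: "\<bar>sol0 r t - E\<bar> \<le> 8 * (r * e') + 2 * exp (- t / 8)"
  proof -
    have "sol0 r t - E = (A - E) / 2 + B / 2 + (sol1 r t - E) / 2"
    proof -
      have "sol0 r t = (A + B) / 2 + sol1 r t / 2" unfolding m0 m1 by simp
      then show ?thesis by (simp add: add_divide_distrib diff_divide_distrib)
    qed
    then have "\<bar>sol0 r t - E\<bar> \<le> \<bar>A - E\<bar> / 2 + B / 2 + \<bar>sol1 r t - E\<bar> / 2"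
      using pos abs_triangle_ineq[of "(A - E) / 2 + B / 2" "(sol1 r t - E) / 2"] abs_triangle_ineq[of "(A - E) / 2" "B / 2"]
      by simp
    moreover have "\<bar>A - E\<bar> \<le> 4 * (r * e')" using AE EA by simp
    moreover have "a \<le> 8 * y + 2 * x"
      if "a \<le> b / 2 + B / 2 + c / 2" "b \<le> 4 * y" "c \<le> 12 * y + 2 * x" "B \<le> x" "0 < x" for a b c x y
      using that by linarith
    ultimately show ?thesis using m1E B exp_gt_zero[of "- t / 8"] by blast
  qed
  have p: "exp (- t / 8) > 0" "0 \<le> r * e'" using r pos by simp_all
  have "8 * (r * e') + 2 * exp (- t / 8) \<le> 12 * (sqrt r * e' + exp (- t / 8))"
    "12 * (r * e') + 2 * exp (- t / 8) \<le> 12 * (sqrt r * e' + exp (- t / 8))"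
    unfolding distrib_left using p rse by linarith+
  then show "\<bar>sol0 r t - exp (- r * t)\<bar> \<le> 12 * (sqrt r * exp (- r * t / 2) + exp (- t / 8))"
    "\<bar>sol1 r t - exp (- r * t)\<bar> \<le> 12 * (sqrt r * exp (- r * t / 2) + exp (- t / 8))"
    using m0E m1E unfolding E_def[symmetric] e'_def[symmetric] by linarith+
qed

text \<open>No cancellation is used: for r >= 3/16 the multipliers and the heat factor are small
  separately. As q >= -1/16, the oscillators grow at most like t exp (t/4) against exp (-t/2), and
  absorbing the factor t leaves the rate 1/8.\<close>

lemma sol_diff_exp_high:
  assumes t: "t \<ge> 0" and r: "r \<ge> 3 / 16"
  shows "\<bar>sol0 r t - exp (- r * t)\<bar> \<le> 12 * (sqrt r * exp (- r * t / 2) + exp (- t / 8))"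
    and "\<bar>sol1 r t - exp (- r * t)\<bar> \<le> 12 * (sqrt r * exp (- r * t / 2) + exp (- t / 8))"
proof -
  define q where "q = r - 1 / 4"
  have s: "\<bar>osc_sin q t\<bar> \<le> t * exp (t / 4)" and c: "\<bar>osc_cos q t\<bar> \<le> exp (t / 4)"
  proof -
    have e1: "1 \<le> exp (t / 4)" using t by simp
    have te: "t \<le> t * exp (t / 4)" using mult_left_mono[OF e1 t] by simp
    consider "q > 0" | "q = 0" | "q < 0" by linarith
    then have "\<bar>osc_sin q t\<bar> \<le> t * exp (t / 4) \<and> \<bar>osc_cos q t\<bar> \<le> exp (t / 4)"
    proof cases
      case 1
      have "\<bar>sin (sqrt q * t)\<bar> \<le> sqrt q * t" using abs_sin_x_le_abs_x[of "sqrt q * t"] 1 t by (simp add: abs_mult)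
      then have "\<bar>osc_sin q t\<bar> \<le> t" using 1 by (simp add: osc_sin_def field_simps)
      moreover have "\<bar>osc_cos q t\<bar> \<le> 1" using 1 by (simp add: osc_cos_def)
      ultimately show ?thesis using te e1 by linarith
    next
      case 2
      then show ?thesis using te e1 t by (simp add: osc_sin_def osc_cos_def)
    next
      case 3
      define a where "a = sqrt (- q)"
      have a0: "a > 0" using 3 by (simp add: a_def)
      have a1: "a \<le> 1 / 4" unfolding a_def q_def using r
        by (intro real_le_lsqrt) (auto simp: power2_eq_square)
      note a = a0 a1
      have at: "exp (a * t) \<le> exp (t / 4)" using a t mult_right_mono[OF a(2) t] by simp
      have "sinh (a * t) / a \<le> (a * t * exp (a * t)) / a"
        using a t by (intro divide_right_mono sinh_le_exp) auto
      also have "\<dots> \<le> t * exp (t / 4)" using a t at by (simp add: mult_left_mono)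
      finally have "sinh (a * t) / a \<le> t * exp (t / 4)" .
      moreover have "0 \<le> sinh (a * t) / a" using a t by simp
      moreover have "cosh (a * t) \<le> exp (t / 4)"
        using order_trans[OF cosh_le_exp at] a t by simp
      moreover have "0 \<le> cosh (a * t)" by simp
      ultimately show ?thesis using 3 by (simp add: osc_sin_def osc_cos_def a_def)
    qed
    then show "\<bar>osc_sin q t\<bar> \<le> t * exp (t / 4)" "\<bar>osc_cos q t\<bar> \<le> exp (t / 4)" by auto
  qed
  have t8: "t \<le> 8 * exp (t / 8)" using exp_ge_add_one_self[of "t / 8"] by linarith
  have te: "exp (- t / 2) * (t * exp (t / 4)) \<le> 8 * exp (- t / 8)"
  proof -
    have "exp (- t / 2) * (t * exp (t / 4)) \<le> exp (- t / 2) * ((8 * exp (t / 8)) * exp (t / 4))"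
      using t8 by (intro mult_left_mono mult_right_mono) auto
    also have "\<dots> = 8 * exp (- t / 8)" by (simp flip: exp_add)
    finally show ?thesis .
  qed
  have ce: "exp (- t / 2) * exp (t / 4) \<le> exp (- t / 8)" using t by (simp flip: exp_add)
  have m1: "\<bar>sol1 r t\<bar> \<le> 8 * exp (- t / 8)"
    using order_trans[OF mult_left_mono[OF s, of "exp (- t / 2)"] te] by (simp add: sol1_def q_def abs_mult)
  have "\<bar>sol0 r t\<bar> \<le> exp (- t / 2) * (\<bar>osc_cos q t\<bar> + \<bar>osc_sin q t\<bar> / 2)"
    unfolding sol0_def q_def[symmetric] abs_mult by (simp add: mult_left_mono)
  also have "\<dots> \<le> exp (- t / 2) * (exp (t / 4) + t * exp (t / 4) / 2)"
    using s c by (intro mult_left_mono) auto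
  also have "\<dots> \<le> 5 * exp (- t / 8)" using ce te by (simp add: distrib_left)
  finally have m0: "\<bar>sol0 r t\<bar> \<le> 5 * exp (- t / 8)" .
  \<comment> \<open>Away from frequency 0 the weight sqrt r is bounded below, so the heat factor
    fits into the first term of the bound.\<close>
  have "1 \<le> 4 * sqrt r"
  proof -
    have "1 / 4 \<le> sqrt r" using r by (intro real_le_rsqrt) (simp add: power2_eq_square)
    then show ?thesis by simp
  qed
  moreover have "exp (- r * t) \<le> exp (- r * t / 2)" using r t by simp
  ultimately have E: "exp (- r * t) \<le> 4 * (sqrt r * exp (- r * t / 2))"
    using mult_mono[of 1 "4 * sqrt r" "exp (- r * t)" "exp (- r * t / 2)"] r by simp
  have p: "exp (- t / 8) > 0" "exp (- r * t) > 0" by simp_all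
  have a: "\<bar>sol0 r t - exp (- r * t)\<bar> \<le> \<bar>sol0 r t\<bar> + exp (- r * t)"
    "\<bar>sol1 r t - exp (- r * t)\<bar> \<le> \<bar>sol1 r t\<bar> + exp (- r * t)"
    using abs_triangle_ineq4[of "sol0 r t" "exp (- r * t)"] abs_triangle_ineq4[of "sol1 r t" "exp (- r * t)"] by simp_all
  show "\<bar>sol0 r t - exp (- r * t)\<bar> \<le> 12 * (sqrt r * exp (- r * t / 2) + exp (- t / 8))"
    "\<bar>sol1 r t - exp (- r * t)\<bar> \<le> 12 * (sqrt r * exp (- r * t / 2) + exp (- t / 8))"
    unfolding distrib_left using a m0 m1 E p by linarith+
qed

lemma sol_diff_exp:
  assumes "t \<ge> 0" "r \<ge> 0"
  shows "\<bar>sol0 r t - exp (- r * t)\<bar> \<le> 12 * (sqrt r * exp (- r * t / 2) + exp (- t / 8))"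
    and "\<bar>sol1 r t - exp (- r * t)\<bar> \<le> 12 * (sqrt r * exp (- r * t / 2) + exp (- t / 8))"
  using sol_diff_exp_low[OF assms(1), of r] sol_diff_exp_high[OF assms(1), of r] assms(2) by linarith+

section \<open>Borel representatives and the Sobolev space\<close>

text \<open>The data and solutions are Lebesgue measurable functions known up to null sets, whereas
  \<open>sq_int\<close> and the transform work with Borel functions; \<open>rep\<close> passes to an
  almost everywhere equal Borel function.\<close>

definition rep :: "('a::euclidean_space \<Rightarrow> real) \<Rightarrow> 'a \<Rightarrow> real" where
  "rep f = (SOME f'. f' \<in> borel_measurable borel \<and> (AE x in lborel. f x = f' x))"

lemma
  fixes f :: "'a::euclidean_space \<Rightarrow> real"
  assumes "f \<in> borel_measurable lebesgue"
  shows measurable_rep: "rep f \<in> borel_measurable borel" and AE_rep: "AE x in lborel. f x = rep f x"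
proof -
  have "\<exists>f'. f' \<in> borel_measurable borel \<and> (AE x in lborel. f x = f' x)"
    using completion_ex_borel_measurable_real[OF assms] by auto
  from someI_ex[OF this] show "rep f \<in> borel_measurable borel" "AE x in lborel. f x = rep f x"
    unfolding rep_def by auto
qed

lemma borel_imp_lebesgue: "f \<in> borel_measurable borel \<Longrightarrow> f \<in> borel_measurable lebesgue"
  by (simp add: measurable_completion)

lemma
  fixes f g :: "'a::euclidean_space \<Rightarrow> real"
  assumes f: "f \<in> borel_measurable lebesgue" and g: "g \<in> borel_measurable borel" and eq: "AE x in lborel. f x = g x"
  shows integral_lebesgue_eq: "integral\<^sup>L lebesgue f = integral\<^sup>L lborel g"
    and integrable_lebesgue_iff: "integrable lebesgue f \<longleftrightarrow> integrable lborel g"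
proof -
  have ae: "AE x in lebesgue. f x = g x" using eq by (rule AE_completion)
  have gl: "g \<in> borel_measurable lebesgue" by (rule borel_imp_lebesgue[OF g])
  show "integral\<^sup>L lebesgue f = integral\<^sup>L lborel g"
    using integral_cong_AE[OF f gl ae] integral_completion[of g lborel] g by simp
  show "integrable lebesgue f \<longleftrightarrow> integrable lborel g"
    using integrable_cong_AE[OF f gl ae] integrable_completion[of g lborel] g by simp
qed

lemma in_L2_measurable: "in_L2 f \<Longrightarrow> f \<in> borel_measurable lebesgue"
  by (simp add: in_L2_def)

lemma in_L2_iff_sq_int:
  fixes f :: "real ^ 'n \<Rightarrow> real"
  assumes f: "f \<in> borel_measurable lebesgue" and g: "g \<in> borel_measurable borel" and eq: "AE x in lborel. f x = g x"
  shows "in_L2 f \<longleftrightarrow> sq_int g" and "L2_nrm f = l2_norm g"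
proof -
  have *: "(\<lambda>x. (norm (f x))\<^sup>2) \<in> borel_measurable lebesgue" using f by measurable
  have **: "(\<lambda>x. (g x)\<^sup>2) \<in> borel_measurable borel" using g by measurable
  have ***: "AE x in lborel. (norm (f x))\<^sup>2 = (g x)\<^sup>2" using eq by eventually_elim simp
  show "in_L2 f \<longleftrightarrow> sq_int g"
    unfolding in_L2_def sq_int_def integrable_lebesgue_iff[OF * ** ***] using f g by simp
  show "L2_nrm f = l2_norm g"
    unfolding L2_nrm_def l2_norm_def integral_lebesgue_eq[OF * ** ***] ..
qed

lemma sq_int_rep: assumes "in_L2 f" shows "sq_int (rep f)"
  using in_L2_iff_sq_int(1)[OF in_L2_measurable measurable_rep AE_rep] in_L2_measurable assms by metis

lemma L2_nrm_rep: assumes "in_L2 f" shows "L2_nrm f = l2_norm (rep f)"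
  by (rule in_L2_iff_sq_int(2)[OF in_L2_measurable measurable_rep AE_rep]) (use in_L2_measurable[OF assms] assms in auto)

lemma sq_int_in_L2: "sq_int f \<Longrightarrow> in_L2 f" and L2_nrm_sq_int: "sq_int f \<Longrightarrow> L2_nrm f = l2_norm f"
  using in_L2_iff_sq_int[of f f] by (auto simp: borel_imp_lebesgue sq_int_measurable)

lemma integral_lebesgue_mult_test:
  fixes f :: "real ^ 'n \<Rightarrow> real"
  assumes "f \<in> borel_measurable lebesgue" "g \<in> borel_measurable borel" "AE x in lborel. f x = g x"
    and "h \<in> borel_measurable borel"
  shows "(LINT x|lebesgue. f x * h x) = l2_inner g h"
  unfolding l2_inner_def
proof (rule integral_lebesgue_eq)
  show "(\<lambda>x. f x * h x) \<in> borel_measurable lebesgue"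
    using assms(1) borel_imp_lebesgue[OF assms(4)] by measurable
  show "(\<lambda>x. g x * h x) \<in> borel_measurable borel" using assms(2,4) by measurable
  show "AE x in lborel. f x * h x = g x * h x" using assms(3) by eventually_elim simp
qed

lemma sq_int_reflect:
  fixes f :: "'a::euclidean_space \<Rightarrow> real"
  assumes "sq_int f" shows "sq_int (\<lambda>x. f (- x))"
proof -
  note [measurable] = sq_int_measurable[OF assms]
  have m: "(\<lambda>x. (f x)\<^sup>2) \<in> borel_measurable borel" by measurable
  have "(\<lambda>x. f (- x)) \<in> borel_measurable borel" by measurable
  then show ?thesis using integrable_lborel_reflect_iff[OF m, of 0] assms by (simp add: sq_int_def)
qed

lemma l2_inner_test_function:
  assumes f: "sq_int f" and \<phi>: "test_function UNIV \<phi>"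
  shows "l2_inner (l2_hartley f) (hartley \<phi>) = l2_inner f \<phi>" "l2_inner (l2_hartley f) \<phi> = l2_inner f (hartley \<phi>)"
proof -
  note P = test_function_integrable[OF \<phi>] test_function_sq_int[OF \<phi>]
  show "l2_inner (l2_hartley f) \<phi> = l2_inner f (hartley \<phi>)" by (rule l2_hartley_inner[OF f P])
  have "l2_inner (l2_hartley f) (hartley \<phi>) = l2_inner (l2_hartley (l2_hartley f)) \<phi>"
    by (rule l2_hartley_inner[OF sq_int_l2_hartley[OF f] P, symmetric])
  also have "\<dots> = l2_inner f \<phi>"
    using l2_hartley_involution[OF f] sq_int_measurable[OF f] sq_int_measurable[OF P(2)]
      sq_int_measurable[OF sq_int_l2_hartley[OF sq_int_l2_hartley[OF f]]]
    by (intro l2_inner_cong_AE) auto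
  finally show "l2_inner (l2_hartley f) (hartley \<phi>) = l2_inner f \<phi>" .
qed

section \<open>The weak gradient and the H1 norm on the frequency side\<close>

lemma axis_Basis: "(axis i 1 :: real ^ 'n) \<in> Basis"
  by (simp add: axis_in_Basis_iff)

lemma has_weak_gradient_iff:
  fixes f :: "real ^ 'n \<Rightarrow> real" and g :: "real ^ 'n \<Rightarrow> real ^ 'n"
  assumes f: "f \<in> borel_measurable lebesgue" "f' \<in> borel_measurable borel" "AE x in lborel. f x = f' x"
    and g: "\<And>i. (\<lambda>x. g x $ i) \<in> borel_measurable lebesgue" "\<And>i. g' i \<in> borel_measurable borel"
      "\<And>i. AE x in lborel. g x $ i = g' i x"
  shows "has_weak_gradient f g \<longleftrightarrow>
    (\<forall>\<phi>. test_function UNIV \<phi> \<longrightarrow> (\<forall>i. l2_inner f' (pd (axis i 1) \<phi>) = - l2_inner (g' i) \<phi>))"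
proof -
  have "(LINT x|lebesgue. f x * pd (axis i 1) \<phi> x) = l2_inner f' (pd (axis i 1) \<phi>)"
    "(LINT x|lebesgue. g x $ i * \<phi> x) = l2_inner (g' i) \<phi>" if "test_function UNIV \<phi>" for i and \<phi> :: "real ^ 'n \<Rightarrow> real"
    using test_function_pd[OF that axis_Basis[of i]] that
    by (auto intro!: integral_lebesgue_mult_test f g smooth_borel test_function_smooth)
  then show ?thesis unfolding has_weak_gradient_def by auto
qed

lemma sq_int_coordinate_mult:
  fixes V :: "real ^ 'n \<Rightarrow> real"
  assumes V: "V \<in> borel_measurable borel" "sq_int (\<lambda>\<xi>. norm \<xi> * V \<xi>)"
  shows "sq_int (\<lambda>\<xi>. \<xi> $ i * V \<xi>)"
proof (rule sq_int_bound[OF V(2)])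
  show "(\<lambda>\<xi>. \<xi> $ i * V \<xi>) \<in> borel_measurable borel" using V(1) by measurable
  show "AE \<xi> in lborel. \<bar>\<xi> $ i * V \<xi>\<bar> \<le> \<bar>norm \<xi> * V \<xi>\<bar>"
    by (auto simp: abs_mult intro!: mult_right_mono component_le_norm_cart)
qed

lemma hartley_pd_axis:
  fixes \<phi> :: "real ^ 'n \<Rightarrow> real"
  assumes "test_function UNIV \<phi>"
  shows "hartley (pd (axis i 1) \<phi>) \<xi> = - (\<xi> $ i) * hartley \<phi> (- \<xi>)"
  using hartley_pd[OF assms axis_Basis] by (simp add: inner_axis)

text \<open>The difference \<open>V\<close> of the two sides pairs to zero with the transforms of
  test functions. Because of the factor xi_i it is known to be square integrable only after division
  by 1 + |xi|^2, which is the growth that \<open>test_functions_total\<close> admits.\<close>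

lemma weak_gradient_hartley:
  fixes f :: "real ^ 'n \<Rightarrow> real"
  assumes f: "sq_int f" and g: "sq_int g"
    and eq: "\<And>\<phi>. test_function UNIV \<phi> \<Longrightarrow> l2_inner f (pd (axis i 1) \<phi>) = - l2_inner g \<phi>"
  shows "AE \<xi> in lborel. l2_hartley g \<xi> = - (\<xi> $ i) * l2_hartley f (- \<xi>)"
proof -
  note Tf = sq_int_l2_hartley[OF f] and Tg = sq_int_l2_hartley[OF g]
  note [measurable] = sq_int_measurable[OF Tf] sq_int_measurable[OF Tg]
  define V where "V \<xi> = l2_hartley g \<xi> + \<xi> $ i * l2_hartley f (- \<xi>)" for \<xi>
  have one: "1 + (norm \<xi>)\<^sup>2 > 0" for \<xi> :: "real ^ 'n" by (simp add: add_pos_nonneg)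
  have "AE \<xi> in lborel. V \<xi> = 0"
  proof (rule test_functions_total)
    show "V \<in> borel_measurable borel" unfolding V_def by measurable
    have "sq_int (\<lambda>\<xi>. (1 / (1 + (norm \<xi>)\<^sup>2)) * l2_hartley g \<xi> + (\<xi> $ i / (1 + (norm \<xi>)\<^sup>2)) * l2_hartley f (- \<xi>))"
    proof (intro sq_int_add sq_int_mult_bounded[OF Tg, of _ 1] sq_int_mult_bounded[OF sq_int_reflect[OF Tf], of _ 1])
      fix \<xi> :: "real ^ 'n"
      show "\<bar>1 / (1 + (norm \<xi>)\<^sup>2)\<bar> \<le> 1" using one[of \<xi>] by (simp add: divide_le_eq_1)
      have "\<bar>\<xi> $ i\<bar> \<le> norm \<xi>" by (rule component_le_norm_cart)
      also have "norm \<xi> \<le> 1 + (norm \<xi>)\<^sup>2" using sum_squares_bound[of "norm \<xi>" 1] norm_ge_zero[of \<xi>] by (simp, linarith)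
      finally show "\<bar>\<xi> $ i / (1 + (norm \<xi>)\<^sup>2)\<bar> \<le> 1" using one[of \<xi>] by (simp add: divide_le_eq_1)
    qed measurable
    then show "sq_int (\<lambda>\<xi>. V \<xi> / (1 + (norm \<xi>)\<^sup>2))" by (simp add: V_def add_divide_distrib)
    fix \<phi> :: "real ^ 'n \<Rightarrow> real" assume \<phi>: "test_function UNIV \<phi>"
    note P = test_function_pd[OF \<phi> axis_Basis[of i]]
    have H\<phi>: "sq_int (hartley \<phi>)" "sq_int (hartley (pd (axis i 1) \<phi>))"
      using \<phi> P by (auto intro: hartley_contraction test_function_integrable test_function_sq_int)
    note [measurable] = sq_int_measurable[OF H\<phi>(1)]
    \<comment> \<open>The substitution xi -> -xi in the integral of \<open>h\<close> moves the
      reflection from the derivative of the test function onto the transform of \<open>f\<close>,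
      where \<open>V\<close> has it.\<close>
    define h where "h \<xi> = l2_hartley f \<xi> * hartley (pd (axis i 1) \<phi>) \<xi>" for \<xi>
    have h_m: "h \<in> borel_measurable borel" unfolding h_def using sq_int_measurable[OF H\<phi>(2)] by measurable
    have h_int: "integrable lborel h" unfolding h_def by (rule sq_int_mult_integrable[OF Tf H\<phi>(2)])
    have h_neg: "h (- \<xi>) = \<xi> $ i * l2_hartley f (- \<xi>) * hartley \<phi> \<xi>" for \<xi>
      by (simp add: h_def hartley_pd_axis[OF \<phi>])
    have "l2_inner V (hartley \<phi>) = (LINT \<xi>|lborel. l2_hartley g \<xi> * hartley \<phi> \<xi> + h (0 - \<xi>))"
      by (simp add: l2_inner_def V_def h_neg distrib_right)
    also have "\<dots> = l2_inner (l2_hartley g) (hartley \<phi>) + integral\<^sup>L lborel h"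
      using sq_int_mult_integrable[OF Tg H\<phi>(1)] integrable_lborel_reflect_iff[OF h_m, of 0] h_int
        integral_lborel_reflect[OF h_m, of 0] by (simp add: l2_inner_def)
    also have "\<dots> = l2_inner g \<phi> + l2_inner f (pd (axis i 1) \<phi>)"
      using l2_inner_test_function(1)[OF g \<phi>] l2_inner_test_function(1)[OF f P]
      by (simp add: h_def[abs_def] l2_inner_def)
    finally show "l2_inner V (hartley \<phi>) = 0" using eq[OF \<phi>] by simp
  qed
  then show ?thesis by eventually_elim (simp add: V_def)
qed

lemma norm_power2_cart: "(norm (x :: real ^ 'n))\<^sup>2 = (\<Sum>i\<in>UNIV. (x $ i)\<^sup>2)"
  by (simp add: norm_vec_def L2_set_def sum_nonneg)

lemma weak_gradient_components:
  fixes g :: "real ^ 'n \<Rightarrow> real ^ 'n"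
  assumes "in_L2 g"
  shows "in_L2 (\<lambda>x. g x $ i)"
    and "(L2_nrm g)\<^sup>2 = (\<Sum>i\<in>UNIV. (L2_nrm (\<lambda>x. g x $ i))\<^sup>2)"
proof -
  have g: "g \<in> borel_measurable lebesgue" "integrable lebesgue (\<lambda>x. (norm (g x))\<^sup>2)"
    using assms by (auto simp: in_L2_def)
  have m: "(\<lambda>x. g x $ i) \<in> borel_measurable lebesgue" for i
    using g(1) by (rule measurable_compose) simp
  have i: "integrable lebesgue (\<lambda>x. (g x $ i)\<^sup>2)" for i
  proof (rule Bochner_Integration.integrable_bound[OF g(2)])
    show "(\<lambda>x. (g x $ i)\<^sup>2) \<in> borel_measurable lebesgue" using m by measurable
    show "AE x in lebesgue. norm ((g x $ i)\<^sup>2) \<le> norm ((norm (g x))\<^sup>2)"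
      by (simp add: abs_le_square_iff[symmetric] component_le_norm_cart)
  qed
  show "in_L2 (\<lambda>x. g x $ i)" using m i by (simp add: in_L2_def)
  have "(L2_nrm g)\<^sup>2 = (LINT x|lebesgue. (norm (g x))\<^sup>2)"
    by (simp add: L2_nrm_def integral_nonneg_AE)
  also have "\<dots> = (LINT x|lebesgue. (\<Sum>i\<in>UNIV. (g x $ i)\<^sup>2))"
    by (simp add: norm_power2_cart)
  also have "\<dots> = (\<Sum>i\<in>UNIV. (LINT x|lebesgue. (g x $ i)\<^sup>2))" using i by simp
  also have "\<dots> = (\<Sum>i\<in>UNIV. (L2_nrm (\<lambda>x. g x $ i))\<^sup>2)"
    by (simp add: L2_nrm_def integral_nonneg_AE)
  finally show "(L2_nrm g)\<^sup>2 = (\<Sum>i\<in>UNIV. (L2_nrm (\<lambda>x. g x $ i))\<^sup>2)" .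
qed

text \<open>Reflection preserves L2 norms, and the squared coordinates add up to |xi|^2. The
  right-hand side does not mention \<open>g\<close>, so every weak gradient has this norm and the
  choice made in \<open>weak_gradient\<close> is harmless.\<close>

lemma weak_gradient_norm:
  fixes f :: "real ^ 'n \<Rightarrow> real" and g :: "real ^ 'n \<Rightarrow> real ^ 'n"
  assumes f: "in_L2 f" and g: "in_L2 g" and fg: "has_weak_gradient f g"
    and f': "f' \<in> borel_measurable borel" "AE x in lborel. f x = f' x"
  shows "sq_int (\<lambda>\<xi>. norm \<xi> * l2_hartley f' \<xi>)"
    and "L2_nrm g = l2_norm (\<lambda>\<xi>. norm \<xi> * l2_hartley f' \<xi>)"
proof -
  have sf: "sq_int f'" using in_L2_iff_sq_int(1)[OF in_L2_measurable[OF f] f'] f by simp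
  note gi = weak_gradient_components(1)[OF g]
  note gim = in_L2_measurable[OF gi]
  have sg: "sq_int (rep (\<lambda>x. g x $ i))" for i by (rule sq_int_rep[OF gi])
  have eq: "l2_inner f' (pd (axis i 1) \<phi>) = - l2_inner (rep (\<lambda>x. g x $ i)) \<phi>" if "test_function UNIV \<phi>" for \<phi> i
    using fg that
    unfolding has_weak_gradient_iff[OF in_L2_measurable[OF f] f' gim measurable_rep[OF gim] AE_rep[OF gim]] by blast
  have T: "AE \<xi> in lborel. l2_hartley (rep (\<lambda>x. g x $ i)) \<xi> = - (\<xi> $ i) * l2_hartley f' (- \<xi>)" for i
    by (rule weak_gradient_hartley[OF sf sg eq])
  note Tf = sq_int_l2_hartley[OF sf]
  note [measurable] = sq_int_measurable[OF Tf]
  have m: "(\<lambda>\<xi>. (\<xi> $ i * l2_hartley f' \<xi>)\<^sup>2) \<in> borel_measurable borel" for i by measurable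
  have sq: "integrable lborel (\<lambda>\<xi>. (\<xi> $ i * l2_hartley f' \<xi>)\<^sup>2)"
    "(LINT \<xi>|lborel. (\<xi> $ i * l2_hartley f' \<xi>)\<^sup>2) = (L2_nrm (\<lambda>x. g x $ i))\<^sup>2" for i
  proof -
    note Tg = sq_int_l2_hartley[OF sg, of i]
    have m2: "(\<lambda>\<xi>. - (\<xi> $ i) * l2_hartley f' (- \<xi>)) \<in> borel_measurable borel" by measurable
    have "sq_int (\<lambda>\<xi>. - (\<xi> $ i) * l2_hartley f' (- \<xi>))"
      using T[of i] by (intro sq_int_cong_AE[OF Tg m2]) auto
    then show "integrable lborel (\<lambda>\<xi>. (\<xi> $ i * l2_hartley f' \<xi>)\<^sup>2)"
      using integrable_lborel_reflect_iff[OF m, of 0 i] by (simp add: sq_int_def)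
    have "(L2_nrm (\<lambda>x. g x $ i))\<^sup>2 = (l2_norm (l2_hartley (rep (\<lambda>x. g x $ i))))\<^sup>2"
      by (simp add: L2_nrm_rep[OF gi] l2_norm_l2_hartley[OF sg])
    also have "\<dots> = (l2_norm (\<lambda>\<xi>. - (\<xi> $ i) * l2_hartley f' (- \<xi>)))\<^sup>2"
      using l2_norm_cong_AE[OF sq_int_measurable[OF Tg] m2 T] by simp
    also have "\<dots> = (LINT \<xi>|lborel. (\<xi> $ i * l2_hartley f' \<xi>)\<^sup>2)"
      unfolding l2_norm_power2 using integral_lborel_reflect[OF m, of 0 i] by simp
    finally show "(LINT \<xi>|lborel. (\<xi> $ i * l2_hartley f' \<xi>)\<^sup>2) = (L2_nrm (\<lambda>x. g x $ i))\<^sup>2" ..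
  qed
  have sum: "(norm \<xi> * l2_hartley f' \<xi>)\<^sup>2 = (\<Sum>i\<in>UNIV. (\<xi> $ i * l2_hartley f' \<xi>)\<^sup>2)" for \<xi>
    unfolding power_mult_distrib norm_power2_cart sum_distrib_right ..
  show "sq_int (\<lambda>\<xi>. norm \<xi> * l2_hartley f' \<xi>)"
    unfolding sq_int_def sum using sq(1) by auto
  have "(L2_nrm g)\<^sup>2 = (l2_norm (\<lambda>\<xi>. norm \<xi> * l2_hartley f' \<xi>))\<^sup>2"
    unfolding weak_gradient_components(2)[OF g] l2_norm_power2 sum using sq by simp
  moreover have "L2_nrm g \<ge> 0" by (simp add: L2_nrm_def integral_nonneg_AE)
  ultimately show "L2_nrm g = l2_norm (\<lambda>\<xi>. norm \<xi> * l2_hartley f' \<xi>)" by simp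
qed

lemma in_H1_hartley:
  fixes f :: "real ^ 'n \<Rightarrow> real"
  assumes f: "in_H1 f" and f': "f' \<in> borel_measurable borel" "AE x in lborel. f x = f' x"
  shows "sq_int f'" "sq_int (\<lambda>\<xi>. norm \<xi> * l2_hartley f' \<xi>)"
    and "(H1_nrm f)\<^sup>2 = (l2_norm f')\<^sup>2 + (l2_norm (\<lambda>\<xi>. norm \<xi> * l2_hartley f' \<xi>))\<^sup>2"
proof -
  have f2: "in_L2 f" using f by (simp add: in_H1_def)
  have "\<exists>g. in_L2 g \<and> has_weak_gradient f g" using f by (simp add: in_H1_def)
  from someI_ex[OF this] have "in_L2 (weak_gradient f) \<and> has_weak_gradient f (weak_gradient f)"
    unfolding weak_gradient_def .
  then have g: "in_L2 (weak_gradient f)" "has_weak_gradient f (weak_gradient f)" by auto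
  show "sq_int f'" using in_L2_iff_sq_int(1)[OF in_L2_measurable[OF f2] f'] f2 by simp
  show "sq_int (\<lambda>\<xi>. norm \<xi> * l2_hartley f' \<xi>)" by (rule weak_gradient_norm(1)[OF f2 g f'])
  show "(H1_nrm f)\<^sup>2 = (l2_norm f')\<^sup>2 + (l2_norm (\<lambda>\<xi>. norm \<xi> * l2_hartley f' \<xi>))\<^sup>2"
    using in_L2_iff_sq_int(2)[OF in_L2_measurable[OF f2] f'] weak_gradient_norm(2)[OF f2 g f']
    by (simp add: H1_nrm_def)
qed

text \<open>The converse direction, for the constructed solution. The gradient is built coordinate
  by coordinate as the transform of -xi_i V(-xi), the only candidate by
  \<open>weak_gradient_hartley\<close>.\<close>

lemma in_H1I:
  fixes V :: "real ^ 'n \<Rightarrow> real"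
  assumes V: "sq_int V" "sq_int (\<lambda>\<xi>. norm \<xi> * V \<xi>)"
    and f: "f \<in> borel_measurable borel" "AE x in lborel. f x = l2_hartley V x"
  shows "in_H1 f"
    and "(H1_nrm f)\<^sup>2 = (l2_norm V)\<^sup>2 + (l2_norm (\<lambda>\<xi>. norm \<xi> * V \<xi>))\<^sup>2"
proof -
  note TV = sq_int_l2_hartley[OF V(1)]
  have fs: "sq_int f" by (rule sq_int_cong_AE[OF TV f])
  define G where "G i = l2_hartley (\<lambda>\<xi>. - (\<xi> $ i) * V (- \<xi>))" for i
  have Vi: "sq_int (\<lambda>\<xi>. - (\<xi> $ i) * V (- \<xi>))" for i
    using sq_int_reflect[OF sq_int_coordinate_mult[OF sq_int_measurable[OF V(1)] V(2), of i]] by simp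
  have G: "sq_int (G i)" for i unfolding G_def by (rule sq_int_l2_hartley[OF Vi])
  define g where "g x = (\<chi> i. G i x)" for x
  have gm: "g \<in> borel_measurable borel"
  proof -
    have "(\<lambda>x. \<Sum>i\<in>UNIV. G i x *\<^sub>R (axis i 1 :: real ^ 'n)) \<in> borel_measurable borel"
      by (intro borel_measurable_sum borel_measurable_scaleR borel_measurable_const sq_int_measurable[OF G])
    moreover have "g = (\<lambda>x. \<Sum>i\<in>UNIV. G i x *\<^sub>R (axis i 1 :: real ^ 'n))"
      by (auto simp: g_def fun_eq_iff vec_eq_iff axis_def if_distrib cong: if_cong)
    ultimately show ?thesis by simp
  qed
  have g2: "in_L2 g"
  proof -
    have "(\<lambda>x. (norm (g x))\<^sup>2) = (\<lambda>x. \<Sum>i\<in>UNIV. (G i x)\<^sup>2)"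
      by (simp add: g_def norm_power2_cart)
    moreover have "integrable lborel (\<lambda>x. \<Sum>i\<in>UNIV. (G i x)\<^sup>2)"
      using sq_int_integrable[OF G] by auto
    ultimately have "integrable lborel (\<lambda>x. (norm (g x))\<^sup>2)" by simp
    then have "integrable lebesgue (\<lambda>x. (norm (g x))\<^sup>2)"
      using integrable_completion[of "\<lambda>x. (norm (g x))\<^sup>2" lborel] gm by simp
    then show ?thesis using gm by (simp add: in_L2_def measurable_completion)
  qed
  have "has_weak_gradient f g"
  proof (subst has_weak_gradient_iff[where f'=f and g'=G])
    show "\<forall>\<phi>. test_function UNIV \<phi> \<longrightarrow> (\<forall>i. l2_inner f (pd (axis i 1) \<phi>) = - l2_inner (G i) \<phi>)"
    proof (intro allI impI)
      fix \<phi> :: "real ^ 'n \<Rightarrow> real" and i assume \<phi>: "test_function UNIV \<phi>"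
      note P = test_function_pd[OF \<phi> axis_Basis[of i]]
      have H\<phi>: "sq_int (hartley (pd (axis i 1) \<phi>))"
        using P by (auto intro: hartley_contraction test_function_integrable test_function_sq_int)
      have m: "(\<lambda>\<xi>. V \<xi> * hartley (pd (axis i 1) \<phi>) \<xi>) \<in> borel_measurable borel"
        using sq_int_measurable[OF V(1)] sq_int_measurable[OF H\<phi>] by measurable
      have "l2_inner f (pd (axis i 1) \<phi>) = l2_inner (l2_hartley V) (pd (axis i 1) \<phi>)"
        using f sq_int_measurable[OF TV] sq_int_measurable[OF test_function_sq_int[OF P]]
        by (intro l2_inner_cong_AE) auto
      also have "\<dots> = l2_inner V (hartley (pd (axis i 1) \<phi>))" by (rule l2_inner_test_function(2)[OF V(1) P])
      also have "\<dots> = (LINT \<xi>|lborel. V (- \<xi>) * hartley (pd (axis i 1) \<phi>) (- \<xi>))"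
        using integral_lborel_reflect[OF m, of 0] by (simp add: l2_inner_def)
      also have "\<dots> = (LINT \<xi>|lborel. - ((- (\<xi> $ i) * V (- \<xi>)) * hartley \<phi> \<xi>))"
        by (simp add: hartley_pd_axis[OF \<phi>] mult_ac)
      also have "\<dots> = - l2_inner (\<lambda>\<xi>. - (\<xi> $ i) * V (- \<xi>)) (hartley \<phi>)"
        by (simp only: integral_minus l2_inner_def)
      also have "\<dots> = - l2_inner (G i) \<phi>"
        unfolding G_def by (simp only: l2_inner_test_function(2)[OF Vi \<phi>])
      finally show "l2_inner f (pd (axis i 1) \<phi>) = - l2_inner (G i) \<phi>" .
    qed
  qed (use f fs sq_int_measurable[OF G] in \<open>auto simp: g_def borel_imp_lebesgue\<close>)
  then show H1: "in_H1 f" using g2 sq_int_in_L2[OF fs] by (auto simp: in_H1_def)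
  have "AE \<xi> in lborel. l2_hartley f \<xi> = V \<xi>"
    using l2_hartley_involution[OF V(1)] l2_hartley_cong_AE[OF f(1) sq_int_measurable[OF TV] f(2)] by simp
  then have "AE \<xi> in lborel. norm \<xi> * l2_hartley f \<xi> = norm \<xi> * V \<xi>" by eventually_elim simp
  then have "l2_norm (\<lambda>\<xi>. norm \<xi> * l2_hartley f \<xi>) = l2_norm (\<lambda>\<xi>. norm \<xi> * V \<xi>)"
    using sq_int_measurable[OF in_H1_hartley(2)[OF H1 f(1)]] sq_int_measurable[OF V(2)] by (intro l2_norm_cong_AE) auto
  moreover have "l2_norm f = l2_norm V"
    using l2_norm_cong_AE[OF f(1) sq_int_measurable[OF TV] f(2)] l2_norm_l2_hartley[OF V(1)] by simp
  ultimately show "(H1_nrm f)\<^sup>2 = (l2_norm V)\<^sup>2 + (l2_norm (\<lambda>\<xi>. norm \<xi> * V \<xi>))\<^sup>2"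
    using in_H1_hartley(3)[OF H1 f(1)] by simp
qed

section \<open>Existence\<close>

definition wave_hat :: "('a::euclidean_space \<Rightarrow> real) \<Rightarrow> ('a \<Rightarrow> real) \<Rightarrow> real \<Rightarrow> 'a \<Rightarrow> real" where
  "wave_hat a b t \<xi> = sol0 ((norm \<xi>)\<^sup>2) t * a \<xi> + sol1 ((norm \<xi>)\<^sup>2) t * b \<xi>"

definition wave_hat' :: "('a::euclidean_space \<Rightarrow> real) \<Rightarrow> ('a \<Rightarrow> real) \<Rightarrow> real \<Rightarrow> 'a \<Rightarrow> real" where
  "wave_hat' a b t \<xi> = - (norm \<xi>)\<^sup>2 * sol1 ((norm \<xi>)\<^sup>2) t * a \<xi>
     + (sol0 ((norm \<xi>)\<^sup>2) t - sol1 ((norm \<xi>)\<^sup>2) t) * b \<xi>"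

text \<open>A majorant uniform in time. Only \<open>a\<close> carries the weight 1 + |xi|, matching
  data in H1 and L2: since |xi| |sol1| <= 1, the evolution gives \<open>b\<close> one derivative for
  free.\<close>

definition wave_bound :: "('a::euclidean_space \<Rightarrow> real) \<Rightarrow> ('a \<Rightarrow> real) \<Rightarrow> 'a \<Rightarrow> real" where
  "wave_bound a b \<xi> = (1 + norm \<xi>) * \<bar>a \<xi>\<bar> + 2 * \<bar>b \<xi>\<bar>"

lemma wave_hat_deriv: "((\<lambda>t. wave_hat a b t \<xi>) has_real_derivative wave_hat' a b t \<xi>) (at t)"
  unfolding wave_hat_def wave_hat'_def
  by (auto intro!: derivative_eq_intros sol0_deriv sol1_deriv simp: algebra_simps)

lemma wave_hat'_deriv:
  "((\<lambda>t. wave_hat' a b t \<xi>) has_real_derivative - (norm \<xi>)\<^sup>2 * wave_hat a b t \<xi> - wave_hat' a b t \<xi>) (at t)"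
  unfolding wave_hat_def wave_hat'_def
  by (auto intro!: derivative_eq_intros sol0_deriv sol1_deriv simp: algebra_simps)

lemma wave_hat_0: "wave_hat a b 0 = a" "wave_hat' a b 0 = b"
  by (simp_all add: wave_hat_def wave_hat'_def fun_eq_iff)

lemma measurable_wave_hat:
  assumes [measurable]: "a \<in> borel_measurable borel" "b \<in> borel_measurable borel"
  shows "(\<lambda>(t, \<xi>). wave_hat a b t \<xi>) \<in> borel_measurable (borel \<Otimes>\<^sub>M borel)"
    and "wave_hat a b t \<in> borel_measurable borel" "wave_hat' a b t \<in> borel_measurable borel"
  unfolding wave_hat_def wave_hat'_def by measurable

text \<open>In \<open>wave_hat'\<close> the symbol |xi|^2 sol1 is split as |xi| (|xi| sol1): one
  weight goes to \<open>a\<close>, the other is absorbed by the energy bound.\<close>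

lemma wave_hat_le:
  assumes t: "t \<ge> 0"
  shows "(1 + norm \<xi>) * \<bar>wave_hat a b t \<xi>\<bar> \<le> wave_bound a b \<xi>" "\<bar>wave_hat a b t \<xi>\<bar> \<le> wave_bound a b \<xi>"
    "norm \<xi> * \<bar>wave_hat a b t \<xi>\<bar> \<le> wave_bound a b \<xi>" "\<bar>wave_hat' a b t \<xi>\<bar> \<le> wave_bound a b \<xi>"
proof -
  define s0 where "s0 = sol0 ((norm \<xi>)\<^sup>2) t"
  define s1 where "s1 = sol1 ((norm \<xi>)\<^sup>2) t"
  have b: "\<bar>s0\<bar> \<le> 1" "\<bar>s1\<bar> \<le> 1" "norm \<xi> * \<bar>s1\<bar> \<le> 1"
    using abs_sol0_le[OF t, of "(norm \<xi>)\<^sup>2"] abs_sol1_le[OF t, of "(norm \<xi>)\<^sup>2"] sqrt_sol1_le[OF t, of "(norm \<xi>)\<^sup>2"]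
    by (simp_all add: s0_def s1_def)
  have "(1 + norm \<xi>) * \<bar>wave_hat a b t \<xi>\<bar> \<le> (1 + norm \<xi>) * (\<bar>s0\<bar> * \<bar>a \<xi>\<bar> + \<bar>s1\<bar> * \<bar>b \<xi>\<bar>)"
    unfolding wave_hat_def s0_def[symmetric] s1_def[symmetric]
    by (intro mult_left_mono order_trans[OF abs_triangle_ineq]) (auto simp: abs_mult)
  also have "\<dots> = (1 + norm \<xi>) * (\<bar>s0\<bar> * \<bar>a \<xi>\<bar>) + (\<bar>s1\<bar> + norm \<xi> * \<bar>s1\<bar>) * \<bar>b \<xi>\<bar>" by (simp add: algebra_simps)
  also have "\<dots> \<le> (1 + norm \<xi>) * (1 * \<bar>a \<xi>\<bar>) + (1 + 1) * \<bar>b \<xi>\<bar>"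
    using b by (intro add_mono mult_left_mono mult_right_mono) auto
  finally show 1: "(1 + norm \<xi>) * \<bar>wave_hat a b t \<xi>\<bar> \<le> wave_bound a b \<xi>" by (simp add: wave_bound_def)
  have "1 * \<bar>wave_hat a b t \<xi>\<bar> \<le> (1 + norm \<xi>) * \<bar>wave_hat a b t \<xi>\<bar>" by (intro mult_right_mono) auto
  with 1 show "\<bar>wave_hat a b t \<xi>\<bar> \<le> wave_bound a b \<xi>" by linarith
  have "norm \<xi> * \<bar>wave_hat a b t \<xi>\<bar> \<le> (1 + norm \<xi>) * \<bar>wave_hat a b t \<xi>\<bar>" by (intro mult_right_mono) auto
  with 1 show "norm \<xi> * \<bar>wave_hat a b t \<xi>\<bar> \<le> wave_bound a b \<xi>" by linarith
  have "\<bar>wave_hat' a b t \<xi>\<bar> \<le> \<bar>- (norm \<xi>)\<^sup>2 * s1 * a \<xi>\<bar> + \<bar>(s0 - s1) * b \<xi>\<bar>"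
    unfolding wave_hat'_def s0_def[symmetric] s1_def[symmetric] by (rule abs_triangle_ineq)
  also have "\<dots> = norm \<xi> * (norm \<xi> * \<bar>s1\<bar>) * \<bar>a \<xi>\<bar> + \<bar>s0 - s1\<bar> * \<bar>b \<xi>\<bar>"
    by (simp add: abs_mult power2_eq_square)
  also have "\<dots> \<le> norm \<xi> * 1 * \<bar>a \<xi>\<bar> + 2 * \<bar>b \<xi>\<bar>"
    using b by (intro add_mono mult_right_mono mult_left_mono) auto
  also have "\<dots> \<le> wave_bound a b \<xi>" by (simp add: wave_bound_def mult_right_mono)
  finally show "\<bar>wave_hat' a b t \<xi>\<bar> \<le> wave_bound a b \<xi>" .
qed

lemma wave_bound_nonneg: "0 \<le> wave_bound a b \<xi>"
  by (simp add: wave_bound_def)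

section \<open>Time regularity of the constructed solution\<close>

text \<open>Dominated convergence along sequences. The point s = t is exempted so that difference
  quotients qualify, whose value there is an artefact of division by zero.\<close>

lemma l2_norm_dominated_tendsto:
  fixes F :: "real \<Rightarrow> 'a::euclidean_space \<Rightarrow> real"
  assumes D: "sq_int D" and m: "\<And>s. s \<in> S \<Longrightarrow> s \<noteq> t \<Longrightarrow> F s \<in> borel_measurable borel"
    and le: "\<And>s x. s \<in> S \<Longrightarrow> s \<noteq> t \<Longrightarrow> \<bar>F s x\<bar> \<le> D x"
    and lim: "\<And>x. ((\<lambda>s. F s x) \<longlongrightarrow> 0) (at t within S)"
  shows "((\<lambda>s. l2_norm (F s)) \<longlongrightarrow> 0) (at t within S)"
  unfolding tendsto_at_iff_sequentially
proof (intro allI impI)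
  fix X :: "nat \<Rightarrow> real" assume X: "\<forall>i. X i \<in> S - {t}" "X \<longlonglongrightarrow> t"
  have "(\<lambda>i. LINT x|lborel. (F (X i) x)\<^sup>2) \<longlonglongrightarrow> (LINT x|(lborel :: 'a measure). 0)"
  proof (rule integral_dominated_convergence[where w="\<lambda>x. (D x)\<^sup>2"])
    show "integrable lborel (\<lambda>x. (D x)\<^sup>2)" using D by (simp add: sq_int_def)
    show "(\<lambda>x. (F (X i) x)\<^sup>2) \<in> borel_measurable lborel" for i using m[of "X i"] X(1) by auto
    show "AE x in lborel. (\<lambda>i. (F (X i) x)\<^sup>2) \<longlonglongrightarrow> 0"
    proof (rule AE_I2)
      fix x
      have "(\<lambda>i. F (X i) x) \<longlonglongrightarrow> 0"
        using lim[of x, unfolded tendsto_at_iff_sequentially, rule_format, of X] X by (simp add: comp_def)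
      from tendsto_power[OF this, of 2] show "(\<lambda>i. (F (X i) x)\<^sup>2) \<longlonglongrightarrow> 0" by simp
    qed
    show "AE x in lborel. norm ((F (X i) x)\<^sup>2) \<le> (D x)\<^sup>2" for i
      using le[of "X i"] X(1) by (auto simp: abs_le_square_iff[symmetric] intro: order_trans[OF _ abs_ge_self])
  qed auto
  from tendsto_real_sqrt[OF this] show "((\<lambda>s. l2_norm (F s)) \<circ> X) \<longlonglongrightarrow> 0"
    by (simp add: l2_norm_def comp_def)
qed

lemma sq_int_le: "sq_int D \<Longrightarrow> f \<in> borel_measurable borel \<Longrightarrow> (\<And>x. \<bar>f x\<bar> \<le> D x) \<Longrightarrow> sq_int f"
  by (rule sq_int_bound[of D]) (auto intro: order_trans[OF _ abs_ge_self])

lemma sq_int_wave: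
  fixes a b :: "'a::euclidean_space \<Rightarrow> real"
  assumes a: "sq_int a" "sq_int (\<lambda>\<xi>. norm \<xi> * a \<xi>)" and b: "sq_int b"
  shows "sq_int (wave_bound a b)"
    and "t \<ge> 0 \<Longrightarrow> sq_int (wave_hat a b t)" "t \<ge> 0 \<Longrightarrow> sq_int (\<lambda>\<xi>. norm \<xi> * wave_hat a b t \<xi>)"
      "t \<ge> 0 \<Longrightarrow> sq_int (wave_hat' a b t)"
proof -
  note m [measurable] = measurable_wave_hat(2,3)[OF sq_int_measurable[OF a(1)] sq_int_measurable[OF b]]
  have "sq_int (\<lambda>\<xi>. \<bar>a \<xi>\<bar> + \<bar>norm \<xi> * a \<xi>\<bar> + 2 * \<bar>b \<xi>\<bar>)"
    using assms by (intro sq_int_add sq_int_cmult sq_int_abs)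
  then show D: "sq_int (wave_bound a b)" by (simp add: wave_bound_def[abs_def] distrib_right abs_mult)
  show "sq_int (wave_hat a b t)" if "t \<ge> 0" by (rule sq_int_le[OF D m(1) wave_hat_le(2)[OF that]])
  show "sq_int (wave_hat' a b t)" if "t \<ge> 0" by (rule sq_int_le[OF D m(2) wave_hat_le(4)[OF that]])
  show "sq_int (\<lambda>\<xi>. norm \<xi> * wave_hat a b t \<xi>)" if "t \<ge> 0"
    by (rule sq_int_le[OF D]) (use wave_hat_le(3)[OF that, of _ a b] in \<open>auto simp: abs_mult\<close>)
qed

text \<open>The mean value theorem; it supplies the time-independent majorant for the difference
  quotients.\<close>

lemma wave_hat_Lipschitz:
  assumes "s \<ge> 0" "t \<ge> 0"
  shows "\<bar>wave_hat a b s \<xi> - wave_hat a b t \<xi>\<bar> \<le> \<bar>s - t\<bar> * wave_bound a b \<xi>"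
proof -
  have *: "\<bar>wave_hat a b s \<xi> - wave_hat a b t \<xi>\<bar> \<le> \<bar>s - t\<bar> * wave_bound a b \<xi>" if st: "t < s" "t \<ge> 0" for s t
  proof -
    obtain z where z: "z > t" "wave_hat a b s \<xi> - wave_hat a b t \<xi> = (s - t) * wave_hat' a b z \<xi>"
      using MVT2[OF st(1), of "\<lambda>t. wave_hat a b t \<xi>" "\<lambda>t. wave_hat' a b t \<xi>"] wave_hat_deriv by blast
    then show ?thesis using wave_hat_le(4)[of z a b \<xi>] st by (auto simp: abs_mult intro!: mult_left_mono)
  qed
  show ?thesis
    using *[of t s] *[of s t] assms by (cases s t rule: linorder_cases) (auto simp: abs_minus_commute)
qed

lemma L2_nrm_eq_if_hartley:
  fixes f :: "real ^ 'n \<Rightarrow> real"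
  assumes V: "sq_int V" and f: "f \<in> borel_measurable borel" "AE x in lborel. f x = l2_hartley V x"
  shows "L2_nrm f = l2_norm V"
proof -
  have "sq_int f" by (rule sq_int_cong_AE[OF sq_int_l2_hartley[OF V] f])
  then show ?thesis
    using l2_norm_cong_AE[OF f(1) sq_int_measurable[OF sq_int_l2_hartley[OF V]] f(2)] l2_norm_l2_hartley[OF V]
    by (simp add: L2_nrm_sq_int)
qed

text \<open>The transform turns the H1 distance between two times into L2 norms of frequency
  differences, without and with the weight |xi|; dominated convergence treats both.\<close>

lemma wave_C0_H1:
  fixes a b :: "real ^ 'n \<Rightarrow> real"
  assumes a: "sq_int a" "sq_int (\<lambda>\<xi>. norm \<xi> * a \<xi>)" and b: "sq_int b"
  shows "C0_H1 (\<lambda>t. l2_hartley (wave_hat a b t))"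
  unfolding C0_H1_def
proof (intro conjI allI impI)
  note W = sq_int_wave[OF a b]
  note [measurable] = measurable_wave_hat(2,3)[OF sq_int_measurable[OF a(1)] sq_int_measurable[OF b]]
  fix t :: real assume t: "t \<ge> 0"
  show "in_H1 (l2_hartley (wave_hat a b t))"
    using in_H1I(1)[OF W(2,3)[OF t]] sq_int_measurable[OF sq_int_l2_hartley[OF W(2)[OF t]]] by simp
  have D2: "sq_int (\<lambda>\<xi>. 2 * wave_bound a b \<xi>)" by (rule sq_int_cmult[OF W(1)])
  have lim: "((\<lambda>s. wave_hat a b s \<xi> - wave_hat a b t \<xi>) \<longlongrightarrow> 0) (at t within {0..})" for \<xi>
    using DERIV_isCont[OF wave_hat_deriv[of a b \<xi> t]] unfolding isCont_def
    by (intro LIM_zero) (rule tendsto_mono[OF at_le], auto)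
  have 1: "((\<lambda>s. l2_norm (\<lambda>\<xi>. wave_hat a b s \<xi> - wave_hat a b t \<xi>)) \<longlongrightarrow> 0) (at t within {0..})"
  proof (rule l2_norm_dominated_tendsto[OF D2 _ _ lim])
    show "\<bar>wave_hat a b s \<xi> - wave_hat a b t \<xi>\<bar> \<le> 2 * wave_bound a b \<xi>" if "s \<in> {0..}" for s \<xi>
      using wave_hat_le(2)[OF t, of a b \<xi>] wave_hat_le(2)[of s a b \<xi>] that by auto
  qed measurable
  have 2: "((\<lambda>s. l2_norm (\<lambda>\<xi>. norm \<xi> * (wave_hat a b s \<xi> - wave_hat a b t \<xi>))) \<longlongrightarrow> 0) (at t within {0..})"
  proof (rule l2_norm_dominated_tendsto[OF D2])
    show "\<bar>norm \<xi> * (wave_hat a b s \<xi> - wave_hat a b t \<xi>)\<bar> \<le> 2 * wave_bound a b \<xi>" if "s \<in> {0..}" for s \<xi>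
    proof -
      have "\<bar>norm \<xi> * (wave_hat a b s \<xi> - wave_hat a b t \<xi>)\<bar> \<le> norm \<xi> * (\<bar>wave_hat a b s \<xi>\<bar> + \<bar>wave_hat a b t \<xi>\<bar>)"
        unfolding abs_mult by (intro mult_mono abs_triangle_ineq4) auto
      then show ?thesis
        using wave_hat_le(3)[OF t, of \<xi> a b] wave_hat_le(3)[of s \<xi> a b] that by (simp add: distrib_left)
    qed
    show "((\<lambda>s. norm \<xi> * (wave_hat a b s \<xi> - wave_hat a b t \<xi>)) \<longlongrightarrow> 0) (at t within {0..})" for \<xi>
      by (rule tendsto_mult_right_zero[OF lim])
  qed measurable
  have eq: "H1_nrm (\<lambda>x. l2_hartley (wave_hat a b s) x - l2_hartley (wave_hat a b t) x) =
      sqrt ((l2_norm (\<lambda>\<xi>. wave_hat a b s \<xi> - wave_hat a b t \<xi>))\<^sup>2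
        + (l2_norm (\<lambda>\<xi>. norm \<xi> * (wave_hat a b s \<xi> - wave_hat a b t \<xi>)))\<^sup>2)" if s: "s \<ge> 0" for s
  proof -
    have "(H1_nrm (\<lambda>x. l2_hartley (wave_hat a b s) x - l2_hartley (wave_hat a b t) x))\<^sup>2 =
      (l2_norm (\<lambda>\<xi>. wave_hat a b s \<xi> - wave_hat a b t \<xi>))\<^sup>2
        + (l2_norm (\<lambda>\<xi>. norm \<xi> * (wave_hat a b s \<xi> - wave_hat a b t \<xi>)))\<^sup>2"
    proof (rule in_H1I(2))
      show "sq_int (\<lambda>\<xi>. wave_hat a b s \<xi> - wave_hat a b t \<xi>)" by (intro sq_int_diff W s t)
      show "sq_int (\<lambda>\<xi>. norm \<xi> * (wave_hat a b s \<xi> - wave_hat a b t \<xi>))"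
        using sq_int_diff[OF W(3)[OF s] W(3)[OF t]] by (simp add: right_diff_distrib)
      show "(\<lambda>x. l2_hartley (wave_hat a b s) x - l2_hartley (wave_hat a b t) x) \<in> borel_measurable borel"
        by (intro sq_int_measurable sq_int_diff sq_int_l2_hartley W s t)
      show "AE x in lborel. l2_hartley (wave_hat a b s) x - l2_hartley (wave_hat a b t) x =
          l2_hartley (\<lambda>\<xi>. wave_hat a b s \<xi> - wave_hat a b t \<xi>) x"
        using l2_hartley_diff[OF W(2)[OF s] W(2)[OF t]] by eventually_elim simp
    qed
    moreover have "H1_nrm f \<ge> 0" for f :: "real ^ 'n \<Rightarrow> real" by (simp add: H1_nrm_def)
    ultimately show ?thesis by (metis real_sqrt_unique)
  qed
  have "((\<lambda>s. sqrt ((l2_norm (\<lambda>\<xi>. wave_hat a b s \<xi> - wave_hat a b t \<xi>))\<^sup>2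
        + (l2_norm (\<lambda>\<xi>. norm \<xi> * (wave_hat a b s \<xi> - wave_hat a b t \<xi>)))\<^sup>2)) \<longlongrightarrow> sqrt (0\<^sup>2 + 0\<^sup>2)) (at t within {0..})"
    by (intro tendsto_intros 1 2)
  then have "((\<lambda>s. sqrt ((l2_norm (\<lambda>\<xi>. wave_hat a b s \<xi> - wave_hat a b t \<xi>))\<^sup>2
        + (l2_norm (\<lambda>\<xi>. norm \<xi> * (wave_hat a b s \<xi> - wave_hat a b t \<xi>)))\<^sup>2)) \<longlongrightarrow> 0) (at t within {0..})"
    by simp
  then show "((\<lambda>s. H1_nrm (\<lambda>x. l2_hartley (wave_hat a b s) x - l2_hartley (wave_hat a b t) x)) \<longlongrightarrow> 0) (at t within {0..})"
    by (rule Lim_transform_eventually) (auto simp: eventually_at_filter eq)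
qed

lemma wave_C1_L2:
  fixes a b :: "real ^ 'n \<Rightarrow> real"
  assumes a: "sq_int a" "sq_int (\<lambda>\<xi>. norm \<xi> * a \<xi>)" and b: "sq_int b"
  shows "C1_L2 (\<lambda>t. l2_hartley (wave_hat a b t)) (\<lambda>t. l2_hartley (wave_hat' a b t))"
  unfolding C1_L2_def
proof (intro conjI allI impI)
  note W = sq_int_wave[OF a b]
  note [measurable] = measurable_wave_hat(2,3)[OF sq_int_measurable[OF a(1)] sq_int_measurable[OF b]]
  fix t :: real assume t: "t \<ge> 0"
  show "in_L2 (l2_hartley (wave_hat a b t))" "in_L2 (l2_hartley (wave_hat' a b t))"
    by (intro sq_int_in_L2 sq_int_l2_hartley W t)+
  have D2: "sq_int (\<lambda>\<xi>. 2 * wave_bound a b \<xi>)" by (rule sq_int_cmult[OF W(1)])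
  have D: "((\<lambda>s. l2_norm (\<lambda>\<xi>. wave_hat' a b s \<xi> - wave_hat' a b t \<xi>)) \<longlongrightarrow> 0) (at t within {0..})"
  proof (rule l2_norm_dominated_tendsto[OF D2])
    show "((\<lambda>s. wave_hat' a b s \<xi> - wave_hat' a b t \<xi>) \<longlongrightarrow> 0) (at t within {0..})" for \<xi>
      using DERIV_isCont[OF wave_hat'_deriv[of a b \<xi> t]] unfolding isCont_def
      by (intro LIM_zero) (rule tendsto_mono[OF at_le], auto)
    show "\<bar>wave_hat' a b s \<xi> - wave_hat' a b t \<xi>\<bar> \<le> 2 * wave_bound a b \<xi>" if "s \<in> {0..}" for s \<xi>
      using wave_hat_le(4)[OF t, of a b \<xi>] wave_hat_le(4)[of s a b \<xi>] that by auto
  qed measurable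
  have "L2_nrm (\<lambda>x. l2_hartley (wave_hat' a b s) x - l2_hartley (wave_hat' a b t) x) =
      l2_norm (\<lambda>\<xi>. wave_hat' a b s \<xi> - wave_hat' a b t \<xi>)" if s: "s \<ge> 0" for s
  proof (rule L2_nrm_eq_if_hartley)
    show "sq_int (\<lambda>\<xi>. wave_hat' a b s \<xi> - wave_hat' a b t \<xi>)" by (intro sq_int_diff W s t)
    show "(\<lambda>x. l2_hartley (wave_hat' a b s) x - l2_hartley (wave_hat' a b t) x) \<in> borel_measurable borel"
      by (intro sq_int_measurable sq_int_diff sq_int_l2_hartley W s t)
    show "AE x in lborel. l2_hartley (wave_hat' a b s) x - l2_hartley (wave_hat' a b t) x =
        l2_hartley (\<lambda>\<xi>. wave_hat' a b s \<xi> - wave_hat' a b t \<xi>) x"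
      using l2_hartley_diff[OF W(4)[OF s] W(4)[OF t]] by eventually_elim simp
  qed
  then show "((\<lambda>s. L2_nrm (\<lambda>x. l2_hartley (wave_hat' a b s) x - l2_hartley (wave_hat' a b t) x)) \<longlongrightarrow> 0) (at t within {0..})"
    by (intro Lim_transform_eventually[OF D]) (auto simp: eventually_at_filter)
  define Q where "Q s \<xi> = 1 / (s - t) * (wave_hat a b s \<xi> - wave_hat a b t \<xi>) - wave_hat' a b t \<xi>" for s \<xi>
  have D': "((\<lambda>s. l2_norm (Q s)) \<longlongrightarrow> 0) (at t within {0..})"
  proof (rule l2_norm_dominated_tendsto[OF D2])
    show "((\<lambda>s. Q s \<xi>) \<longlongrightarrow> 0) (at t within {0..})" for \<xi>
    proof -
      have "((\<lambda>s. (wave_hat a b s \<xi> - wave_hat a b t \<xi>) / (s - t)) \<longlongrightarrow> wave_hat' a b t \<xi>) (at t)"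
        using wave_hat_deriv[of a b \<xi> t] by (simp add: has_field_derivative_iff)
      then have "((\<lambda>s. (wave_hat a b s \<xi> - wave_hat a b t \<xi>) / (s - t)) \<longlongrightarrow> wave_hat' a b t \<xi>) (at t within {0..})"
        by (rule tendsto_mono[OF at_le, rotated]) auto
      from LIM_zero[OF this] show ?thesis by (simp add: Q_def)
    qed
    show "\<bar>Q s \<xi>\<bar> \<le> 2 * wave_bound a b \<xi>" if s: "s \<in> {0..}" "s \<noteq> t" for s \<xi>
    proof -
      have "\<bar>1 / (s - t) * (wave_hat a b s \<xi> - wave_hat a b t \<xi>)\<bar> \<le> wave_bound a b \<xi>"
        using wave_hat_Lipschitz[of s t a b \<xi>] s t by (simp add: field_simps)
      then show ?thesis unfolding Q_def
        using wave_hat_le(4)[OF t, of a b \<xi>]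
          abs_triangle_ineq4[of "1 / (s - t) * (wave_hat a b s \<xi> - wave_hat a b t \<xi>)" "wave_hat' a b t \<xi>"] by linarith
    qed
    show "Q s \<in> borel_measurable borel" for s unfolding Q_def by measurable
  qed
  have "L2_nrm (\<lambda>x. (l2_hartley (wave_hat a b s) x - l2_hartley (wave_hat a b t) x) / (s - t) - l2_hartley (wave_hat' a b t) x) =
      l2_norm (Q s)" if s: "s \<ge> 0" for s
  proof (rule L2_nrm_eq_if_hartley)
    have d: "sq_int (\<lambda>\<xi>. wave_hat a b s \<xi> - wave_hat a b t \<xi>)" by (intro sq_int_diff W s t)
    have c: "sq_int (\<lambda>\<xi>. 1 / (s - t) * (wave_hat a b s \<xi> - wave_hat a b t \<xi>))" by (rule sq_int_cmult[OF d])
    show "sq_int (Q s)" unfolding Q_def by (rule sq_int_diff[OF c W(4)[OF t]])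
    have "sq_int (\<lambda>x. 1 / (s - t) * (l2_hartley (wave_hat a b s) x - l2_hartley (wave_hat a b t) x) - l2_hartley (wave_hat' a b t) x)"
      by (intro sq_int_cmult sq_int_diff sq_int_l2_hartley W s t)
    from sq_int_measurable[OF this]
    show "(\<lambda>x. (l2_hartley (wave_hat a b s) x - l2_hartley (wave_hat a b t) x) / (s - t) - l2_hartley (wave_hat' a b t) x)
        \<in> borel_measurable borel" by simp
    show "AE x in lborel. (l2_hartley (wave_hat a b s) x - l2_hartley (wave_hat a b t) x) / (s - t) - l2_hartley (wave_hat' a b t) x =
        l2_hartley (Q s) x"
      using l2_hartley_diff[OF W(2)[OF s] W(2)[OF t]] l2_hartley_cmult[OF d, of "1 / (s - t)"] l2_hartley_diff[OF c W(4)[OF t]]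
      unfolding Q_def by eventually_elim simp
  qed
  then show "((\<lambda>s. L2_nrm (\<lambda>x. (l2_hartley (wave_hat a b s) x - l2_hartley (wave_hat a b t) x) / (s - t) - l2_hartley (wave_hat' a b t) x)) \<longlongrightarrow> 0) (at t within {0..})"
    by (intro Lim_transform_eventually[OF D']) (auto simp: eventually_at_filter)
qed

section \<open>The constructed function satisfies the weak equation\<close>

lemma space_time_Basis:
  "(1, 0) \<in> (Basis :: (real \<times> (real ^ 'n)) set)" "(0, axis i 1) \<in> (Basis :: (real \<times> (real ^ 'n)) set)"
  by (auto simp: Basis_prod_def axis_in_Basis_iff)

lemma has_derivative_time_space_product:
  fixes f :: "real \<Rightarrow> real" and g :: "'a::euclidean_space \<Rightarrow> real"
  assumes f: "(f has_real_derivative f') (at (fst z))" and g: "g differentiable (at (snd z))"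
  shows "((\<lambda>z. f (fst z) * g (snd z)) has_derivative
    (\<lambda>h. f (fst z) * frechet_derivative g (at (snd z)) (snd h) + f' * fst h * g (snd z))) (at z)"
proof -
  have "((\<lambda>z. f (fst z)) has_derivative (\<lambda>h. f' * fst h)) (at z)"
    using has_derivative_compose[OF has_derivative_fst[OF has_derivative_ident] f[unfolded has_field_derivative_def]] .
  moreover have "((\<lambda>z. g (snd z)) has_derivative (\<lambda>h. frechet_derivative g (at (snd z)) (snd h))) (at z)"
    using has_derivative_compose[OF has_derivative_snd[OF has_derivative_ident] has_derivative_frechet[OF g]] .
  ultimately show ?thesis by (rule has_derivative_mult)
qed

lemma pd_time_space_product:
  fixes f :: "real \<Rightarrow> real" and g :: "'a::euclidean_space \<Rightarrow> real"
  assumes f: "\<And>t. (f has_real_derivative f' t) (at t)" and g: "\<And>x. g differentiable (at x)"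
  shows "pd (1, 0) (\<lambda>z. f (fst z) * g (snd z)) = (\<lambda>z. f' (fst z) * g (snd z))"
    and "pd (0, b) (\<lambda>z. f (fst z) * g (snd z)) = (\<lambda>z. f (fst z) * pd b g (snd z))"
    and "(\<lambda>z. f (fst z) * g (snd z)) differentiable (at z)"
proof -
  note D = has_derivative_time_space_product[OF f g]
  have "frechet_derivative g (at x) 0 = 0" for x
    using has_derivative_frechet[OF g, of x] by (simp add: has_derivative_def linear_0 bounded_linear.linear)
  then show "pd (1, 0) (\<lambda>z. f (fst z) * g (snd z)) = (\<lambda>z. f' (fst z) * g (snd z))"
    by (intro ext, subst pd_eqI[OF D]) simp
  show "pd (0, b) (\<lambda>z. f (fst z) * g (snd z)) = (\<lambda>z. f (fst z) * pd b g (snd z))"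
    by (intro ext, subst pd_eqI[OF D]) (simp add: pd_def)
  show "(\<lambda>z. f (fst z) * g (snd z)) differentiable (at z)"
    using D[of z] unfolding differentiable_def by blast
qed

text \<open>The product y(t) cas(x . xi) is a classical solution, since \<open>cas\<close> gives an
  eigenfunction of the Laplacian with eigenvalue -|xi|^2. Moving all derivatives from the test
  function onto it leaves zero.\<close>

lemma damped_wave_plane_wave:
  fixes \<psi> :: "real \<times> (real ^ 'n) \<Rightarrow> real"
  assumes \<psi>: "test_function \<Omega> \<psi>"
    and y: "\<And>t. (y has_real_derivative y' t) (at t)" "\<And>t. (y' has_real_derivative - (norm \<xi>)\<^sup>2 * y t - y' t) (at t)"
  shows "(LINT z|lborel. (ptime (ptime \<psi>) z - laplacian \<psi> z - ptime \<psi> z) * (y (fst z) * cas (snd z \<bullet> \<xi>))) = 0"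
proof -
  let ?c = "\<lambda>x. cas (x \<bullet> \<xi>)" and ?c' = "\<lambda>x. cas (- (x \<bullet> \<xi>))"
  obtain R where R: "\<And>z. norm z \<ge> R \<Longrightarrow> \<psi> z = 0" using test_function_support[OF \<psi>] by metis
  have y_cont: "continuous_on UNIV y" "continuous_on UNIV y'"
    using y by (auto intro!: continuous_at_imp_continuous_on DERIV_isCont)
  have c: "?c differentiable (at x)" "?c' differentiable (at x)" for x
    unfolding cas_def by (auto simp: differentiable_def intro!: exI derivative_eq_intros)
  have pdc: "pd b ?c = (\<lambda>x. (b \<bullet> \<xi>) * cas (- (x \<bullet> \<xi>)))" for b
    by (intro ext pd_eqI[OF has_derivative_cas_inner])
  have pdc': "pd b ?c' = (\<lambda>x. - (b \<bullet> \<xi>) * cas (x \<bullet> \<xi>))" for b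
    using has_derivative_cas_inner[of "- \<xi>"] by (intro ext pd_eqI) simp
  have bc: "(\<lambda>x. (b \<bullet> \<xi>) * cas (- (x \<bullet> \<xi>))) differentiable (at x)" for b x
    by (intro differentiable_mult differentiable_const c)
  have cc: "continuous_on UNIV (\<lambda>z. f (fst z) * cas (snd z \<bullet> v))" if "continuous_on UNIV f" for f :: "real \<Rightarrow> real" and v :: "real ^ 'n"
  proof -
    have c1: "continuous_on UNIV (\<lambda>z::real \<times> (real ^ 'n). f (fst z))"
      by (intro continuous_on_compose2[OF that] continuous_intros) auto
    have c2: "continuous_on UNIV (\<lambda>z::real \<times> (real ^ 'n). snd z \<bullet> v)"
      by (intro continuous_intros)
    show ?thesis unfolding cas_def
      by (intro continuous_on_mult continuous_on_add c1 continuous_on_cos[OF c2] continuous_on_sin[OF c2])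
  qed
  define G where "G z = y (fst z) * ?c (snd z)" for z :: "real \<times> (real ^ 'n)"
  define Gt where "Gt z = y' (fst z) * ?c (snd z)" for z :: "real \<times> (real ^ 'n)"
  define Gi where "Gi i z = y (fst z) * ((axis i 1 \<bullet> \<xi>) * ?c' (snd z))" for z :: "real \<times> (real ^ 'n)" and i
  have G: "pd (1, 0) G = Gt" "pd (0, axis i 1) G = Gi i" "G differentiable (at z)" for i z
    using pd_time_space_product[OF y(1) c(1)] by (simp_all add: G_def[abs_def] Gt_def[abs_def] Gi_def[abs_def] pdc)
  have Gt: "pd (1, 0) Gt = (\<lambda>z. (- (norm \<xi>)\<^sup>2 * y (fst z) - y' (fst z)) * ?c (snd z))" "Gt differentiable (at z)" for z
    using pd_time_space_product[OF y(2) c(1)] by (simp_all add: Gt_def[abs_def])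
  have Gi: "pd (0, axis i 1) (Gi i) = (\<lambda>z. - (axis i 1 \<bullet> \<xi>)\<^sup>2 * G z)" "Gi i differentiable (at z)" for i z
  proof -
    have "pd (axis i 1) (\<lambda>x. (axis i 1 \<bullet> \<xi>) * ?c' x) = (\<lambda>x. (axis i 1 \<bullet> \<xi>) * (- (axis i 1 \<bullet> \<xi>) * cas (x \<bullet> \<xi>)))"
      by (rule ext, subst pd_mult) (auto simp: pd_const pdc' intro: c)
    then show "pd (0, axis i 1) (Gi i) = (\<lambda>z. - (axis i 1 \<bullet> \<xi>)\<^sup>2 * G z)"
      using pd_time_space_product(2)[OF y(1) bc, of "axis i 1" "axis i 1"]
      by (simp add: Gi_def[abs_def] G_def power2_eq_square fun_eq_iff)
    show "Gi i differentiable (at z)"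
      using pd_time_space_product(3)[OF y(1) bc] by (simp add: Gi_def[abs_def])
  qed
  have cont: "continuous_on UNIV G" "continuous_on UNIV Gt" "continuous_on UNIV (Gi i)"
    "continuous_on UNIV (pd (1, 0) Gt)" "continuous_on UNIV (pd (0, axis i 1) (Gi i))" for i
  proof -
    show g: "continuous_on UNIV G" "continuous_on UNIV Gt"
      unfolding G_def[abs_def] Gt_def[abs_def] by (intro cc y_cont)+
    have "continuous_on UNIV (\<lambda>z. (axis i 1 \<bullet> \<xi>) * (y (fst z) * cas (snd z \<bullet> (- \<xi>))))"
      by (intro continuous_intros cc y_cont)
    then show "continuous_on UNIV (Gi i)" by (simp add: Gi_def[abs_def] mult.left_commute)
    show "continuous_on UNIV (pd (1, 0) Gt)" unfolding Gt by (intro cc continuous_intros y_cont)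
    show "continuous_on UNIV (pd (0, axis i 1) (Gi i))" unfolding Gi by (intro continuous_intros g)
  qed
  note sm = test_function_smooth
  have \<psi>t: "test_function \<Omega> (ptime \<psi>)" "test_function \<Omega> (ptime (ptime \<psi>))"
    unfolding ptime_def by (intro test_function_pd \<psi> space_time_Basis)+
  have \<psi>i: "test_function \<Omega> (pspace i \<psi>)" "test_function \<Omega> (pspace i (pspace i \<psi>))" for i
    unfolding pspace_def by (intro test_function_pd \<psi> space_time_Basis)+
  have ibp: "(LINT z|lborel. pd b f z * g z) = - (LINT z|lborel. f z * pd b g z)"
    if "test_function \<Omega> f" "b \<in> Basis" "\<And>z. g differentiable (at z)" "continuous_on UNIV (pd b g)" for f g b
    using test_function_support[OF that(1)] integral_pd_mult[OF sm[OF that(1)] _ that(2,3,4)] by metis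
  have int: "integrable lborel (\<lambda>z. f z * g z)" if fg: "test_function \<Omega> f" "continuous_on UNIV g" for f g
  proof -
    obtain R where "\<And>z. norm z \<ge> R \<Longrightarrow> f z = 0" using test_function_support[OF fg(1)] by metis
    then show ?thesis
      by (intro continuous_support_integrable(1)[where R=R] continuous_intros smooth_continuous[OF sm[OF fg(1)]] fg) auto
  qed
  have tt: "(LINT z|lborel. ptime (ptime \<psi>) z * G z) = (LINT z|lborel. \<psi> z * pd (1, 0) Gt z)"
    using ibp[OF \<psi>t(1) space_time_Basis(1), of G] ibp[OF \<psi> space_time_Basis(1), of Gt] G Gt cont
    by (simp add: ptime_def)
  have t: "(LINT z|lborel. ptime \<psi> z * G z) = - (LINT z|lborel. \<psi> z * Gt z)"
    using ibp[OF \<psi> space_time_Basis(1), of G] G cont by (simp add: ptime_def)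
  have ii: "(LINT z|lborel. pspace i (pspace i \<psi>) z * G z) = - (axis i 1 \<bullet> \<xi>)\<^sup>2 * (LINT z|lborel. \<psi> z * G z)" for i
  proof -
    have "(LINT z|lborel. pspace i (pspace i \<psi>) z * G z) = (LINT z|lborel. \<psi> z * pd (0, axis i 1) (Gi i) z)"
      using ibp[OF \<psi>i(1) space_time_Basis(2), of G i i] ibp[OF \<psi> space_time_Basis(2), of "Gi i" i] G Gi(2) cont
      by (simp add: pspace_def)
    then show ?thesis unfolding Gi mult.left_commute[of "\<psi> _"] by simp
  qed
  have "(LINT z|lborel. (ptime (ptime \<psi>) z - laplacian \<psi> z - ptime \<psi> z) * G z) =
      (LINT z|lborel. ptime (ptime \<psi>) z * G z - (\<Sum>i\<in>UNIV. pspace i (pspace i \<psi>) z * G z) - ptime \<psi> z * G z)"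
    by (simp add: laplacian_def left_diff_distrib sum_distrib_right)
  also have "\<dots> = (LINT z|lborel. ptime (ptime \<psi>) z * G z) - (\<Sum>i\<in>UNIV. (LINT z|lborel. pspace i (pspace i \<psi>) z * G z))
      - (LINT z|lborel. ptime \<psi> z * G z)"
    using int[OF \<psi>t(1) cont(1)] int[OF \<psi>t(2) cont(1)] int[OF \<psi>i(2) cont(1)] by simp
  also have "\<dots> = (LINT z|lborel. \<psi> z * pd (1, 0) Gt z) + (norm \<xi>)\<^sup>2 * (LINT z|lborel. \<psi> z * G z) + (LINT z|lborel. \<psi> z * Gt z)"
    unfolding tt t ii by (simp add: sum_negf norm_power2_cart inner_axis' flip: sum_distrib_right)
  also have "(LINT z|lborel. \<psi> z * pd (1, 0) Gt z) = (LINT z|lborel. - (norm \<xi>)\<^sup>2 * (\<psi> z * G z) - \<psi> z * Gt z)"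
    unfolding Gt by (intro Bochner_Integration.integral_cong refl) (simp add: G_def Gt_def algebra_simps)
  also have "\<dots> = - (norm \<xi>)\<^sup>2 * (LINT z|lborel. \<psi> z * G z) - (LINT z|lborel. \<psi> z * Gt z)"
    using int[OF \<psi> cont(1)] int[OF \<psi> cont(2)] by simp
  finally show ?thesis by (simp add: G_def)
qed

lemma slice_continuous_support:
  fixes L :: "real \<times> (real ^ 'n) \<Rightarrow> real"
  assumes c: "continuous_on UNIV L" and R: "\<And>z. norm z \<ge> R \<Longrightarrow> L z = 0"
  shows "integrable lborel (\<lambda>x. L (t, x))" "sq_int (\<lambda>x. L (t, x))"
proof -
  have "continuous_on UNIV (\<lambda>x. L (t, x))"
    by (intro continuous_on_compose2[OF c] continuous_intros) auto
  moreover have "L (t, x) = 0" if "norm x \<ge> R" for x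
    using that norm_snd_le[of x t] by (intro R) simp
  ultimately show "integrable lborel (\<lambda>x. L (t, x))" "sq_int (\<lambda>x. L (t, x))"
    by (auto intro: continuous_support_integrable)
qed

text \<open>Superposition of plane waves: the pairing is moved to the frequency side, the integrals
  over t and xi are exchanged, and for each xi the plane wave identity gives zero.\<close>

lemma wave_damped_wave_eq:
  fixes a b :: "real ^ 'n \<Rightarrow> real"
  assumes a: "sq_int a" "sq_int (\<lambda>\<xi>. norm \<xi> * a \<xi>)" and b: "sq_int b"
  shows "damped_wave_eq (\<lambda>t. l2_hartley (wave_hat a b t))"
  unfolding damped_wave_eq_def
proof (intro allI impI)
  fix \<psi> :: "real \<times> (real ^ 'n) \<Rightarrow> real"
  assume \<psi>: "test_function ({0<..} \<times> UNIV) \<psi>"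
  note W = sq_int_wave[OF a b]
  note wm = measurable_wave_hat[OF sq_int_measurable[OF a(1)] sq_int_measurable[OF b]]
  define L where "L z = ptime (ptime \<psi>) z - laplacian \<psi> z - ptime \<psi> z" for z
  have \<psi>t: "test_function ({0<..} \<times> UNIV) (ptime \<psi>)" "test_function ({0<..} \<times> UNIV) (ptime (ptime \<psi>))"
    unfolding ptime_def by (intro test_function_pd \<psi> space_time_Basis)+
  have \<psi>i: "test_function ({0<..} \<times> UNIV) (pspace i (pspace i \<psi>))" for i
    unfolding pspace_def by (intro test_function_pd \<psi> space_time_Basis)+
  have L_cont: "continuous_on UNIV L"
    unfolding L_def[abs_def] laplacian_def
    by (intro continuous_intros smooth_continuous test_function_smooth[OF \<psi>t(1)] test_function_smooth[OF \<psi>t(2)] test_function_smooth[OF \<psi>i])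
  have L_m: "L \<in> borel_measurable borel" by (rule borel_measurable_continuous_onI[OF L_cont])
  have vanish: "f z = 0" if "test_function ({0<..} \<times> UNIV) f" "fst z \<le> 0" for f and z :: "real \<times> (real ^ 'n)"
  proof (rule ccontr)
    assume "f z \<noteq> 0"
    then have z: "z \<in> {z. f z \<noteq> 0}" by simp
    have "closure {z. f z \<noteq> 0} \<subseteq> {0<..} \<times> UNIV" using that(1) by (simp add: test_function_def)
    from subsetD[OF this subsetD[OF closure_subset z]] have "z \<in> {0<..} \<times> UNIV" .
    then show False using that(2) by auto
  qed
  have L_past: "L z = 0" if "fst z \<le> 0" for z
    using vanish[OF \<psi>t(1) that] vanish[OF \<psi>t(2) that] vanish[OF \<psi>i that] by (simp add: L_def laplacian_def)
  obtain R1 where R1: "\<And>z. norm z \<ge> R1 \<Longrightarrow> ptime \<psi> z = 0" using test_function_support[OF \<psi>t(1)] by metis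
  obtain R2 where R2: "\<And>z. norm z \<ge> R2 \<Longrightarrow> ptime (ptime \<psi>) z = 0" using test_function_support[OF \<psi>t(2)] by metis
  have "\<exists>R. \<forall>z. norm z \<ge> R \<longrightarrow> pspace i (pspace i \<psi>) z = 0" for i
    by (rule test_function_support[OF \<psi>i[of i]]) blast
  then obtain R3 where R3: "\<And>i z. norm z \<ge> R3 i \<Longrightarrow> pspace i (pspace i \<psi>) z = 0" by metis
  define R where "R = \<bar>R1\<bar> + \<bar>R2\<bar> + (\<Sum>i\<in>UNIV. \<bar>R3 i\<bar>)"
  have L_supp: "L z = 0" if z: "norm z \<ge> R" for z
  proof -
    have s: "\<bar>R3 i\<bar> \<le> (\<Sum>i\<in>UNIV. \<bar>R3 i\<bar>)" for i by (rule member_le_sum) auto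
    have "0 \<le> (\<Sum>i\<in>UNIV. \<bar>R3 i\<bar>)" by (rule sum_nonneg) simp
    then have "norm z \<ge> R1" "norm z \<ge> R2" using z unfolding R_def by linarith+
    moreover have "norm z \<ge> R3 i" for i using s[of i] z unfolding R_def by linarith
    ultimately show ?thesis using R1 R2 R3 by (simp add: L_def laplacian_def)
  qed
  obtain K where K: "K \<ge> 0" "\<And>z. \<bar>L z\<bar> \<le> K" using continuous_compact_support_bounded[OF L_cont L_supp] by metis
  note Lt = slice_continuous_support[OF L_cont L_supp]
  have HLt: "sq_int (hartley (\<lambda>x. L (t, x)))" for t by (rule hartley_contraction(1)[OF Lt])
  \<comment> \<open>Fubini's theorem is applied to this function because it is jointly measurable,
    being built from explicit multipliers. The functions \<open>l2_hartley (wave_hat a b t)\<close>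
    are chosen separately for each t and carry no joint measurability in (t, x).\<close>
  define k where "k t \<xi> = indicator {0<..} t * wave_hat a b t \<xi> * hartley (\<lambda>x. L (t, x)) \<xi>" for t \<xi>
  have k_m: "(\<lambda>(t, \<xi>). k t \<xi>) \<in> borel_measurable (borel \<Otimes>\<^sub>M borel)"
  proof -
    have [measurable]: "L \<in> borel_measurable (borel \<Otimes>\<^sub>M borel)" using L_m by (simp add: borel_prod)
    have [measurable]: "(\<lambda>(t, \<xi>). wave_hat a b t \<xi>) \<in> borel_measurable (borel \<Otimes>\<^sub>M borel)" by (rule wm(1))
    show ?thesis unfolding k_def hartley_def by measurable
  qed
  have inner: "indicator {0<..} t *\<^sub>R (LINT x|lebesgue. l2_hartley (wave_hat a b t) x *
      (ptime (ptime \<psi>) (t, x) - laplacian \<psi> (t, x) - ptime \<psi> (t, x))) = (LINT \<xi>|lborel. k t \<xi>)" for t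
  proof (cases "t > 0")
    case True
    then have t: "t \<ge> 0" by simp
    note T = sq_int_l2_hartley[OF W(2)[OF t]]
    have "(LINT x|lebesgue. l2_hartley (wave_hat a b t) x * L (t, x)) = l2_inner (l2_hartley (wave_hat a b t)) (\<lambda>x. L (t, x))"
      by (rule integral_lebesgue_mult_test)
        (use sq_int_measurable[OF T] sq_int_measurable[OF Lt(2)] in \<open>auto simp: borel_imp_lebesgue\<close>)
    also have "\<dots> = l2_inner (wave_hat a b t) (hartley (\<lambda>x. L (t, x)))"
      by (rule l2_hartley_inner[OF W(2)[OF t] Lt])
    finally show ?thesis using True by (simp add: l2_inner_def k_def L_def)
  qed (simp add: k_def)
  \<comment> \<open>Bounds the L2 norm of every time slice of \<open>L\<close>, and by contraction
    also that of its transform.\<close>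
  define B where "B = l2_norm (\<lambda>x::real ^ 'n. K * indicator (cball 0 \<bar>R\<bar>) x)"
  have ball_sq: "sq_int (\<lambda>x::real ^ 'n. K * indicator (cball 0 \<bar>R\<bar>) x)"
    by (rule bounded_support_sq_int[of _ "\<bar>R\<bar> + 1" K]) (use K in \<open>auto simp: indicator_def\<close>)
  have k_int: "integrable lborel (k t)" and k_le: "(LINT \<xi>|lborel. \<bar>k t \<xi>\<bar>) \<le> indicator (cball 0 \<bar>R\<bar>) t * (l2_norm (wave_bound a b) * B)" for t
  proof -
    have "integrable lborel (k t) \<and> (LINT \<xi>|lborel. \<bar>k t \<xi>\<bar>) \<le> indicator (cball 0 \<bar>R\<bar>) t * (l2_norm (wave_bound a b) * B)"
    proof (cases "t > 0 \<and> t \<le> \<bar>R\<bar>")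
      case True
      then have t: "t \<ge> 0" by simp
      have k_eq: "k t = (\<lambda>\<xi>. wave_hat a b t \<xi> * hartley (\<lambda>x. L (t, x)) \<xi>)" using True by (simp add: k_def fun_eq_iff)
      have "(LINT \<xi>|lborel. \<bar>k t \<xi>\<bar>) = l2_inner (\<lambda>\<xi>. \<bar>wave_hat a b t \<xi>\<bar>) (\<lambda>\<xi>. \<bar>hartley (\<lambda>x. L (t, x)) \<xi>\<bar>)"
        by (simp add: k_eq l2_inner_def abs_mult)
      also have "\<dots> \<le> l2_norm (\<lambda>\<xi>. \<bar>wave_hat a b t \<xi>\<bar>) * l2_norm (\<lambda>\<xi>. \<bar>hartley (\<lambda>x. L (t, x)) \<xi>\<bar>)"
        by (rule order_trans[OF abs_ge_self l2_Cauchy_Schwarz]) (intro sq_int_abs W t HLt)+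
      also have "\<dots> \<le> l2_norm (wave_bound a b) * B"
      proof (intro mult_mono)
        show "l2_norm (\<lambda>\<xi>. \<bar>wave_hat a b t \<xi>\<bar>) \<le> l2_norm (wave_bound a b)"
          using wave_hat_le(2)[OF t] wave_bound_nonneg[of a b]
          by (intro l2_norm_mono_AE W sq_int_measurable[OF sq_int_abs[OF W(2)[OF t]]]) auto
        have "l2_norm (\<lambda>\<xi>. \<bar>hartley (\<lambda>x. L (t, x)) \<xi>\<bar>) = l2_norm (hartley (\<lambda>x. L (t, x)))" by (simp add: l2_norm_def)
        also have "\<dots> \<le> l2_norm (\<lambda>x. L (t, x))" by (rule hartley_contraction(2)[OF Lt])
        also have "\<dots> \<le> B" unfolding B_def
        proof (intro l2_norm_mono_AE ball_sq sq_int_measurable[OF Lt(2)] AE_I2)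
          fix x :: "real ^ 'n"
          show "\<bar>L (t, x)\<bar> \<le> \<bar>K * indicator (cball 0 \<bar>R\<bar>) x\<bar>"
          proof (cases "norm x \<le> \<bar>R\<bar>")
            case True
            then show ?thesis using K by simp
          next
            case False
            then have "L (t, x) = 0" using norm_snd_le[of x t] by (intro L_supp) simp
            then show ?thesis by simp
          qed
        qed
        finally show "l2_norm (\<lambda>\<xi>. \<bar>hartley (\<lambda>x. L (t, x)) \<xi>\<bar>) \<le> B" .
      qed auto
      finally show ?thesis using True sq_int_mult_integrable[OF W(2)[OF t] HLt] by (simp add: k_eq)
    next
      case False
      \<comment> \<open>For t <= 0 and for t > |R| the slice of \<open>L\<close> is zero, so the
        majorant in t has bounded support.\<close>
      have "L (t, x) = 0" for x
        using False norm_fst_le[of t x] L_past[of "(t, x)"] L_supp[of "(t, x)"] by (cases "t > 0") auto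
      then have "k t = (\<lambda>\<xi>. 0)" by (simp add: k_def fun_eq_iff hartley_def)
      then show ?thesis by (simp add: B_def)
    qed
    then show "integrable lborel (k t)" "(LINT \<xi>|lborel. \<bar>k t \<xi>\<bar>) \<le> indicator (cball 0 \<bar>R\<bar>) t * (l2_norm (wave_bound a b) * B)" by auto
  qed
  have pair: "integrable (lborel \<Otimes>\<^sub>M lborel) (\<lambda>(t, \<xi>). k t \<xi>)"
  proof (rule lborel_pair.Fubini_integrable)
    show "(\<lambda>(t, \<xi>). k t \<xi>) \<in> borel_measurable (lborel \<Otimes>\<^sub>M lborel)" using k_m by simp
    show "integrable lborel (\<lambda>t. LINT \<xi>|lborel. norm (case (t, \<xi>) of (t, \<xi>) \<Rightarrow> k t \<xi>))"
    proof (rule Bochner_Integration.integrable_bound)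
      show "integrable lborel (\<lambda>t::real. indicator (cball 0 \<bar>R\<bar>) t * (l2_norm (wave_bound a b) * B))"
        using emeasure_lborel_cball_finite[of "0::real" "\<bar>R\<bar>"] by simp
      show "(\<lambda>t. LINT \<xi>|lborel. norm (case (t, \<xi>) of (t, \<xi>) \<Rightarrow> k t \<xi>)) \<in> borel_measurable lborel"
        using k_m by measurable
      show "AE t in lborel. norm (LINT \<xi>|lborel. norm (case (t, \<xi>) of (t, \<xi>) \<Rightarrow> k t \<xi>))
          \<le> norm (indicator (cball 0 \<bar>R\<bar>) t * (l2_norm (wave_bound a b) * B))"
        using k_le by (intro AE_I2) (auto simp: integral_nonneg_AE intro: order_trans[OF _ abs_ge_self])
    qed
    show "AE t in lborel. integrable lborel (\<lambda>\<xi>. case (t, \<xi>) of (t, \<xi>) \<Rightarrow> k t \<xi>)"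
      using k_int by simp
  qed
  have zero: "(LINT t|lborel. k t \<xi>) = 0" for \<xi>
  proof -
    let ?y = "\<lambda>t. wave_hat a b t \<xi>"
    define F where "F z = L z * (?y (fst z) * cas (snd z \<bullet> \<xi>))" for z :: "real \<times> (real ^ 'n)"
    have y_cont: "continuous_on UNIV ?y" using wave_hat_deriv by (auto intro!: continuous_at_imp_continuous_on DERIV_isCont)
    have yf: "continuous_on UNIV (\<lambda>z::real \<times> (real ^ 'n). ?y (fst z))"
      by (intro continuous_on_compose2[OF y_cont] continuous_intros) auto
    have "integrable lborel F"
      unfolding F_def cas_def
      by (rule continuous_support_integrable(1)[where R=R])
        (auto intro!: continuous_intros L_cont yf simp: L_supp)
    then have F_int: "integrable (lborel \<Otimes>\<^sub>M lborel) (\<lambda>(t, x). F (t, x))" by (simp add: lborel_prod)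
    have "(LINT t|lborel. k t \<xi>) = (LINT t|lborel. 1 / sqrt (2 * pi) ^ CARD('n) * (LINT x|lborel. F (t, x)))"
    proof (intro Bochner_Integration.integral_cong refl)
      fix t
      show "k t \<xi> = 1 / sqrt (2 * pi) ^ CARD('n) * (LINT x|lborel. F (t, x))"
      proof (cases "t > 0")
        case True
        have "(LINT x|lborel. F (t, x)) = ?y t * (LINT x|lborel. L (t, x) * cas (x \<bullet> \<xi>))"
          unfolding F_def by (subst integral_mult_right_zero[symmetric]) (simp add: mult_ac)
        then show ?thesis using True by (simp add: k_def hartley_def)
      next
        case False
        then show ?thesis using L_past by (simp add: k_def F_def)
      qed
    qed
    also have "\<dots> = 1 / sqrt (2 * pi) ^ CARD('n) * (LINT t|lborel. LINT x|lborel. F (t, x))" by simp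
    also have "(LINT t|lborel. LINT x|lborel. F (t, x)) = integral\<^sup>L lborel F"
      using lborel_pair.integral_fst[OF F_int] by (simp add: lborel_prod)
    also have "\<dots> = 0"
      unfolding F_def L_def by (rule damped_wave_plane_wave[OF \<psi> wave_hat_deriv wave_hat'_deriv])
    finally show ?thesis by simp
  qed
  have h_m: "(\<lambda>t. LINT \<xi>|lborel. k t \<xi>) \<in> borel_measurable borel" using k_m by measurable
  have "(LINT t:{0<..}|lebesgue. (LINT x|lebesgue. l2_hartley (wave_hat a b t) x *
      (ptime (ptime \<psi>) (t, x) - laplacian \<psi> (t, x) - ptime \<psi> (t, x)))) = (LINT t|lebesgue. LINT \<xi>|lborel. k t \<xi>)"
    unfolding set_lebesgue_integral_def inner ..
  also have "\<dots> = (LINT t|lborel. LINT \<xi>|lborel. k t \<xi>)"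
    using integral_completion[of "\<lambda>t. LINT \<xi>|lborel. k t \<xi>" lborel] h_m by simp
  also have "\<dots> = (LINT \<xi>|lborel. LINT t|lborel. k t \<xi>)"
    by (rule lborel_pair.Fubini_integral[OF pair, symmetric])
  also have "\<dots> = 0" using zero by simp
  finally show "(LINT t:{0<..}|lebesgue. (LINT x|lebesgue. l2_hartley (wave_hat a b t) x *
      (ptime (ptime \<psi>) (t, x) - laplacian \<psi> (t, x) - ptime \<psi> (t, x)))) = 0" .
qed

section \<open>Uniqueness\<close>

lemma smooth_has_real_derivative:
  fixes \<theta> :: "real \<Rightarrow> real"
  assumes "smooth \<theta>" shows "(\<theta> has_real_derivative pd 1 \<theta> s) (at s)"
proof -
  have d: "\<theta> differentiable (at s)" by (rule smooth_differentiable[OF assms])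
  have "frechet_derivative \<theta> (at s) = (\<lambda>h. pd 1 \<theta> s * h)"
    by (rule ext, subst frechet_derivative_eq_sum_pd[OF d]) (simp add: mult.commute)
  then show ?thesis using has_derivative_frechet[OF d] by (simp add: has_field_derivative_def)
qed

text \<open>The test function is a mollified indicator of [t1, t2]; its derivative is a bump at t1
  minus a bump at t2. Hence the averages of \<open>k\<close> around the two points agree, and narrow
  bumps compare the values themselves.\<close>

lemma du_Bois_Reymond:
  fixes k :: "real \<Rightarrow> real"
  assumes k: "continuous_on {0<..} k"
    and zero: "\<And>\<theta> c d. test_function {0<..} \<theta> \<Longrightarrow> 0 < c \<Longrightarrow> c \<le> d \<Longrightarrow> (\<And>t. t \<notin> {c<..<d} \<Longrightarrow> \<theta> t = 0) \<Longrightarrow>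
      integral {c..d} (\<lambda>t. pd 1 \<theta> t * k t) = 0"
    and t: "0 < t1" "t1 < t2"
  shows "k t1 = k t2"
proof -
  have close: "\<bar>k t1 - k t2\<bar> \<le> 2 * \<eta>" if \<eta>: "\<eta> > 0" for \<eta>
  proof -
    have "\<exists>\<delta>>0. \<forall>s. \<bar>s - t\<bar> < \<delta> \<longrightarrow> \<bar>k s - k t\<bar> \<le> \<eta>" if "t > 0" for t
    proof -
      have "isCont k t" using k that by (simp add: continuous_on_eq_continuous_at)
      then have "\<exists>\<delta>>0. \<forall>s. \<bar>s - t\<bar> < \<delta> \<longrightarrow> \<bar>k s - k t\<bar> < \<eta>"
        using \<eta> unfolding continuous_at_eps_delta by (simp add: dist_real_def)
      then show ?thesis by (meson less_imp_le)
    qed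
    from this[of t1] this[of t2] t obtain \<delta>1 \<delta>2 where \<delta>: "\<delta>1 > 0" "\<delta>2 > 0"
      "\<And>s. \<bar>s - t1\<bar> < \<delta>1 \<Longrightarrow> \<bar>k s - k t1\<bar> \<le> \<eta>" "\<And>s. \<bar>s - t2\<bar> < \<delta>2 \<Longrightarrow> \<bar>k s - k t2\<bar> \<le> \<eta>"
      by auto
    \<comment> \<open>The bound t1 / 2 keeps the bump around t1 inside the positive half-line, where
      test functions live; the other two keep each bump where \<open>k\<close> varies by at most
      \<open>\<eta>\<close>.\<close>
    define e where "e = min (t1 / 2) (min \<delta>1 \<delta>2)"
    have e: "e > 0" "e \<le> t1 / 2" "e \<le> \<delta>1" "e \<le> \<delta>2" using \<delta> t by (auto simp: e_def)
    define c where "c = t1 - e"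
    define d where "d = t2 + e"
    have cd: "0 < c" "c < d" using e t by (auto simp: c_def d_def)
    define \<rho> where "\<rho> = (bump e :: real \<Rightarrow> real)"
    have \<rho>: "test_function UNIV \<rho>" unfolding \<rho>_def by (rule test_function_bump[OF e(1)])
    have \<rho>0: "\<rho> s = 0" if "\<bar>s\<bar> \<ge> e" for s unfolding \<rho>_def using bump_eq_0[OF e(1), of s] that by simp
    have \<rho>_nn: "\<rho> s \<ge> 0" for s by (simp add: \<rho>_def bump_nonneg)
    have \<rho>_cont: "continuous_on S \<rho>" "continuous_on S (pd 1 \<rho>)" for S
      using test_function_smooth[OF \<rho>] smooth_pd[of \<rho> 1] by (auto intro: smooth_continuous)
    note \<rho>_deriv = smooth_has_real_derivative[OF test_function_smooth[OF \<rho>]]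
    define I where "I = (indicator {t1..t2} :: real \<Rightarrow> real)"
    have I: "integrable lborel I" unfolding I_def by (intro integrable_real_indicator) (auto simp: emeasure_lborel_Icc_eq)
    define \<theta> where "\<theta> = conv \<rho> I"
    have \<theta>_smooth: "smooth \<theta>" unfolding \<theta>_def by (rule smooth_conv[OF \<rho> I])
    have \<theta>0: "\<theta> s = 0" if "s \<notin> {c<..<d}" for s
    proof -
      have "(\<lambda>y. \<rho> (s - y) * I y) = (\<lambda>y. 0)"
        using that \<rho>0 by (auto simp: fun_eq_iff I_def indicator_def c_def d_def)
      then show ?thesis by (simp only: \<theta>_def conv_def) simp
    qed
    have "s \<in> {c..d}" if "\<theta> s \<noteq> 0" for s using \<theta>0[of s] that by (cases "s \<in> {c<..<d}") auto
    then have "closure {s. \<theta> s \<noteq> 0} \<subseteq> {c..d}" by (intro closure_minimal) auto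
    then have cl: "closure {s. \<theta> s \<noteq> 0} \<subseteq> {c..d}" .
    have "compact ({c..d} \<inter> closure {s. \<theta> s \<noteq> 0})"
      by (intro compact_Int_closed compact_Icc closed_closure)
    then have "compact (closure {s. \<theta> s \<noteq> 0})" using cl by (simp only: inf.absorb2)
    moreover have "closure {s. \<theta> s \<noteq> 0} \<subseteq> {0<..}" by (rule order_trans[OF cl]) (use cd in auto)
    ultimately have \<theta>: "test_function {0<..} \<theta>"
      using \<theta>_smooth unfolding test_function_def by (intro conjI)
    have \<theta>': "pd 1 \<theta> s = \<rho> (s - t1) - \<rho> (s - t2)" for s
    proof -
      have "pd 1 \<theta> s = (LINT y|lborel. pd 1 \<rho> (s - y) * indicator {t1..t2} y)"
        unfolding \<theta>_def pd_conv[OF \<rho> I] by (simp add: conv_def I_def)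
      also have "\<dots> = - \<rho> (s - t2) - (- \<rho> (s - t1))"
      proof (rule integral_FTC_Icc_real)
        show "((\<lambda>y. - \<rho> (s - y)) has_real_derivative pd 1 \<rho> (s - y)) (at y)" for y
          by (auto intro!: derivative_eq_intros DERIV_chain'[OF _ \<rho>_deriv])
        show "isCont (\<lambda>y. pd 1 \<rho> (s - y)) y" for y
        proof -
          have "continuous_on UNIV (\<lambda>y. pd 1 \<rho> (s - y))"
            by (intro continuous_on_compose2[OF \<rho>_cont(2)[of UNIV]] continuous_intros) auto
          then show ?thesis by (simp add: continuous_on_eq_continuous_at)
        qed
      qed (use t in auto)
      finally show ?thesis by simp
    qed
    have k_cont: "continuous_on {c..d} k" using cd by (intro continuous_on_subset[OF k]) auto
    have \<rho>t: "continuous_on {c..d} (\<lambda>s. \<rho> (s - x))" for x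
      by (intro continuous_on_compose2[OF \<rho>_cont(1)[of UNIV]] continuous_intros) auto
    have int: "(\<lambda>s. \<rho> (s - x)) integrable_on {c..d}" "(\<lambda>s. \<rho> (s - x) * k s) integrable_on {c..d}" for x
      by (intro integrable_continuous_interval continuous_intros \<rho>t k_cont)+
    \<comment> \<open>Unnormalized averages: \<open>A\<close> is the mass of the translated bump,
      \<open>J\<close> its pairing with \<open>k\<close>. The masses at t1 and t2 agree because the
      derivative of \<open>\<theta>\<close> integrates to zero.\<close>
    define A where "A x = integral {c..d} (\<lambda>s. \<rho> (s - x))" for x
    define J where "J x = integral {c..d} (\<lambda>s. \<rho> (s - x) * k s)" for x
    have J: "J t1 = J t2"
      using zero[OF \<theta> cd(1) less_imp_le[OF cd(2)] \<theta>0] int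
      by (simp add: J_def \<theta>' left_diff_distrib integral_diff)
    have "(pd 1 \<theta> has_integral \<theta> d - \<theta> c) {c..d}"
    proof (rule fundamental_theorem_of_calculus)
      show "(\<theta> has_vector_derivative pd 1 \<theta> s) (at s within {c..d})" for s
        using has_field_derivative_at_within[OF smooth_has_real_derivative[OF \<theta>_smooth]]
        by (simp add: has_real_derivative_iff_has_vector_derivative)
    qed (use cd in auto)
    then have A_eq: "A t1 = A t2"
      using \<theta>0[of c] \<theta>0[of d] int by (auto simp: A_def \<theta>'[abs_def] integral_diff dest!: integral_unique)
    have A_pos: "A t1 > 0"
    proof -
      have "A t1 \<noteq> 0"
      proof
        assume "A t1 = 0"
        then have "\<forall>x\<in>{c..d}. \<rho> (x - t1) = 0"
          unfolding A_def using integral_eq_0_iff[OF \<rho>t[of t1] cd(2)] \<rho>_nn by simp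
        moreover have "t1 \<in> {c..d}" using e t by (auto simp: c_def d_def)
        ultimately have "\<rho> (t1 - t1) = 0" by blast
        moreover have "\<rho> 0 > 0" unfolding \<rho>_def using bump_pos_iff[OF e(1), of "0::real"] e by simp
        ultimately show False by simp
      qed
      moreover have "A t1 \<ge> 0" unfolding A_def by (intro Henstock_Kurzweil_Integration.integral_nonneg int \<rho>_nn)
      ultimately show ?thesis by simp
    qed
    have dev: "\<bar>J x - k x * A x\<bar> \<le> \<eta> * A x" if x: "\<And>s. \<bar>s - x\<bar> < e \<Longrightarrow> \<bar>k s - k x\<bar> \<le> \<eta>" for x
    proof -
      have "J x - k x * A x = integral {c..d} (\<lambda>s. \<rho> (s - x) * k s - k x * \<rho> (s - x))"
        unfolding J_def A_def Henstock_Kurzweil_Integration.integral_mult_right[symmetric]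
        by (rule Henstock_Kurzweil_Integration.integral_diff[symmetric])
          (intro int integrable_continuous_interval continuous_intros \<rho>t)+
      also have "norm \<dots> \<le> integral {c..d} (\<lambda>s. \<eta> * \<rho> (s - x))"
      proof (rule Henstock_Kurzweil_Integration.integral_norm_bound_integral)
        show "(\<lambda>s. \<rho> (s - x) * k s - k x * \<rho> (s - x)) integrable_on {c..d}" "(\<lambda>s. \<eta> * \<rho> (s - x)) integrable_on {c..d}"
          by (intro integrable_continuous_interval continuous_intros \<rho>t k_cont)+
        fix s
        have "\<rho> (s - x) * \<bar>k s - k x\<bar> \<le> \<rho> (s - x) * \<eta>"
          using x[of s] \<rho>0[of "s - x"] \<rho>_nn[of "s - x"] by (cases "\<bar>s - x\<bar> < e") (auto intro: mult_left_mono)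
        moreover have "\<rho> (s - x) * k s - k x * \<rho> (s - x) = \<rho> (s - x) * (k s - k x)" by (simp add: algebra_simps)
        ultimately show "norm (\<rho> (s - x) * k s - k x * \<rho> (s - x)) \<le> \<eta> * \<rho> (s - x)"
          using \<rho>_nn[of "s - x"] by (simp add: abs_mult mult.commute)
      qed
      finally show ?thesis by (simp add: A_def)
    qed
    have "\<bar>J t1 - k t1 * A t1\<bar> \<le> \<eta> * A t1" "\<bar>J t2 - k t2 * A t2\<bar> \<le> \<eta> * A t2"
      using \<delta> e by (auto intro!: dev)
    then have "\<bar>k t1 * A t1 - k t2 * A t1\<bar> \<le> 2 * \<eta> * A t1" unfolding J A_eq by linarith
    then have "\<bar>k t1 - k t2\<bar> * A t1 \<le> 2 * \<eta> * A t1" using A_pos by (simp add: abs_mult flip: left_diff_distrib)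
    then show ?thesis using A_pos by simp
  qed
  show ?thesis
  proof (rule ccontr)
    assume "k t1 \<noteq> k t2"
    then show False using close[of "\<bar>k t1 - k t2\<bar> / 4"] by simp
  qed
qed

lemma C1_L2_sq_int:
  assumes "C1_L2 v v'" "t \<ge> 0"
  shows "in_L2 (v t)" "in_L2 (v' t)" "sq_int (rep (v t))" "sq_int (rep (v' t))"
  using assms by (auto simp: C1_L2_def intro: sq_int_rep)

lemma AE_rep_L2: "in_L2 f \<Longrightarrow> AE x in lborel. f x = rep f x"
  by (rule AE_rep[OF in_L2_measurable])

lemma C1_L2_inner_deriv:
  fixes v v' :: "real \<Rightarrow> real ^ 'n \<Rightarrow> real"
  assumes v: "C1_L2 v v'" and h: "sq_int h" and t: "t \<ge> 0"
  shows "((\<lambda>s. l2_inner (rep (v s)) h) has_real_derivative l2_inner (rep (v' t)) h) (at t within {0..})"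
  unfolding has_field_derivative_iff
proof (rule LIM_zero_cancel, rule Lim_null_comparison)
  let ?Q = "\<lambda>s x. (v s x - v t x) / (s - t) - v' t x"
  have "((\<lambda>s. L2_nrm (?Q s)) \<longlongrightarrow> 0) (at t within {0..})"
    using v t by (simp add: C1_L2_def)
  from tendsto_mult_left_zero[OF this] show "((\<lambda>s. L2_nrm (?Q s) * l2_norm h) \<longlongrightarrow> 0) (at t within {0..})" .
  show "\<forall>\<^sub>F s in at t within {0..}. norm ((l2_inner (rep (v s)) h - l2_inner (rep (v t)) h) / (s - t) - l2_inner (rep (v' t)) h)
      \<le> L2_nrm (?Q s) * l2_norm h"
    unfolding eventually_at_filter
  proof (intro always_eventually allI impI)
    fix s :: real assume "s \<noteq> t" "s \<in> {0..}"
    then have s: "s \<ge> 0" by simp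
    note V = C1_L2_sq_int[OF v s] and V0 = C1_L2_sq_int[OF v t]
    let ?R = "\<lambda>x. 1 / (s - t) * (rep (v s) x - rep (v t) x) - rep (v' t) x"
    have R: "sq_int ?R" by (intro sq_int_diff sq_int_cmult V V0)
    have m: "?Q s \<in> borel_measurable lebesgue"
      using in_L2_measurable[OF V(1)] in_L2_measurable[OF V0(1)] in_L2_measurable[OF V0(2)] by measurable
    have "AE x in lborel. ?Q s x = ?R x"
      using AE_rep_L2[OF V(1)] AE_rep_L2[OF V0(1)] AE_rep_L2[OF V0(2)] by eventually_elim simp
    then have "L2_nrm (?Q s) = l2_norm ?R" by (rule in_L2_iff_sq_int(2)[OF m sq_int_measurable[OF R]])
    moreover have "l2_inner ?R h = (l2_inner (rep (v s)) h - l2_inner (rep (v t)) h) / (s - t) - l2_inner (rep (v' t)) h"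
      using l2_inner_diff[OF sq_int_cmult[OF sq_int_diff[OF V(3) V0(3)], of "1 / (s - t)"] V0(4) h]
      unfolding l2_inner_cmult l2_inner_diff[OF V(3) V0(3) h] by simp
    ultimately show "norm ((l2_inner (rep (v s)) h - l2_inner (rep (v t)) h) / (s - t) - l2_inner (rep (v' t)) h)
      \<le> L2_nrm (?Q s) * l2_norm h"
      using l2_Cauchy_Schwarz[OF R h] by simp
  qed
qed

lemma C1_L2_inner_continuous:
  fixes v v' :: "real \<Rightarrow> real ^ 'n \<Rightarrow> real"
  assumes v: "C1_L2 v v'" and h: "sq_int h"
  shows "continuous_on {0..} (\<lambda>s. l2_inner (rep (v s)) h)" "continuous_on {0..} (\<lambda>s. l2_inner (rep (v' s)) h)"
proof -
  show "continuous_on {0..} (\<lambda>s. l2_inner (rep (v s)) h)"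
    using C1_L2_inner_deriv[OF v h] by (intro DERIV_continuous_on) auto
  show "continuous_on {0..} (\<lambda>s. l2_inner (rep (v' s)) h)"
    unfolding continuous_on
  proof (intro ballI)
    fix t :: real assume "t \<in> {0..}"
    then have t: "t \<ge> 0" by simp
    show "((\<lambda>s. l2_inner (rep (v' s)) h) \<longlongrightarrow> l2_inner (rep (v' t)) h) (at t within {0..})"
    proof (rule LIM_zero_cancel, rule Lim_null_comparison)
      have "((\<lambda>s. L2_nrm (\<lambda>x. v' s x - v' t x)) \<longlongrightarrow> 0) (at t within {0..})"
        using v t by (simp add: C1_L2_def)
      from tendsto_mult_left_zero[OF this]
      show "((\<lambda>s. L2_nrm (\<lambda>x. v' s x - v' t x) * l2_norm h) \<longlongrightarrow> 0) (at t within {0..})" .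
      show "\<forall>\<^sub>F s in at t within {0..}. norm (l2_inner (rep (v' s)) h - l2_inner (rep (v' t)) h)
          \<le> L2_nrm (\<lambda>x. v' s x - v' t x) * l2_norm h"
        unfolding eventually_at_filter
      proof (intro always_eventually allI impI)
        fix s :: real assume "s \<in> {0..}"
        then have s: "s \<ge> 0" by simp
        note V = C1_L2_sq_int[OF v s] and V0 = C1_L2_sq_int[OF v t]
        have R: "sq_int (\<lambda>x. rep (v' s) x - rep (v' t) x)" by (intro sq_int_diff V V0)
        have m: "(\<lambda>x. v' s x - v' t x) \<in> borel_measurable lebesgue"
          using in_L2_measurable[OF V(2)] in_L2_measurable[OF V0(2)] by measurable
        have "AE x in lborel. v' s x - v' t x = rep (v' s) x - rep (v' t) x"
          using AE_rep_L2[OF V(2)] AE_rep_L2[OF V0(2)] by eventually_elim simp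
        then have "L2_nrm (\<lambda>x. v' s x - v' t x) = l2_norm (\<lambda>x. rep (v' s) x - rep (v' t) x)"
          by (rule in_L2_iff_sq_int(2)[OF m sq_int_measurable[OF R]])
        then show "norm (l2_inner (rep (v' s)) h - l2_inner (rep (v' t)) h) \<le> L2_nrm (\<lambda>x. v' s x - v' t x) * l2_norm h"
          using l2_Cauchy_Schwarz[OF R h] V V0 h by (simp add: l2_inner_diff)
      qed
    qed
  qed
qed

lemma lap_cart:
  fixes \<phi> :: "real ^ 'n \<Rightarrow> real"
  shows "lap \<phi> x = (\<Sum>i\<in>UNIV. pd (axis i 1) (pd (axis i 1) \<phi>) x)"
proof -
  have B: "(Basis :: (real ^ 'n) set) = (\<lambda>i. axis i 1) ` UNIV" by (auto simp: Basis_vec_def)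
  have "inj (\<lambda>i. axis i 1 :: real ^ 'n)" by (auto simp: inj_on_def axis_eq_axis)
  then show ?thesis unfolding lap_def B by (simp add: sum.reindex)
qed

lemma test_function_time_space_product:
  fixes \<theta> :: "real \<Rightarrow> real" and \<phi> :: "real ^ 'n \<Rightarrow> real"
  assumes \<theta>: "test_function {0<..} \<theta>" and \<phi>: "test_function UNIV \<phi>"
  shows "test_function ({0<..} \<times> UNIV) (\<lambda>z. \<theta> (fst z) * \<phi> (snd z))"
proof -
  let ?S = "closure {s. \<theta> s \<noteq> 0} \<times> closure {x. \<phi> x \<noteq> 0}"
  have c: "compact ?S" using \<theta> \<phi> by (intro compact_Times) (auto simp: test_function_def)
  have "{z. \<theta> (fst z) * \<phi> (snd z) \<noteq> 0} \<subseteq> ?S"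
  proof
    fix z assume "z \<in> {z. \<theta> (fst z) * \<phi> (snd z) \<noteq> 0}"
    then have "fst z \<in> {s. \<theta> s \<noteq> 0}" "snd z \<in> {x. \<phi> x \<noteq> 0}" by auto
    then show "z \<in> ?S"
      unfolding mem_Times_iff by (intro conjI subsetD[OF closure_subset])
  qed
  then have s: "closure {z. \<theta> (fst z) * \<phi> (snd z) \<noteq> 0} \<subseteq> ?S"
    by (rule closure_minimal) (rule compact_imp_closed[OF c])
  have "smooth (\<lambda>z. \<theta> (fst z) * \<phi> (snd z))"
    by (rule smooth_mult[OF smooth_compose_linear[OF test_function_smooth[OF \<theta>] bounded_linear_fst]
          smooth_compose_linear[OF test_function_smooth[OF \<phi>] bounded_linear_snd]])
  moreover have "compact (closure {z. \<theta> (fst z) * \<phi> (snd z) \<noteq> 0})"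
    using compact_Int_closed[OF c closed_closure[of "{z. \<theta> (fst z) * \<phi> (snd z) \<noteq> 0}"]] s by (simp add: inf.absorb2)
  moreover have "?S \<subseteq> {0<..} \<times> UNIV" using \<theta> by (intro Sigma_mono) (auto simp: test_function_def)
  ultimately show ?thesis using order_trans[OF s] by (simp add: test_function_def)
qed

text \<open>Testing with products theta(t) phi(x) and integrating by parts once, which is legitimate
  since \<open>v\<close> is C1 into L2, leaves theta' paired with \<open>k\<close>. So
  \<open>k\<close> is constant for t > 0, and continuity carries the constant down to t = 0, where
  no test function reaches.\<close>

lemma weak_solution_identity:
  fixes v v' :: "real \<Rightarrow> real ^ 'n \<Rightarrow> real"
  assumes v: "C1_L2 v v'" and eq: "damped_wave_eq v" and \<phi>: "test_function UNIV \<phi>" and t: "t \<ge> 0"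
  shows "l2_inner (rep (v' t)) \<phi> + l2_inner (rep (v t)) \<phi> - integral {0..t} (\<lambda>s. l2_inner (rep (v s)) (lap \<phi>))
    = l2_inner (rep (v' 0)) \<phi> + l2_inner (rep (v 0)) \<phi>"
proof -
  define \<alpha> where "\<alpha> s = l2_inner (rep (v s)) \<phi>" for s
  define \<alpha>' where "\<alpha>' s = l2_inner (rep (v' s)) \<phi>" for s
  define \<beta> where "\<beta> s = l2_inner (rep (v s)) (lap \<phi>)" for s
  \<comment> \<open>A primitive of \<open>\<beta>\<close>, so that the term with
    \<open>\<theta>\<close> itself also integrates by parts to one with its derivative.\<close>
  define B where "B s = integral {0..s} \<beta>" for s
  define k where "k s = \<alpha>' s + \<alpha> s - B s" for s
  note P = test_function_sq_int[OF \<phi>] test_function_sq_int[OF test_function_lap[OF \<phi>]]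
  have \<alpha>d: "(\<alpha> has_real_derivative \<alpha>' s) (at s within {0..})" if "s \<ge> 0" for s
    unfolding \<alpha>_def \<alpha>'_def by (rule C1_L2_inner_deriv[OF v P(1) that])
  have cont: "continuous_on {0..} \<alpha>" "continuous_on {0..} \<alpha>'" "continuous_on {0..} \<beta>"
    unfolding \<alpha>_def \<alpha>'_def \<beta>_def by (intro C1_L2_inner_continuous[OF v] P)+
  have Bd: "(B has_real_derivative \<beta> s) (at s within {0..d})" if "0 \<le> s" "s \<le> d" for s d
  proof -
    have "(B has_vector_derivative \<beta> s) (at s within {0..d})"
      unfolding B_def by (rule integral_has_vector_derivative) (use that cont(3) in \<open>auto intro: continuous_on_subset\<close>)
    then show ?thesis by (simp add: has_real_derivative_iff_has_vector_derivative)
  qed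
  have B_cont: "continuous_on {0..} B"
    unfolding continuous_on_eq_continuous_within
  proof
    fix s :: real assume s: "s \<in> {0..}"
    have "continuous (at s within {0..s + 1}) B"
      using Bd[of s "s + 1"] s by (intro DERIV_continuous) auto
    moreover have "at s within {0..s + 1} = at s within {0..}"
      by (rule at_within_nhd[of s "{..<s + 1}"]) auto
    ultimately show "continuous (at s within {0..}) B" by simp
  qed
  have k_cont: "continuous_on {0..} k" unfolding k_def by (intro continuous_intros cont B_cont)
  have const: "k t1 = k t2" if "0 < t1" "t1 < t2" for t1 t2
  proof (rule du_Bois_Reymond[OF _ _ that])
    show "continuous_on {0<..} k" by (rule continuous_on_subset[OF k_cont]) auto
    fix \<theta> :: "real \<Rightarrow> real" and c d :: real
    assume \<theta>: "test_function {0<..} \<theta>" and cd: "0 < c" "c \<le> d" and \<theta>0: "\<And>t. t \<notin> {c<..<d} \<Longrightarrow> \<theta> t = 0"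
    have one: "(1::real) \<in> Basis" by simp
    have sm: "smooth \<theta>" "smooth (pd 1 \<theta>)" "smooth (pd 1 (pd 1 \<theta>))"
      using smooth_pd[OF _ one] test_function_smooth[OF \<theta>] by auto
    note \<theta>d = smooth_has_real_derivative[OF sm(1)] and \<theta>dd = smooth_has_real_derivative[OF sm(2)]
    have \<theta>_cont: "continuous_on S \<theta>" "continuous_on S (pd 1 \<theta>)" "continuous_on S (pd 1 (pd 1 \<theta>))" for S
      by (intro smooth_continuous sm)+
    have "x \<in> {c..d}" if "\<theta> x \<noteq> 0" for x using \<theta>0[of x] that by (cases "x \<in> {c<..<d}") auto
    then have cl: "closure {x. \<theta> x \<noteq> 0} \<subseteq> {c..d}" by (intro closure_minimal) auto
    have out: "pd 1 \<theta> s = 0" "pd 1 (pd 1 \<theta>) s = 0" if "s \<notin> {c..d}" for s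
    proof -
      show "pd 1 \<theta> s = 0" using that cl pd_support[of 1 \<theta>] closure_subset[of "{x. pd 1 \<theta> x \<noteq> 0}"] by blast
      show "pd 1 (pd 1 \<theta>) s = 0"
        using that cl pd_support[of 1 \<theta>] pd_support[of 1 "pd 1 \<theta>"] closure_subset[of "{x. pd 1 (pd 1 \<theta>) x \<noteq> 0}"] by blast
    qed
    \<comment> \<open>At the end points \<open>\<theta>\<close> vanishes by hypothesis, and its
      derivative by continuity from outside [c, d].\<close>
    have bd: "\<theta> c = 0" "\<theta> d = 0" "pd 1 \<theta> c = 0" "pd 1 \<theta> d = 0"
    proof -
      show "\<theta> c = 0" "\<theta> d = 0" using \<theta>0 by auto
      have "pd 1 \<theta> x = 0" if "x \<in> closure {..<c}" for x
        by (rule continuous_constant_on_closure[OF \<theta>_cont(2) _ that]) (auto intro: out)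
      then show "pd 1 \<theta> c = 0" by simp
      have "pd 1 \<theta> x = 0" if "x \<in> closure {d<..}" for x
        by (rule continuous_constant_on_closure[OF \<theta>_cont(2) _ that]) (auto intro: out)
      then show "pd 1 \<theta> d = 0" by simp
    qed
    define p where "p s = (pd 1 (pd 1 \<theta>) s - pd 1 \<theta> s) * \<alpha> s - \<theta> s * \<beta> s" for s
    let ?\<psi> = "\<lambda>z. \<theta> (fst z) * \<phi> (snd z)"
    note \<phi>d = smooth_differentiable[OF test_function_smooth[OF \<phi>]]
    have \<phi>i: "pd (axis i 1) \<phi> differentiable (at x)" for i x
      by (intro smooth_differentiable smooth_pd test_function_smooth[OF \<phi>] axis_Basis)
    have 1: "ptime ?\<psi> = (\<lambda>z. pd 1 \<theta> (fst z) * \<phi> (snd z))"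
      unfolding ptime_def by (rule pd_time_space_product[OF \<theta>d \<phi>d])
    have 2: "ptime (ptime ?\<psi>) = (\<lambda>z. pd 1 (pd 1 \<theta>) (fst z) * \<phi> (snd z))"
      unfolding 1 unfolding ptime_def by (rule pd_time_space_product[OF \<theta>dd \<phi>d])
    have 3: "pspace i (pspace i ?\<psi>) = (\<lambda>z. \<theta> (fst z) * pd (axis i 1) (pd (axis i 1) \<phi>) (snd z))" for i
      unfolding pspace_def pd_time_space_product(2)[OF \<theta>d \<phi>d] by (rule pd_time_space_product(2)[OF \<theta>d \<phi>i])
    have L: "ptime (ptime ?\<psi>) (s, x) - laplacian ?\<psi> (s, x) - ptime ?\<psi> (s, x)
        = (pd 1 (pd 1 \<theta>) s - pd 1 \<theta> s) * \<phi> x - \<theta> s * lap \<phi> x" for s x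
      unfolding 2 laplacian_def 3 unfolding 1 by (simp add: lap_cart sum_distrib_left left_diff_distrib)
    have inner: "(LINT x|lebesgue. v s x * (ptime (ptime ?\<psi>) (s, x) - laplacian ?\<psi> (s, x) - ptime ?\<psi> (s, x))) = p s"
      if s: "s \<ge> 0" for s
    proof -
      note V = C1_L2_sq_int[OF v s]
      have h: "sq_int (\<lambda>x. (pd 1 (pd 1 \<theta>) s - pd 1 \<theta> s) * \<phi> x)" "sq_int (\<lambda>x. \<theta> s * lap \<phi> x)"
        by (intro sq_int_cmult P)+
      have "(LINT x|lebesgue. v s x * ((pd 1 (pd 1 \<theta>) s - pd 1 \<theta> s) * \<phi> x - \<theta> s * lap \<phi> x)) =
          l2_inner (rep (v s)) (\<lambda>x. (pd 1 (pd 1 \<theta>) s - pd 1 \<theta> s) * \<phi> x - \<theta> s * lap \<phi> x)"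
        by (rule integral_lebesgue_mult_test[OF in_L2_measurable[OF V(1)] sq_int_measurable[OF V(3)] AE_rep_L2[OF V(1)]])
          (rule sq_int_measurable[OF sq_int_diff[OF h]])
      also have "\<dots> = p s"
        unfolding l2_inner_commute[of "rep (v s)"] l2_inner_diff[OF h V(3)] l2_inner_cmult
        by (simp add: p_def \<alpha>_def \<beta>_def l2_inner_commute)
      finally show ?thesis unfolding L .
    qed
    have p_cont: "continuous_on {c..d} p"
      unfolding p_def using cd by (intro continuous_intros \<theta>_cont continuous_on_subset[OF cont(1)] continuous_on_subset[OF cont(3)]) auto
    have "0 = (LINT s:{0<..}|lebesgue. (LINT x|lebesgue. v s x * (ptime (ptime ?\<psi>) (s, x) - laplacian ?\<psi> (s, x) - ptime ?\<psi> (s, x))))"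
      using eq test_function_time_space_product[OF \<theta> \<phi>] unfolding damped_wave_eq_def by simp
    also have "\<dots> = (LINT s:{c..d}|lebesgue. p s)"
      unfolding set_lebesgue_integral_def
    proof (intro Bochner_Integration.integral_cong refl)
      fix s
      show "indicator {0<..} s *\<^sub>R (LINT x|lebesgue. v s x * (ptime (ptime ?\<psi>) (s, x) - laplacian ?\<psi> (s, x) - ptime ?\<psi> (s, x)))
          = indicator {c..d} s *\<^sub>R p s"
      proof (cases "s \<in> {c..d}")
        case True
        then show ?thesis using cd inner[of s] by simp
      next
        case False
        then have "s \<notin> {c<..<d}" by auto
        then have "p s = 0" using out[OF False] \<theta>0[of s] by (simp add: p_def)
        then show ?thesis using inner[of s] False by (cases "s > 0") simp_all
      qed
    qed
    also have "\<dots> = integral {c..d} p"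
      by (rule set_lebesgue_integral_eq_integral(2)[OF absolutely_integrable_continuous_real[OF p_cont]])
    finally have p0: "integral {c..d} p = 0" by simp
    \<comment> \<open>A primitive of p + theta' k is theta' alpha - theta B, which vanishes at both
      ends; p alone integrates to 0 by the weak equation.\<close>
    have "((\<lambda>s. p s + pd 1 \<theta> s * k s) has_integral
        ((pd 1 \<theta> d * \<alpha> d - \<theta> d * B d) - (pd 1 \<theta> c * \<alpha> c - \<theta> c * B c))) {c..d}"
    proof (rule fundamental_theorem_of_calculus)
      fix s assume s: "s \<in> {c..d}"
      have w: "(f has_real_derivative D) (at s within {c..d})" if "(f has_real_derivative D) (at s within {0..})" for f D
        using that cd by (auto intro: DERIV_subset)
      have "(B has_real_derivative \<beta> s) (at s within {c..d})"
        using Bd[of s d] s cd by (auto intro: DERIV_subset)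
      then have "((\<lambda>s. pd 1 \<theta> s * \<alpha> s - \<theta> s * B s) has_real_derivative
          ((pd 1 (pd 1 \<theta>) s * \<alpha> s + \<alpha>' s * pd 1 \<theta> s) - (pd 1 \<theta> s * B s + \<beta> s * \<theta> s))) (at s within {c..d})"
        using s cd by (intro DERIV_diff DERIV_mult w[OF \<alpha>d] has_field_derivative_at_within[OF \<theta>d] has_field_derivative_at_within[OF \<theta>dd]) auto
      moreover have "(pd 1 (pd 1 \<theta>) s * \<alpha> s + \<alpha>' s * pd 1 \<theta> s) - (pd 1 \<theta> s * B s + \<beta> s * \<theta> s) = p s + pd 1 \<theta> s * k s"
        by (simp add: p_def k_def algebra_simps)
      ultimately show "((\<lambda>s. pd 1 \<theta> s * \<alpha> s - \<theta> s * B s) has_vector_derivative (p s + pd 1 \<theta> s * k s)) (at s within {c..d})"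
        by (simp add: has_real_derivative_iff_has_vector_derivative)
    qed (use cd in auto)
    then have "integral {c..d} (\<lambda>s. p s + pd 1 \<theta> s * k s) = 0" using bd by (auto dest: integral_unique)
    moreover have "p integrable_on {c..d}" "(\<lambda>s. pd 1 \<theta> s * k s) integrable_on {c..d}"
      using cd by (auto intro!: integrable_continuous_interval p_cont continuous_intros \<theta>_cont continuous_on_subset[OF k_cont])
    ultimately show "integral {c..d} (\<lambda>s. pd 1 \<theta> s * k s) = 0"
      using p0 by (simp add: integral_add)
  qed
  have k1: "k s = k 1" if "s > 0" for s
  proof (cases s "1::real" rule: linorder_cases)
    case less
    then show ?thesis by (rule const[OF that])
  next
    case greater
    show ?thesis by (rule const[OF zero_less_one greater, symmetric])
  qed simp
  have "k s = k 1" if "s \<ge> 0" for s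
  proof (rule continuous_constant_on_closure[where f=k and S="{0<..}" and x=s])
    show "continuous_on (closure {0<..}) k" using k_cont by simp
    show "k x = k 1" if "x \<in> {0<..}" for x by (rule k1) (use that in simp)
    show "s \<in> closure {0<..}" using that by simp
  qed
  from this[OF t] this[OF order_refl] have "k t = k 0" by metis
  moreover have "B 0 = 0" by (simp add: B_def)
  ultimately show ?thesis by (simp add: k_def \<alpha>_def \<alpha>'_def \<beta>_def[abs_def] B_def)
qed

section \<open>Vanishing of the difference of two solutions\<close>

text \<open>Picard iteration. The equation for \<open>p\<close> involves the functional of
  \<open>nx p\<close>, so no single Gronwall inequality closes; the bound is improved for all of
  \<open>P\<close> at once. Each round costs a factor \<open>Q\<close> and gains t / (n + 1) by
  integration in time, so the factorial wins.\<close>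

lemma damped_iteration_zero:
  fixes a a' :: "'p \<Rightarrow> real \<Rightarrow> real" and N :: "'p \<Rightarrow> real"
  assumes T: "0 \<le> T" and Q: "0 \<le> Q" and C: "0 \<le> C"
    and P: "\<And>p. p \<in> P \<Longrightarrow> nx p \<in> P" and N: "\<And>p. p \<in> P \<Longrightarrow> N (nx p) \<le> Q * N p" "\<And>p. 0 \<le> N p"
    and bd: "\<And>p t. p \<in> P \<Longrightarrow> 0 \<le> t \<Longrightarrow> t \<le> T \<Longrightarrow> \<bar>a p t\<bar> \<le> C * N p"
    and der: "\<And>p t. p \<in> P \<Longrightarrow> 0 \<le> t \<Longrightarrow> (a p has_real_derivative a' p t) (at t within {0..})"
    and eq: "\<And>p t. p \<in> P \<Longrightarrow> 0 \<le> t \<Longrightarrow> a' p t + a p t = - integral {0..t} (a (nx p))"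
    and a0: "\<And>p. p \<in> P \<Longrightarrow> a p 0 = 0"
    and p: "p \<in> P"
  shows "a p T = 0"
proof -
  have cont: "continuous_on {0..} (a p)" if "p \<in> P" for p
    using der[OF that] by (intro DERIV_continuous_on) auto
  have claim: "\<bar>a p t\<bar> \<le> C * N p * (Q * T) ^ n * t ^ n / fact n" if "p \<in> P" "0 \<le> t" "t \<le> T" for n p t
    using that
  proof (induction n arbitrary: p t)
    case 0
    then show ?case using bd by simp
  next
    case (Suc n)
    note p = Suc.prems(1)
    define c where "c = C * N p * (Q * T) ^ Suc n"
    have c0: "0 \<le> c" unfolding c_def using C N(2) Q T by simp
    \<comment> \<open>The bound to be proved; its derivative is the bound on a' + a that the
      induction hypothesis yields.\<close>
    define G where "G s = c * s ^ Suc n / fact (Suc n)" for s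
    have G: "(G has_real_derivative c * s ^ n / fact n) (at s)" for s
    proof -
      have "(G has_real_derivative c * (real (Suc n) * s ^ n) / fact (Suc n)) (at s)"
      proof -
        have "((\<lambda>s. s ^ Suc n) has_real_derivative real (Suc n) * s ^ n) (at s)"
          using DERIV_pow[of "Suc n" s] by simp
        from DERIV_cdivide[OF DERIV_cmult[OF this]] show ?thesis unfolding G_def .
      qed
      moreover have "c * (real (Suc n) * s ^ n) / fact (Suc n) = c * s ^ n / fact n"
        by (simp add: divide_simps)
      ultimately show ?thesis by simp
    qed
    have b: "\<bar>a' p s + a p s\<bar> \<le> c * s ^ n / fact n" if s: "0 \<le> s" "s \<le> T" for s
    proof -
      define D where "D = C * (Q * N p) * (Q * T) ^ n * s ^ n / fact n"
      have "norm (integral {0..s} (a (nx p))) \<le> D * (s - 0)"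
      proof (rule integral_bound)
        show "continuous_on {0..s} (a (nx p))" by (rule continuous_on_subset[OF cont[OF P[OF p]]]) auto
        fix x assume x: "x \<in> {0..s}"
        have "\<bar>a (nx p) x\<bar> \<le> C * N (nx p) * (Q * T) ^ n * x ^ n / fact n"
          using x s by (intro Suc.IH P p) auto
        also have "\<dots> \<le> D" unfolding D_def
          using x s C Q T N p by (intro divide_right_mono mult_mono power_mono mult_nonneg_nonneg) auto
        finally show "norm (a (nx p) x) \<le> D" by simp
      qed (use s in auto)
      \<comment> \<open>Of the two time integrations this one is estimated crudely by
        \<open>T\<close>; the other one supplies the factorial.\<close>
      also have "\<dots> \<le> D * T" unfolding D_def using s C Q T N(2) by (intro mult_left_mono) auto
      also have "D * T = c * s ^ n / fact n" by (simp add: D_def c_def mult_ac)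
      finally show ?thesis using eq[OF p s(1)] by simp
    qed
    have at: "at s within {0..} = at s" if "s > 0" for s :: real
      using that by (intro at_within_interior) simp
    \<comment> \<open>The signs e = 1 and e = -1 give the two-sided bound. The integrating factor
      turns a' + a into a derivative, and the extra term from differentiating it against
      \<open>G\<close> is nonnegative.\<close>
    have main: "0 \<le> exp t * (G t - e * a p t)" if e: "e \<in> {-1, 1}" for e
    proof -
      have "exp 0 * (G 0 - e * a p 0) \<le> exp t * (G t - e * a p t)"
      proof (rule DERIV_nonneg_imp_increasing_open[OF Suc.prems(2)])
        fix s assume s: "0 < s" "s < t"
        have "(a p has_real_derivative a' p s) (at s)" using der[OF p, of s] at[OF s(1)] s by simp
        then have "((\<lambda>s. exp s * (G s - e * a p s)) has_real_derivative
            exp s * ((c * s ^ n / fact n - e * a' p s) + (G s - e * a p s))) (at s)"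
          by (auto intro!: derivative_eq_intros G simp: algebra_simps)
        moreover have "0 \<le> exp s * ((c * s ^ n / fact n - e * a' p s) + (G s - e * a p s))"
        proof -
          have "0 \<le> G s" using c0 s by (simp add: G_def)
          moreover have "e * (a' p s + a p s) \<le> c * s ^ n / fact n"
            using b[of s] e s Suc.prems by auto
          ultimately have "0 \<le> (c * s ^ n / fact n - e * a' p s) + (G s - e * a p s)"
            by (simp add: distrib_left)
          then show ?thesis by simp
        qed
        ultimately show "\<exists>y. ((\<lambda>s. exp s * (G s - e * a p s)) has_real_derivative y) (at s) \<and> 0 \<le> y" by blast
      next
        have "continuous_on {0..t} G" using G by (intro DERIV_continuous_on) (auto intro: has_field_derivative_at_within)
        moreover have "continuous_on {0..t} (a p)" by (rule continuous_on_subset[OF cont[OF p]]) auto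
        ultimately show "continuous_on {0..t} (\<lambda>s. exp s * (G s - e * a p s))" by (intro continuous_intros)
      qed
      then show ?thesis using a0[OF p] by (simp add: G_def)
    qed
    have "0 \<le> G t - a p t" "0 \<le> G t + a p t"
      using main[of 1] main[of "-1"] by (simp_all add: zero_le_mult_iff)
    then have "\<bar>a p t\<bar> \<le> G t" by linarith
    then show ?case by (simp only: G_def c_def)
  qed
  have lim: "(\<lambda>n. C * N p * (inverse (fact n) * (Q * T * T) ^ n)) \<longlonglongrightarrow> C * N p * 0"
    by (intro tendsto_mult_left summable_LIMSEQ_zero summable_exp)
  have "\<bar>a p T\<bar> \<le> C * N p * (inverse (fact n) * (Q * T * T) ^ n)" for n
    using claim[OF p T order_refl, of n] by (simp add: power_mult_distrib field_simps)
  then have "\<bar>a p T\<bar> \<le> C * N p * 0" by (intro LIMSEQ_le_const[OF lim]) auto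
  then show ?thesis by simp
qed

text \<open>A bound uniform on [0, T] starts the iteration and controls the passage to the limit
  under the time integral. It comes from compactness, as the L2 norm is continuous in time.\<close>

lemma C0_H1_bounded:
  fixes v :: "real \<Rightarrow> real ^ 'n \<Rightarrow> real"
  assumes v: "C0_H1 v"
  obtains M where "M \<ge> 0" "\<And>s. 0 \<le> s \<Longrightarrow> s \<le> T \<Longrightarrow> l2_norm (rep (v s)) \<le> M"
proof -
  have L2: "in_L2 (v s)" if "s \<ge> 0" for s using v that by (auto simp: C0_H1_def in_H1_def)
  have "continuous_on {0..} (\<lambda>s. l2_norm (rep (v s)))"
    unfolding continuous_on
  proof (intro ballI)
    fix t :: real assume "t \<in> {0..}"
    then have t: "t \<ge> 0" by simp
    show "((\<lambda>s. l2_norm (rep (v s))) \<longlongrightarrow> l2_norm (rep (v t))) (at t within {0..})"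
    proof (rule LIM_zero_cancel, rule Lim_null_comparison)
      show "((\<lambda>s. H1_nrm (\<lambda>x. v s x - v t x)) \<longlongrightarrow> 0) (at t within {0..})" using v t by (simp add: C0_H1_def)
      show "\<forall>\<^sub>F s in at t within {0..}. norm (l2_norm (rep (v s)) - l2_norm (rep (v t))) \<le> H1_nrm (\<lambda>x. v s x - v t x)"
        unfolding eventually_at_filter
      proof (intro always_eventually allI impI)
        fix s :: real assume "s \<in> {0..}"
        then have s: "s \<ge> 0" by simp
        note V = sq_int_rep[OF L2[OF s]] and V0 = sq_int_rep[OF L2[OF t]]
        have m: "(\<lambda>x. v s x - v t x) \<in> borel_measurable lebesgue"
          using in_L2_measurable[OF L2[OF s]] in_L2_measurable[OF L2[OF t]] by measurable
        have "AE x in lborel. v s x - v t x = rep (v s) x - rep (v t) x"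
          using AE_rep_L2[OF L2[OF s]] AE_rep_L2[OF L2[OF t]] by eventually_elim simp
        then have eq: "L2_nrm (\<lambda>x. v s x - v t x) = l2_norm (\<lambda>x. rep (v s) x - rep (v t) x)"
          by (rule in_L2_iff_sq_int(2)[OF m sq_int_measurable[OF sq_int_diff[OF V V0]]])
        have "l2_norm (rep (v s)) \<le> l2_norm (\<lambda>x. rep (v s) x - rep (v t) x) + l2_norm (rep (v t))"
          using l2_norm_triangle[OF sq_int_diff[OF V V0] V0] by simp
        moreover have "l2_norm (rep (v t)) \<le> l2_norm (\<lambda>x. rep (v s) x - rep (v t) x) + l2_norm (rep (v s))"
          using l2_norm_triangle[OF sq_int_diff[OF V0 V] V] by (simp add: l2_norm_minus_commute[of "rep (v t)"])
        moreover have "L2_nrm (\<lambda>x. v s x - v t x) \<le> H1_nrm (\<lambda>x. v s x - v t x)"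
          unfolding H1_nrm_def by (rule real_le_rsqrt) simp
        ultimately show "norm (l2_norm (rep (v s)) - l2_norm (rep (v t))) \<le> H1_nrm (\<lambda>x. v s x - v t x)"
          using eq by simp
      qed
    qed
  qed
  then have "continuous_on {0..T} (\<lambda>s. l2_norm (rep (v s)))" by (rule continuous_on_subset) auto
  from compact_imp_bounded[OF compact_continuous_image[OF this compact_Icc]]
  obtain M where M: "\<And>y. y \<in> (\<lambda>s. l2_norm (rep (v s))) ` {0..T} \<Longrightarrow> norm y \<le> M"
    unfolding bounded_iff by blast
  have "l2_norm (rep (v s)) \<le> \<bar>M\<bar>" if "0 \<le> s" "s \<le> T" for s
    using M[of "l2_norm (rep (v s))"] that by auto
  then show thesis by (intro that[of "\<bar>M\<bar>"]) auto
qed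

text \<open>The difference \<open>Z\<close> is paired with transforms of m p, where p lives in a
  frequency ball. On such p the Laplacian is multiplication by -|xi|^2, of norm at most R^2, so
  \<open>damped_iteration_zero\<close> applies. Taking p as a cut-off of m times the transform of
  \<open>Z T\<close> makes the pairing a squared norm.\<close>

lemma weak_solution_unique:
  fixes u0 u1 :: "real ^ 'n \<Rightarrow> real"
  assumes v: "weak_solution u0 u1 v" and w: "weak_solution u0 u1 w" and T: "T \<ge> 0"
  shows "AE x in lebesgue. v T x = w T x"
proof -
  obtain v' where v': "C1_L2 v v'" "AE x in lebesgue. v' 0 x = u1 x" and v0: "AE x in lebesgue. v 0 x = u0 x"
    and v1: "C0_H1 v" "damped_wave_eq v" using v unfolding weak_solution_def by blast
  obtain w' where w': "C1_L2 w w'" "AE x in lebesgue. w' 0 x = u1 x" and w0: "AE x in lebesgue. w 0 x = u0 x"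
    and w1: "C0_H1 w" "damped_wave_eq w" using w unfolding weak_solution_def by blast
  define Z where "Z t x = rep (v t) x - rep (w t) x" for t x
  define Z' where "Z' t x = rep (v' t) x - rep (w' t) x" for t x
  have Z: "sq_int (Z t)" "sq_int (Z' t)" if "t \<ge> 0" for t
    unfolding Z_def Z'_def using C1_L2_sq_int[OF v'(1) that] C1_L2_sq_int[OF w'(1) that] by (auto intro: sq_int_diff)
  have Z_inner: "l2_inner (Z t) h = l2_inner (rep (v t)) h - l2_inner (rep (w t)) h"
    "l2_inner (Z' t) h = l2_inner (rep (v' t)) h - l2_inner (rep (w' t)) h" if "t \<ge> 0" "sq_int h" for t h
    unfolding Z_def Z'_def using C1_L2_sq_int[OF v'(1) that(1)] C1_L2_sq_int[OF w'(1) that(1)] that(2)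
    by (auto intro: l2_inner_diff)
  have init: "l2_inner (Z 0) h = 0" "l2_inner (Z' 0) h = 0" for h
  proof -
    note V = C1_L2_sq_int[OF v'(1) order_refl] and W = C1_L2_sq_int[OF w'(1) order_refl]
    have "AE x in lborel. Z 0 x * h x = 0"
      using AE_rep_L2[OF V(1)] AE_rep_L2[OF W(1)] v0[unfolded AE_completion_iff] w0[unfolded AE_completion_iff]
      by eventually_elim (simp add: Z_def)
    then show "l2_inner (Z 0) h = 0" unfolding l2_inner_def by (rule integral_eq_zero_AE)
    have "AE x in lborel. Z' 0 x * h x = 0"
      using AE_rep_L2[OF V(2)] AE_rep_L2[OF W(2)] v'(2)[unfolded AE_completion_iff] w'(2)[unfolded AE_completion_iff]
      by eventually_elim (simp add: Z'_def)
    then show "l2_inner (Z' 0) h = 0" unfolding l2_inner_def by (rule integral_eq_zero_AE)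
  qed
  have Z_cont: "continuous_on {0..} (\<lambda>s. l2_inner (Z s) h)" if h: "sq_int h" for h
  proof -
    have "continuous_on {0..} (\<lambda>s. l2_inner (rep (v s)) h - l2_inner (rep (w s)) h)"
      by (intro continuous_intros C1_L2_inner_continuous[OF v'(1) h] C1_L2_inner_continuous[OF w'(1) h])
    then show ?thesis by (rule continuous_on_eq) (simp add: Z_inner h)
  qed
  have Z_der: "((\<lambda>s. l2_inner (Z s) h) has_real_derivative l2_inner (Z' t) h) (at t within {0..})" if t: "t \<ge> 0" and h: "sq_int h" for t h
  proof -
    have "((\<lambda>s. l2_inner (rep (v s)) h - l2_inner (rep (w s)) h) has_real_derivative l2_inner (Z' t) h) (at t within {0..})"
      unfolding Z_inner(2)[OF t h]
      by (intro DERIV_diff C1_L2_inner_deriv[OF v'(1) h t] C1_L2_inner_deriv[OF w'(1) h t])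
    then show ?thesis
      by (rule has_field_derivative_transform_within[where d=1]) (use t Z_inner(1) h in auto)
  qed
  have identity: "l2_inner (Z' t) \<phi> + l2_inner (Z t) \<phi> = integral {0..t} (\<lambda>s. l2_inner (Z s) (lap \<phi>))"
    if \<phi>: "test_function UNIV \<phi>" and t: "t \<ge> 0" for \<phi> t
  proof -
    note P = test_function_sq_int[OF \<phi>] and L = test_function_sq_int[OF test_function_lap[OF \<phi>]]
    have i: "(\<lambda>s. l2_inner (rep (v s)) (lap \<phi>)) integrable_on {0..t}" "(\<lambda>s. l2_inner (rep (w s)) (lap \<phi>)) integrable_on {0..t}"
      by (intro integrable_continuous_interval continuous_on_subset[OF C1_L2_inner_continuous(1)[OF v'(1) L]]
          continuous_on_subset[OF C1_L2_inner_continuous(1)[OF w'(1) L]]; auto)+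
    have "integral {0..t} (\<lambda>s. l2_inner (Z s) (lap \<phi>)) =
        integral {0..t} (\<lambda>s. l2_inner (rep (v s)) (lap \<phi>) - l2_inner (rep (w s)) (lap \<phi>))"
      by (intro Henstock_Kurzweil_Integration.integral_cong) (simp add: Z_inner L)
    also have "\<dots> = integral {0..t} (\<lambda>s. l2_inner (rep (v s)) (lap \<phi>)) - integral {0..t} (\<lambda>s. l2_inner (rep (w s)) (lap \<phi>))"
      by (rule Henstock_Kurzweil_Integration.integral_diff[OF i])
    finally show ?thesis
      using weak_solution_identity[OF v'(1) v1(2) \<phi> t] weak_solution_identity[OF w'(1) w1(2) \<phi> t]
        Z_inner[OF t P] Z_inner[OF order_refl P] init[of \<phi>] by linarith
  qed
  define Y where "Y = l2_hartley (Z T)"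
  have Y: "sq_int Y" unfolding Y_def by (rule sq_int_l2_hartley[OF Z(1)[OF T]])
  have main: "AE \<xi> in lborel. norm \<xi> \<le> R \<longrightarrow> Y \<xi> = 0" if R: "R > 0" for R
  proof -
    obtain m :: "real ^ 'n \<Rightarrow> real" and K where m [measurable]: "m \<in> borel_measurable borel"
      and K: "\<And>\<xi>. \<bar>m \<xi>\<bar> \<le> K" "\<And>\<xi>. (norm \<xi>)\<^sup>2 * \<bar>m \<xi>\<bar> \<le> K"
      and pos: "\<And>\<xi>. norm \<xi> \<le> R \<Longrightarrow> m \<xi> > 0"
      and ex: "\<And>g k. sq_int g \<Longrightarrow> \<exists>\<phi>. test_function UNIV \<phi> \<and>
        (\<forall>\<xi>. hartley \<phi> \<xi> = m \<xi> * hartley (\<lambda>x. indicator (ball 0 (real k)) x * g x) \<xi>)"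
      by (rule test_function_multiplier[OF R], rule that)
    have K0: "K \<ge> 0" using K(1)[of 0] by linarith
    have mult: "sq_int (\<lambda>\<xi>. m \<xi> * p \<xi>)" "l2_norm (\<lambda>\<xi>. m \<xi> * p \<xi>) \<le> K * l2_norm p"
      "sq_int (\<lambda>\<xi>. (norm \<xi>)\<^sup>2 * m \<xi> * p \<xi>)" "l2_norm (\<lambda>\<xi>. (norm \<xi>)\<^sup>2 * m \<xi> * p \<xi>) \<le> K * l2_norm p" if p: "sq_int p" for p
    proof -
      note [measurable] = sq_int_measurable[OF p]
      show s: "sq_int (\<lambda>\<xi>. m \<xi> * p \<xi>)" by (rule sq_int_mult_bounded[OF p m K(1)])
      have m2: "(\<lambda>\<xi>. (norm \<xi>)\<^sup>2 * m \<xi>) \<in> borel_measurable borel" by measurable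
      have K2: "\<bar>(norm \<xi>)\<^sup>2 * m \<xi>\<bar> \<le> K" for \<xi> using K(2)[of \<xi>] by (simp add: abs_mult)
      show s2: "sq_int (\<lambda>\<xi>. (norm \<xi>)\<^sup>2 * m \<xi> * p \<xi>)" by (rule sq_int_mult_bounded[OF p m2 K2])
      have "l2_norm (\<lambda>\<xi>. m \<xi> * p \<xi>) \<le> l2_norm (\<lambda>\<xi>. K * p \<xi>)"
        using K(1) K0 by (intro l2_norm_mono_AE sq_int_cmult p sq_int_measurable[OF s] AE_I2)
          (auto simp: abs_mult intro!: mult_right_mono)
      then show "l2_norm (\<lambda>\<xi>. m \<xi> * p \<xi>) \<le> K * l2_norm p" using K0 by (simp add: l2_norm_cmult)
      have "l2_norm (\<lambda>\<xi>. (norm \<xi>)\<^sup>2 * m \<xi> * p \<xi>) \<le> l2_norm (\<lambda>\<xi>. K * p \<xi>)"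
        using K(2) K0 by (intro l2_norm_mono_AE sq_int_cmult p sq_int_measurable[OF s2] AE_I2)
          (auto simp: abs_mult intro!: mult_right_mono)
      then show "l2_norm (\<lambda>\<xi>. (norm \<xi>)\<^sup>2 * m \<xi> * p \<xi>) \<le> K * l2_norm p" using K0 by (simp add: l2_norm_cmult)
    qed
    \<comment> \<open>The transform of m p is in general only an L2 limit of test functions, so
      these pairings inherit the integrated equation through a limit.\<close>
    define a where "a p t = l2_inner (Z t) (l2_hartley (\<lambda>\<xi>. m \<xi> * p \<xi>))" for p t
    define a' where "a' p t = l2_inner (Z' t) (l2_hartley (\<lambda>\<xi>. m \<xi> * p \<xi>))" for p t
    define nx where "nx p \<xi> = (norm \<xi>)\<^sup>2 * p \<xi>" for p :: "real ^ 'n \<Rightarrow> real" and \<xi>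
    define P where "P = {p :: real ^ 'n \<Rightarrow> real. sq_int p \<and> (\<forall>\<xi>. norm \<xi> > R \<longrightarrow> p \<xi> = 0)}"
    have Psq: "sq_int p" if "p \<in> P" for p using that by (simp add: P_def)
    have nx_le: "\<bar>nx p \<xi>\<bar> \<le> \<bar>R\<^sup>2 * p \<xi>\<bar>" if "p \<in> P" for p \<xi>
    proof (cases "norm \<xi> > R")
      case False
      then have "(norm \<xi>)\<^sup>2 \<le> R\<^sup>2" by (intro power_mono) auto
      then show ?thesis by (simp add: nx_def abs_mult mult_right_mono)
    qed (use that in \<open>auto simp: P_def nx_def\<close>)
    have nx_m: "nx p \<in> borel_measurable borel" if "p \<in> P" for p
      unfolding nx_def using sq_int_measurable[OF Psq[OF that]] by measurable
    have nx: "nx p \<in> P" "l2_norm (nx p) \<le> R\<^sup>2 * l2_norm p" if p: "p \<in> P" for p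
    proof -
      have "sq_int (nx p)" by (rule sq_int_bound[OF sq_int_cmult[OF Psq[OF p]] nx_m[OF p]]) (use nx_le[OF p] in auto)
      then show "nx p \<in> P" using p by (auto simp: P_def nx_def)
      have "l2_norm (nx p) \<le> l2_norm (\<lambda>\<xi>. R\<^sup>2 * p \<xi>)"
        by (rule l2_norm_mono_AE[OF sq_int_cmult[OF Psq[OF p]] nx_m[OF p]]) (use nx_le[OF p] in auto)
      then show "l2_norm (nx p) \<le> R\<^sup>2 * l2_norm p" by (simp add: l2_norm_cmult)
    qed
    have T_mult: "sq_int (l2_hartley (\<lambda>\<xi>. m \<xi> * p \<xi>))" if "p \<in> P" for p
      by (rule sq_int_l2_hartley[OF mult(1)[OF Psq[OF that]]])
    have bounded: "\<exists>M\<ge>0. \<forall>s. 0 \<le> s \<longrightarrow> s \<le> t \<longrightarrow> l2_norm (Z s) \<le> M" for t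
    proof -
      obtain M1 where M1: "M1 \<ge> 0" "\<And>s. 0 \<le> s \<Longrightarrow> s \<le> t \<Longrightarrow> l2_norm (rep (v s)) \<le> M1"
        using C0_H1_bounded[OF v1(1), of t] by metis
      obtain M2 where M2: "M2 \<ge> 0" "\<And>s. 0 \<le> s \<Longrightarrow> s \<le> t \<Longrightarrow> l2_norm (rep (w s)) \<le> M2"
        using C0_H1_bounded[OF w1(1), of t] by metis
      have "l2_norm (Z s) \<le> M1 + M2" if s: "0 \<le> s" "s \<le> t" for s
        unfolding Z_def
        using l2_norm_triangle_diff[OF C1_L2_sq_int(3)[OF v'(1) s(1)] C1_L2_sq_int(3)[OF w'(1) s(1)]] M1(2)[OF s] M2(2)[OF s]
        by linarith
      then show ?thesis using M1(1) M2(1) by (intro exI[of _ "M1 + M2"]) auto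
    qed
    have a_eq: "a' p t + a p t = - integral {0..t} (a (nx p))" if p: "p \<in> P" and t: "t \<ge> 0" for p t
    proof -
      note ps = Psq[OF p] and qs = Psq[OF nx(1)[OF p]]
      note Tp = sq_int_l2_hartley[OF ps]
      \<comment> \<open>Truncations of the transform of \<open>p\<close>. The multiplier lemma makes
        them into test functions \<open>\<phi> k\<close> whose transforms, m times that of
        \<open>g k\<close>, tend to m p in L2.\<close>
      define g where "g k x = indicator (ball 0 (real k)) x * l2_hartley p x" for k x
      have g: "integrable lborel (g k)" "sq_int (g k)" for k
        unfolding g_def using Tp by (auto intro: integrable_truncation sq_int_indicator)
      note Hg = hartley_contraction(1)[OF g]
      have g_lim: "(\<lambda>k. l2_norm (\<lambda>x. hartley (g k) x - p x)) \<longlonglongrightarrow> 0"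
      proof -
        have "l2_norm (\<lambda>x. hartley (g k) x - p x) = l2_norm (\<lambda>x. g k x - l2_hartley p x)" for k
        proof -
          have d: "sq_int (\<lambda>x. g k x - l2_hartley p x)" by (rule sq_int_diff[OF g(2) Tp])
          have "AE x in lborel. hartley (g k) x - p x = l2_hartley (\<lambda>x. g k x - l2_hartley p x) x"
            using l2_hartley_eq_hartley[OF g[of k]] l2_hartley_involution[OF ps] l2_hartley_diff[OF g(2)[of k] Tp]
            by eventually_elim simp
          then have "l2_norm (\<lambda>x. hartley (g k) x - p x) = l2_norm (l2_hartley (\<lambda>x. g k x - l2_hartley p x))"
            by (intro l2_norm_cong_AE sq_int_measurable[OF sq_int_diff[OF Hg ps]] sq_int_measurable[OF sq_int_l2_hartley[OF d]])
          then show ?thesis by (simp add: l2_norm_l2_hartley[OF d])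
        qed
        then show ?thesis using l2_truncation_tendsto[OF Tp] by (simp add: g_def)
      qed
      have "\<exists>\<phi>. test_function UNIV \<phi> \<and> (\<forall>\<xi>. hartley \<phi> \<xi> = m \<xi> * hartley (g k) \<xi>)" for k
        using ex[OF Tp, of k] unfolding g_def .
      then obtain \<phi> where \<phi>: "\<And>k. test_function UNIV (\<phi> k)" "\<And>k \<xi>. hartley (\<phi> k) \<xi> = m \<xi> * hartley (g k) \<xi>" by metis
      have \<phi>_eq: "hartley (\<phi> k) = (\<lambda>\<xi>. m \<xi> * hartley (g k) \<xi>)" for k by (intro ext \<phi>(2))
      have conv: "(\<lambda>k. l2_inner X (\<phi> k)) \<longlonglongrightarrow> l2_inner X (l2_hartley (\<lambda>\<xi>. m \<xi> * p \<xi>))" if X: "sq_int X" for X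
      proof -
        note TX = sq_int_l2_hartley[OF X]
        have "(\<lambda>k. l2_norm (\<lambda>\<xi>. m \<xi> * hartley (g k) \<xi> - m \<xi> * p \<xi>)) \<longlonglongrightarrow> 0"
        proof (rule Lim_null_comparison)
          show "(\<lambda>k. K * l2_norm (\<lambda>x. hartley (g k) x - p x)) \<longlonglongrightarrow> 0" by (rule tendsto_mult_right_zero[OF g_lim])
          show "\<forall>\<^sub>F k in sequentially. norm (l2_norm (\<lambda>\<xi>. m \<xi> * hartley (g k) \<xi> - m \<xi> * p \<xi>)) \<le> K * l2_norm (\<lambda>x. hartley (g k) x - p x)"
            using mult(2)[OF sq_int_diff[OF Hg ps]] by (simp add: right_diff_distrib)
        qed
        from l2_inner_tendsto[OF mult(1)[OF Hg] mult(1)[OF ps] TX this]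
        have "(\<lambda>k. l2_inner (l2_hartley X) (hartley (\<phi> k))) \<longlonglongrightarrow> l2_inner (l2_hartley X) (\<lambda>\<xi>. m \<xi> * p \<xi>)"
          unfolding l2_inner_commute[of "l2_hartley X"] \<phi>_eq .
        then show ?thesis
          by (simp add: l2_inner_test_function(1)[OF X \<phi>(1)] l2_hartley_selfadjoint[OF X mult(1)[OF ps]])
      qed
      have lap_eq: "l2_inner (Z s) (lap (\<phi> k)) = - l2_inner (l2_hartley (Z s)) (\<lambda>\<xi>. (norm \<xi>)\<^sup>2 * m \<xi> * hartley (g k) \<xi>)" if s: "s \<ge> 0" for s k
        unfolding l2_inner_test_function(1)[OF Z(1)[OF s] test_function_lap[OF \<phi>(1)], symmetric]
        by (simp add: l2_inner_def hartley_lap[OF \<phi>(1)] \<phi>(2) mult_ac)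
      have nx_eq: "a (nx p) s = l2_inner (l2_hartley (Z s)) (\<lambda>\<xi>. (norm \<xi>)\<^sup>2 * m \<xi> * p \<xi>)" if s: "s \<ge> 0" for s
        unfolding a_def l2_hartley_selfadjoint[OF Z(1)[OF s] mult(1)[OF qs], symmetric] by (simp add: nx_def mult_ac)
      obtain M where M: "M \<ge> 0" "\<And>s. 0 \<le> s \<Longrightarrow> s \<le> t \<Longrightarrow> l2_norm (Z s) \<le> M" using bounded[of t] by blast
      have ic: "continuous_on {0..t} (\<lambda>s. l2_inner (Z s) (lap (\<phi> k)))" "continuous_on {0..t} (a (nx p))" for k
        unfolding a_def
        by (intro continuous_on_subset[OF Z_cont[OF test_function_sq_int[OF test_function_lap[OF \<phi>(1)]]]]
            continuous_on_subset[OF Z_cont[OF T_mult[OF nx(1)[OF p]]]]; auto)+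
      \<comment> \<open>The Laplacian is unbounded, but on these test functions it acts through
        |xi|^2 m, bounded by \<open>K\<close>. The convergence is therefore uniform for times up to
        \<open>t\<close> and passes under the integral.\<close>
      have "(\<lambda>k. integral {0..t} (\<lambda>s. l2_inner (Z s) (lap (\<phi> k)))) \<longlonglongrightarrow> - integral {0..t} (a (nx p))"
      proof (rule LIM_zero_cancel, rule Lim_null_comparison)
        show "(\<lambda>k. M * K * t * l2_norm (\<lambda>x. hartley (g k) x - p x)) \<longlonglongrightarrow> 0" by (rule tendsto_mult_right_zero[OF g_lim])
        have "\<bar>integral {0..t} (\<lambda>s. l2_inner (Z s) (lap (\<phi> k))) + integral {0..t} (a (nx p))\<bar>
            \<le> M * K * t * l2_norm (\<lambda>x. hartley (g k) x - p x)" for k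
        proof -
          have "integral {0..t} (\<lambda>s. l2_inner (Z s) (lap (\<phi> k))) + integral {0..t} (a (nx p)) =
              integral {0..t} (\<lambda>s. l2_inner (Z s) (lap (\<phi> k)) + a (nx p) s)"
            by (rule Henstock_Kurzweil_Integration.integral_add[symmetric]) (intro integrable_continuous_interval ic)+
          also have "norm \<dots> \<le> (M * (K * l2_norm (\<lambda>x. hartley (g k) x - p x))) * (t - 0)"
          proof (rule integral_bound)
            show "continuous_on {0..t} (\<lambda>s. l2_inner (Z s) (lap (\<phi> k)) + a (nx p) s)" by (intro continuous_intros ic)
            fix s assume "s \<in> {0..t}"
            then have s: "0 \<le> s" "s \<le> t" by auto
            note TZ = sq_int_l2_hartley[OF Z(1)[OF s(1)]]
            have "l2_inner (Z s) (lap (\<phi> k)) + a (nx p) s =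
                - l2_inner (\<lambda>\<xi>. (norm \<xi>)\<^sup>2 * m \<xi> * hartley (g k) \<xi> - (norm \<xi>)\<^sup>2 * m \<xi> * p \<xi>) (l2_hartley (Z s))"
              unfolding lap_eq[OF s(1)] nx_eq[OF s(1)] l2_inner_diff[OF mult(3)[OF Hg] mult(3)[OF ps] TZ]
              by (simp add: l2_inner_commute)
            also have "(\<lambda>\<xi>. (norm \<xi>)\<^sup>2 * m \<xi> * hartley (g k) \<xi> - (norm \<xi>)\<^sup>2 * m \<xi> * p \<xi>) =
                (\<lambda>\<xi>. (norm \<xi>)\<^sup>2 * m \<xi> * (hartley (g k) \<xi> - p \<xi>))" by (simp add: right_diff_distrib)
            also have "norm (- l2_inner (\<lambda>\<xi>. (norm \<xi>)\<^sup>2 * m \<xi> * (hartley (g k) \<xi> - p \<xi>)) (l2_hartley (Z s)))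
                \<le> l2_norm (\<lambda>\<xi>. (norm \<xi>)\<^sup>2 * m \<xi> * (hartley (g k) \<xi> - p \<xi>)) * l2_norm (l2_hartley (Z s))"
              using l2_Cauchy_Schwarz[OF mult(3)[OF sq_int_diff[OF Hg ps]] TZ] by simp
            also have "\<dots> \<le> (K * l2_norm (\<lambda>x. hartley (g k) x - p x)) * M"
              using mult(4)[OF sq_int_diff[OF Hg ps]] M(2)[OF s] K0 by (intro mult_mono) (auto simp: l2_norm_l2_hartley[OF Z(1)[OF s(1)]])
            finally show "norm (l2_inner (Z s) (lap (\<phi> k)) + a (nx p) s) \<le> M * (K * l2_norm (\<lambda>x. hartley (g k) x - p x))"
              by (simp add: mult_ac)
          qed (use t in auto)
          finally show ?thesis by (simp add: mult_ac)
        qed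
        then show "\<forall>\<^sub>F k in sequentially. norm (integral {0..t} (\<lambda>s. l2_inner (Z s) (lap (\<phi> k))) - - integral {0..t} (a (nx p)))
            \<le> M * K * t * l2_norm (\<lambda>x. hartley (g k) x - p x)" by simp
      qed
      moreover have "(\<lambda>k. integral {0..t} (\<lambda>s. l2_inner (Z s) (lap (\<phi> k)))) \<longlonglongrightarrow> a' p t + a p t"
        unfolding identity[OF \<phi>(1) t, symmetric] a_def a'_def by (intro tendsto_add conv Z t)
      ultimately show ?thesis by (rule LIMSEQ_unique[rotated])
    qed
    have a_zero: "a p T = 0" if p: "p \<in> P" for p
    proof -
      obtain M where M: "M \<ge> 0" "\<And>s. 0 \<le> s \<Longrightarrow> s \<le> T \<Longrightarrow> l2_norm (Z s) \<le> M" using bounded[of T] by blast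
      show ?thesis
      proof (rule damped_iteration_zero[where P=P and nx=nx and N=l2_norm and Q="R\<^sup>2" and C="M * K" and a=a and a'=a' and p=p and T=T])
        show "\<bar>a p t\<bar> \<le> M * K * l2_norm p" if p: "p \<in> P" and t: "0 \<le> t" "t \<le> T" for p t
        proof -
          have "\<bar>a p t\<bar> \<le> l2_norm (Z t) * l2_norm (l2_hartley (\<lambda>\<xi>. m \<xi> * p \<xi>))"
            unfolding a_def by (rule l2_Cauchy_Schwarz[OF Z(1)[OF t(1)] T_mult[OF p]])
          also have "\<dots> \<le> M * (K * l2_norm p)"
            using M t mult(2)[OF Psq[OF p]] by (intro mult_mono) (auto simp: l2_norm_l2_hartley[OF mult(1)[OF Psq[OF p]]])
          finally show ?thesis by simp
        qed
        show "(a p has_real_derivative a' p t) (at t within {0..})" if "p \<in> P" "0 \<le> t" for p t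
          unfolding a_def[abs_def] a'_def by (rule Z_der[OF that(2) T_mult[OF that(1)]])
        show "a p 0 = 0" for p unfolding a_def by (rule init)
      qed (use T M K0 nx a_eq p in auto)
    qed
    \<comment> \<open>For this choice the pairing at time \<open>T\<close> is the squared norm of
      \<open>p\<close>; so m Y vanishes on the ball, and with m > 0 also \<open>Y\<close>.\<close>
    define p where "p \<xi> = indicator (cball 0 R) \<xi> * (m \<xi> * Y \<xi>)" for \<xi>
    have p: "p \<in> P"
      unfolding P_def p_def using mult(1)[OF Y] by (auto intro!: sq_int_indicator)
    have "(l2_norm p)\<^sup>2 = l2_inner Y (\<lambda>\<xi>. m \<xi> * p \<xi>)"
      unfolding l2_norm_inner l2_inner_def p_def
      by (intro Bochner_Integration.integral_cong refl) (auto simp: indicator_def mult_ac)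
    also have "\<dots> = a p T"
      unfolding a_def Y_def by (rule l2_hartley_selfadjoint[OF Z(1)[OF T] mult(1)[OF Psq[OF p]]])
    also have "\<dots> = 0" by (rule a_zero[OF p])
    finally have "l2_norm p = 0" by simp
    from l2_norm_eq_0D[OF Psq[OF p] this] show ?thesis
      by eventually_elim (use pos in \<open>force simp: p_def\<close>)
  qed
  have "AE \<xi> in lborel. \<forall>k. norm \<xi> \<le> real (Suc k) \<longrightarrow> Y \<xi> = 0"
    unfolding AE_all_countable using main by (intro allI) simp
  then have "AE \<xi> in lborel. Y \<xi> = 0"
  proof eventually_elim
    case (elim \<xi>)
    obtain k :: nat where "norm \<xi> \<le> real k" using real_arch_simple[of "norm \<xi>"] ..
    then show ?case using elim[rule_format, of k] by simp
  qed
  then have "l2_norm Y = 0" unfolding l2_norm_def by (subst integral_eq_zero_AE) auto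
  then have "l2_norm (Z T) = 0" unfolding Y_def l2_norm_l2_hartley[OF Z(1)[OF T]] .
  from l2_norm_eq_0D[OF Z(1)[OF T] this] AE_rep_L2[OF C1_L2_sq_int(1)[OF v'(1) T]] AE_rep_L2[OF C1_L2_sq_int(1)[OF w'(1) T]]
  have "AE x in lborel. v T x = w T x" by eventually_elim (simp add: Z_def)
  then show ?thesis by (rule AE_completion)
qed

section \<open>The asymptotic profile\<close>

text \<open>For large t the exponential beats every power; for small t the left side is at most 1
  and the negative power at least 1. Both cases are covered by t^p <= 1 + t^m with an integer m >=
  p.\<close>

lemma exp_decay_le_powr:
  fixes p :: real and m :: nat
  assumes t: "t > 0" and p: "0 \<le> p" "p \<le> real m" and m: "m > 0"
  shows "exp (- t / 8) \<le> (1 + (8 * real m) ^ m) * t powr (- p)"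
proof -
  have e: "t ^ m \<le> (8 * real m) ^ m * exp (t / 8)"
  proof -
    have "t / (8 * real m) \<le> exp (t / (8 * real m))"
      using exp_ge_add_one_self[of "t / (8 * real m)"] by linarith
    then have "(t / (8 * real m)) ^ m \<le> exp (t / (8 * real m)) ^ m"
      using t by (intro power_mono) auto
    also have "\<dots> = exp (t / 8)" using m by (simp flip: exp_of_nat_mult)
    finally show ?thesis using m by (simp add: power_divide field_simps)
  qed
  have "t powr p \<le> 1 + t ^ m"
  proof (cases "t \<le> 1")
    case True
    then have "t powr p \<le> 1" using t p by (intro powr_le1) auto
    then show ?thesis using t by (simp add: add_increasing2)
  next
    case False
    then have "t powr p \<le> t powr real m" using p by (intro powr_mono) auto
    then show ?thesis using t by (simp add: powr_realpow)
  qed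
  also have "\<dots> \<le> exp (t / 8) + (8 * real m) ^ m * exp (t / 8)" using e t by (intro add_mono) auto
  finally have "exp (- t / 8) * t powr p \<le> exp (- t / 8) * ((1 + (8 * real m) ^ m) * exp (t / 8))"
    by (intro mult_left_mono) (auto simp: distrib_right)
  also have "\<dots> = 1 + (8 * real m) ^ m" by (simp flip: exp_add add: mult.left_commute[of "exp _"])
  finally show ?thesis using t by (simp add: powr_minus field_simps)
qed

text \<open>With y = t |xi|^2 / 2, the bound y exp (-2 y) <= exp (-y) replaces the weight |xi|^2 by
  2 / t times a Gaussian of integral (2 pi / t)^(n/2). The square root of this product is the rate
  t^(-n/4 - 1/2).\<close>

lemma norm_gauss_decay:
  assumes t: "t > 0"
  shows "sq_int (\<lambda>\<xi>::'a::euclidean_space. norm \<xi> * exp (- (norm \<xi>)\<^sup>2 * t / 2))"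
    and "l2_norm (\<lambda>\<xi>::'a. norm \<xi> * exp (- (norm \<xi>)\<^sup>2 * t / 2))
      \<le> sqrt (2 * sqrt (2 * pi) ^ DIM('a)) * t powr (- (real DIM('a) / 4) - 1 / 2)"
proof -
  have t2: "t / 2 > 0" using t by simp
  define w where "w \<xi> = 2 / t * exp (- (t / 2) * (norm \<xi>)\<^sup>2)" for \<xi> :: 'a
  have w: "integrable lborel w" "integral\<^sup>L lborel w = 2 / t * sqrt (pi / (t / 2)) ^ DIM('a)"
    unfolding w_def using integrable_exp_norm[OF t2, where 'a='a] integral_exp_norm[OF t2, where 'a='a] by simp_all
  have le: "(norm \<xi> * exp (- (norm \<xi>)\<^sup>2 * t / 2))\<^sup>2 \<le> w \<xi>" for \<xi> :: 'a
  proof -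
    define y where "y = (norm \<xi>)\<^sup>2 * (t / 2)"
    have "y \<le> exp y" using exp_ge_add_one_self[of y] by linarith
    then have "2 / t * (y * exp (- 2 * y)) \<le> 2 / t * (exp y * exp (- 2 * y))"
      using t by (intro mult_left_mono mult_right_mono) auto
    moreover have "(norm \<xi> * exp (- (norm \<xi>)\<^sup>2 * t / 2))\<^sup>2 = 2 / t * (y * exp (- 2 * y))"
      using t by (simp add: power_mult_distrib y_def power2_eq_square flip: exp_add)
    moreover have "2 / t * (exp y * exp (- 2 * y)) = w \<xi>"
      by (simp add: w_def y_def mult.commute flip: exp_add)
    ultimately show ?thesis by simp
  qed
  have i: "integrable lborel (\<lambda>\<xi>::'a. (norm \<xi> * exp (- (norm \<xi>)\<^sup>2 * t / 2))\<^sup>2)"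
  proof (rule Bochner_Integration.integrable_bound[OF w(1)])
    show "AE \<xi> in lborel. norm ((norm \<xi> * exp (- (norm \<xi>)\<^sup>2 * t / 2))\<^sup>2) \<le> norm (w \<xi>)"
      using order_trans[OF le abs_ge_self] by auto
  qed measurable
  then show "sq_int (\<lambda>\<xi>::'a. norm \<xi> * exp (- (norm \<xi>)\<^sup>2 * t / 2))" unfolding sq_int_def by simp
  have "l2_norm (\<lambda>\<xi>::'a. norm \<xi> * exp (- (norm \<xi>)\<^sup>2 * t / 2)) \<le> sqrt (2 / t * sqrt (pi / (t / 2)) ^ DIM('a))"
    unfolding l2_norm_def w(2)[symmetric] using integral_mono[OF i w(1) le] by (rule real_sqrt_le_mono)
  also have "2 / t * sqrt (pi / (t / 2)) ^ DIM('a) = (2 * sqrt (2 * pi) ^ DIM('a)) * (1 / t * (1 / sqrt t) ^ DIM('a))"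
    using t by (simp add: real_sqrt_divide power_divide mult.commute)
  also have "1 / t * (1 / sqrt t) ^ DIM('a) = (t powr (- (real DIM('a) / 4) - 1 / 2))\<^sup>2"
  proof -
    have e1: "(1 / sqrt t) ^ DIM('a) = t powr (- (real DIM('a) / 2))"
    proof -
      have "1 / sqrt t = t powr (- 1 / 2)" using t by (simp add: powr_minus powr_half_sqrt inverse_eq_divide)
      then show ?thesis using t by (simp add: powr_power mult.commute)
    qed
    have e2: "1 / t = t powr (- 1)" using t by (simp add: powr_minus inverse_eq_divide)
    have e3: "(t powr (- (real DIM('a) / 4) - 1 / 2))\<^sup>2 = t powr (- (real DIM('a) / 2) - 1)"
      using t by (simp add: powr_power algebra_simps)
    show ?thesis unfolding e1 e2 e3 powr_add[symmetric] by (rule arg_cong[where f="(powr) t"]) simp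
  qed
  also have "sqrt ((2 * sqrt (2 * pi) ^ DIM('a)) * (t powr (- (real DIM('a) / 4) - 1 / 2))\<^sup>2) =
      sqrt (2 * sqrt (2 * pi) ^ DIM('a)) * t powr (- (real DIM('a) / 4) - 1 / 2)"
    by (simp only: real_sqrt_mult real_sqrt_abs) simp
  finally show "l2_norm (\<lambda>\<xi>::'a. norm \<xi> * exp (- (norm \<xi>)\<^sup>2 * t / 2))
      \<le> sqrt (2 * sqrt (2 * pi) ^ DIM('a)) * t powr (- (real DIM('a) / 4) - 1 / 2)" .
qed

lemma abs_cas_minus_1: "\<bar>cas y - 1\<bar> \<le> 2 * \<bar>y\<bar>"
proof -
  have "\<bar>cos y - 1\<bar> \<le> \<bar>y\<bar>"
  proof -
    have "norm (cos y - cos 0) \<le> 1 * norm (y - 0)"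
      by (rule field_differentiable_bound[of UNIV cos "\<lambda>x. - sin x"])
        (auto intro!: derivative_eq_intros)
    then show ?thesis by simp
  qed
  then show ?thesis using abs_sin_x_le_abs_x[of y] unfolding cas_def by linarith
qed

text \<open>The weight 1 + |x| is spent in the second bound: |cas(x . xi) - 1| <= 2 |x| |xi|
  compares the transform with its value at frequency 0. The normalizing factor is at most 1 and is
  dropped where it only helps.\<close>

lemma hartley_moment_bounds:
  fixes f :: "'a::euclidean_space \<Rightarrow> real"
  assumes f: "integrable lborel f" and xf: "integrable lborel (\<lambda>x. (1 + norm x) * \<bar>f x\<bar>)"
  defines "N \<equiv> (LINT x|lborel. (1 + norm x) * \<bar>f x\<bar>)"
  shows "\<bar>hartley f \<xi>\<bar> \<le> 2 * N"
    and "\<bar>hartley f \<xi> - 1 / sqrt (2 * pi) ^ DIM('a) * integral\<^sup>L lborel f\<bar> \<le> 2 * norm \<xi> * N"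
proof -
  have "1 \<le> sqrt (2 * pi)" using pi_gt3 by (intro real_le_rsqrt) simp
  then have c: "1 / sqrt (2 * pi) ^ DIM('a) \<le> 1" "0 \<le> 1 / sqrt (2 * pi) ^ DIM('a)" by auto
  have fN: "(LINT x|lborel. \<bar>f x\<bar>) \<le> N" unfolding N_def
    using f xf by (intro integral_mono) (auto simp: distrib_right)
  have f0: "0 \<le> (LINT x|lborel. \<bar>f x\<bar>)" by (intro integral_nonneg_AE) simp
  have "\<bar>hartley f \<xi>\<bar> \<le> 1 / sqrt (2 * pi) ^ DIM('a) * (2 * (LINT x|lborel. \<bar>f x\<bar>))"
    using hartley_bound[OF f, of \<xi>] by simp
  also have "\<dots> \<le> 1 * (2 * N)" using c fN f0 by (intro mult_mono) auto
  finally show "\<bar>hartley f \<xi>\<bar> \<le> 2 * N" by simp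
  have fc: "integrable lborel (\<lambda>x. f x * cas (x \<bullet> \<xi>))" by (rule integrable_mult_cas[OF f])
  have "hartley f \<xi> - 1 / sqrt (2 * pi) ^ DIM('a) * integral\<^sup>L lborel f
      = 1 / sqrt (2 * pi) ^ DIM('a) * (LINT x|lborel. f x * (cas (x \<bullet> \<xi>) - 1))"
    using f fc by (simp add: hartley_def right_diff_distrib diff_divide_distrib)
  also have "\<bar>\<dots>\<bar> \<le> 1 * \<bar>LINT x|lborel. f x * (cas (x \<bullet> \<xi>) - 1)\<bar>"
    unfolding abs_mult using c by (intro mult_right_mono) auto
  also have "\<bar>LINT x|lborel. f x * (cas (x \<bullet> \<xi>) - 1)\<bar> \<le> (LINT x|lborel. 2 * norm \<xi> * ((1 + norm x) * \<bar>f x\<bar>))"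
  proof -
    have "norm (LINT x|lborel. f x * (cas (x \<bullet> \<xi>) - 1)) \<le> (LINT x|lborel. 2 * norm \<xi> * ((1 + norm x) * \<bar>f x\<bar>))"
    proof (rule Bochner_Integration.integral_norm_bound_integral)
      show "integrable lborel (\<lambda>x. f x * (cas (x \<bullet> \<xi>) - 1))" using f fc by (simp add: right_diff_distrib)
      show "integrable lborel (\<lambda>x. 2 * norm \<xi> * ((1 + norm x) * \<bar>f x\<bar>))" using xf by simp
      fix x
      have "\<bar>cas (x \<bullet> \<xi>) - 1\<bar> \<le> 2 * (norm x * norm \<xi>)"
        using abs_cas_minus_1[of "x \<bullet> \<xi>"] Cauchy_Schwarz_ineq2[of x \<xi>] by linarith
      also have "\<dots> \<le> 2 * norm \<xi> * (1 + norm x)" by (simp add: algebra_simps)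
      finally have "\<bar>f x\<bar> * \<bar>cas (x \<bullet> \<xi>) - 1\<bar> \<le> \<bar>f x\<bar> * (2 * norm \<xi> * (1 + norm x))" by (intro mult_left_mono) auto
      then show "norm (f x * (cas (x \<bullet> \<xi>) - 1)) \<le> 2 * norm \<xi> * ((1 + norm x) * \<bar>f x\<bar>)"
        by (simp add: abs_mult mult_ac)
    qed
    then show ?thesis by simp
  qed
  finally show "\<bar>hartley f \<xi> - 1 / sqrt (2 * pi) ^ DIM('a) * integral\<^sup>L lborel f\<bar> \<le> 2 * norm \<xi> * N"
    by (simp add: N_def)
qed

text \<open>By Plancherel the error is an L2 norm in frequency. The factor exp (-t/8) has no decay
  in xi, so beside it the transformed data are measured in L2; |xi| exp (-t |xi|^2 / 2) is square
  integrable by itself, so beside it the data are bounded pointwise by the weighted norms.\<close>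

lemma wave_profile_estimate:
  fixes f g :: "real ^ 'n \<Rightarrow> real"
  assumes f: "integrable lborel f" "sq_int f" "integrable lborel (\<lambda>x. (1 + norm x) * \<bar>f x\<bar>)"
    and g: "integrable lborel g" "sq_int g" "integrable lborel (\<lambda>x. (1 + norm x) * \<bar>g x\<bar>)"
    and fH: "sq_int (\<lambda>\<xi>. norm \<xi> * l2_hartley f \<xi>)" and t: "t > 0"
  defines "N \<equiv> (LINT x|lborel. (1 + norm x) * \<bar>f x\<bar>) + (LINT x|lborel. (1 + norm x) * \<bar>g x\<bar>)"
  shows "L2_nrm (\<lambda>x. l2_hartley (wave_hat (l2_hartley f) (l2_hartley g) t) x
      - (integral\<^sup>L lborel f + integral\<^sup>L lborel g) * gauss_kernel t x)
    \<le> 26 * sqrt (2 * sqrt (2 * pi) ^ CARD('n)) * t powr (- (real CARD('n) / 4) - 1 / 2) * N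
      + 12 * exp (- t / 8) * (l2_norm f + l2_norm g)"
proof -
  let ?c = "1 / sqrt (2 * pi) ^ CARD('n)"
  define a where "a = l2_hartley f"
  define b where "b = l2_hartley g"
  define P where "P = integral\<^sup>L lborel f + integral\<^sup>L lborel g"
  have a: "sq_int a" "sq_int (\<lambda>\<xi>. norm \<xi> * a \<xi>)" and b: "sq_int b"
    unfolding a_def b_def using fH by (auto intro: sq_int_l2_hartley f g)
  define U where "U = wave_hat a b t"
  have U: "sq_int U" unfolding U_def using t by (intro sq_int_wave(2)[OF a b]) simp
  note TU = sq_int_l2_hartley[OF U]
  have G: "integrable lborel (gauss t :: real ^ 'n \<Rightarrow> real)" "sq_int (gauss t :: real ^ 'n \<Rightarrow> real)"
    using integrable_gauss[OF t] sq_int_gauss_diff[OF t, of 0] by simp_all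
  have HG: "hartley (gauss t) \<xi> = ?c * exp (- t * (norm \<xi>)\<^sup>2)" for \<xi> :: "real ^ 'n"
    using hartley_gauss[OF t, of 0 \<xi>] by (simp add: cas_def)
  note HGs = hartley_contraction(1)[OF G]
  define D where "D \<xi> = U \<xi> - P * hartley (gauss t) \<xi>" for \<xi>
  have D: "sq_int D" unfolding D_def[abs_def] by (intro sq_int_diff sq_int_cmult U HGs)
  have "L2_nrm (\<lambda>x. l2_hartley U x - P * gauss t x) = l2_norm D"
  proof (rule L2_nrm_eq_if_hartley[OF D])
    show "(\<lambda>x. l2_hartley U x - P * gauss t x) \<in> borel_measurable borel"
      by (intro sq_int_measurable sq_int_diff sq_int_cmult TU G)
    have TG: "AE x in lborel. l2_hartley (hartley (gauss t)) x = gauss t (x :: real ^ 'n)"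
      using l2_hartley_involution[OF G(2)] l2_hartley_cong_AE[OF sq_int_measurable[OF sq_int_l2_hartley[OF G(2)]]
        sq_int_measurable[OF HGs] l2_hartley_eq_hartley[OF G]] by simp
    show "AE x in lborel. l2_hartley U x - P * gauss t x = l2_hartley D x"
      using TG l2_hartley_cmult[OF HGs, of P] l2_hartley_diff[OF U sq_int_cmult[OF HGs], of P]
      unfolding D_def by eventually_elim simp
  qed
  also have "l2_norm D \<le> l2_norm (\<lambda>\<xi>. 26 * N * (norm \<xi> * exp (- (norm \<xi>)\<^sup>2 * t / 2)) + 12 * exp (- t / 8) * (\<bar>a \<xi>\<bar> + \<bar>b \<xi>\<bar>))"
  proof (rule l2_norm_mono_AE)
    show "sq_int (\<lambda>\<xi>. 26 * N * (norm \<xi> * exp (- (norm \<xi>)\<^sup>2 * t / 2)) + 12 * exp (- t / 8) * (\<bar>a \<xi>\<bar> + \<bar>b \<xi>\<bar>))"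
      by (intro sq_int_add sq_int_cmult sq_int_abs a b norm_gauss_decay t)
    show "D \<in> borel_measurable borel" by (rule sq_int_measurable[OF D])
    show "AE \<xi> in lborel. \<bar>D \<xi>\<bar> \<le> \<bar>26 * N * (norm \<xi> * exp (- (norm \<xi>)\<^sup>2 * t / 2)) + 12 * exp (- t / 8) * (\<bar>a \<xi>\<bar> + \<bar>b \<xi>\<bar>)\<bar>"
      using l2_hartley_eq_hartley[OF f(1,2)] l2_hartley_eq_hartley[OF g(1,2)]
    proof eventually_elim
      case (elim \<xi>)
      define r where "r = (norm \<xi>)\<^sup>2"
      define E where "E = exp (- r * t)"
      define q where "q = norm \<xi> * exp (- r * t / 2)"
      define x where "x = exp (- t / 8)"
      define N0 where "N0 = (LINT x|lborel. (1 + norm x) * \<bar>f x\<bar>)"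
      define N1 where "N1 = (LINT x|lborel. (1 + norm x) * \<bar>g x\<bar>)"
      have N: "N = N0 + N1" by (simp add: N_def N0_def N1_def)
      have nn: "0 \<le> N0" "0 \<le> N1" unfolding N0_def N1_def by (auto intro!: integral_nonneg_AE)
      have q0: "0 \<le> q" "0 \<le> x" "0 \<le> E" by (simp_all add: q_def x_def E_def)
      have s: "\<bar>sol0 r t - E\<bar> \<le> 12 * (q + x)" "\<bar>sol1 r t - E\<bar> \<le> 12 * (q + x)"
        using sol_diff_exp[of t r] t by (simp_all add: r_def E_def q_def x_def)
      have ab: "\<bar>a \<xi>\<bar> \<le> 2 * N0" "\<bar>b \<xi>\<bar> \<le> 2 * N1" "\<bar>a \<xi> - ?c * integral\<^sup>L lborel f\<bar> \<le> 2 * norm \<xi> * N0"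
        "\<bar>b \<xi> - ?c * integral\<^sup>L lborel g\<bar> \<le> 2 * norm \<xi> * N1"
        using hartley_moment_bounds[OF f(1,3), of \<xi>] hartley_moment_bounds[OF g(1,3), of \<xi>] elim
        by (simp_all add: a_def b_def N0_def N1_def)
      have Eq: "norm \<xi> * E \<le> q" unfolding q_def E_def using t by (intro mult_left_mono) (auto simp: r_def)
      \<comment> \<open>First the multipliers are replaced by the heat factor \<open>E\<close>, then
        \<open>a\<close> and \<open>b\<close> by their values at frequency 0. The errors 12 q (2 N)
        and 2 q N add up to the constant 26.\<close>
      have "D \<xi> = (sol0 r t - E) * a \<xi> + (sol1 r t - E) * b \<xi>
          + E * ((a \<xi> - ?c * integral\<^sup>L lborel f) + (b \<xi> - ?c * integral\<^sup>L lborel g))"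
        by (simp add: D_def U_def wave_hat_def HG P_def r_def E_def algebra_simps add_divide_distrib)
      also have "\<bar>\<dots>\<bar> \<le> \<bar>(sol0 r t - E) * a \<xi>\<bar> + \<bar>(sol1 r t - E) * b \<xi>\<bar>
          + \<bar>E * ((a \<xi> - ?c * integral\<^sup>L lborel f) + (b \<xi> - ?c * integral\<^sup>L lborel g))\<bar>"
        by linarith
      also have "\<dots> \<le> 12 * (q + x) * \<bar>a \<xi>\<bar> + 12 * (q + x) * \<bar>b \<xi>\<bar> + E * (2 * norm \<xi> * N0 + 2 * norm \<xi> * N1)"
        unfolding abs_mult using s ab q0
        by (intro add_mono mult_mono order_trans[OF abs_triangle_ineq]) auto
      also have "\<dots> = 12 * q * (\<bar>a \<xi>\<bar> + \<bar>b \<xi>\<bar>) + 12 * x * (\<bar>a \<xi>\<bar> + \<bar>b \<xi>\<bar>) + 2 * (norm \<xi> * E) * N"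
        by (simp add: N algebra_simps)
      also have "\<dots> \<le> 12 * q * (2 * N) + 12 * x * (\<bar>a \<xi>\<bar> + \<bar>b \<xi>\<bar>) + 2 * q * N"
        using ab q0 nn Eq by (intro add_mono mult_mono mult_left_mono) (auto simp: N)
      also have "\<dots> = 26 * N * q + 12 * x * (\<bar>a \<xi>\<bar> + \<bar>b \<xi>\<bar>)" by (simp add: algebra_simps)
      finally show ?case
        unfolding q_def x_def r_def by (rule order_trans[OF _ abs_ge_self])
    qed
  qed
  also have "\<dots> \<le> l2_norm (\<lambda>\<xi>::real ^ 'n. 26 * N * (norm \<xi> * exp (- (norm \<xi>)\<^sup>2 * t / 2)))
      + l2_norm (\<lambda>\<xi>. 12 * exp (- t / 8) * (\<bar>a \<xi>\<bar> + \<bar>b \<xi>\<bar>))"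
    by (intro l2_norm_triangle sq_int_add sq_int_cmult sq_int_abs a b norm_gauss_decay t)
  also have "\<dots> = 26 * N * l2_norm (\<lambda>\<xi>::real ^ 'n. norm \<xi> * exp (- (norm \<xi>)\<^sup>2 * t / 2))
      + 12 * exp (- t / 8) * l2_norm (\<lambda>\<xi>. \<bar>a \<xi>\<bar> + \<bar>b \<xi>\<bar>)"
  proof -
    have "0 \<le> N" unfolding N_def by (intro add_nonneg_nonneg integral_nonneg_AE) auto
    then show ?thesis unfolding l2_norm_cmult by simp
  qed
  also have "\<dots> \<le> 26 * N * (sqrt (2 * sqrt (2 * pi) ^ CARD('n)) * t powr (- (real CARD('n) / 4) - 1 / 2))
      + 12 * exp (- t / 8) * (l2_norm f + l2_norm g)"
  proof (intro add_mono mult_left_mono)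
    show "l2_norm (\<lambda>\<xi>::real ^ 'n. norm \<xi> * exp (- (norm \<xi>)\<^sup>2 * t / 2))
        \<le> sqrt (2 * sqrt (2 * pi) ^ CARD('n)) * t powr (- (real CARD('n) / 4) - 1 / 2)"
      using norm_gauss_decay(2)[OF t, where 'a="real ^ 'n"] by simp
    have "l2_norm (\<lambda>\<xi>. \<bar>a \<xi>\<bar> + \<bar>b \<xi>\<bar>) \<le> l2_norm (\<lambda>\<xi>. \<bar>a \<xi>\<bar>) + l2_norm (\<lambda>\<xi>. \<bar>b \<xi>\<bar>)"
      by (intro l2_norm_triangle sq_int_abs a b)
    also have "\<dots> = l2_norm a + l2_norm b" by (simp add: l2_norm_def)
    also have "\<dots> = l2_norm f + l2_norm g" unfolding a_def b_def by (simp add: l2_norm_l2_hartley f g)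
    finally show "l2_norm (\<lambda>\<xi>. \<bar>a \<xi>\<bar> + \<bar>b \<xi>\<bar>) \<le> l2_norm f + l2_norm g" .
    show "0 \<le> 26 * N" unfolding N_def by (intro mult_nonneg_nonneg add_nonneg_nonneg integral_nonneg_AE) auto
  qed auto
  finally show ?thesis
    unfolding gauss_eq_gauss_kernel U_def P_def a_def b_def by (simp only: mult_ac)
qed

section \<open>Return to the given data and conclusion\<close>

lemma in_L11_rep:
  fixes u :: "real ^ 'n \<Rightarrow> real"
  assumes u: "in_L11 u"
  shows "integrable lborel (rep u)" "integrable lborel (\<lambda>x. (1 + norm x) * \<bar>rep u x\<bar>)"
    and "(LINT x|lebesgue. u x) = integral\<^sup>L lborel (rep u)"
    and "L11_nrm u = (LINT x|lborel. (1 + norm x) * \<bar>rep u x\<bar>)"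
proof -
  have i: "integrable lebesgue u" "integrable lebesgue (\<lambda>x. (1 + norm x) * \<bar>u x\<bar>)"
    using u by (auto simp: in_L11_def)
  have m: "u \<in> borel_measurable lebesgue" using i(1) by (rule borel_measurable_integrable)
  note R = measurable_rep[OF m] AE_rep[OF m]
  show "integrable lborel (rep u)" "(LINT x|lebesgue. u x) = integral\<^sup>L lborel (rep u)"
    using i(1) integrable_lebesgue_iff[OF m R] integral_lebesgue_eq[OF m R] by simp_all
  have m2: "(\<lambda>x. (1 + norm x) * \<bar>u x\<bar>) \<in> borel_measurable lebesgue"
    using i(2) by (rule borel_measurable_integrable)
  have R2: "(\<lambda>x. (1 + norm x) * \<bar>rep u x\<bar>) \<in> borel_measurable borel" using R(1) by measurable
  have ae: "AE x in lborel. (1 + norm x) * \<bar>u x\<bar> = (1 + norm x) * \<bar>rep u x\<bar>" using R(2) by eventually_elim simp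
  show "integrable lborel (\<lambda>x. (1 + norm x) * \<bar>rep u x\<bar>)" using i(2) integrable_lebesgue_iff[OF m2 R2 ae] by simp
  show "L11_nrm u = (LINT x|lborel. (1 + norm x) * \<bar>rep u x\<bar>)"
    unfolding L11_nrm_def by (rule integral_lebesgue_eq[OF m2 R2 ae])
qed

text \<open>At time 0 the frequency data are the transforms of the given functions, so the
  involution returns the initial values; membership of \<open>u0\<close> in H1 gives the weight |xi|
  that the existence lemmas require.\<close>

lemma weak_solution_wave:
  fixes u0 u1 :: "real ^ 'n \<Rightarrow> real"
  assumes u0: "in_H1 u0" and u1: "in_L2 u1"
  shows "weak_solution u0 u1 (\<lambda>t. l2_hartley (wave_hat (l2_hartley (rep u0)) (l2_hartley (rep u1)) t))"
proof -
  have u0': "in_L2 u0" using u0 by (simp add: in_H1_def)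
  note f = sq_int_rep[OF u0'] and g = sq_int_rep[OF u1]
  have fH: "sq_int (\<lambda>\<xi>. norm \<xi> * l2_hartley (rep u0) \<xi>)"
    by (rule in_H1_hartley(2)[OF u0 sq_int_measurable[OF f] AE_rep_L2[OF u0']])
  note W = sq_int_l2_hartley[OF f] fH sq_int_l2_hartley[OF g]
  have "AE x in lborel. l2_hartley (l2_hartley (rep u0)) x = u0 x"
    using l2_hartley_involution[OF f] AE_rep_L2[OF u0'] by eventually_elim simp
  then have i0: "AE x in lebesgue. l2_hartley (wave_hat (l2_hartley (rep u0)) (l2_hartley (rep u1)) 0) x = u0 x"
    unfolding wave_hat_0 by (rule AE_completion)
  have "AE x in lborel. l2_hartley (l2_hartley (rep u1)) x = u1 x"
    using l2_hartley_involution[OF g] AE_rep_L2[OF u1] by eventually_elim simp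
  then have i1: "AE x in lebesgue. l2_hartley (wave_hat' (l2_hartley (rep u0)) (l2_hartley (rep u1)) 0) x = u1 x"
    unfolding wave_hat_0 by (rule AE_completion)
  show ?thesis
    unfolding weak_solution_def
    using wave_C0_H1[OF W] wave_damped_wave_eq[OF W] wave_C1_L2[OF W] i0 i1 by blast
qed

theorem theorem1p2:
  shows "\<exists>C::real. C > 0 \<and>
    (\<forall>(u\<^sub>0 :: real ^ 'n \<Rightarrow> real) (u\<^sub>1 :: real ^ 'n \<Rightarrow> real).
      in_H1 u\<^sub>0 \<and> in_L11 u\<^sub>0 \<and> in_L2 u\<^sub>1 \<and> in_L11 u\<^sub>1 \<longrightarrow>
      (\<exists>u. weak_solution u\<^sub>0 u\<^sub>1 u \<and>
         (\<forall>v. weak_solution u\<^sub>0 u\<^sub>1 v \<longrightarrow> (\<forall>t\<ge>0. AE x in lebesgue. v t x = u t x)) \<and>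
         (\<forall>t>0. L2_nrm (\<lambda>x. u t x - ((LINT y|lebesgue. u\<^sub>0 y) + (LINT y|lebesgue. u\<^sub>1 y)) * gauss_kernel t x)
            \<le> C * t powr (- (real CARD('n) / 4) - 1 / 2) *
              (L11_nrm u\<^sub>0 + L11_nrm u\<^sub>1 + L2_nrm u\<^sub>0 + L2_nrm (weak_gradient u\<^sub>0) + L2_nrm u\<^sub>1))))"
proof -
  define A where "A = 26 * sqrt (2 * sqrt (2 * pi) ^ CARD('n))"
  \<comment> \<open>Here n + 1 serves as an integer exponent above n/4 + 1/2 when exp (-t/8) is
    converted into the same power of t as the low-frequency term with constant
    \<open>A\<close>.\<close>
  define B where "B = 12 * (1 + (8 * real (CARD('n) + 1)) ^ (CARD('n) + 1))"
  have AB: "A \<ge> 0" "B > 0" by (auto simp: A_def B_def intro!: add_pos_nonneg)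
  show ?thesis
  proof (intro exI[of _ "A + B"] conjI allI impI)
    show "A + B > 0" using AB by simp
    fix u0 u1 :: "real ^ 'n \<Rightarrow> real"
    assume u: "in_H1 u0 \<and> in_L11 u0 \<and> in_L2 u1 \<and> in_L11 u1"
    then have u0: "in_H1 u0" "in_L2 u0" "in_L11 u0" and u1: "in_L2 u1" "in_L11 u1" by (auto simp: in_H1_def)
    let ?u = "\<lambda>t. l2_hartley (wave_hat (l2_hartley (rep u0)) (l2_hartley (rep u1)) t)"
    note sol = weak_solution_wave[OF u0(1) u1(1)]
    have est: "L2_nrm (\<lambda>x. ?u t x - ((LINT y|lebesgue. u0 y) + (LINT y|lebesgue. u1 y)) * gauss_kernel t x)
        \<le> (A + B) * t powr (- (real CARD('n) / 4) - 1 / 2) *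
          (L11_nrm u0 + L11_nrm u1 + L2_nrm u0 + L2_nrm (weak_gradient u0) + L2_nrm u1)" if t: "t > 0" for t
    proof -
      define \<tau> where "\<tau> = t powr (- (real CARD('n) / 4) - 1 / 2)"
      define S where "S = L11_nrm u0 + L11_nrm u1 + L2_nrm u0 + L2_nrm (weak_gradient u0) + L2_nrm u1"
      have \<tau>: "\<tau> \<ge> 0" by (simp add: \<tau>_def)
      have nn: "L11_nrm u0 \<ge> 0" "L11_nrm u1 \<ge> 0" "L2_nrm u0 \<ge> 0" "L2_nrm u1 \<ge> 0" "L2_nrm (weak_gradient u0) \<ge> 0"
        by (auto simp: L11_nrm_def L2_nrm_def intro!: integral_nonneg_AE)
      have fH: "sq_int (\<lambda>\<xi>. norm \<xi> * l2_hartley (rep u0) \<xi>)"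
        by (rule in_H1_hartley(2)[OF u0(1) sq_int_measurable[OF sq_int_rep[OF u0(2)]] AE_rep_L2[OF u0(2)]])
      note L0 = in_L11_rep[OF u0(3)] and L1 = in_L11_rep[OF u1(2)]
      have "exp (- t / 8) \<le> (1 + (8 * real (CARD('n) + 1)) ^ (CARD('n) + 1)) * t powr (- (real CARD('n) / 4 + 1 / 2))"
        by (rule exp_decay_le_powr[OF t]) auto
      moreover have "- (real CARD('n) / 4 + 1 / 2) = - (real CARD('n) / 4) - 1 / 2" by simp
      ultimately have "exp (- t / 8) \<le> (1 + (8 * real (CARD('n) + 1)) ^ (CARD('n) + 1)) * \<tau>"
        by (simp only: \<tau>_def)
      then have e: "12 * exp (- t / 8) \<le> B * \<tau>" unfolding B_def mult.assoc by (rule mult_left_mono) simp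
      have "L2_nrm (\<lambda>x. ?u t x - ((LINT y|lebesgue. u0 y) + (LINT y|lebesgue. u1 y)) * gauss_kernel t x)
          \<le> A * \<tau> * (L11_nrm u0 + L11_nrm u1) + 12 * exp (- t / 8) * (L2_nrm u0 + L2_nrm u1)"
        unfolding L0(3,4) L1(3,4) L2_nrm_rep[OF u0(2)] L2_nrm_rep[OF u1(1)] A_def \<tau>_def
        by (rule wave_profile_estimate[OF L0(1) sq_int_rep[OF u0(2)] L0(2) L1(1) sq_int_rep[OF u1(1)] L1(2) fH t])
      also have "\<dots> \<le> A * \<tau> * S + B * \<tau> * S"
        using nn AB \<tau> by (intro add_mono mult_left_mono mult_mono[OF e]) (auto simp: S_def)
      also have "\<dots> = (A + B) * \<tau> * S" by (simp add: distrib_right)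
      finally show ?thesis unfolding \<tau>_def S_def .
    qed
    show "\<exists>u. weak_solution u0 u1 u \<and> (\<forall>v. weak_solution u0 u1 v \<longrightarrow> (\<forall>t\<ge>0. AE x in lebesgue. v t x = u t x)) \<and>
       (\<forall>t>0. L2_nrm (\<lambda>x. u t x - ((LINT y|lebesgue. u0 y) + (LINT y|lebesgue. u1 y)) * gauss_kernel t x)
            \<le> (A + B) * t powr (- (real CARD('n) / 4) - 1 / 2) *
              (L11_nrm u0 + L11_nrm u1 + L2_nrm u0 + L2_nrm (weak_gradient u0) + L2_nrm u1))"
    proof (intro exI[of _ ?u] conjI allI impI)
      show "weak_solution u0 u1 ?u" by (rule sol)
      show "AE x in lebesgue. v t x = ?u t x" if "weak_solution u0 u1 v" "t \<ge> 0" for v t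
        by (rule weak_solution_unique[OF that(1) sol that(2)])
    qed (rule est)
  qed
qed

end
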